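(* Let $\mathbb{E}=(J,b)$ be a pair on a regular local ring $R$ whose closed point lies in $\operatorname{Sing}(\mathbb{E})$, and let $(u,y)=(u_1,\dots,u_e;y_1,\dots,y_r)$ be a regular system of parameters for $R$ such that the initial forms of $(y)$ define the directrix $\operatorname{Dir}_{x'}(\mathbb{E}')$. Then there exist elements $(y^* )=(y_1^*,\dots,y_r^* )$ in the completion $\widehat{R}$ such that $(u,y^* )$ is a regular system of parameters for $\widehat{R}$, $(y^* )$ yields $\operatorname{Dir}_{x'}(\mathbb{E}')$, and $$\Delta(\mathbb{E};u;y^* )=\Delta(\mathbb{E};u).$$
   Context: A pair $\mathbb{E}=(J,b)$ on a regular local ring $R$ (maximal ideal $M$, residue field $K$) consists of an ideal $J\subset R$ and a positive integer $b$. The closed point lies in $\operatorname{Sing}(\mathbb{E})$ iff $J\subseteq M^b$. $\widehat{R}$ is the $M$-adic completion of $R$. Directrix. For a pair $(J,b)$ with $J\subseteq M^b$, let $\operatorname{in}(J,b)=\langle f\bmod M^{b+1}\mid f\in J\rangle\subset\operatorname{gr}_M(R)=\bigoplus_{a\ge0}M^a/M^{a+1}=:S$, a polynomial ring over $K$. The ideal of the directrix of $(J,b)$ at the closed point is $\langle Y_1,\dots,Y_r\rangle$ where $\bigoplus_jKY_j\subset S_1$ is the smallest $K$-subspace of linear forms with $(\operatorname{in}(J,b)\cap K[Y_1,\dots,Y_r])S=\operatorname{in}(J,b)$; the directrix $\operatorname{Dir}$ is the subspace of $\operatorname{Spec}S$ defined by this ideal. Elements define (yield) the directrix if their initial forms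 are such a minimal system $(Y_1,\dots,Y_r)$. Given $\mathbb{E}=(J,b)$ and $(u,y)$, put $R'=R/\langle u\rangle$, $J'=JR'$, $\mathbb{E}'=(J',b)$, a pair on $R'$, and let $x'$ be the point of $\operatorname{Spec}(R')$ defined by the ideal generated by the images of $(y)$ in $R'$. (For systems in $\widehat R$ the same is used after passing to completions.) Polyhedra. Every $g\in R$ has a finite expansion $g=\sum_{(A,B)\in\mathbb{Z}_{\ge0}^{e+r}}C_{A,B}u^Ay^B$ with $C_{A,B}\in R^\times\cup\{0\}$ (multi-index notation, $|B|=B_1+\dots+B_r$). If $(f_1,\dots,f_m)$ generate $J$ and $C_{A,B,i}$ are the coefficients of such an expansion of $f_i$, the polyhedron $\Delta(\mathbb{E};u;y)$ is the smallest closed convex subset of $\mathbb{R}^e_{\ge0}$ containing all the sets $\frac{A}{b-|B|}+\mathbb{R}^e_{\ge0}$ with $1\le i\le m$, $C_{A,B,i}\ne0$, $|B|<b$ (it does not depend on the generators). For a regular system of parameters $(u,\widehat y)$ of $\widehat R$, $\Delta(\mathbb{E};u;\widehat y)$ is defined in the same way using $J\widehat R$. The characteristic polyhedron is $$\Delta(\mathbb{E};u)=\bigcap_{(\widehat y)}\Delta(\mathbb{E};u;\widehat y),$$ the intersection over all systems $(\widehat y)$ extending $(u)$ to a regular system of parameters of $\widehat R$. *)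

theory Defs
  imports "HOL-Analysis.Abstract_Euclidean_Space" "HOL-Library.Extended_Nat" "HOL-Algebra.Algebra"
begin

section \<open>Regular local rings and their completions\<close>

text \<open>Powers are taken in the monoid of ideals, so the zeroth power is the whole ring.\<close>

abbreviation ideal_power :: "('a, 'm) ring_scheme \<Rightarrow> 'a set \<Rightarrow> nat \<Rightarrow> 'a set" where
  "ideal_power R I n \<equiv> I [^]\<^bsub>ideals_set R\<^esub> n"

definition local_ring :: "('a, 'm) ring_scheme \<Rightarrow> bool" where
  "local_ring R \<longleftrightarrow> cring R \<and> (\<exists>!M. maximalideal M R)"

definition max_ideal :: "('a, 'm) ring_scheme \<Rightarrow> 'a set" where
  "max_ideal R = (THE M. maximalideal M R)"

definition krull_dim :: "('a, 'm) ring_scheme \<Rightarrow> enat" where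
  "krull_dim R = Sup {enat n | n. \<exists>p :: nat \<Rightarrow> 'a set.
     (\<forall>i\<le>n. primeideal (p i) R) \<and> (\<forall>i<n. p i \<subset> p (Suc i))}"

definition regular_system_of_parameters :: "('a, 'm) ring_scheme \<Rightarrow> 'a list \<Rightarrow> bool" where
  "regular_system_of_parameters R xs \<longleftrightarrow>
     set xs \<subseteq> carrier R \<and> Idl\<^bsub>R\<^esub> (set xs) = max_ideal R \<and> krull_dim R = enat (length xs)"

definition regular_local_ring :: "('a, 'm) ring_scheme \<Rightarrow> bool" where
  "regular_local_ring R \<longleftrightarrow>
     noetherian_ring R \<and> local_ring R \<and> (\<exists>xs. regular_system_of_parameters R xs)"

text \<open>
  The \<open>M\<close>-adic completion is the inverse limit of the rings \<open>R / M\<^sup>n\<close>. An element is a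
  sequence of cosets; the inclusion \<open>s (Suc n) \<subseteq> s n\<close> says that the transition map
  \<open>R / M\<^sup>n\<^sup>+\<^sup>1 \<rightarrow> R / M\<^sup>n\<close> sends \<open>s (Suc n)\<close> to \<open>s n\<close>.
\<close>

definition adic_completion :: "('a, 'm) ring_scheme \<Rightarrow> 'a set \<Rightarrow> (nat \<Rightarrow> 'a set) ring" where
  "adic_completion R M =
     \<lparr>carrier = {s. (\<forall>n. s n \<in> carrier (R Quot ideal_power R M n)) \<and> (\<forall>n. s (Suc n) \<subseteq> s n)},
      monoid.mult = (\<lambda>s t n. s n \<otimes>\<^bsub>R Quot ideal_power R M n\<^esub> t n),
      monoid.one = (\<lambda>n. \<one>\<^bsub>R Quot ideal_power R M n\<^esub>),
      ring.zero = (\<lambda>n. \<zero>\<^bsub>R Quot ideal_power R M n\<^esub>),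
      ring.add = (\<lambda>s t n. s n \<oplus>\<^bsub>R Quot ideal_power R M n\<^esub> t n)\<rparr>"

abbreviation completion :: "('a, 'm) ring_scheme \<Rightarrow> (nat \<Rightarrow> 'a set) ring" where
  "completion R \<equiv> adic_completion R (max_ideal R)"

definition to_completion :: "('a, 'm) ring_scheme \<Rightarrow> 'a \<Rightarrow> (nat \<Rightarrow> 'a set)" where
  "to_completion R x = (\<lambda>n. ideal_power R (max_ideal R) n +>\<^bsub>R\<^esub> x)"

section \<open>Pairs\<close>

definition is_pair :: "('a, 'm) ring_scheme \<Rightarrow> 'a set \<Rightarrow> nat \<Rightarrow> bool" where
  "is_pair R J b \<longleftrightarrow> ideal J R \<and> 0 < b"

definition closed_point_in_Sing :: "('a, 'm) ring_scheme \<Rightarrow> 'a set \<Rightarrow> nat \<Rightarrow> bool" where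
  "closed_point_in_Sing R J b \<longleftrightarrow> J \<subseteq> ideal_power R (max_ideal R) b"

section \<open>The associated graded ring\<close>

text \<open>
  An element of \<open>gr\<^sub>M(R)\<close> is a sequence whose \<open>a\<close>-th entry is a coset of \<open>M\<^sup>a\<^sup>+\<^sup>1\<close> in \<open>M\<^sup>a\<close>,
  almost all entries being the zero coset. In the product, the union over all
  representatives is a single coset, as for \<^const>\<open>rcoset_mult\<close>.
\<close>

definition assoc_graded :: "('a, 'm) ring_scheme \<Rightarrow> 'a set \<Rightarrow> (nat \<Rightarrow> 'a set) ring" where
  "assoc_graded R M =
     \<lparr>carrier = {s. (\<forall>a. \<exists>x \<in> ideal_power R M a. s a = ideal_power R M (Suc a) +>\<^bsub>R\<^esub> x) \<and>
                    finite {a. s a \<noteq> ideal_power R M (Suc a)}},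
      monoid.mult = (\<lambda>s t n. \<Union>x \<in> Pi {..n} s. \<Union>y \<in> Pi {..n} t.
                ideal_power R M (Suc n) +>\<^bsub>R\<^esub> (\<Oplus>\<^bsub>R\<^esub>i\<in>{..n}. x i \<otimes>\<^bsub>R\<^esub> y (n - i))),
      monoid.one = (\<lambda>n. if n = 0 then ideal_power R M (Suc n) +>\<^bsub>R\<^esub> \<one>\<^bsub>R\<^esub> else ideal_power R M (Suc n)),
      ring.zero = (\<lambda>n. ideal_power R M (Suc n)),
      ring.add = (\<lambda>s t n. s n <+>\<^bsub>R\<^esub> t n)\<rparr>"

text \<open>For \<open>x \<in> M\<^sup>a\<close>: the class \<open>x mod M\<^sup>a\<^sup>+\<^sup>1\<close>, as a homogeneous element of \<open>gr\<^sub>M(R)\<close> of degree \<open>a\<close>.\<close>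

definition graded_class :: "('a, 'm) ring_scheme \<Rightarrow> 'a set \<Rightarrow> nat \<Rightarrow> 'a \<Rightarrow> (nat \<Rightarrow> 'a set)" where
  "graded_class R M a x =
     (\<lambda>n. if n = a then ideal_power R M (Suc n) +>\<^bsub>R\<^esub> x else ideal_power R M (Suc n))"

definition graded_part :: "('a, 'm) ring_scheme \<Rightarrow> 'a set \<Rightarrow> nat \<Rightarrow> (nat \<Rightarrow> 'a set) set" where
  "graded_part R M a = graded_class R M a ` ideal_power R M a"

section \<open>The directrix\<close>

definition initial_ideal :: "('a, 'm) ring_scheme \<Rightarrow> 'a set \<Rightarrow> 'a set \<Rightarrow> nat \<Rightarrow> (nat \<Rightarrow> 'a set) set" where
  "initial_ideal R M J b = Idl\<^bsub>assoc_graded R M\<^esub> (graded_class R M b ` J)"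

text \<open>
  The residue field \<open>K\<close> is identified with the degree-zero part of \<open>S = gr\<^sub>M(R)\<close>. For a space
  \<open>V\<close> of linear forms with basis \<open>Y\<^sub>1, \<dots>, Y\<^sub>r\<close>, the ring \<open>K[Y\<^sub>1, \<dots>, Y\<^sub>r]\<close> is the subring
  of \<open>S\<close> generated by \<open>K\<close> and \<open>V\<close>. The library's \<^const>\<open>subalgebra\<close> is the notion of a linear
  subspace over a subfield.
\<close>

definition generating_forms ::
    "('a, 'm) ring_scheme \<Rightarrow> 'a set \<Rightarrow> 'a set \<Rightarrow> nat \<Rightarrow> (nat \<Rightarrow> 'a set) set \<Rightarrow> bool" where
  "generating_forms R M J b V \<longleftrightarrow>
     V \<subseteq> graded_part R M 1 \<and>
     subalgebra (graded_part R M 0) V (assoc_graded R M) \<and>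
     Idl\<^bsub>assoc_graded R M\<^esub>
       (initial_ideal R M J b \<inter> generate_ring (assoc_graded R M) (graded_part R M 0 \<union> V))
       = initial_ideal R M J b"

text \<open>
  \<open>V\<close> is the space of linear forms generating the ideal of the directrix of \<open>(J, b)\<close> at the
  closed point given by \<open>M\<close>.
\<close>

definition directrix_forms ::
    "('a, 'm) ring_scheme \<Rightarrow> 'a set \<Rightarrow> 'a set \<Rightarrow> nat \<Rightarrow> (nat \<Rightarrow> 'a set) set \<Rightarrow> bool" where
  "directrix_forms R M J b V \<longleftrightarrow>
     generating_forms R M J b V \<and> (\<forall>W. generating_forms R M J b W \<longrightarrow> V \<subseteq> W)"

text \<open>
  Linear independence of the degree-one classes forces each element of \<open>ys\<close> to lie outside
  \<open>M\<^sup>2\<close>, so these classes are the initial forms.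
\<close>

definition defines_directrix ::
    "('a, 'm) ring_scheme \<Rightarrow> 'a set \<Rightarrow> 'a set \<Rightarrow> nat \<Rightarrow> 'a list \<Rightarrow> bool" where
  "defines_directrix R M J b ys \<longleftrightarrow>
     set ys \<subseteq> M \<and>
     (let S = assoc_graded R M; K = graded_part R M 0; Ys = map (graded_class R M 1) ys
      in ring.independent S K Ys \<and> directrix_forms R M J b (ring.Span S K Ys))"

text \<open>
  \<open>(ys)\<close> yields the directrix of \<open>(J R', b)\<close> at the point of \<open>R' = R / \<langle>us\<rangle>\<close> defined by the
  ideal generated by the images of \<open>(ys)\<close>. If \<open>(us, ys)\<close> is a regular system of parameters, that
  ideal is the maximal ideal of the local ring \<open>R'\<close>, and no further localization is needed.
\<close>

definition yields_directrix_mod ::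
    "('a, 'm) ring_scheme \<Rightarrow> 'a set \<Rightarrow> nat \<Rightarrow> 'a list \<Rightarrow> 'a list \<Rightarrow> bool" where
  "yields_directrix_mod R J b us ys \<longleftrightarrow>
     (let I = Idl\<^bsub>R\<^esub> (set us); R' = R Quot I; \<pi> = (\<lambda>x. I +>\<^bsub>R\<^esub> x)
      in defines_directrix R' (Idl\<^bsub>R'\<^esub> (\<pi> ` set ys)) (Idl\<^bsub>R'\<^esub> (\<pi> ` J)) b (map \<pi> ys))"

section \<open>Polyhedra\<close>

definition monomial :: "('a, 'm) ring_scheme \<Rightarrow> 'a list \<Rightarrow> nat list \<Rightarrow> 'a" where
  "monomial R xs A = (\<Otimes>\<^bsub>R\<^esub>i\<in>{..<length xs}. (xs ! i) [^]\<^bsub>R\<^esub> (A ! i))"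

text \<open>\<open>C\<close> is the coefficient family of a finite expansion of \<open>g\<close>, with each coefficient zero or a unit.\<close>

definition is_expansion ::
    "('a, 'm) ring_scheme \<Rightarrow> 'a list \<Rightarrow> 'a list \<Rightarrow> 'a \<Rightarrow> (nat list \<times> nat list \<Rightarrow> 'a) \<Rightarrow> bool" where
  "is_expansion R us ys g C \<longleftrightarrow>
     finite {AB. C AB \<noteq> \<zero>\<^bsub>R\<^esub>} \<and>
     (\<forall>A B. C (A, B) \<noteq> \<zero>\<^bsub>R\<^esub> \<longrightarrow>
        length A = length us \<and> length B = length ys \<and> C (A, B) \<in> Units R) \<and>
     g = (\<Oplus>\<^bsub>R\<^esub>AB\<in>{AB. C AB \<noteq> \<zero>\<^bsub>R\<^esub>}.
            C AB \<otimes>\<^bsub>R\<^esub> monomial R us (fst AB) \<otimes>\<^bsub>R\<^esub> monomial R ys (snd AB))"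

text \<open>
  Points of \<open>\<real>\<^sup>e\<close> are the points of \<^term>\<open>Euclidean_space e\<close>, i.e. the functions
  vanishing at all indices \<open>i \<ge> e\<close>; this type carries no vector space instance, hence the
  pointwise notion of convexity.
\<close>

definition orthant :: "nat \<Rightarrow> (nat \<Rightarrow> real) set" where
  "orthant e = {v \<in> topspace (Euclidean_space e). \<forall>i. 0 \<le> v i}"

definition pointwise_convex :: "(nat \<Rightarrow> real) set \<Rightarrow> bool" where
  "pointwise_convex D \<longleftrightarrow>
     (\<forall>v\<in>D. \<forall>w\<in>D. \<forall>t\<in>{0..1}. (\<lambda>i. (1 - t) * v i + t * w i) \<in> D)"

definition shifted_orthant :: "nat \<Rightarrow> nat \<Rightarrow> nat list \<times> nat list \<Rightarrow> (nat \<Rightarrow> real) set" where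
  "shifted_orthant e b AB =
     {(\<lambda>i. (if i < e then real (fst AB ! i) / (real b - real (sum_list (snd AB))) else 0) + v i)
      | v. v \<in> orthant e}"

definition polyhedron_of_expansions ::
    "('a, 'm) ring_scheme \<Rightarrow> nat \<Rightarrow> nat \<Rightarrow> (nat list \<times> nat list \<Rightarrow> 'a) list \<Rightarrow> (nat \<Rightarrow> real) set" where
  "polyhedron_of_expansions R e b Cs =
     \<Inter>{D. D \<subseteq> orthant e \<and> closedin (Euclidean_space e) D \<and> pointwise_convex D \<and>
          (\<forall>C \<in> set Cs. \<forall>A B. C (A, B) \<noteq> \<zero>\<^bsub>R\<^esub> \<and> sum_list B < b \<longrightarrow> shifted_orthant e b (A, B) \<subseteq> D)}"

text \<open>
  The polyhedron of \<open>(J, b)\<close> with respect to \<open>(us; ys)\<close> does not depend on the chosen generators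
  \<open>fs\<close> of \<open>J\<close> and their expansions, so an arbitrary choice is made.
\<close>

definition polyhedron ::
    "('a, 'm) ring_scheme \<Rightarrow> 'a set \<Rightarrow> nat \<Rightarrow> 'a list \<Rightarrow> 'a list \<Rightarrow> (nat \<Rightarrow> real) set" where
  "polyhedron R J b us ys =
     (SOME D. \<exists>fs Cs. set fs \<subseteq> carrier R \<and> Idl\<^bsub>R\<^esub> (set fs) = J \<and>
        list_all2 (is_expansion R us ys) fs Cs \<and>
        D = polyhedron_of_expansions R (length us) b Cs)"

definition polyhedron_completion ::
    "('a, 'm) ring_scheme \<Rightarrow> 'a set \<Rightarrow> nat \<Rightarrow> 'a list \<Rightarrow> (nat \<Rightarrow> 'a set) list \<Rightarrow> (nat \<Rightarrow> real) set" where
  "polyhedron_completion R J b us ys =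
     polyhedron (completion R) (Idl\<^bsub>completion R\<^esub> (to_completion R ` J)) b
       (map (to_completion R) us) ys"

definition characteristic_polyhedron ::
    "('a, 'm) ring_scheme \<Rightarrow> 'a set \<Rightarrow> nat \<Rightarrow> 'a list \<Rightarrow> (nat \<Rightarrow> real) set" where
  "characteristic_polyhedron R J b us =
     \<Inter>{polyhedron_completion R J b us ys | ys.
         regular_system_of_parameters (completion R) (map (to_completion R) us @ ys)}"

end

theory Submission
 imports Defs "HOL-Library.Function_Algebras"
begin

text \<open>A regular system of parameters satisfies the monomial conjecture: a monomial lies in the ideal generated
 by an up-closed set of monomials only if its exponent belongs to that set. This follows from the Krull dimension
 by counting chains of ideals. Hence finite expansions have well-defined minimal exponents, also in the
 completion, and a half space with positive weights contains the polyhedron iff \<open>J\<close> is contained in a certain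
 ideal generated by monomials.

 If the polyhedron for \<open>y\<close> is not contained in the one for \<open>y'\<close>, choose generic weights defining a half space that
 contains the latter but not the former, and let \<open>- c u\<^sup>A\<close> be the part of least weight in the expansion
 of \<open>y\<close> with respect to \<open>(u, y')\<close>. Then the translation \<open>y + c u\<^sup>A\<close> removes the point \<open>A\<close> from the polyhedron: otherwise the initial
 forms would be invariant under a translation, and fewer than \<open>r\<close> forms would define the directrix. Removing
 such points one after the other, always the first one in an enumeration of the exponents, yields translations that
 converge in the completion to a system whose polyhedron is minimal. The translations lie in the ideal
 generated by \<open>u\<close>, so neither \<open>x'\<close> nor the directrix changes.\<close>

section \<open>Ideals and monomials\<close>

text \<open>A regular local ring need not contain a coefficient field, so expansions are not unique
  and their coefficients cannot be compared directly. Every comparison is made instead by testing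
  membership in ideals generated by monomials. A weight that is injective on exponents serves as a
  monomial order: a coefficient either is a unit, and then its monomial can be isolated, or lies in
  \<open>M\<close>, and then the term moves to heavier monomials. For the comparison of polyhedra
  only the ideal generated by y' matters, so y' may be replaced by y minus finite sums of monomials
  in u with unit coefficients; the part of least weight is taken from these sums. Injectivity also
  shows that an exponent of \<open>J\<close> on the hyperplane through \<open>A\<close> contributes
  the point \<open>A\<close> itself. The polyhedra decrease, so removed points do not return; they
  are distinct lattice points, their degrees tend to infinity, and this gives convergence. The use
  of an enumeration is a fairness condition: a point still removable for the limit is removable at
  all late stages, where only finitely many points can be preferred to it.\<close>

definition exps :: "nat => (nat => nat) set" where
 "exps n = {al. \<forall>i\<ge>n. al i = 0}"

definition tdeg :: "nat => (nat => nat) => nat" where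
 "tdeg n al = (\<Sum>i<n. al i)"

definition wt :: "nat => (nat => real) => (nat => nat) => real" where
 "wt n L al = (\<Sum>i<n. L i * real (al i))"

definition upset :: "nat => (nat => nat) set => bool" where
 "upset n S \<longleftrightarrow> S \<subseteq> exps n \<and> (\<forall>al\<in>S. \<forall>be\<in>exps n. al \<le> be \<longrightarrow> be \<in> S)"

definition unit_exp :: "nat => nat => nat" where
 "unit_exp i = (\<lambda>j. if j = i then 1 else 0)"

definition mon :: "('a, 'm) ring_scheme => (nat => 'a) => nat => (nat => nat) => 'a" where
 "mon R x n al = (\<Otimes>\<^bsub>R\<^esub>i\<in>{..<n}. x i [^]\<^bsub>R\<^esub> al i)"

lemma exps_zero [simp]: "0 \<in> exps n"
 by (simp add: exps_def)

lemma exps_add [simp]: "al \<in> exps n ==> be \<in> exps n ==> al + be \<in> exps n"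
 by (simp add: exps_def)

lemma exps_diff [simp]: "al \<in> exps n ==> al - be \<in> exps n"
 by (simp add: exps_def)

lemma exps_unit [simp]: "i < n ==> unit_exp i \<in> exps n"
 by (auto simp: exps_def unit_exp_def)

declare plus_fun_apply [simp del]

lemma tdeg_zero [simp]: "tdeg n 0 = 0"
 by (simp add: tdeg_def)

lemma tdeg_add [simp]: "tdeg n (al + be) = tdeg n al + tdeg n be"
 by (simp add: tdeg_def plus_fun_apply sum.distrib)

lemma tdeg_unit [simp]: "i < n ==> tdeg n (unit_exp i) = 1"
 by (simp add: tdeg_def unit_exp_def)

lemma wt_zero [simp]: "wt n L 0 = 0"
 by (simp add: wt_def)

lemma wt_add [simp]: "wt n L (al + be) = wt n L al + wt n L be"
 by (simp add: wt_def plus_fun_apply sum.distrib algebra_simps)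

lemma wt_unit [simp]: "i < n ==> wt n L (unit_exp i) = L i"
 by (simp add: wt_def unit_exp_def if_distrib cong: if_cong)

lemma exp_diff_add: "(al :: nat => nat) \<le> be ==> al + (be - al) = be"
 by (auto simp: le_fun_def fun_eq_iff plus_fun_apply)

lemma tdeg_mono: "al \<le> be ==> tdeg n al \<le> tdeg n be"
 by (simp add: tdeg_def le_fun_def sum_mono)

lemma wt_mono:
 assumes "\<And>i. i < n ==> 0 \<le> L i" "al \<le> be"
 shows "wt n L al \<le> wt n L be"
 unfolding wt_def using assms by (intro sum_mono mult_left_mono) (auto simp: le_fun_def)

lemma wt_nonneg: "(\<And>i. i < n ==> 0 \<le> L i) ==> 0 \<le> wt n L al"
 unfolding wt_def by (intro sum_nonneg) auto

lemma tdeg_eq_0: "al \<in> exps n ==> tdeg n al = 0 ==> al = 0"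
 by (auto simp: tdeg_def exps_def fun_eq_iff) (meson lessThan_iff not_le)

lemma exp_pos:
 assumes "al \<in> exps n" "tdeg n al > 0"
 obtains i where "i < n" "unit_exp i \<le> al" 
proof -
 have "\<exists>i<n. al i > 0" using assms(2) by (auto simp: tdeg_def intro: ccontr)
 then obtain i where "i < n" "al i > 0" by blast
 hence "unit_exp i \<le> al" by (auto simp: le_fun_def unit_exp_def)
 with \<open>i < n\<close> that show ?thesis by blast
qed

text \<open>Relates a monomial of large degree to the generators of a given power of the maximal
  ideal, the monomials of degree exactly \<open>k\<close>.\<close>

lemma exp_split:
 assumes "al \<in> exps n" "k \<le> tdeg n al"
 shows "\<exists>be ga. be \<in> exps n \<and> ga \<in> exps n \<and> al = be + ga \<and> tdeg n be = k"
 using assms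
proof (induction k)
 case 0
 show ?case using 0 by (metis add_0 exps_zero tdeg_zero)
next
 case (Suc k)
 then obtain be ga where *: "be \<in> exps n" "ga \<in> exps n" "al = be + ga" "tdeg n be = k" by auto
 with Suc(3) have "tdeg n ga > 0" by auto
 then obtain i where i: "i < n" "unit_exp i \<le> ga" using exp_pos *(2) by blast
 have "al = (be + unit_exp i) + (ga - unit_exp i)"
  using *(3) exp_diff_add[OF i(2)] by (simp add: add.assoc)
 moreover have "tdeg n (be + unit_exp i) = Suc k" using i * by simp
 ultimately show ?case using i * by (metis exps_add exps_diff exps_unit)
qed

lemma exps_degree_split: "al \<in> exps n ==> tdeg n al = 1 ==> \<exists>i<n. al = unit_exp i"
proof -
 assume a: "al \<in> exps n" "tdeg n al = 1"
 then obtain i where i: "i < n" "unit_exp i \<le> al" using exp_pos by (metis zero_less_one)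
 have e: "al = unit_exp i + (al - unit_exp i)" using exp_diff_add[OF i(2)] by simp
 have "tdeg n al = tdeg n (unit_exp i) + tdeg n (al - unit_exp i)" by (metis e tdeg_add)
 hence "tdeg n (al - unit_exp i) = 0" using a i by simp
 hence "al - unit_exp i = 0" using a tdeg_eq_0 exps_diff by blast
 thus ?thesis using e i by (metis add.right_neutral)
qed

lemma finite_bounded_exps: "finite {al \<in> exps n. \<forall>i<n. al i < m}"
proof -
 have "{al \<in> exps n. \<forall>i<n. al i < m} \<subseteq> (\<lambda>f i. if i < n then f i else 0) ` (PiE {..<n} (\<lambda>_. {..<m}))"
 proof
  fix al assume a: "al \<in> {al \<in> exps n. \<forall>i<n. al i < m}"
  hence "restrict al {..<n} \<in> PiE {..<n} (\<lambda>_. {..<m})" by auto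
  moreover have "al = (\<lambda>i. if i < n then restrict al {..<n} i else 0)"
   using a by (auto simp: exps_def fun_eq_iff)
  ultimately show "al \<in> (\<lambda>f i. if i < n then f i else 0) ` (PiE {..<n} (\<lambda>_. {..<m}))" by blast
 qed
 thus ?thesis by (rule finite_subset) (intro finite_imageI finite_PiE, auto)
qed

lemma le_tdeg: "i < n ==> al i \<le> tdeg n al"
 unfolding tdeg_def by (rule member_le_sum) auto

lemma finite_exps_tdeg: "finite {al \<in> exps n. tdeg n al < m}"
 by (rule finite_subset[OF _ finite_bounded_exps[of n m]]) (auto dest: le_tdeg le_less_trans)

lemma finite_exps_tdeg_eq: "finite {al \<in> exps n. tdeg n al = m}"
 by (rule finite_subset[OF _ finite_exps_tdeg[of n "Suc m"]]) auto

lemma wt_tdeg_lower: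
 assumes "\<And>i. i < n ==> c \<le> L i"
 shows "c * real (tdeg n al) \<le> wt n L al"
 unfolding wt_def tdeg_def of_nat_sum sum_distrib_left
 using assms by (intro sum_mono mult_right_mono) auto

lemma wt_tdeg_upper:
 assumes "\<And>i. i < n ==> L i \<le> c"
 shows "wt n L al \<le> c * real (tdeg n al)"
 unfolding wt_def tdeg_def of_nat_sum sum_distrib_left
 using assms by (intro sum_mono mult_right_mono) auto

lemma min_weight:
 fixes n :: nat
 assumes "\<And>i. i < n ==> (0::real) < L i"
 obtains c where "0 < c" "\<And>i. i < n ==> c \<le> L i"
proof -
 \<comment> \<open>The entry 1 keeps the set nonempty when \<open>n\<close> is 0.\<close>
 let ?A = "insert 1 (L ` {..<n})"
 have fin: "finite ?A" by simp
 have "0 < Min ?A" using assms by (subst Min_gr_iff[OF fin]) auto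
 moreover have "Min ?A \<le> L i" if "i < n" for i using that by (intro Min_le[OF fin]) auto
 ultimately show ?thesis using that by blast
qed

text \<open>A positive weight dominates a positive multiple of the degree.\<close>

lemma finite_exps_wt:
 assumes "\<And>i. i < n ==> 0 < L i"
 shows "finite {al \<in> exps n. wt n L al < w}"
proof -
 obtain c where c: "0 < c" "\<And>i. i < n ==> c \<le> L i" using min_weight assms by blast
 obtain m where m: "w / c < real m" using reals_Archimedean2 by blast
 have "tdeg n al < m" if "wt n L al < w" for al
 proof -
  have "c * real (tdeg n al) < w" using wt_tdeg_lower[OF c(2), of n] that by (meson le_less_trans)
  hence "real (tdeg n al) < w / c" using c(1) by (simp add: field_simps)
  thus ?thesis using m by linarith
 qed
 thus ?thesis by (intro finite_subset[OF _ finite_exps_tdeg[of n m]]) auto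
qed

text \<open>Sublevel sets of a positive weight are finite, so a minimum exists, and injectivity
  makes it unique. This is how an injective weight takes the place of a monomial order.\<close>

lemma least_exp:
 assumes L: "\<And>i. i < n ==> 0 < L i" and inj: "inj_on (wt n L) (exps n)" and S: "S \<subseteq> exps n" "S \<noteq> {}"
 shows "\<exists>al\<in>S. \<forall>be\<in>S. be \<noteq> al \<longrightarrow> wt n L al < wt n L be"
proof -
 obtain \<sigma> where s: "\<sigma> \<in> S" using S(2) by blast
 \<comment> \<open>The summand 1 only makes the finite sublevel set contain
   \<open>\<sigma>\<close>.\<close>
 define B where "B = {be \<in> S. wt n L be < wt n L \<sigma> + 1}"
 have fin: "finite B" unfolding B_def using S(1) by (intro finite_subset[OF _ finite_exps_wt[of n L, OF L]]) auto
 have ne: "B \<noteq> {}" using s by (auto simp: B_def)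
 define al where "al = arg_min_on (wt n L) B"
 have a: "al \<in> B" using arg_min_if_finite(1)[OF fin ne] al_def by blast
 have "wt n L al < wt n L be" if b: "be \<in> S" "be \<noteq> al" for be
 proof -
  have "wt n L al \<le> wt n L be"
   using arg_min_least[OF fin ne, of be "wt n L"] a b(1) by (cases "be \<in> B") (auto simp: B_def al_def)
  moreover have "wt n L al \<noteq> wt n L be" using inj_onD[OF inj, of al be] a b S(1) by (auto simp: B_def)
  ultimately show ?thesis by simp
 qed
 thus ?thesis using a by (auto simp: B_def)
qed

section \<open>Dickson's lemma\<close>

lemma nat_incseq_subseq:
 fixes f :: "nat => nat"
 shows "\<exists>g. strict_mono g \<and> incseq (f \<circ> g)"
proof -
 obtain g where g: "strict_mono (g :: nat => nat)" "monoseq (\<lambda>k. f (g k))" using seq_monosub by blast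
 show ?thesis
 proof (cases "incseq (\<lambda>k. f (g k))")
  case True
  thus ?thesis using g by (auto simp: o_def)
 next
  case False
  hence d: "decseq (\<lambda>k. f (g k))" using g by (auto simp: monoseq_iff)
  \<comment> \<open>A decreasing sequence of natural numbers is constant once it has reached its
    least value, and a constant tail is increasing.\<close>
  obtain K where K: "\<And>k. f (g K) \<le> f (g k)"
   using ex_has_least_nat[of "\<lambda>_. True" 0 "\<lambda>k. f (g k)"] by auto
  have "f (g k) = f (g K)" if "k \<ge> K" for k using d K[of k] that by (simp add: decseq_def le_antisym)
  hence "incseq (f \<circ> (g \<circ> (\<lambda>k. k + K)))" unfolding incseq_def o_def by (metis le_add2 order_refl)
  moreover have "strict_mono (g \<circ> (\<lambda>k. k + K))" using g by (auto simp: strict_mono_def)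
  ultimately show ?thesis by blast
 qed
qed

text \<open>The sequence is refined one coordinate after the other; passing to a further subsequence
  preserves monotonicity in the coordinates already treated.\<close>

lemma dickson:
 fixes s :: "nat => nat => nat"
 assumes "\<And>k. s k \<in> exps n"
 shows "\<exists>g. strict_mono g \<and> incseq (s \<circ> g)"
proof -
 have "\<exists>g. strict_mono (g :: nat => nat) \<and> (\<forall>i<m. incseq (\<lambda>k. s (g k) i))" for m
 proof (induction m)
  case 0
  show ?case by (rule exI[of _ id]) (auto simp: strict_mono_def)
 next
  case (Suc m)
  then obtain g where g: "strict_mono (g :: nat => nat)" "\<forall>i<m. incseq (\<lambda>k. s (g k) i)" by blast
  obtain h where h: "strict_mono h" "incseq ((\<lambda>k. s (g k) m) \<circ> h)" using nat_incseq_subseq by blast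
  have "incseq (\<lambda>k. s (g (h k)) i)" if "i < Suc m" for i
  proof (cases "i = m")
   case False
   hence "incseq (\<lambda>k. s (g k) i)" using g that by auto
   thus ?thesis using strict_mono_mono[OF h(1)] by (auto simp: incseq_def mono_def)
  qed (use h in \<open>simp add: o_def\<close>)
  moreover have "strict_mono (\<lambda>k. g (h k))" using g h by (simp add: strict_mono_def)
  ultimately show ?case by blast
 qed
 then obtain g where g: "strict_mono (g :: nat => nat)" "\<forall>i<n. incseq (\<lambda>k. s (g k) i)" by blast
 have "incseq (s \<circ> g)"
  unfolding incseq_def le_fun_def
 proof (intro allI impI)
  fix k l i :: nat assume "k \<le> l"
  thus "(s \<circ> g) k i \<le> (s \<circ> g) l i"
   using g(2) assms by (cases "i < n") (auto simp: incseq_def exps_def)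
 qed
 with g show ?thesis by blast
qed

lemma dickson_finite:
 assumes "S \<subseteq> exps n" "infinite S"
 obtains s :: "nat => nat => nat" where "\<And>k. s k \<in> S" "\<And>k l. k < l ==> s k \<le> s l \<and> s k \<noteq> s l"
proof -
 obtain f :: "nat => nat => nat" where f: "inj f" "range f \<subseteq> S"
  using assms(2) infinite_countable_subset by blast
 hence "\<And>k. f k \<in> exps n" using assms by blast
 then obtain g where g: "strict_mono g" "incseq (f \<circ> g)" using dickson by blast
 show thesis
 proof (rule that[of "f \<circ> g"])
  show "(f \<circ> g) k \<in> S" for k using f by auto
  show "(f \<circ> g) k \<le> (f \<circ> g) l \<and> (f \<circ> g) k \<noteq> (f \<circ> g) l" if "k < l" for k l
   using that f g by (auto simp: incseq_def inj_def) (metis nat_neq_iff strict_mono_less)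
 qed
qed

text \<open>The minimal elements form an antichain, and an infinite set of exponents contains a
  strictly increasing sequence. A minimal element below a given one is found by induction on the
  degree.\<close>

lemma minimal_exps:
 assumes "S \<subseteq> exps n"
 obtains T where "finite T" "T \<subseteq> S" "\<And>al. al \<in> S ==> \<exists>ta\<in>T. ta \<le> al"
  "\<And>\<sigma> ta. \<sigma> \<in> T ==> ta \<in> T ==> \<sigma> \<le> ta ==> \<sigma> = ta"
proof -
 define T where "T = {ta \<in> S. \<forall>\<sigma>\<in>S. \<sigma> \<le> ta \<longrightarrow> \<sigma> = ta}"
 have "finite T"
 proof (rule ccontr)
  assume "infinite T"
  moreover have "T \<subseteq> exps n" using assms T_def by auto
  ultimately obtain s :: "nat => nat => nat" where "\<And>k. s k \<in> T" "\<And>k l. k < l ==> s k \<le> s l \<and> s k \<noteq> s l"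
   using dickson_finite by metis
  thus False unfolding T_def by (metis (mono_tags, lifting) lessI mem_Collect_eq)
 qed
 moreover have "\<exists>ta\<in>T. ta \<le> al" if "al \<in> S" for al
  using that
 proof (induction "tdeg n al" arbitrary: al rule: less_induct)
  case less
  show ?case
  proof (cases "al \<in> T")
   case False
   then obtain \<sigma> where \<sigma>: "\<sigma> \<in> S" "\<sigma> \<le> al" "\<sigma> \<noteq> al" using less T_def by auto
   have "al = \<sigma> + (al - \<sigma>)" using exp_diff_add[OF \<sigma>(2)] by simp
   hence "tdeg n al = tdeg n \<sigma> + tdeg n (al - \<sigma>)" by (metis tdeg_add)
   moreover have "tdeg n (al - \<sigma>) \<noteq> 0"
    using tdeg_eq_0 exps_diff assms less(2) \<sigma> \<open>al = \<sigma> + (al - \<sigma>)\<close> by (metis add.right_neutral subsetD)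
   ultimately have "tdeg n \<sigma> < tdeg n al" by simp
   then obtain ta where "ta \<in> T" "ta \<le> \<sigma>" using less(1)[of \<sigma>] \<sigma> by blast
   thus ?thesis using \<sigma> by (meson order_trans)
  qed blast
 qed
 ultimately show thesis using that[of T] unfolding T_def by blast
qed

section \<open>Ideals of a commutative ring\<close>

context cring
begin

lemma ideal_add: "ideal I R ==> a \<in> I ==> b \<in> I ==> a \<oplus> b \<in> I"
 by (simp add: additive_subgroup.a_closed ideal.axioms(1))

lemma ideal_mult: "ideal I R ==> a \<in> carrier R ==> b \<in> I ==> a \<otimes> b \<in> I"
 by (simp add: ideal.I_l_closed)

lemma ideal_zero: "ideal I R ==> \<zero> \<in> I"
 by (simp add: additive_subgroup.zero_closed ideal.axioms(1))

lemma ideal_uminus: "ideal I R ==> a \<in> I ==> \<ominus> a \<in> I"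
 by (simp add: additive_subgroup.a_inv_closed ideal.axioms(1))

lemma ideal_minus: "ideal I R ==> a \<in> I ==> b \<in> I ==> a \<ominus> b \<in> I"
 unfolding a_minus_def by (intro ideal_add ideal_uminus)

lemma ideal_sub: "ideal I R ==> I \<subseteq> carrier R"
 by (intro subsetI ideal.Icarr)

lemma ideal_addE1: "ideal I R ==> a \<oplus> b \<in> I ==> b \<in> I ==> a \<in> carrier R ==> a \<in> I"
proof -
 assume *: "ideal I R" "a \<oplus> b \<in> I" "b \<in> I" "a \<in> carrier R"
 hence "a = (a \<oplus> b) \<ominus> b" using ideal.Icarr[of I R] by (simp add: a_minus_def a_assoc r_neg)
 thus ?thesis using * ideal_minus by metis
qed

lemma ideal_minusE1: "ideal I R ==> a \<ominus> b \<in> I ==> b \<in> I ==> a \<in> carrier R ==> a \<in> I"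
 unfolding a_minus_def using ideal_addE1 ideal_uminus by blast

lemma unit_cancel:
 assumes "a \<in> Units R" "g \<in> carrier R" "ideal I R" "a \<otimes> g \<in> I"
 shows "g \<in> I"
proof -
 have "inv a \<otimes> (a \<otimes> g) \<in> I" by (rule ideal_mult[OF assms(3) Units_inv_closed[OF assms(1)] assms(4)])
 thus ?thesis using assms by (simp add: m_assoc[symmetric] Units_closed)
qed

lemma proper_ideal_no_unit: "ideal I R ==> I \<noteq> carrier R ==> a \<in> I ==> a \<notin> Units R"
 using unit_cancel[of a \<one> I] ideal.one_imp_carrier r_one Units_closed by force

lemma coset_eq: "ideal I R ==> a \<in> carrier R ==> b \<in> carrier R ==> I +> a = I +> b \<longleftrightarrow> a \<ominus> b \<in> I"
 using quotient_eq_iff_same_a_r_cos by blast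

lemma coset_zero: "ideal I R ==> I +> \<zero> = I"
 by (rule a_coset_add_zero[OF ideal_sub])

lemma coset_mem: "ideal I R ==> a \<in> carrier R ==> b \<in> I +> a \<longleftrightarrow> b \<in> carrier R \<and> b \<ominus> a \<in> I"
proof
 assume I: "ideal I R" and a: "a \<in> carrier R"
 {
  assume "b \<in> I +> a"
  then obtain p where p: "p \<in> I" "b = p \<oplus> a" unfolding a_r_coset_def' by blast
  moreover have "p \<in> carrier R" using p(1) ideal_sub[OF I] by blast
  moreover from this have "(p \<oplus> a) \<ominus> a = p" using a by algebra
  ultimately show "b \<in> carrier R \<and> b \<ominus> a \<in> I" using a by simp
 next
  assume b: "b \<in> carrier R \<and> b \<ominus> a \<in> I"
  hence "b = (b \<ominus> a) \<oplus> a" using a by algebra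
  thus "b \<in> I +> a" unfolding a_r_coset_def' using b by blast
 }
qed

lemma ideal_Collect:
 assumes "\<And>a. P a ==> a \<in> carrier R" "P \<zero>" "\<And>a b. P a ==> P b ==> P (a \<oplus> b)"
  "\<And>a x. P a ==> x \<in> carrier R ==> P (x \<otimes> a)"
 shows "ideal {a. P a} R"
proof (rule idealI)
 show "subgroup {a. P a} (add_monoid R)"
 proof (rule add.subgroupI)
  fix a assume a: "a \<in> {a. P a}"
  hence "P (\<ominus> \<one> \<otimes> a)" using assms by auto
  moreover have "\<ominus> \<one> \<otimes> a = \<ominus> a" using a assms by (simp add: l_minus)
  ultimately show "\<ominus> a \<in> {a. P a}" by simp
 qed (use assms in auto)
 show "ring R" by (rule ring_axioms)
qed (use assms m_comm in \<open>auto\<close>)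

lemma genideal_ind:
 assumes G: "G \<subseteq> carrier R" and f: "f \<in> Idl G" and 0: "P \<zero>"
  and 1: "\<And>a x. a \<in> carrier R ==> x \<in> G ==> P (a \<otimes> x)"
  and 2: "\<And>f g. f \<in> Idl G ==> g \<in> Idl G ==> P f ==> P g ==> P (f \<oplus> g)"
 shows "P f"
proof -
 have id: "ideal (Idl G) R" using G genideal_ideal by blast
 have "ideal {f. f \<in> Idl G \<and> (\<forall>a\<in>carrier R. P (a \<otimes> f))} R"
 proof (rule ideal_Collect)
  fix f g assume "f \<in> Idl G \<and> (\<forall>a\<in>carrier R. P (a \<otimes> f))" "g \<in> Idl G \<and> (\<forall>a\<in>carrier R. P (a \<otimes> g))"
  thus "f \<oplus> g \<in> Idl G \<and> (\<forall>a\<in>carrier R. P (a \<otimes> (f \<oplus> g)))"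
   using 2 ideal_add[OF id] ideal_mult[OF id] ideal.Icarr[OF id] by (auto simp: r_distr)
 next
  fix a x assume "a \<in> Idl G \<and> (\<forall>aa\<in>carrier R. P (aa \<otimes> a))" "x \<in> carrier R"
  thus "x \<otimes> a \<in> Idl G \<and> (\<forall>aa\<in>carrier R. P (aa \<otimes> (x \<otimes> a)))"
   using ideal_mult[OF id] ideal.Icarr[OF id] by (auto simp flip: m_assoc)
 qed (use 0 ideal.Icarr[OF id] ideal_zero[OF id] in auto)
 moreover have "G \<subseteq> {f. f \<in> Idl G \<and> (\<forall>a\<in>carrier R. P (a \<otimes> f))}"
  using 1 genideal_self[OF G] by auto
 ultimately have "f \<in> {f. f \<in> Idl G \<and> (\<forall>a\<in>carrier R. P (a \<otimes> f))}"
  using f genideal_minimal by blast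
 hence "P (\<one> \<otimes> f)" by auto
 moreover have "f \<in> carrier R" using f id ideal.Icarr by fast
 ultimately show ?thesis by simp
qed

lemma genideal_mono: "G \<subseteq> Y ==> Idl G \<subseteq> Idl Y"
 unfolding genideal_def by blast

lemma genideal_of_ideal: "ideal I R ==> Idl I = I"
 by (intro subset_antisym genideal_minimal genideal_self ideal_sub) auto

lemma genideal_union:
 assumes "G \<subseteq> carrier R" "Y \<subseteq> carrier R"
 shows "f \<in> Idl (G \<union> Y) \<longleftrightarrow> (\<exists>g\<in>Idl G. \<exists>h\<in>Idl Y. f = g \<oplus> h)"
proof
 have iG: "ideal (Idl G) R" and iY: "ideal (Idl Y) R" using assms genideal_ideal by auto
 have GY: "G \<union> Y \<subseteq> carrier R" using assms by auto
 show "\<exists>g\<in>Idl G. \<exists>h\<in>Idl Y. f = g \<oplus> h" if "f \<in> Idl (G \<union> Y)"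
 proof (rule genideal_ind[OF GY that])
  show "\<exists>g\<in>Idl G. \<exists>h\<in>Idl Y. \<zero> = g \<oplus> h"
   using ideal_zero[OF iG] ideal_zero[OF iY] by force
 next
  fix a x assume a: "a \<in> carrier R" "x \<in> G \<union> Y"
  show "\<exists>g\<in>Idl G. \<exists>h\<in>Idl Y. a \<otimes> x = g \<oplus> h"
  proof (cases "x \<in> G")
   case True
   hence "a \<otimes> x \<in> Idl G" using a ideal_mult[OF iG] genideal_self[OF assms(1)] by auto
   thus ?thesis using ideal_zero[OF iY] ideal.Icarr[OF iG] by (metis r_zero)
  next
   case False
   hence "a \<otimes> x \<in> Idl Y" using a ideal_mult[OF iY] genideal_self[OF assms(2)] by auto
   thus ?thesis using ideal_zero[OF iG] ideal.Icarr[OF iY] by (metis l_zero)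
  qed
 next
  fix f g
  assume "\<exists>h\<in>Idl G. \<exists>k\<in>Idl Y. f = h \<oplus> k" "\<exists>h\<in>Idl G. \<exists>k\<in>Idl Y. g = h \<oplus> k"
  then obtain h k h' k' where "h\<in>Idl G" "k\<in>Idl Y" "f = h \<oplus> k" "h'\<in>Idl G" "k'\<in>Idl Y" "g = h' \<oplus> k'"
   by blast
  moreover from this have "f \<oplus> g = (h \<oplus> h') \<oplus> (k \<oplus> k')"
   using ideal.Icarr[OF iG] ideal.Icarr[OF iY] by (simp add: a_ac)
  ultimately show "\<exists>h\<in>Idl G. \<exists>k\<in>Idl Y. f \<oplus> g = h \<oplus> k"
   using ideal_add[OF iG] ideal_add[OF iY] by blast
 qed
 assume "\<exists>g\<in>Idl G. \<exists>h\<in>Idl Y. f = g \<oplus> h"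
 thus "f \<in> Idl (G \<union> Y)"
  using ideal_add[OF genideal_ideal[OF GY]] genideal_mono[of G "G \<union> Y"] genideal_mono[of Y "G \<union> Y"] by blast
qed

lemma genideal_singleton: "g \<in> carrier R ==> f \<in> Idl {g} \<longleftrightarrow> (\<exists>a\<in>carrier R. f = a \<otimes> g)"
 using cgenideal_eq_genideal[of g] by (auto simp: cgenideal_def)

lemma genideal_insert:
 assumes "g \<in> carrier R" "G \<subseteq> carrier R"
 shows "f \<in> Idl (insert g G) \<longleftrightarrow> (\<exists>a\<in>carrier R. \<exists>h\<in>Idl G. f = a \<otimes> g \<oplus> h)"
proof -
 have "f \<in> Idl (insert g G) \<longleftrightarrow> (\<exists>k\<in>Idl {g}. \<exists>h\<in>Idl G. f = k \<oplus> h)"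
  using genideal_union[of "{g}" G] assms by simp
 thus ?thesis unfolding Bex_def genideal_singleton[OF assms(1)] by blast
qed

lemma genideal_mult:
 assumes "G \<subseteq> carrier R" "f \<in> Idl G" "g \<in> carrier R" "ideal I R" "\<And>x. x \<in> G ==> g \<otimes> x \<in> I"
 shows "g \<otimes> f \<in> I"
proof (rule genideal_ind[OF assms(1,2), where P = "\<lambda>f. g \<otimes> f \<in> I"])
 show "g \<otimes> \<zero> \<in> I" using assms ideal_zero by simp
 show "g \<otimes> (a \<otimes> x) \<in> I" if "a \<in> carrier R" "x \<in> G" for a x
 proof -
  have "x \<in> carrier R" using that assms by blast
  hence "g \<otimes> (a \<otimes> x) = a \<otimes> (g \<otimes> x)" using assms that by (simp add: m_lcomm)
  thus ?thesis using assms that ideal_mult by metis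
 qed
 fix f h assume "f \<in> Idl G" "h \<in> Idl G" "g \<otimes> f \<in> I" "g \<otimes> h \<in> I"
 moreover have "Idl G \<subseteq> carrier R" using assms genideal_ideal ideal_sub by blast
 ultimately show "g \<otimes> (f \<oplus> h) \<in> I" using assms ideal_add by (simp add: r_distr subset_iff)
qed

lemma ideal_union_mem: "ideal I R ==> ideal J R ==> f \<in> Idl (I \<union> J) \<longleftrightarrow> (\<exists>g\<in>I. \<exists>h\<in>J. f = g \<oplus> h)"
 by (simp add: genideal_union ideal_sub genideal_of_ideal)

text \<open>The ideal fJ + I. It transports a chain above a colon ideal to a chain above
  \<open>I\<close>, and it bounds the product of an ideal with (f) + I after an application of
  Artin-Rees.\<close>

lemma ideal_scaled_add:
 assumes I: "ideal I R" and J: "ideal J R" and f: "f \<in> carrier R"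
 shows "ideal {g. \<exists>a\<in>J. \<exists>h\<in>I. g = f \<otimes> a \<oplus> h} R"
proof (rule ideal_Collect)
 have c: "I \<subseteq> carrier R" "J \<subseteq> carrier R" using ideal_sub I J by auto
 thus "g \<in> carrier R" if "\<exists>a\<in>J. \<exists>h\<in>I. g = f \<otimes> a \<oplus> h" for g using that f by auto
 show "\<exists>a\<in>J. \<exists>h\<in>I. \<zero> = f \<otimes> a \<oplus> h"
  using ideal_zero[OF I] ideal_zero[OF J] f by (intro bexI[of _ \<zero>]) auto
 fix g assume "\<exists>a\<in>J. \<exists>h\<in>I. g = f \<otimes> a \<oplus> h"
 then obtain a h where g: "a \<in> J" "h \<in> I" "g = f \<otimes> a \<oplus> h" by blast
 hence gc: "a \<in> carrier R" "h \<in> carrier R" using c by auto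
 show "\<exists>a\<in>J. \<exists>h\<in>I. y \<otimes> g = f \<otimes> a \<oplus> h" if y: "y \<in> carrier R" for y
 proof -
  have "y \<otimes> g = f \<otimes> (y \<otimes> a) \<oplus> y \<otimes> h" unfolding g(3) using gc y f by algebra
  thus ?thesis using ideal_mult[OF J y g(1)] ideal_mult[OF I y g(2)] by blast
 qed
 fix g' assume "\<exists>a\<in>J. \<exists>h\<in>I. g' = f \<otimes> a \<oplus> h"
 then obtain a' h' where g': "a' \<in> J" "h' \<in> I" "g' = f \<otimes> a' \<oplus> h'" by blast
 hence gc': "a' \<in> carrier R" "h' \<in> carrier R" using c by auto
 have "g \<oplus> g' = f \<otimes> (a \<oplus> a') \<oplus> (h \<oplus> h')" unfolding g(3) g'(3) using gc gc' f by algebra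
 thus "\<exists>a\<in>J. \<exists>h\<in>I. g \<oplus> g' = f \<otimes> a \<oplus> h"
  using ideal_add[OF J g(1) g'(1)] ideal_add[OF I g(2) g'(2)] by blast
qed

lemma ideal_power_ideal: "ideal I R ==> ideal (ideal_power R I k) R"
proof (induction k)
 case 0
 thus ?case by (simp add: ideals_set_def nat_pow_def oneideal)
next
 case (Suc k)
 thus ?case using ideal_prod_is_ideal
  by (simp add: ideals_set_def nat_pow_def)
qed

lemma ideal_power_0: "ideal_power R I 0 = carrier R"
 by (simp add: ideals_set_def nat_pow_def)

lemma ideal_power_Suc: "ideal_power R I (Suc k) = ideal_prod R (ideal_power R I k) I"
 by (simp add: ideals_set_def nat_pow_def)

lemma ideal_power_1: "ideal I R ==> ideal_power R I 1 = I"
 using ideal_prod_one[of I] ideal_prod_commute[OF oneideal, of I]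
 by (simp only: One_nat_def ideal_power_Suc ideal_power_0)

lemma ideal_power_Suc_le: "ideal I R ==> ideal_power R I (Suc k) \<subseteq> ideal_power R I k"
 unfolding ideal_power_Suc using ideal_prod_inter[OF ideal_power_ideal[of I k]] by blast

lemma ideal_power_antimono: "ideal I R ==> k \<le> l ==> ideal_power R I l \<subseteq> ideal_power R I k"
 by (rule lift_Suc_antimono_le[of "ideal_power R I"]) (use ideal_power_Suc_le in blast)+

section \<open>Monomials and powers of an ideal\<close>

lemma mon_closed [simp]: "x \<in> {..<n} \<rightarrow> carrier R ==> mon R x n al \<in> carrier R"
 unfolding mon_def by (rule finprod_closed) auto

lemma mon_add:
 assumes "x \<in> {..<n} \<rightarrow> carrier R"
 shows "mon R x n (al + be) = mon R x n al \<otimes> mon R x n be"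
proof -
 have "mon R x n (al + be) = (\<Otimes>i\<in>{..<n}. x i [^] al i \<otimes> x i [^] be i)"
  unfolding mon_def using assms by (intro finprod_cong') (auto simp: nat_pow_mult plus_fun_apply Pi_def)
 also have "\<dots> = mon R x n al \<otimes> mon R x n be"
  unfolding mon_def using assms by (intro finprod_multf) auto
 finally show ?thesis .
qed

lemma mon_zero [simp]: "mon R x n 0 = \<one>"
 unfolding mon_def by (rule finprod_one_eqI) auto

lemma mon_unit:
 assumes "x \<in> {..<n} \<rightarrow> carrier R" "j < n"
 shows "mon R x n (unit_exp j) = x j"
proof -
 have "mon R x n (unit_exp j) = (\<Otimes>i\<in>{..<n}. if j = i then x i else \<one>)"
  unfolding mon_def unit_exp_def using assms by (intro finprod_cong') (auto simp: Pi_def)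
 thus ?thesis using finprod_singleton[of j "{..<n}" x] assms by (auto simp: Pi_def)
qed

lemma mon_le:
 assumes "x \<in> {..<n} \<rightarrow> carrier R" "al \<le> be"
 shows "mon R x n be = mon R x n (be - al) \<otimes> mon R x n al"
 using mon_add[OF assms(1), of "be - al" al] exp_diff_add[OF assms(2)]
  by (simp add: add.commute)

lemma mon_image_closed: "x \<in> {..<n} \<rightarrow> carrier R ==> mon R x n ` S \<subseteq> carrier R"
 using mon_closed by blast

lemma mon_mem_le:
 assumes "x \<in> {..<n} \<rightarrow> carrier R" "al \<in> S" "al \<le> be"
 shows "mon R x n be \<in> Idl (mon R x n ` S)"
 using mon_le[OF assms(1,3)] ideal_mult[OF genideal_ideal[OF mon_image_closed[OF assms(1)]]]
  genideal_self[OF mon_image_closed[OF assms(1)], of S] assms by auto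

text \<open>A monomial of degree k + 1 splits off one variable, and a monomial of degree k times a
  variable has degree k + 1. Questions about powers of the maximal ideal thus become questions about
  exponents.\<close>

lemma ideal_power_monomials:
 assumes x: "x \<in> {..<n} \<rightarrow> carrier R" and M: "M = Idl (x ` {..<n})"
 shows "ideal_power R M k = Idl (mon R x n ` {al \<in> exps n. tdeg n al = k})"
proof (induction k)
 case 0
 have "\<one> \<in> mon R x n ` {al \<in> exps n. tdeg n al = 0}"
  by (rule image_eqI[of _ _ 0]) auto
 hence "carrier R \<subseteq> Idl (mon R x n ` {al \<in> exps n. tdeg n al = 0})"
  using genideal_mono[of "{\<one>}"] genideal_one by (metis empty_subsetI insert_subset)
 thus ?case using ideal_sub[OF genideal_ideal[OF mon_image_closed[OF x]]] ideal_power_0 by blast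
next
 case (Suc k)
 let ?m = "mon R x n" and ?E = "\<lambda>k. {al \<in> exps n. tdeg n al = k}"
 have xc: "x ` {..<n} \<subseteq> carrier R" using x by auto
 have iM: "ideal M R" using M genideal_ideal xc by blast
 have c: "?m ` S \<subseteq> carrier R" for S using mon_image_closed[OF x] .
 have id: "ideal (Idl (?m ` S)) R" for S using genideal_ideal[OF c] .
 show ?case
 proof
  show "Idl (?m ` ?E (Suc k)) \<subseteq> ideal_power R M (Suc k)"
  proof (rule genideal_minimal)
   show "ideal (ideal_power R M (Suc k)) R" using ideal_power_ideal iM .
   show "?m ` ?E (Suc k) \<subseteq> ideal_power R M (Suc k)"
   proof (rule image_subsetI)
    fix al assume a: "al \<in> ?E (Suc k)"
    obtain be ga where *: "be \<in> exps n" "ga \<in> exps n" "al = be + ga" "tdeg n be = k"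
     using exp_split[of al n k] a by auto
    hence "tdeg n ga = 1" using a by auto
    then obtain i where "i < n" "ga = unit_exp i" using * exps_degree_split by blast
    hence "?m ga \<in> M" using mon_unit[OF x] M genideal_self[OF xc] by auto
    moreover have "?m be \<in> ideal_power R M k" using Suc * genideal_self[OF c, of "?E k"] by auto
    ultimately show "?m al \<in> ideal_power R M (Suc k)"
     unfolding ideal_power_Suc *(3) mon_add[OF x] by (rule ideal_prod.prod[rotated])
   qed
  qed
  have "i \<otimes> j \<in> Idl (?m ` ?E (Suc k))" if ij: "i \<in> Idl (?m ` ?E k)" "j \<in> M" for i j
  proof (rule genideal_mult[OF xc, of j i])
   have ic: "i \<in> carrier R" using ij id ideal.Icarr by fast
   show "j \<in> Idl (x ` {..<n})" using ij M by simp
   show "i \<in> carrier R" by fact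
   show "ideal (Idl (?m ` ?E (Suc k))) R" by (rule id)
   fix z assume "z \<in> x ` {..<n}"
   then obtain l where l: "l < n" "z = x l" by auto
   have "z \<otimes> i \<in> Idl (?m ` ?E (Suc k))"
   proof (rule genideal_mult[OF c ij(1)])
    show "z \<in> carrier R" using l x by auto
    show "ideal (Idl (?m ` ?E (Suc k))) R" by (rule id)
    fix y assume "y \<in> ?m ` ?E k"
    then obtain be where "be \<in> ?E k" "y = ?m be" by auto
    hence "z \<otimes> y = ?m (unit_exp l + be)" "unit_exp l + be \<in> ?E (Suc k)"
     using l mon_add[OF x] mon_unit[OF x] by auto
    thus "z \<otimes> y \<in> Idl (?m ` ?E (Suc k))"
     using genideal_self[OF c, of "?E (Suc k)"] by (metis (no_types, lifting) image_eqI subsetD)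
   qed
   moreover have "z \<in> carrier R" using l x by auto
   ultimately show "i \<otimes> z \<in> Idl (?m ` ?E (Suc k))" using ic m_comm[of i z] by simp
  qed
  thus "ideal_power R M (Suc k) \<subseteq> Idl (?m ` ?E (Suc k))"
   unfolding ideal_power_Suc Suc
  proof (intro subsetI)
   fix f assume "f \<in> (Idl (?m ` ?E k)) \<cdot> M"
   thus "f \<in> Idl (?m ` ?E (Suc k))"
   proof (induction rule: ideal_prod.induct)
    case (sum a b)
    thus ?case using ideal_add[OF id] by blast
   qed fact
  qed
 qed
qed

end

section \<open>Counting chains of ideals\<close>

lemma countable_exps: "countable (exps n)"
proof -
 have "exps n \<subseteq> (\<Union>m. {al \<in> exps n. tdeg n al < m})" by blast
 moreover have "countable (\<Union>m. {al \<in> exps n. tdeg n al < m})"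
  by (rule countable_UN) (auto intro: countable_finite finite_exps_tdeg)
 ultimately show ?thesis by (rule countable_subset)
qed

text \<open>\<open>L0\<close> is perturbed by (s, s^2, s^3, ...). Two distinct exponents then have
  equal weight only if s is a root of a nonzero polynomial. There are countably many pairs of
  exponents and uncountably many s, so one s serves all pairs.\<close>

lemma generic_weight:
 fixes L0 :: "nat => real"
 assumes "\<epsilon> > 0"
 obtains L where "\<And>i. L0 i < L i" "\<And>i. L i < L0 i + \<epsilon>" "inj_on (wt n L) (exps n)"
proof -
 define B where "B = (\<lambda>(al, be). {s :: real. wt n (\<lambda>i. L0 i + s ^ Suc i) al = wt n (\<lambda>i. L0 i + s ^ Suc i) be})"
 have fin: "finite (B (al, be))" if ab: "al \<in> exps n" "be \<in> exps n" "al \<noteq> be" for al be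
 proof -
  \<comment> \<open>Coefficients of the weight difference as a polynomial in s: the constant one
    comes from \<open>L0\<close>, the k-th from coordinate k - 1.\<close>
  define c where "c k = (if k = 0 then \<Sum>i<n. L0 i * (real (al i) - real (be i))
              else real (al (k - 1)) - real (be (k - 1)))" for k
  obtain i where i: "al i \<noteq> be i" using ab by auto
  hence "i < n" using ab by (auto simp: exps_def not_less[symmetric])
  hence "\<exists>k\<le>n. c k \<noteq> 0" using i by (intro exI[of _ "Suc i"]) (auto simp: c_def)
  hence f: "finite {z. (\<Sum>k\<le>n. c k * z ^ k) = 0}"
   by (simp add: polyfun_finite_roots)
  have eq: "wt n (\<lambda>i. L0 i + s ^ Suc i) al - wt n (\<lambda>i. L0 i + s ^ Suc i) be = (\<Sum>k\<le>n. c k * s ^ k)" for s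
  proof -
   have "(\<Sum>k\<le>n. c k * s ^ k) = c 0 + (\<Sum>k<n. c (Suc k) * s ^ Suc k)"
    by (simp add: sum.atMost_shift)
   also have "\<dots> = (\<Sum>i<n. L0 i * (real (al i) - real (be i)) + (real (al i) - real (be i)) * s ^ Suc i)"
    by (simp add: c_def sum.distrib)
   also have "\<dots> = wt n (\<lambda>i. L0 i + s ^ Suc i) al - wt n (\<lambda>i. L0 i + s ^ Suc i) be"
    unfolding wt_def sum_subtractf[symmetric] by (intro sum.cong) (auto simp: algebra_simps)
   finally show ?thesis by simp
  qed
  have "B (al, be) = {z. (\<Sum>k\<le>n. c k * z ^ k) = 0}"
   by (simp only: B_def prod.case eq[symmetric] right_minus_eq)
  thus ?thesis using f by simp
 qed
 let ?P = "{(al, be) \<in> exps n \<times> exps n. al \<noteq> be}"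
 have "countable (\<Union>p\<in>?P. B p)"
 proof (rule countable_UN)
  show "countable ?P"
   by (rule countable_subset[of _ "exps n \<times> exps n"]) (auto intro: countable_SIGMA countable_exps)
 qed (use fin in \<open>auto intro: countable_finite\<close>)
 moreover have "uncountable {0<..<min 1 \<epsilon>}" using assms by (simp add: uncountable_open_interval)
 ultimately have "\<not> {0<..<min 1 \<epsilon>} \<subseteq> (\<Union>p\<in>?P. B p)" using countable_subset by blast
 then obtain s where s: "s \<in> {0<..<min 1 \<epsilon>}" "s \<notin> (\<Union>p\<in>?P. B p)" unfolding subset_eq by blast
 show thesis
 proof (rule that[of "\<lambda>i. L0 i + s ^ Suc i"])
  show "L0 i < L0 i + s ^ Suc i" for i using s by simp
  show "L0 i + s ^ Suc i < L0 i + \<epsilon>" for i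
  proof -
   have "s * s ^ i \<le> s * 1" using s by (intro mult_left_mono power_le_one) auto
   moreover have "s < \<epsilon>" using s by simp
   ultimately show ?thesis unfolding power_Suc by linarith
  qed
  show "inj_on (wt n (\<lambda>i. L0 i + s ^ Suc i)) (exps n)"
   using s(2) by (auto simp: inj_on_def B_def)
 qed
qed

lemma positive_generic_weight: "\<exists>L. (\<forall>i. (0::real) < L i) \<and> inj_on (wt n L) (exps n)"
proof -
 obtain L where "\<And>i. (\<lambda>_. 0 :: real) i < L i" "inj_on (wt n L) (exps n)"
  by (rule generic_weight[of 1 "\<lambda>_. 0" n]) auto
 thus ?thesis by auto
qed

section \<open>Counting exponents\<close>

lemma card_box: "card {al \<in> exps n. \<forall>i<n. al i < B i} = (\<Prod>i<n. B i)"
proof -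
 have "bij_betw (\<lambda>al. restrict al {..<n}) {al \<in> exps n. \<forall>i<n. al i < B i} (PiE {..<n} (\<lambda>i. {..<B i}))"
  by (rule bij_betwI[of _ _ _ "\<lambda>f i. if i < n then f i else 0"])
    (auto simp: exps_def fun_eq_iff PiE_def extensional_def)
 hence "card {al \<in> exps n. \<forall>i<n. al i < B i} = card (PiE {..<n} (\<lambda>i. {..<B i}))"
  by (rule bij_betw_same_card)
 thus ?thesis by (simp add: card_PiE)
qed

lemma card_exps_tdeg: "card {al \<in> exps n. tdeg n al < m} \<le> m ^ n"
proof -
 have "card {al \<in> exps n. tdeg n al < m} \<le> card {al \<in> exps n. \<forall>i<n. al i < m}"
  by (rule card_mono[OF finite_bounded_exps]) (auto dest: le_tdeg le_less_trans)
 thus ?thesis by (simp add: card_box)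
qed

text \<open>An exponent not above \<open>\<mu>\<close> is smaller than \<open>\<mu>\<close> in some
  coordinate i, which leaves \<open>\<mu> i\<close> values there and at most \<open>m\<close> in
  every other coordinate. The power of \<open>m\<close> is one less than in the count of all
  exponents, and this gap is what \<open>growth_leading\<close> exploits.\<close>

lemma card_exps_not_above:
 "card {al \<in> exps n. tdeg n al < m \<and> \<not> \<mu> \<le> al} \<le> tdeg n \<mu> * m ^ (n - 1)" if "\<mu> \<in> exps n"
proof -
 let ?B = "\<lambda>i j. if j = i then \<mu> i else m"
 have "{al \<in> exps n. tdeg n al < m \<and> \<not> \<mu> \<le> al} \<subseteq> (\<Union>i<n. {al \<in> exps n. \<forall>j<n. al j < ?B i j})"
 proof
  fix al assume a: "al \<in> {al \<in> exps n. tdeg n al < m \<and> \<not> \<mu> \<le> al}"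
  then obtain i where i: "al i < \<mu> i" by (auto simp: le_fun_def not_le)
  hence "i < n" using that by (auto simp: exps_def) (metis less_zeroE not_less)
  moreover have "al j < ?B i j" if "j < n" for j using i le_tdeg[OF that, of al] a by auto
  ultimately show "al \<in> (\<Union>i<n. {al \<in> exps n. \<forall>j<n. al j < ?B i j})"
   using a by (intro UN_I[of i]) (simp_all del: if_split)
 qed
 moreover have "finite (\<Union>i<n. {al \<in> exps n. \<forall>j<n. al j < ?B i j})"
 proof (intro finite_UN_I)
  fix i assume "i \<in> {..<n}"
  show "finite {al \<in> exps n. \<forall>j<n. al j < ?B i j}"
   by (rule finite_subset[OF _ finite_bounded_exps[of n "max (\<mu> i) m"]]) (auto split: if_splits)
 qed auto
 ultimately have "card {al \<in> exps n. tdeg n al < m \<and> \<not> \<mu> \<le> al} \<le> card (\<Union>i<n. {al \<in> exps n. \<forall>j<n. al j < ?B i j})"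
  by (rule card_mono[rotated])
 also have "\<dots> \<le> (\<Sum>i<n. card {al \<in> exps n. \<forall>j<n. al j < ?B i j})" by (rule card_UN_le) auto
 also have "\<dots> = (\<Sum>i<n. \<mu> i * m ^ (n - 1))"
 proof (rule sum.cong)
  fix i assume i: "i \<in> {..<n}"
  have "(\<Prod>j<n. ?B i j) = \<mu> i * (\<Prod>j\<in>{..<n}-{i}. ?B i j)" using i by (subst prod.remove) auto
  also have "(\<Prod>j\<in>{..<n}-{i}. ?B i j) = (\<Prod>j\<in>{..<n}-{i}. m)" by (rule prod.cong) auto
  finally show "card {al \<in> exps n. \<forall>j<n. al j < ?B i j} = \<mu> i * m ^ (n - 1)"
   using i unfolding card_box by simp
 qed auto
 also have "\<dots> = tdeg n \<mu> * m ^ (n - 1)" by (simp add: tdeg_def sum_distrib_right)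
 finally show ?thesis .
qed

text \<open>In terms of modules, R/I has length at least \<open>N\<close>: the chain has N + 1
  members and \<open>N\<close> strict steps.\<close>

definition chain_above :: "('a, 'm) ring_scheme => 'a set => nat => bool" where
 "chain_above R I N \<longleftrightarrow>
   (\<exists>c. (\<forall>i\<le>N. ideal (c i) R \<and> I \<subseteq> c i) \<and> (\<forall>i<N. c i \<subset> c (Suc i)))"

text \<open>A substitute for the Hilbert--Samuel function having degree at least \<open>k\<close>, which needs no lengths of modules.\<close>

definition growth :: "('a, 'm) ring_scheme => 'a set => nat => bool" where
 "growth R M k \<longleftrightarrow> (\<exists>K>0. \<forall>q\<ge>1. chain_above R (ideal_power R M (K * q)) (q ^ k))"

text \<open>A local ring with \<open>n\<close> generators of its maximal ideal. That
  \<open>n\<close> is also the right number is the separate condition \<open>growth\<close> of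
  \<open>regular_parameters\<close>.\<close>

locale parameters = cring R for R (structure) +
 fixes x :: "nat => 'a" and n :: nat and M :: "'a set"
 assumes x_closed: "x \<in> {..<n} \<rightarrow> carrier R"
  and M_gen: "M = Idl (x ` {..<n})"
  and M_proper: "M \<noteq> carrier R"
  and M_local: "\<And>a. a \<in> carrier R ==> a \<notin> M ==> a \<in> Units R"
begin

abbreviation mx :: "(nat => nat) => 'a" where "mx \<equiv> mon R x n"

abbreviation mI :: "(nat => nat) set => 'a set" where "mI S \<equiv> Idl (mx ` S)"

lemma x_image: "x ` {..<n} \<subseteq> carrier R"
 using x_closed by auto

lemma mx_closed [simp]: "mx al \<in> carrier R"
 using x_closed by simp

lemma mx_sub: "mx ` S \<subseteq> carrier R"
 using mx_closed by blast

lemma mI_ideal: "ideal (mI S) R"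
 by (rule genideal_ideal[OF mx_sub])

lemma mI_carr: "f \<in> mI S ==> f \<in> carrier R"
 using mI_ideal ideal.Icarr by fast

lemma M_ideal: "ideal M R"
 unfolding M_gen by (rule genideal_ideal[OF x_image])

lemma M_carr: "f \<in> M ==> f \<in> carrier R"
 using M_ideal ideal.Icarr by fast

lemma mI_memI: "al \<in> S ==> mx al \<in> mI S"
 using genideal_self[OF mx_sub, of S] by blast

lemma mI_memI': "al \<in> S ==> al \<le> be ==> mx be \<in> mI S"
 by (rule mon_mem_le[OF x_closed])

lemma mI_mono: "S \<subseteq> T ==> mI S \<subseteq> mI T"
 by (rule genideal_mono) auto

lemma mx_add: "mx (al + be) = mx al \<otimes> mx be"
 by (rule mon_add[OF x_closed])

lemma power_M: "ideal_power R M k = mI {al \<in> exps n. tdeg n al = k}"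
 by (rule ideal_power_monomials[OF x_closed M_gen])

lemma mx_power_M: "al \<in> exps n ==> k \<le> tdeg n al ==> mx al \<in> ideal_power R M k"
proof -
 assume a: "al \<in> exps n" "k \<le> tdeg n al"
 then obtain be ga where "be \<in> exps n" "al = be + ga" "tdeg n be = k" using exp_split by blast
 moreover from this have "be \<le> al" by (simp add: le_fun_def plus_fun_apply)
 ultimately show ?thesis unfolding power_M by (intro mI_memI'[of be]) auto
qed

lemma M_unit: "a \<in> Units R ==> a \<notin> M"
 using proper_ideal_no_unit[OF M_ideal M_proper] by blast

lemma mult_M:
 assumes "a \<in> M" "ideal I R" "g \<in> carrier R" "\<And>i. i < n ==> x i \<otimes> g \<in> I"
 shows "a \<otimes> g \<in> I"
proof -
 have "g \<otimes> a \<in> I"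
 proof (rule genideal_mult[OF x_image _ assms(3,2)])
  show "a \<in> Idl (x ` {..<n})" using assms M_gen by simp
  fix z assume "z \<in> x ` {..<n}"
  then obtain i where i: "i < n" "z = x i" by auto
  moreover have "x i \<in> carrier R" using i x_closed by auto
  ultimately show "g \<otimes> z \<in> I" using assms m_comm[of g z] by auto
 qed
 thus ?thesis using assms M_carr m_comm by simp
qed

lemma mult_M_mx:
 assumes "a \<in> M" "ideal I R" "\<And>i. i < n ==> mx (unit_exp i + al) \<in> I"
 shows "a \<otimes> mx al \<in> I"
 by (rule mult_M) (use assms mx_add mon_unit[OF x_closed] in auto)

lemma mI_insert: "f \<in> mI (insert al S) \<longleftrightarrow> (\<exists>a\<in>carrier R. \<exists>h\<in>mI S. f = a \<otimes> mx al \<oplus> h)"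
 unfolding image_insert by (rule genideal_insert[OF mx_closed mx_sub])

lemma mult_M_mI:
 assumes "a \<in> M" "\<And>i. i < n ==> unit_exp i + al \<in> S"
 shows "a \<otimes> mx al \<in> mI S"
 by (rule mult_M_mx[OF assms(1) mI_ideal mI_memI[OF assms(2)]])

text \<open>An ideal above M^m is controlled by its leading exponents, those \<open>al\<close> for
  which \<open>mx al\<close> is, modulo the ideal, a combination of heavier monomials. If
  \<open>I\<close> has all leading exponents of \<open>I'\<close>, the two ideals agree. Starting
  with all monomials of degree below \<open>m\<close>, the lightest one is discarded at each stage:
  its coefficient either lies in \<open>M\<close>, and the term becomes heavier, or is a unit, and
  \<open>E\<close> exchanges the monomial for heavier ones.\<close>

lemma chain_step:
 assumes L: "\<And>i. i < n ==> 0 < L i" and inj: "inj_on (wt n L) (exps n)"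
  and I: "ideal I R" "ideal I' R" "ideal_power R M m \<subseteq> I" "I \<subseteq> I'"
  and E: "\<And>al. al \<in> exps n ==> tdeg n al < m ==> mx al \<in> Idl (I' \<union> mx ` {be \<in> exps n. wt n L al < wt n L be})
       ==> mx al \<in> Idl (I \<union> mx ` {be \<in> exps n. wt n L al < wt n L be})"
 shows "I' \<subseteq> I"
proof -
 let ?X = "{al \<in> exps n. tdeg n al < m}"
 have cI: "I \<subseteq> carrier R" "I' \<subseteq> carrier R" using I ideal_sub by auto
 have c: "I \<union> mx ` T \<subseteq> carrier R" "I' \<union> mx ` T \<subseteq> carrier R" for T using cI mx_sub by auto
 have id: "ideal (Idl (I \<union> mx ` T)) R" "ideal (Idl (I' \<union> mx ` T)) R" for T using c genideal_ideal by auto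
 have main: "I' \<subseteq> I" if "T \<subseteq> ?X" "\<And>al be. al \<in> T ==> be \<in> ?X ==> wt n L al < wt n L be ==> be \<in> T"
  "I' \<subseteq> Idl (I \<union> mx ` T)" for T
  using that
 proof (induction "card T" arbitrary: T rule: less_induct)
  case less
  have finT: "finite T" using less(2) finite_exps_tdeg finite_subset by blast
  show ?case
  proof (cases "T = {}")
   case True
   thus ?thesis using less(4) genideal_of_ideal[OF I(1)] by simp
  next
   case False
   have "T \<subseteq> exps n" using less(2) by auto
   then obtain al where a: "al \<in> T" "\<And>be. be \<in> T ==> be \<noteq> al ==> wt n L al < wt n L be"
    using least_exp[OF L inj _ False] by blast
   have aX: "al \<in> exps n" "tdeg n al < m" using a less(2) by auto
   let ?T' = "T - {al}" let ?H = "Idl (I \<union> mx ` ?T')" let ?U = "{be \<in> exps n. wt n L al < wt n L be}"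
   have T'U: "?T' \<subseteq> ?U" using a(2) less(2) by auto
   have UH: "mx ` ?U \<subseteq> ?H"
   proof (rule image_subsetI)
    fix be assume b: "be \<in> ?U"
    show "mx be \<in> ?H"
    proof (cases "tdeg n be < m")
     case True
     hence "be \<in> ?T'" using b less(3) a by auto
     thus ?thesis using genideal_self[OF c(1), of ?T'] by auto
    next
     case False
     hence "mx be \<in> ideal_power R M m" using b by (intro mx_power_M) auto
     thus ?thesis using I(3) genideal_self[OF c(1), of ?T'] by auto
    qed
   qed
   have IH: "I \<subseteq> ?H" using genideal_self[OF c(1), of ?T'] by auto
   have "I' \<subseteq> ?H"
   proof
    fix f assume f: "f \<in> I'"
    have "f \<in> Idl (insert (mx al) (I \<union> mx ` ?T'))"
     using f less(4) a(1) genideal_mono[of "I \<union> mx ` T" "insert (mx al) (I \<union> mx ` ?T')"] by auto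
    then obtain a' h where ah: "a' \<in> carrier R" "h \<in> ?H" "f = a' \<otimes> mx al \<oplus> h"
     using genideal_insert[OF mx_closed c(1)] by metis
    have hc: "h \<in> carrier R" using ah id ideal.Icarr by fast
    have "a' \<otimes> mx al \<in> ?H"
    proof (cases "a' \<in> M")
     case True
     thus ?thesis
     proof (rule mult_M_mx[OF _ id(1)])
      fix i assume i: "i < n"
      hence "unit_exp i + al \<in> ?U" using aX L by auto
      thus "mx (unit_exp i + al) \<in> ?H" using UH by auto
     qed
    next
     case False
     hence u: "a' \<in> Units R" using ah M_local by auto
     let ?H' = "Idl (I' \<union> mx ` ?U)"
     have "I \<union> mx ` ?T' \<subseteq> I' \<union> mx ` ?U" using I(4) T'U by auto
     hence "h \<in> ?H'" using ah(2) genideal_mono by blast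
     moreover have "f \<in> ?H'" using f genideal_self[OF c(2), of ?U] by auto
     ultimately have "a' \<otimes> mx al \<in> ?H'"
      using ideal_addE1[OF id(2), of "a' \<otimes> mx al" h] ah by auto
     hence "mx al \<in> ?H'" using unit_cancel[OF u mx_closed id(2)] by blast
     hence "mx al \<in> Idl (I \<union> mx ` ?U)" using E aX by blast
     moreover have "Idl (I \<union> mx ` ?U) \<subseteq> ?H" using IH UH by (intro genideal_minimal[OF id(1)] Un_least)
     ultimately show ?thesis using ideal_mult[OF id(1)] ah by blast
    qed
    thus "f \<in> ?H" using ah ideal_add[OF id(1)] by blast
   qed
   moreover have "card ?T' < card T" using finT a by (meson card_Diff1_less)
   moreover have "?T' \<subseteq> ?X" using less(2) by auto
   moreover have "be \<in> ?T'" if "ga \<in> ?T'" "be \<in> ?X" "wt n L ga < wt n L be" for ga be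
    using that less(3)[of ga be] a(2)[of ga] by auto
   ultimately show ?thesis using less(1)[of ?T'] by blast
  qed
 qed
 show ?thesis
 proof (cases "m = 0")
  case True
  thus ?thesis using I(3) cI ideal_power_0 by auto
 next
  case False
  \<comment> \<open>Start of the descent: \<open>mx 0\<close> is the unit element, so the monomials
    of \<open>?X\<close> generate the whole ring.\<close>
  hence "0 \<in> ?X" by simp
  hence "\<one> \<in> mx ` ?X" using mon_zero by (metis (no_types, lifting) image_eqI)
  hence "\<one> \<in> Idl (I \<union> mx ` ?X)" using genideal_self[OF c(1), of ?X] by auto
  hence "Idl (I \<union> mx ` ?X) = carrier R" using id(1) ideal.one_imp_carrier by blast
  thus ?thesis using main[of ?X] cI by auto
 qed
qed

text \<open>Along a strict chain the set of leading exponents of degree below \<open>m\<close> grows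
  strictly, by \<open>chain_step\<close>. From the outset it contains every exponent of degree below
  \<open>m\<close> outside \<open>Z\<close>, so there is room for at most \<open>card Z\<close>
  steps.\<close>

lemma chain_upper_bound:
 assumes L: "\<And>i. i < n ==> 0 < L i" and inj: "inj_on (wt n L) (exps n)"
  and c: "chain_above R (ideal_power R M m) N"
  and sub: "Z \<subseteq> {al \<in> exps n. tdeg n al < m}"
  and Z: "\<And>al. al \<in> exps n ==> tdeg n al < m ==> al \<notin> Z ==> mx al \<in> mI {be \<in> exps n. wt n L al < wt n L be}"
 shows "N \<le> card Z"
proof -
 let ?X = "{al \<in> exps n. tdeg n al < m}" and ?U = "\<lambda>al. {be \<in> exps n. wt n L al < wt n L be}"
 obtain c where c: "\<And>i. i \<le> N ==> ideal (c i) R" "\<And>i. i \<le> N ==> ideal_power R M m \<subseteq> c i"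
  "\<And>i. i < N ==> c i \<subset> c (Suc i)"
  using c unfolding chain_above_def by blast
 define E where "E I = {al \<in> ?X. mx al \<in> Idl (I \<union> mx ` ?U al)}" for I
 have Emono: "E I \<subseteq> E I'" if "I \<subseteq> I'" for I I'
  unfolding E_def using genideal_mono[of "I \<union> mx ` ?U _" "I' \<union> mx ` ?U _"] that by blast
 have finX: "finite ?X" by (rule finite_exps_tdeg)
 have finE: "finite (E I)" for I unfolding E_def by (rule finite_subset[OF _ finX]) auto
 have strict: "E (c i) \<subset> E (c (Suc i))" if "i < N" for i
 proof -
  have "\<not> E (c (Suc i)) \<subseteq> E (c i)"
  proof
   assume le: "E (c (Suc i)) \<subseteq> E (c i)"
   have "c (Suc i) \<subseteq> c i"
   proof (rule chain_step[OF L inj])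
    fix al assume "al \<in> exps n" "tdeg n al < m" "mx al \<in> Idl (c (Suc i) \<union> mx ` ?U al)"
    hence "al \<in> E (c (Suc i))" by (simp add: E_def)
    thus "mx al \<in> Idl (c i \<union> mx ` ?U al)" using le unfolding E_def by blast
   next
    show "c i \<subseteq> c (Suc i)" using c(3)[OF that] by blast
   qed (use c that in auto)
   thus False using c(3)[OF that] by blast
  qed
  thus ?thesis using Emono[of "c i" "c (Suc i)"] c(3)[OF that] by blast
 qed
 have grow: "card (E (c 0)) + i \<le> card (E (c i))" if "i \<le> N" for i
  using that
 proof (induction i)
  case (Suc i)
  hence "card (E (c i)) < card (E (c (Suc i)))" using strict[of i] finE by (intro psubset_card_mono) auto
  thus ?case using Suc by auto
 qed simp
 have "?X - Z \<subseteq> E (c 0)"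
 proof
  fix al assume "al \<in> ?X - Z"
  hence "mx al \<in> mI (?U al)" "al \<in> ?X" using Z by auto
  thus "al \<in> E (c 0)" using genideal_mono[of "mx ` ?U al" "c 0 \<union> mx ` ?U al"] unfolding E_def by blast
 qed
 hence "card (?X - Z) \<le> card (E (c 0))" using finE card_mono by blast
 moreover have "card (?X - Z) = card ?X - card Z" using sub finX by (intro card_Diff_subset) (auto intro: finite_subset)
 moreover have "card (E (c N)) \<le> card ?X" using finX by (intro card_mono) (auto simp: E_def)
 moreover have "card Z \<le> card ?X" using sub finX card_mono by blast
 ultimately show ?thesis using grow[of N] by linarith
qed

text \<open>Counting all exponents of degree below Kq bounds q^k by K^n q^n, which is impossible for
  k > n as soon as q exceeds K^n.\<close>

lemma growth_le:
 assumes "growth R M k"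
 shows "k \<le> n"
proof (rule ccontr)
 assume "\<not> k \<le> n"
 hence k: "k \<ge> Suc n" by simp
 obtain K where K: "K > 0" "\<And>q. q \<ge> 1 ==> chain_above R (ideal_power R M (K * q)) (q ^ k)"
  using assms unfolding growth_def by blast
 define q where "q = Suc (K ^ n)"
 obtain L where L: "\<And>i. 0 < L i" "inj_on (wt n L) (exps n)"
  using positive_generic_weight by blast
 have "q ^ k \<le> card {al \<in> exps n. tdeg n al < K * q}"
  by (rule chain_upper_bound[OF L(1) L(2) K(2)]) (auto simp: q_def)
 also have "\<dots> \<le> (K * q) ^ n" by (rule card_exps_tdeg)
 also have "\<dots> = K ^ n * q ^ n" by (simp add: power_mult_distrib)
 also have "\<dots> < q * q ^ n" by (simp add: q_def)
 also have "\<dots> \<le> q ^ k" using power_increasing[OF k, of q] by (simp add: q_def)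
 finally show False by simp
qed

text \<open>If \<open>mx \<mu>\<close> were a combination of heavier monomials, so would be each of
  its multiples, and only exponents not above \<open>\<mu>\<close> would count in
  \<open>chain_upper_bound\<close>. Their number is of order q^(n-1), too small for growth of degree
  n.\<close>

lemma growth_leading:
 assumes g: "growth R M n" and L: "\<And>i. i < n ==> 0 < L i" and inj: "inj_on (wt n L) (exps n)"
  and mu: "\<mu> \<in> exps n"
 shows "mx \<mu> \<notin> mI {be \<in> exps n. wt n L \<mu> < wt n L be}"
proof
 assume m: "mx \<mu> \<in> mI {be \<in> exps n. wt n L \<mu> < wt n L be}"
 obtain K where K: "K > 0" "\<And>q. q \<ge> 1 ==> chain_above R (ideal_power R M (K * q)) (q ^ n)"
  using g unfolding growth_def by blast
 \<comment> \<open>Larger than the constant in front of q^(n-1) in the bound for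
   \<open>?Z\<close>.\<close>
 define q where "q = Suc (tdeg n \<mu> * K ^ (n - 1))"
 let ?Z = "{al \<in> exps n. tdeg n al < K * q \<and> \<not> \<mu> \<le> al}"
 have "q ^ n \<le> card ?Z"
 proof (rule chain_upper_bound[OF L inj K(2)])
  fix al assume a: "al \<in> exps n" "tdeg n al < K * q" "al \<notin> ?Z"
  hence le: "\<mu> \<le> al" by auto
  show "mx al \<in> mI {be \<in> exps n. wt n L al < wt n L be}"
   unfolding mon_le[OF x_closed le]
  proof (rule genideal_mult[OF mx_sub m mx_closed mI_ideal])
   fix z assume "z \<in> mx ` {be \<in> exps n. wt n L \<mu> < wt n L be}"
   then obtain be where b: "be \<in> exps n" "wt n L \<mu> < wt n L be" "z = mx be" by auto
   have "wt n L al = wt n L (al - \<mu>) + wt n L \<mu>" using exp_diff_add[OF le] by (metis add.commute wt_add)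
   hence "(al - \<mu>) + be \<in> {be \<in> exps n. wt n L al < wt n L be}" using b a by simp
   thus "mx (al - \<mu>) \<otimes> z \<in> mI {be \<in> exps n. wt n L al < wt n L be}"
    unfolding b(3) mx_add[symmetric] by (rule mI_memI)
  qed
 qed (auto simp: q_def)
 also have le: "card ?Z \<le> tdeg n \<mu> * (K * q) ^ (n - 1)" by (rule card_exps_not_above[OF mu])
 finally have *: "q ^ n \<le> tdeg n \<mu> * (K * q) ^ (n - 1)" .
 show False
 proof (cases n)
  case 0
  thus False using * by (simp add: tdeg_def)
 next
  case (Suc k)
  have "tdeg n \<mu> * (K * q) ^ (n - 1) = tdeg n \<mu> * K ^ (n - 1) * q ^ (n - 1)" by (simp add: power_mult_distrib)
  also have "\<dots> < q * q ^ (n - 1)" by (simp add: q_def)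
  also have "\<dots> = q ^ n" using Suc by simp
  finally show False using * by simp
 qed
qed

end

section \<open>Monomials in a regular system of parameters\<close>

locale regular_parameters = parameters +
 assumes growth: "growth R M n"
begin

text \<open>\<open>growth_leading\<close> settles the set of all exponents heavier than
  \<open>al\<close>. For general \<open>S\<close> the induction is on the number of members of
  \<open>S\<close> lighter than \<open>al\<close>. The lightest member \<open>\<nu>\<close> of
  \<open>S\<close> has a coefficient in \<open>M\<close>, by \<open>growth_leading\<close> for
  \<open>\<nu>\<close>, so its term can be rewritten by proper multiples of \<open>mx \<nu>\<close>,
  whose exponents stay in \<open>S\<close>.\<close>

theorem monomial_not_mem:
 assumes "upset n S" and a: "al \<in> exps n" "al \<notin> S"
 shows "mx al \<notin> mI S"
proof -
 obtain L where L: "\<And>i. 0 < L i" "inj_on (wt n L) (exps n)" using positive_generic_weight by blast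
 let ?U = "\<lambda>\<mu>. {be \<in> exps n. wt n L \<mu> < wt n L be}"
 have lead: "mx \<mu> \<notin> mI (?U \<mu>)" if "\<mu> \<in> exps n" for \<mu>
  using growth_leading[OF growth _ L(2) that] L(1) by blast
 show ?thesis
  using assms
 proof (induction "card {be \<in> S. wt n L be < wt n L al}" arbitrary: S rule: less_induct)
  case less
  let ?B = "{be \<in> S. wt n L be < wt n L al}"
  have S: "S \<subseteq> exps n" using less(2) by (simp add: upset_def)
  have fin: "finite ?B" by (rule finite_subset[OF _ finite_exps_wt[of n L "wt n L al"]]) (use S L(1) in auto)
  show ?case
  proof
   assume m: "mx al \<in> mI S"
   have "S \<noteq> {}"
    using m lead[OF a(1)] mI_mono[of S "?U al"] by blast
   then obtain \<nu> where nu: "\<nu> \<in> S" "\<And>be. be \<in> S ==> be \<noteq> \<nu> ==> wt n L \<nu> < wt n L be"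
    using least_exp[OF L(1,2) S] by blast
   have ne: "\<nu> \<in> exps n" using nu(1) S by blast
   have lt: "wt n L \<nu> < wt n L al"
   proof (rule ccontr)
    assume n: "\<not> ?thesis"
    have "wt n L \<nu> \<noteq> wt n L al" using inj_onD[OF L(2) _ ne a(1)] nu(1) less(4) by auto
    hence "S \<subseteq> ?U al" using n nu(2) S by force
    thus False using lead[OF a(1)] m mI_mono by blast
   qed
   have SU: "S - {\<nu>} \<subseteq> ?U \<nu>" using nu(2) S by auto
   obtain c h where ch: "c \<in> carrier R" "h \<in> mI (S - {\<nu>})" "mx al = c \<otimes> mx \<nu> \<oplus> h"
    using m nu(1) mI_insert[of "mx al" \<nu> "S - {\<nu>}"] by (auto simp: insert_absorb)
   have up: "be \<in> S - {\<nu>}" if "ga \<in> S" "ga \<le> be" "be \<in> exps n" "be \<noteq> \<nu>" for ga be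
    using that less(2) unfolding upset_def by blast
   have "c \<in> M"
   proof (rule ccontr)
    assume "c \<notin> M"
    hence u: "c \<in> Units R" by (rule M_local[OF ch(1)])
    have "h \<in> mI (?U \<nu>)" "mx al \<in> mI (?U \<nu>)" using ch(2) mI_mono[OF SU] mI_memI[of al "?U \<nu>"] lt a(1) by auto
    hence "c \<otimes> mx \<nu> \<in> mI (?U \<nu>)" using ideal_addE1[OF mI_ideal, of "c \<otimes> mx \<nu>" h] ch by simp
    thus False using unit_cancel[OF u mx_closed mI_ideal] lead[OF ne] by blast
   qed
   hence "c \<otimes> mx \<nu> \<in> mI (S - {\<nu>})"
   proof (rule mult_M_mI)
    fix i assume i: "i < n"
    have "\<nu> \<le> unit_exp i + \<nu>" "unit_exp i + \<nu> \<noteq> \<nu>" by (auto simp: le_fun_def plus_fun_apply unit_exp_def fun_eq_iff)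
    thus "unit_exp i + \<nu> \<in> S - {\<nu>}" using up[OF nu(1)] i ne by simp
   qed
   hence m': "mx al \<in> mI (S - {\<nu>})" unfolding ch(3) by (rule ideal_add[OF mI_ideal _ ch(2)])
   have "upset n (S - {\<nu>})"
    unfolding upset_def
   proof (intro conjI ballI impI)
    fix ga be assume b: "ga \<in> S - {\<nu>}" "be \<in> exps n" "ga \<le> be"
    have "wt n L ga \<le> wt n L be" using b(3) L(1) by (intro wt_mono) (auto intro: less_imp_le)
    hence "be \<noteq> \<nu>" using nu(2)[of ga] b(1) by auto
    thus "be \<in> S - {\<nu>}" using up b by blast
   qed (use S in blast)
   moreover have "card {be \<in> S - {\<nu>}. wt n L be < wt n L al} < card ?B"
    using nu(1) lt fin by (intro psubset_card_mono) auto
   ultimately show False using less(1)[of "S - {\<nu>}"] a less(4) m' by blast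
  qed
 qed
qed

end

section \<open>The Artin--Rees lemma\<close>

lemma dickson_chain:
 assumes "S \<subseteq> exps n" "infinite S"
 shows "\<exists>s :: nat => nat => nat. (\<forall>k. s k \<in> S) \<and> (\<forall>k l. k < l \<longrightarrow> s k \<le> s l \<and> s k \<noteq> s l)"
proof -
 obtain s :: "nat => nat => nat" where "\<And>k. s k \<in> S" "\<And>k l. k < l ==> s k \<le> s l \<and> s k \<noteq> s l"
  using dickson_finite[OF assms] by metis
 thus ?thesis by blast
qed

context cring
begin

lemma genideal_empty: "Idl {} = {\<zero>}"
proof -
 have "Idl {} \<subseteq> {\<zero>}" by (rule genideal_minimal[OF zeroideal]) simp
 moreover have "\<zero> \<in> Idl {}" by (rule ideal_zero[OF genideal_ideal]) simp
 ultimately show ?thesis by blast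
qed

lemma noetherian_no_ascending:
 assumes "noetherian_ring R" "\<And>k. ideal (f k) R" "\<And>k. f k \<subset> f (Suc k)"
 shows False
proof -
 have le: "f k \<subseteq> f l" if "k \<le> l" for k l
  using that by (rule lift_Suc_mono_le[of f, rotated]) (use assms(3) in blast)
 have "subset.chain {I. ideal I R} (range f)"
  unfolding pred_on.chain_def using assms(2) le nat_le_linear by blast
 hence "\<Union>(range f) \<in> range f"
  by (intro noetherian_ring.ideal_chain_is_trivial[OF assms(1)]) auto
 then obtain K where K: "\<Union>(range f) = f K" by auto
 have "f (Suc K) \<subseteq> \<Union>(range f)" by (rule Union_upper) simp
 thus False using K assms(3)[of K] by blast
qed

lemma ideal_prod_mono: "A \<subseteq> A' ==> B \<subseteq> B' ==> A \<cdot> B \<subseteq> A' \<cdot> B'"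
proof
 fix f assume "A \<subseteq> A'" "B \<subseteq> B'" "f \<in> A \<cdot> B"
 from this(3) show "f \<in> A' \<cdot> B'"
 proof (induction f rule: ideal_prod.induct)
  case (prod i j)
  thus ?case using \<open>A \<subseteq> A'\<close> \<open>B \<subseteq> B'\<close> by (intro ideal_prod.prod) auto
 next
  case (sum s1 s2)
  thus ?case by (intro ideal_prod.sum)
 qed
qed

lemma ideal_prod_minimal:
 assumes "ideal I R" "\<And>i j. i \<in> A ==> j \<in> B ==> i \<otimes> j \<in> I"
 shows "A \<cdot> B \<subseteq> I"
proof
 fix f assume "f \<in> A \<cdot> B"
 thus "f \<in> I"
 proof (induction f rule: ideal_prod.induct)
  case (prod i j)
  thus ?case using assms by blast
 next
  case (sum s1 s2)
  thus ?case using ideal_add[OF assms(1)] by blast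
 qed
qed

lemma chain_above_mono: "chain_above R I N ==> I' \<subseteq> I ==> chain_above R I' N"
 unfolding chain_above_def by (meson subset_trans)

end

context parameters
begin

text \<open>\<open>D al\<close> is the ideal of leading coefficients of \<open>N\<close> at
  \<open>al\<close>. It increases with \<open>al\<close>, so by the Noetherian property and
  Dickson's lemma it jumps in all directions at once only at finitely many exponents. Beyond their
  degrees, every leading term of an element of \<open>N\<close> is a variable times a leading term
  one degree lower. Hence the part of \<open>N\<close> in M^(k+1) is contained in M times the part
  of \<open>N\<close> in M^k, and iteration gives the claim.\<close>

lemma artin_rees:
 assumes noeth: "noetherian_ring R" and N: "ideal N R"
 shows "\<exists>c. \<forall>j. N \<inter> ideal_power R M (c + j) \<subseteq> ideal_prod R (ideal_power R M j) N"
proof -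
 obtain L where L: "\<And>i. 0 < L i" and inj: "inj_on (wt n L) (exps n)"
  using positive_generic_weight by blast
 \<comment> \<open>Only monomials of equal degree are compared, and their coefficients are arbitrary
   ring elements. The elimination below therefore stays in one degree and ends after finitely many
   steps, without a limit.\<close>
 define Z where "Z al = {be \<in> exps n. tdeg n be = tdeg n al \<and> wt n L al < wt n L be}" for al
 define D where "D al = {a. a \<in> carrier R \<and> a \<otimes> mx al \<in> Idl (N \<union> mx ` Z al)}" for al
 have Nc: "N \<subseteq> carrier R" using N by (rule ideal_sub)
 have c: "N \<union> mx ` T \<subseteq> carrier R" for T using Nc mx_sub by auto
 have id: "ideal (Idl (N \<union> mx ` T)) R" for T by (rule genideal_ideal[OF c])
 have Did: "ideal (D al) R" for al
  unfolding D_def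
 proof (rule ideal_Collect)
  fix a b assume "a \<in> carrier R \<and> a \<otimes> mx al \<in> Idl (N \<union> mx ` Z al)" "b \<in> carrier R \<and> b \<otimes> mx al \<in> Idl (N \<union> mx ` Z al)"
  thus "a \<oplus> b \<in> carrier R \<and> (a \<oplus> b) \<otimes> mx al \<in> Idl (N \<union> mx ` Z al)"
   using ideal_add[OF id] by (simp add: l_distr)
 next
  fix a b assume "a \<in> carrier R \<and> a \<otimes> mx al \<in> Idl (N \<union> mx ` Z al)" "b \<in> carrier R"
  thus "b \<otimes> a \<in> carrier R \<and> b \<otimes> a \<otimes> mx al \<in> Idl (N \<union> mx ` Z al)"
   using ideal_mult[OF id] by (simp add: m_assoc)
 qed (use ideal_zero[OF id] in auto)
 have Dmono: "D al \<subseteq> D be" if "al \<le> be" "be \<in> exps n" for al be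
 proof
  fix a assume a: "a \<in> D al"
  hence ac: "a \<in> carrier R" "a \<otimes> mx al \<in> Idl (N \<union> mx ` Z al)" by (auto simp: D_def)
  have "mx (be - al) \<otimes> (a \<otimes> mx al) \<in> Idl (N \<union> mx ` Z be)"
  proof (rule genideal_mult[OF c ac(2) mx_closed id])
   fix z assume z: "z \<in> N \<union> mx ` Z al"
   show "mx (be - al) \<otimes> z \<in> Idl (N \<union> mx ` Z be)"
   proof (cases "z \<in> N")
    case True
    hence "mx (be - al) \<otimes> z \<in> N" using ideal_mult[OF N mx_closed] by blast
    thus ?thesis using genideal_self[OF c, of "Z be"] by blast
   next
    case False
    then obtain ga where g: "ga \<in> Z al" "z = mx ga" using z by blast
    have "(be - al) + al = be" using exp_diff_add[OF that(1)] by (simp add: add.commute)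
    hence "tdeg n be = tdeg n (be - al) + tdeg n al" "wt n L be = wt n L (be - al) + wt n L al"
     by (metis tdeg_add, metis wt_add)
    hence "(be - al) + ga \<in> Z be" using g that(2) by (auto simp: Z_def)
    hence "mx (be - al) \<otimes> z \<in> mx ` Z be" unfolding g(2) mx_add[symmetric] by (rule imageI)
    thus ?thesis using genideal_self[OF c, of "Z be"] by blast
   qed
  qed
  also have "mx (be - al) \<otimes> (a \<otimes> mx al) = a \<otimes> mx be"
   using ac(1) mon_le[OF x_closed that(1)] by (simp add: m_lcomm)
  finally show "a \<in> D be" using ac(1) by (simp add: D_def)
 qed
 \<comment> \<open>The exponents at which \<open>D\<close> changes along each coordinate direction
   in which one can step back; \<open>0\<close> belongs to them vacuously.\<close>
 define Jp where "Jp = {al \<in> exps n. \<forall>i<n. unit_exp i \<le> al \<longrightarrow> D (al - unit_exp i) \<noteq> D al}"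
 have finJ: "finite Jp"
 proof (rule ccontr)
  assume inf: "infinite Jp"
  have Jsub: "Jp \<subseteq> exps n" by (auto simp: Jp_def)
  obtain s :: "nat => nat => nat" where s: "\<forall>k. s k \<in> Jp" "\<forall>k l. k < l \<longrightarrow> s k \<le> s l \<and> s k \<noteq> s l"
   using dickson_chain[OF Jsub inf] by blast
  \<comment> \<open>Between the two exponents there is room for one step back from the larger one,
    and at a member of \<open>Jp\<close> such a step changes \<open>D\<close>.\<close>
  have "D (s k) \<subset> D (s (Suc k))" for k
  proof -
   let ?a = "s k" and ?b = "s (Suc k)"
   have ab: "?a \<le> ?b" "?a \<noteq> ?b" "?a \<in> exps n" "?b \<in> exps n" using s Jsub by auto
   have e: "?a + (?b - ?a) = ?b" by (rule exp_diff_add[OF ab(1)])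
   have "?b - ?a \<noteq> 0" using e ab(2) by (metis add.right_neutral)
   hence "tdeg n (?b - ?a) > 0" using tdeg_eq_0[of "?b - ?a" n] ab by (metis exps_diff gr0I)
   then obtain i where i: "i < n" "unit_exp i \<le> ?b - ?a" using exp_pos[of "?b - ?a" n] ab by (metis exps_diff)
   have p: "unit_exp i j \<le> ?b j - ?a j" "?a j \<le> ?b j" for j using i(2) ab(1) by (auto simp: le_fun_def)
   have "unit_exp i j \<le> ?b j" "?a j \<le> ?b j - unit_exp i j" for j using p[of j] by linarith+
   hence "unit_exp i \<le> ?b" "?a \<le> ?b - unit_exp i" by (auto simp: le_fun_def)
   moreover from this have "D (?b - unit_exp i) \<noteq> D ?b" using s(1) i(1) by (auto simp: Jp_def)
   moreover have "D ?a \<subseteq> D (?b - unit_exp i)" using calculation ab by (intro Dmono) auto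
   moreover have "D (?b - unit_exp i) \<subseteq> D ?b" using ab by (intro Dmono) (auto simp: le_fun_def)
   ultimately show ?thesis by blast
  qed
  thus False by (rule noetherian_no_ascending[OF noeth Did])
 qed
 obtain c' where c': "\<And>al. al \<in> Jp ==> tdeg n al \<le> c'"
  using finJ by (metis finite_imageI finite_nat_set_iff_bounded_le imageI)
 have pid: "ideal (ideal_power R M k) R" for k by (rule ideal_power_ideal[OF M_ideal])
 have NMid: "ideal (N \<inter> ideal_power R M k) R" for k by (rule i_intersect[OF N pid])
 have step: "N \<inter> ideal_power R M (Suc k) \<subseteq> M \<cdot> (N \<inter> ideal_power R M k)" if k: "k \<ge> c'" for k
 proof -
  let ?P = "M \<cdot> (N \<inter> ideal_power R M k)"
  have P: "ideal ?P R" by (rule ideal_prod_is_ideal[OF M_ideal NMid])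
  have "f \<in> ?P" if "f \<in> N" "f \<in> mI T" "T \<subseteq> {al \<in> exps n. tdeg n al = Suc k}"
   "\<And>al. al \<in> T ==> Z al \<subseteq> T" for f T
   using that
  proof (induction "card T" arbitrary: T f rule: less_induct)
   case less
   have finT: "finite T" using less(4) finite_exps_tdeg_eq finite_subset by blast
   show ?case
   proof (cases "T = {}")
    case True
    thus ?thesis using less(3) genideal_empty ideal_zero[OF P] by simp
   next
    case False
    have "T \<subseteq> exps n" using less(4) by auto
    then obtain al where aT: "al \<in> T" and amin: "\<And>be. be \<in> T ==> be \<noteq> al ==> wt n L al < wt n L be"
     using least_exp[OF L inj _ False] by blast
    have aX: "al \<in> exps n" "tdeg n al = Suc k" using aT less(4) by auto
    let ?T' = "T - {al}"
    have T'Z: "?T' \<subseteq> Z al" using amin less(4) aX by (auto simp: Z_def)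
    have ZT': "Z al \<subseteq> ?T'" using less(5)[OF aT] by (auto simp: Z_def)
    have "f \<in> Idl (insert (mx al) (mx ` ?T'))"
     using less(3) aT by (metis image_insert insert_Diff)
    then obtain a h where ah: "a \<in> carrier R" "h \<in> mI ?T'" "f = a \<otimes> mx al \<oplus> h"
     using genideal_insert[OF mx_closed mx_sub] by metis
    have hc: "h \<in> carrier R" using ah mI_carr by blast
    have "h \<in> Idl (N \<union> mx ` Z al)" using ah(2) genideal_mono[of "mx ` ?T'" "N \<union> mx ` Z al"] T'Z by blast
    moreover have "f \<in> Idl (N \<union> mx ` Z al)" using less(2) genideal_self[OF c, of "Z al"] by blast
    ultimately have "a \<otimes> mx al \<in> Idl (N \<union> mx ` Z al)"
     using ideal_addE1[OF id, of "a \<otimes> mx al" h] ah by simp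
    hence aD: "a \<in> D al" using ah by (simp add: D_def)
    have "al \<notin> Jp" using c'[of al] aX k by auto
    then obtain i where i: "i < n" "unit_exp i \<le> al" "D (al - unit_exp i) = D al"
     using aX by (auto simp: Jp_def)
    let ?be = "al - unit_exp i"
    have e: "unit_exp i + ?be = al" by (rule exp_diff_add[OF i(2)])
    have degb: "tdeg n ?be = k" using arg_cong[OF e, of "tdeg n"] aX i by simp
    have be: "?be \<in> exps n" using aX by simp
    have "a \<otimes> mx ?be \<in> Idl (N \<union> mx ` Z ?be)" using aD i by (auto simp: D_def)
    then obtain \<nu> z where nz: "\<nu> \<in> N" "z \<in> mI (Z ?be)" "a \<otimes> mx ?be = \<nu> \<oplus> z"
     using genideal_union[OF Nc mx_sub] genideal_of_ideal[OF N] by blast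
    have nzc: "\<nu> \<in> carrier R" "z \<in> carrier R" using nz Nc mI_carr by auto
    have xi: "x i \<in> carrier R" using x_closed i by auto
    have "mI (Z ?be) \<subseteq> ideal_power R M k"
     unfolding power_M by (rule mI_mono) (auto simp: Z_def degb)
    moreover have "a \<otimes> mx ?be \<in> ideal_power R M k"
     using ideal_mult[OF pid ah(1)] mx_power_M[OF be, of k] degb by blast
    ultimately have "\<nu> \<in> ideal_power R M k"
     using ideal_addE1[OF pid _ _ nzc(1), of z] nz by auto
    moreover have "x i \<in> M" unfolding M_gen using genideal_self[OF x_image] i by auto
    ultimately have xn: "x i \<otimes> \<nu> \<in> ?P" using nz by (intro ideal_prod.prod) auto
    have eq: "x i \<otimes> (a \<otimes> mx ?be) = a \<otimes> mx al"
     using e mx_add[of "unit_exp i" ?be] mon_unit[OF x_closed i(1)] xi ah(1) by (simp add: m_lcomm)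
    \<comment> \<open>Subtracting \<open>x i \<otimes> \<nu>\<close> cancels the leading term up to
      heavier monomials of the same degree, that is, up to \<open>mI ?T'\<close>.\<close>
    let ?f' = "f \<ominus> x i \<otimes> \<nu>"
    have fc: "f \<in> carrier R" using less(2) Nc by auto
    have "f = (x i \<otimes> \<nu> \<oplus> x i \<otimes> z) \<oplus> h"
     unfolding ah(3) eq[symmetric] nz(3) using xi nzc by (simp add: r_distr)
    hence f': "?f' = x i \<otimes> z \<oplus> h" using xi nzc hc by algebra
    have "x i \<otimes> z \<in> mI ?T'"
    proof (rule genideal_mult[OF mx_sub nz(2) xi mI_ideal])
     fix y assume "y \<in> mx ` Z ?be"
     then obtain ga where g: "ga \<in> Z ?be" "y = mx ga" by blast
     have "wt n L al = wt n L (unit_exp i) + wt n L ?be" using e by (metis wt_add)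
     hence "unit_exp i + ga \<in> Z al" using g i degb aX by (auto simp: Z_def)
     hence "mx (unit_exp i + ga) \<in> mI ?T'" using ZT' by (intro mI_memI) auto
     thus "x i \<otimes> y \<in> mI ?T'" using g i mx_add mon_unit[OF x_closed i(1)] by simp
    qed
    hence "?f' \<in> mI ?T'" using f' ah ideal_add[OF mI_ideal] by simp
    moreover have "?f' \<in> N" using less(2) nz ideal_mult[OF N xi] by (intro ideal_minus[OF N]) auto
    moreover have "card ?T' < card T" using finT aT by (meson card_Diff1_less)
    moreover have "Z be \<subseteq> ?T'" if "be \<in> ?T'" for be
    proof -
     have "Z be \<subseteq> T" "wt n L al < wt n L be" using less(5) amin that by auto
     thus ?thesis by (auto simp: Z_def)
    qed
    ultimately have "?f' \<in> ?P" using less(1)[of ?T' ?f'] less(4) by blast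
    moreover have "f = ?f' \<oplus> x i \<otimes> \<nu>" using fc xi nzc by algebra
    ultimately show ?thesis using xn ideal_add[OF P] by metis
   qed
  qed
  note main = this
  have "f \<in> ?P" if "f \<in> N" "f \<in> mI {al \<in> exps n. tdeg n al = Suc k}" for f
   by (rule main[OF that]) (auto simp: Z_def)
  thus ?thesis unfolding power_M[of "Suc k"] by blast
 qed
 show ?thesis
 proof (intro exI[of _ c'] allI)
  fix j
  show "N \<inter> ideal_power R M (c' + j) \<subseteq> ideal_power R M j \<cdot> N"
  proof (induction j)
   case 0
   have "f \<in> carrier R \<cdot> N" if "f \<in> N" for f
    using ideal_prod.prod[of \<one> "carrier R" f N R] that Nc by auto
   thus ?case unfolding ideal_power_0 by auto
  next
   case (Suc j)
   have "N \<inter> ideal_power R M (c' + Suc j) \<subseteq> M \<cdot> (N \<inter> ideal_power R M (c' + j))"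
    using step[of "c' + j"] by simp
   also have "\<dots> \<subseteq> M \<cdot> (ideal_power R M j \<cdot> N)" using Suc by (intro ideal_prod_mono) auto
   also have "\<dots> = (ideal_power R M j \<cdot> M) \<cdot> N"
    using ideal_prod_assoc[OF M_ideal pid N] ideal_prod_commute[OF M_ideal pid] by simp
   also have "\<dots> = ideal_power R M (Suc j) \<cdot> N" unfolding ideal_power_Suc ..
   finally show ?case .
  qed
 qed
qed

text \<open>Artin-Rees for the ideal (f) + I: an element of this ideal in M^(c+j) has the form f b +
  h with b in M^j and h in \<open>I\<close>. The case a = 1 gives Krull's intersection theorem; for
  \<open>I\<close> prime it bounds colon ideals by f.\<close>

lemma artin_rees_principal:
 assumes noeth: "noetherian_ring R" and I: "ideal I R" and f: "f \<in> carrier R"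
 shows "\<exists>c. \<forall>j. \<forall>a\<in>carrier R. f \<otimes> a \<in> Idl (I \<union> ideal_power R M (c + j)) \<longrightarrow>
  (\<exists>b\<in>ideal_power R M j. f \<otimes> (a \<ominus> b) \<in> I)"
proof -
 have pid: "ideal (ideal_power R M k) R" for k by (rule ideal_power_ideal[OF M_ideal])
 have Ic: "I \<subseteq> carrier R" by (rule ideal_sub[OF I])
 hence fI: "insert f I \<subseteq> carrier R" using f by auto
 note N = genideal_ideal[OF fI] and self = genideal_self[OF fI]
 obtain c where c: "\<And>j. Idl (insert f I) \<inter> ideal_power R M (c + j) \<subseteq> ideal_power R M j \<cdot> (Idl (insert f I))"
  using artin_rees[OF noeth N] by blast
 show ?thesis
 proof (intro exI[of _ c] allI ballI impI)
  fix j a assume a: "a \<in> carrier R" "f \<otimes> a \<in> Idl (I \<union> ideal_power R M (c + j))"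
  obtain g t where gt: "g \<in> I" "t \<in> ideal_power R M (c + j)" "f \<otimes> a = g \<oplus> t"
   using a(2) ideal_union_mem[OF I pid] by blast
  have gtc: "g \<in> carrier R" "t \<in> carrier R" using gt(1,2) Ic ideal_sub[OF pid] by auto
  have "a \<otimes> f \<ominus> g \<in> Idl (insert f I)" using self gt(1) a(1) by (intro ideal_minus[OF N] ideal_mult[OF N]) auto
  moreover have "t = (g \<oplus> t) \<ominus> g" using gtc by algebra
  ultimately have "t \<in> Idl (insert f I)" using gt(3) m_comm[OF a(1) f] by simp
  hence "t \<in> ideal_power R M j \<cdot> (Idl (insert f I))" using c gt(2) by blast
  moreover have "ideal_power R M j \<cdot> (Idl (insert f I)) \<subseteq> {t. \<exists>b\<in>ideal_power R M j. \<exists>h\<in>I. t = f \<otimes> b \<oplus> h}"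
  proof (rule ideal_prod_minimal[OF ideal_scaled_add[OF I pid f]])
   fix b g assume bg: "b \<in> ideal_power R M j" "g \<in> Idl (insert f I)"
   obtain d h where dh: "d \<in> carrier R" "h \<in> I" "g = d \<otimes> f \<oplus> h"
    using bg(2) genideal_insert[OF f Ic] genideal_of_ideal[OF I] by blast
   have bc: "b \<in> carrier R" "h \<in> carrier R" using bg(1) ideal_sub[OF pid] dh(2) Ic by auto
   have "b \<otimes> g = f \<otimes> (d \<otimes> b) \<oplus> b \<otimes> h" unfolding dh(3) using bc dh(1) f by algebra
   thus "b \<otimes> g \<in> {t. \<exists>b\<in>ideal_power R M j. \<exists>h\<in>I. t = f \<otimes> b \<oplus> h}"
    using ideal_mult[OF I bc(1) dh(2)] ideal_mult[OF pid dh(1) bg(1)] by blast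
  qed
  ultimately obtain b h where bh: "b \<in> ideal_power R M j" "h \<in> I" "t = f \<otimes> b \<oplus> h" by blast
  have bc: "b \<in> carrier R" "h \<in> carrier R" using bh(1,2) ideal_sub[OF pid] Ic by auto
  have "f \<otimes> (a \<ominus> b) = f \<otimes> a \<ominus> f \<otimes> b" using a(1) bc f by algebra
  also have "\<dots> = g \<oplus> h" unfolding gt(3) bh(3) using gtc bc f by algebra
  finally show "\<exists>b\<in>ideal_power R M j. f \<otimes> (a \<ominus> b) \<in> I" using ideal_add[OF I gt(1) bh(2)] by (intro bexI[OF _ bh(1)]) simp
 qed
qed

text \<open>With a = 1, \<open>artin_rees_principal\<close> puts f(1 - b) into \<open>I\<close> for
  some b in \<open>M\<close>, and 1 - b is a unit.\<close>

lemma krull_intersection: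
 assumes noeth: "noetherian_ring R" and I: "ideal I R" and f: "f \<in> carrier R"
  and fm: "\<And>m. f \<in> Idl (I \<union> ideal_power R M m)"
 shows "f \<in> I"
proof -
 obtain c where "\<forall>j. \<forall>a\<in>carrier R. f \<otimes> a \<in> Idl (I \<union> ideal_power R M (c + j)) \<longrightarrow>
  (\<exists>b\<in>ideal_power R M j. f \<otimes> (a \<ominus> b) \<in> I)" using artin_rees_principal[OF noeth I f] by blast
 then obtain b where b: "b \<in> ideal_power R M 1" "f \<otimes> (\<one> \<ominus> b) \<in> I" using fm[of "c + 1"] r_one[OF f] one_closed by metis
 have bM: "b \<in> M" using b(1) ideal_power_1[OF M_ideal] by simp
 hence oc: "\<one> \<ominus> b \<in> carrier R" using M_carr by simp
 have "\<one> \<ominus> b \<notin> M"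
 proof
  assume "\<one> \<ominus> b \<in> M"
  hence "\<one> \<in> M" by (rule ideal_minusE1[OF M_ideal _ bM]) simp
  thus False using M_unit by auto
 qed
 hence "\<one> \<ominus> b \<in> Units R" by (rule M_local[OF oc])
 thus ?thesis using unit_cancel[OF _ f I] b(2) m_comm[OF f oc] by simp
qed

section \<open>Dimension and growth\<close>

lemma proper_le_M: "ideal I R ==> I \<noteq> carrier R ==> I \<subseteq> M"
 using proper_ideal_no_unit M_local ideal_sub by blast

text \<open>Additivity of length for the quotient of R/(p + M^m) by the ideal of f, stated for
  chains. Multiplication by f carries the second chain into the gap between p + M^m and p' + M^m,
  and assumption \<open>c\<close>, a bound on the colon ideal, keeps its steps strict.\<close>

lemma chain_concat:
 assumes p: "ideal p R" "ideal p' R" "p \<subseteq> p'" and f: "f \<in> p'"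
  and c: "\<And>a. a \<in> carrier R ==> f \<otimes> a \<in> Idl (p \<union> ideal_power R M m) ==> a \<in> Idl (p \<union> ideal_power R M l)"
  and ch1: "chain_above R (Idl (p' \<union> ideal_power R M m)) N1"
  and ch2: "chain_above R (Idl (p \<union> ideal_power R M l)) N2"
 shows "chain_above R (Idl (p \<union> ideal_power R M m)) (N1 + N2)"
proof -
 let ?I = "Idl (p \<union> ideal_power R M m)"
 have pc: "p \<union> ideal_power R M k \<subseteq> carrier R" "p' \<union> ideal_power R M k \<subseteq> carrier R" for k
  using p ideal_sub ideal_power_ideal[OF M_ideal] by auto
 have I: "ideal ?I R" by (rule genideal_ideal[OF pc(1)])
 have fc: "f \<in> carrier R" using f p ideal_sub by blast
 obtain c1 where c1: "\<And>i. i \<le> N1 ==> ideal (c1 i) R" "\<And>i. i \<le> N1 ==> Idl (p' \<union> ideal_power R M m) \<subseteq> c1 i"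
  "\<And>i. i < N1 ==> c1 i \<subset> c1 (Suc i)" using ch1 unfolding chain_above_def by blast
 obtain c2 where c2: "\<And>i. i \<le> N2 ==> ideal (c2 i) R" "\<And>i. i \<le> N2 ==> Idl (p \<union> ideal_power R M l) \<subseteq> c2 i"
  "\<And>i. i < N2 ==> c2 i \<subset> c2 (Suc i)" using ch2 unfolding chain_above_def by blast
 define d where "d i = {g. \<exists>a\<in>c2 i. \<exists>h\<in>?I. g = f \<otimes> a \<oplus> h}" for i
 have dI: "ideal (d i) R" if "i \<le> N2" for i unfolding d_def by (rule ideal_scaled_add[OF I c2(1)[OF that] fc])
 have Id: "?I \<subseteq> d i" if "i \<le> N2" for i
 proof
  fix h assume h: "h \<in> ?I"
  have "h \<in> carrier R" using h I ideal_sub by blast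
  hence "h = f \<otimes> \<zero> \<oplus> h" using fc by simp
  thus "h \<in> d i" unfolding d_def using h ideal_zero[OF c2(1)[OF that]] by blast
 qed
 have strict: "d i \<subset> d (Suc i)" if iN: "i < N2" for i
 proof -
  have sub: "d i \<subseteq> d (Suc i)" using c2(3)[OF iN] unfolding d_def by blast
  obtain a where a: "a \<in> c2 (Suc i)" "a \<notin> c2 i" using c2(3)[OF iN] by blast
  have J: "ideal (c2 i) R" "ideal (c2 (Suc i)) R" using c2(1) iN by auto
  have ac: "a \<in> carrier R" using a J ideal_sub by blast
  have "f \<otimes> a = f \<otimes> a \<oplus> \<zero>" using ac fc by simp
  hence "f \<otimes> a \<in> d (Suc i)" unfolding d_def using a ideal_zero[OF I] by blast
  moreover have "f \<otimes> a \<notin> d i"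
  proof
   assume "f \<otimes> a \<in> d i"
   then obtain a' h where ah: "a' \<in> c2 i" "h \<in> ?I" "f \<otimes> a = f \<otimes> a' \<oplus> h" unfolding d_def by blast
   have ahc: "a' \<in> carrier R" "h \<in> carrier R" using ah J I ideal_sub by blast+
   have "f \<otimes> (a \<ominus> a') = f \<otimes> a \<ominus> f \<otimes> a'" using ahc ac fc by algebra
   also have "\<dots> = h" unfolding ah(3) using ahc fc by algebra
   finally have "a \<ominus> a' \<in> Idl (p \<union> ideal_power R M l)" using c[of "a \<ominus> a'"] ac ahc ah by simp
   hence "a \<ominus> a' \<in> c2 i" using c2(2)[of i] iN by auto
   thus False using a ideal_minusE1[OF J(1) _ ah(1) ac] by blast
  qed
  ultimately show ?thesis using sub by blast
 qed
 have dc1: "d N2 \<subseteq> c1 0"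
 proof
  fix g assume "g \<in> d N2"
  then obtain a h where ah: "a \<in> c2 N2" "h \<in> ?I" "g = f \<otimes> a \<oplus> h" unfolding d_def by blast
  have "p \<union> ideal_power R M m \<subseteq> p' \<union> ideal_power R M m" using p by auto
  hence h: "h \<in> Idl (p' \<union> ideal_power R M m)" using genideal_mono ah by blast
  have ac: "a \<in> carrier R" using ah c2(1) ideal_sub by blast
  have "a \<otimes> f \<in> p'" by (rule ideal_mult[OF p(2) ac f])
  hence "f \<otimes> a \<in> p'" using ac fc m_comm by simp
  hence "f \<otimes> a \<in> Idl (p' \<union> ideal_power R M m)" using genideal_self[OF pc(2), of m] by blast
  hence "g \<in> Idl (p' \<union> ideal_power R M m)" unfolding ah using h ideal_add[OF genideal_ideal[OF pc(2)]] by blast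
  thus "g \<in> c1 0" using c1(2) by blast
 qed
 define e where "e i = (if i \<le> N2 then d i else c1 (i - N2))" for i
 have Ile: "?I \<subseteq> c1 i" if "i \<le> N1" for i
  using c1(2)[OF that] genideal_mono[of "p \<union> ideal_power R M m" "p' \<union> ideal_power R M m"] p by blast
 have "ideal (e i) R \<and> ?I \<subseteq> e i" if "i \<le> N1 + N2" for i
  using that dI Id c1(1) Ile by (auto simp: e_def)
 moreover have "e i \<subset> e (Suc i)" if iN: "i < N1 + N2" for i
 proof -
  consider "i < N2" | "i = N2" "N1 > 0" | "i > N2" using iN by linarith
  thus ?thesis
  proof cases
   case 2
   thus ?thesis using dc1 c1(3)[of 0] by (auto simp: e_def)
  next
   case 3
   hence "Suc i - N2 = Suc (i - N2)" by simp
   thus ?thesis using c1(3)[of "i - N2"] 3 iN by (simp add: e_def)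
  qed (use strict in \<open>auto simp: e_def\<close>)
 qed
 ultimately show ?thesis unfolding chain_above_def by blast
qed

text \<open>Induction from the top of the chain downwards. For f in the next prime but not in p_i,
  Artin-Rees gives a constant C such that the colon ideal of p_i + M^(C+j) by f is contained in p_i
  + M^j. Raising the exponent by C therefore adds a copy of the q^s steps available above the next
  prime, and q copies yield q^(s+1) steps at exponent (K + C)q.\<close>

lemma prime_chain_growth:
 assumes noeth: "noetherian_ring R"
  and prime: "\<And>i. i \<le> k ==> primeideal (p i) R" and strict: "\<And>i. i < k ==> p i \<subset> p (Suc i)"
 shows "growth R M k"
proof -
 have pid: "ideal (p i) R" if "i \<le> k" for i using prime[OF that] primeideal.axioms(1) by blast
 have Mid: "ideal (ideal_power R M m) R" for m by (rule ideal_power_ideal[OF M_ideal])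
 have c: "p i \<union> ideal_power R M m \<subseteq> carrier R" if "i \<le> k" for i m
  using ideal_sub[OF pid[OF that]] ideal_sub[OF Mid] by auto
 have "\<exists>K>0. \<forall>q\<ge>1. chain_above R (Idl (p (k - s) \<union> ideal_power R M (K * q))) (q ^ s)" if "s \<le> k" for s
  using that
 proof (induction s)
  case 0
  have "chain_above R (Idl (p k \<union> ideal_power R M (1 * q))) 1" if "q \<ge> 1" for q
  proof -
   have "p k \<noteq> carrier R" using prime[of k] primeideal.I_notcarr by blast
   hence "p k \<subseteq> M" using proper_le_M pid by blast
   moreover have "ideal_power R M q \<subseteq> M"
    using ideal_power_antimono[OF M_ideal that] ideal_power_1[OF M_ideal] by simp
   ultimately have "Idl (p k \<union> ideal_power R M q) \<subseteq> M" by (intro genideal_minimal[OF M_ideal]) auto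
   hence "Idl (p k \<union> ideal_power R M q) \<subset> carrier R" using M_proper ideal_sub[OF M_ideal] by blast
   thus ?thesis unfolding chain_above_def
    using genideal_ideal[OF c[of k q]] oneideal
    by (intro exI[of _ "\<lambda>i. if i = 0 then Idl (p k \<union> ideal_power R M q) else carrier R"]) auto
  qed
  thus ?case by (intro exI[of _ 1]) auto
 next
  case (Suc s)
  then obtain K where K: "K > 0" "\<And>q. q \<ge> 1 ==> chain_above R (Idl (p (k - s) \<union> ideal_power R M (K * q))) (q ^ s)"
   by auto
  define i where "i = k - Suc s"
  have i: "Suc i = k - s" "i < k" using Suc(2) by (auto simp: i_def)
  obtain f where f: "f \<in> p (Suc i)" "f \<notin> p i" using strict[OF i(2)] by blast
  have pp: "ideal (p i) R" "ideal (p (Suc i)) R" using pid i by auto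
  have fc: "f \<in> carrier R" using f pp ideal_sub by blast
  obtain C where C: "\<forall>j. \<forall>a\<in>carrier R. f \<otimes> a \<in> Idl (p i \<union> ideal_power R M (C + j)) \<longrightarrow>
   (\<exists>b\<in>ideal_power R M j. f \<otimes> (a \<ominus> b) \<in> p i)" using artin_rees_principal[OF noeth pp(1) fc] by blast
  have col: "a \<in> Idl (p i \<union> ideal_power R M j)"
   if a: "a \<in> carrier R" "f \<otimes> a \<in> Idl (p i \<union> ideal_power R M (C + j))" for a j
  proof -
   obtain b where b: "b \<in> ideal_power R M j" "f \<otimes> (a \<ominus> b) \<in> p i" using C a by blast
   have bc: "b \<in> carrier R" using b(1) ideal_sub[OF Mid] by blast
   hence "a \<ominus> b \<in> p i" using primeideal.I_prime[OF prime[OF less_imp_le[OF i(2)]] fc _ b(2)] f(2) a(1) by auto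
   hence "a \<ominus> b \<in> Idl (p i \<union> ideal_power R M j)" "b \<in> Idl (p i \<union> ideal_power R M j)"
    using genideal_self[OF c[of i j]] i b(1) by auto
   thus ?thesis by (rule ideal_minusE1[OF genideal_ideal[OF c[OF less_imp_le[OF i(2)]]] _ _ a(1)])
  qed
  have H: "chain_above R (Idl (p i \<union> ideal_power R M (K * q + C * j))) (j * q ^ s)" if q: "q \<ge> 1" for q j
  proof (induction j)
   case 0
   show ?case unfolding chain_above_def using genideal_ideal[OF c[of i]] i by (intro exI[of _ "\<lambda>_. Idl (p i \<union> ideal_power R M (K * q))"]) auto
  next
   case (Suc j)
   let ?m = "C + (K * q + C * j)"
   have "Idl (p (Suc i) \<union> ideal_power R M ?m) \<subseteq> Idl (p (Suc i) \<union> ideal_power R M (K * q))"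
    using ideal_power_antimono[OF M_ideal, of "K * q" ?m] by (intro genideal_mono) auto
   hence "chain_above R (Idl (p (Suc i) \<union> ideal_power R M ?m)) (q ^ s)"
    using chain_above_mono[OF K(2)[OF q]] i by simp
   hence "chain_above R (Idl (p i \<union> ideal_power R M ?m)) (q ^ s + j * q ^ s)"
    using strict[OF i(2)] by (intro chain_concat[OF pp _ f(1) col _ Suc]) auto
   thus ?case by (simp add: algebra_simps)
  qed
  have "chain_above R (Idl (p i \<union> ideal_power R M ((K + C) * q))) (q ^ Suc s)" if "q \<ge> 1" for q
   using H[of q q] that by (simp add: distrib_right)
  thus ?case using K(1) i_def by (intro exI[of _ "K + C"]) auto
 qed
 then obtain K where K: "K > 0" "\<And>q. q \<ge> 1 ==> chain_above R (Idl (p 0 \<union> ideal_power R M (K * q))) (q ^ k)"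
  by (metis diff_self_eq_0 order_refl)
 have "chain_above R (ideal_power R M (K * q)) (q ^ k)" if "q \<ge> 1" for q
  using genideal_self[OF c[of 0 "K * q"]] by (intro chain_above_mono[OF K(2)[OF that]]) auto
 thus ?thesis unfolding growth_def using K(1) by blast
qed

end

section \<open>Complete filtered rings\<close>

locale complete_filtered = cring R for R (structure) +
 fixes F :: "nat => 'a set"
 assumes F_ideal: "\<And>k. ideal (F k) R"
  and F_Suc: "\<And>k. F (Suc k) \<subseteq> F k"
  and F_separated: "\<And>a. (\<And>k. a \<in> F k) ==> a = \<zero>"
  and F_complete: "\<And>s. (\<And>k. s k \<in> carrier R) ==> (\<And>k. s (Suc k) \<ominus> s k \<in> F k) ==>
   \<exists>l\<in>carrier R. \<forall>k. l \<ominus> s k \<in> F k"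
begin

lemma F_carr: "f \<in> F k ==> f \<in> carrier R"
 using ideal_sub[OF F_ideal] by blast

lemma F_antimono: "k \<le> l ==> F l \<subseteq> F k"
 by (rule lift_Suc_antimono_le[of F, OF F_Suc])

text \<open>The product of \<open>F k\<close> with the ideal generated by \<open>T\<close>.\<close>

definition FT :: "nat => 'a set => 'a set" where
 "FT k T = Idl {m \<otimes> t | m t. m \<in> F k \<and> t \<in> T}"

lemma FT_sub: "T \<subseteq> carrier R ==> {m \<otimes> t | m t. m \<in> F k \<and> t \<in> T} \<subseteq> carrier R"
 using F_carr by auto

lemma FT_ideal: "T \<subseteq> carrier R ==> ideal (FT k T) R"
 unfolding FT_def by (rule genideal_ideal[OF FT_sub])

lemma FT_memI: "T \<subseteq> carrier R ==> m \<in> F k ==> t \<in> T ==> m \<otimes> t \<in> FT k T"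
 unfolding FT_def using genideal_self[OF FT_sub] by blast

lemma FT_empty: "FT k {} = {\<zero>}"
 unfolding FT_def by (simp add: genideal_empty)

lemma FT_insert:
 assumes t: "t \<in> carrier R" and T: "T \<subseteq> carrier R" and g: "g \<in> FT k (insert t T)"
 shows "\<exists>a\<in>F k. \<exists>h\<in>FT k T. g = a \<otimes> t \<oplus> h"
proof -
 note I = FT_ideal[OF T, of k]
 have c: "FT k T \<subseteq> carrier R" by (rule ideal_sub[OF I])
 have "ideal {g. \<exists>a\<in>F k. \<exists>h\<in>FT k T. g = t \<otimes> a \<oplus> h} R" by (rule ideal_scaled_add[OF I F_ideal t])
 moreover have "{g. \<exists>a\<in>F k. \<exists>h\<in>FT k T. g = t \<otimes> a \<oplus> h} = {g. \<exists>a\<in>F k. \<exists>h\<in>FT k T. g = a \<otimes> t \<oplus> h}"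
  using m_comm[OF t F_carr] by (intro Collect_cong bex_cong refl) auto
 ultimately have "ideal {g. \<exists>a\<in>F k. \<exists>h\<in>FT k T. g = a \<otimes> t \<oplus> h} R" by simp
 moreover have "{m \<otimes> s | m s. m \<in> F k \<and> s \<in> insert t T} \<subseteq> {g. \<exists>a\<in>F k. \<exists>h\<in>FT k T. g = a \<otimes> t \<oplus> h}"
 proof
  fix g assume "g \<in> {m \<otimes> s | m s. m \<in> F k \<and> s \<in> insert t T}"
  then obtain m s where ms: "m \<in> F k" "s \<in> insert t T" "g = m \<otimes> s" by blast
  have mc: "m \<in> carrier R" "s \<in> carrier R" using ms(1,2) F_carr t T by auto
  show "g \<in> {g. \<exists>a\<in>F k. \<exists>h\<in>FT k T. g = a \<otimes> t \<oplus> h}"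
  proof (cases "s = t")
   case True
   hence "g = m \<otimes> t \<oplus> \<zero>" using ms mc by simp
   thus ?thesis using ms(1) ideal_zero[OF I] by blast
  next
   case False
   hence "m \<otimes> s \<in> FT k T" using ms FT_memI[OF T] by blast
   moreover have "g = \<zero> \<otimes> t \<oplus> m \<otimes> s" using ms mc t by simp
   ultimately show ?thesis using ideal_zero[OF F_ideal] by blast
  qed
 qed
 ultimately have "FT k (insert t T) \<subseteq> {g. \<exists>a\<in>F k. \<exists>h\<in>FT k T. g = a \<otimes> t \<oplus> h}"
  unfolding FT_def[of k "insert t T"] by (rule genideal_minimal)
 thus ?thesis using g by blast
qed

text \<open>The differences of consecutive f_k add up to f_0, with coefficients that converge.
  Generators are split off one at a time: the coefficients of t are summed to \<open>l\<close>, and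
  the f_k, corrected by the tails of this sum, satisfy the same assumptions for the smaller
  set.\<close>

lemma limit_mem_genideal:
 assumes "finite T" "T \<subseteq> carrier R" "\<And>k. f k \<in> F k" "\<And>k. f k \<ominus> f (Suc k) \<in> FT k T"
 shows "f 0 \<in> Idl T"
 using assms
proof (induction T arbitrary: f rule: finite_induct)
 case empty
 have fc: "f k \<in> carrier R" for k using empty(2) F_carr by blast
 have "f k = f (Suc k)" for k
 proof -
  have "f k \<ominus> f (Suc k) = \<zero>" using empty(3)[of k] unfolding FT_empty by blast
  thus ?thesis using fc r_right_minus_eq by blast
 qed
 note eq = this
 have "f 0 = f k" for k by (induction k) (use eq in auto)
 hence "f 0 \<in> F k" for k using empty(2)[of k] by metis
 thus ?case using F_separated unfolding genideal_empty by blast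
next
 case (insert t T)
 have t: "t \<in> carrier R" and T: "T \<subseteq> carrier R" using insert.prems(1) by auto
 have fc: "f k \<in> carrier R" for k using insert.prems(2) F_carr by blast
 have "\<exists>a h. a \<in> F k \<and> h \<in> FT k T \<and> f k \<ominus> f (Suc k) = a \<otimes> t \<oplus> h" for k
  using FT_insert[OF t T insert.prems(3)] by blast
 then obtain a h where ah: "\<And>k. a k \<in> F k" "\<And>k. h k \<in> FT k T" "\<And>k. f k \<ominus> f (Suc k) = a k \<otimes> t \<oplus> h k"
  by metis
 have ac: "a k \<in> carrier R" "h k \<in> carrier R" for k
  using ah(1,2)[of k] F_carr ideal_sub[OF FT_ideal[OF T]] by blast+
 define s where "s = rec_nat \<zero> (\<lambda>k r. r \<oplus> a k)"
 have s0: "s 0 = \<zero>" and sS: "s (Suc k) = s k \<oplus> a k" for k by (simp_all add: s_def)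
 have sc: "s k \<in> carrier R" for k by (induction k) (auto simp: s0 sS ac)
 have "s (Suc k) \<ominus> s k = a k" for k unfolding sS using sc[of k] ac(1)[of k] by algebra
 hence "\<exists>l\<in>carrier R. \<forall>k. l \<ominus> s k \<in> F k" using F_complete[of s] sc ah(1) by simp
 then obtain l where l: "l \<in> carrier R" "\<And>k. l \<ominus> s k \<in> F k" by blast
 \<comment> \<open>\<open>l \<ominus> s k\<close> is the tail of the series of coefficients of
   \<open>t\<close>, an element of \<open>F k\<close>.\<close>
 define f' where "f' k = f k \<ominus> (l \<ominus> s k) \<otimes> t" for k
 have "f' k \<in> F k" for k
 proof -
  have "t \<otimes> (l \<ominus> s k) \<in> F k" by (rule ideal_mult[OF F_ideal t l(2)])
  hence "(l \<ominus> s k) \<otimes> t \<in> F k" using m_comm[of t "l \<ominus> s k"] t l(1) sc by simp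
  thus ?thesis unfolding f'_def by (rule ideal_minus[OF F_ideal insert.prems(2)])
 qed
 moreover have "f' k \<ominus> f' (Suc k) \<in> FT k T" for k
 proof -
  have "f' k \<ominus> f' (Suc k) = (f k \<ominus> f (Suc k)) \<ominus> a k \<otimes> t"
   unfolding f'_def sS using fc[of k] fc[of "Suc k"] l(1) sc[of k] ac(1)[of k] t by algebra
  also have "\<dots> = h k" unfolding ah(3) using ac[of k] t by algebra
  finally show ?thesis using ah(2)[of k] by simp
 qed
 ultimately have "f' 0 \<in> Idl T" by (rule insert.IH[OF T])
 moreover have "f 0 = l \<otimes> t \<oplus> f' 0" unfolding f'_def s0 using fc[of 0] l(1) t by algebra
 ultimately show ?case using genideal_insert[OF t T] l(1) by blast
qed

end

section \<open>The completion\<close>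

lemma (in ring_hom_cring) hom_genideal:
 assumes G: "G \<subseteq> carrier R" and f: "f \<in> Idl\<^bsub>R\<^esub> G"
 shows "h f \<in> Idl\<^bsub>S\<^esub> (h ` G)"
proof -
 have c: "h ` G \<subseteq> carrier S" using G by auto
 note I = S.genideal_ideal[OF c]
 show ?thesis
 proof (rule R.genideal_ind[OF G f])
  show "h \<zero>\<^bsub>R\<^esub> \<in> Idl\<^bsub>S\<^esub> (h ` G)" using S.ideal_zero[OF I] by simp
  show "h (a \<otimes>\<^bsub>R\<^esub> g) \<in> Idl\<^bsub>S\<^esub> (h ` G)" if "a \<in> carrier R" "g \<in> G" for a g
  proof -
   have "h (a \<otimes>\<^bsub>R\<^esub> g) = h a \<otimes>\<^bsub>S\<^esub> h g" using that G by (intro hom_mult) auto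
   thus ?thesis using S.ideal_mult[OF I hom_closed[OF that(1)]] S.genideal_self[OF c] that(2) by auto
  qed
  fix f g assume fg: "f \<in> Idl\<^bsub>R\<^esub> G" "g \<in> Idl\<^bsub>R\<^esub> G" "h f \<in> Idl\<^bsub>S\<^esub> (h ` G)" "h g \<in> Idl\<^bsub>S\<^esub> (h ` G)"
  have "f \<in> carrier R" "g \<in> carrier R" using fg(1,2) R.ideal_sub[OF R.genideal_ideal[OF G]] by auto
  hence "h (f \<oplus>\<^bsub>R\<^esub> g) = h f \<oplus>\<^bsub>S\<^esub> h g" by (rule hom_add)
  thus "h (f \<oplus>\<^bsub>R\<^esub> g) \<in> Idl\<^bsub>S\<^esub> (h ` G)" using S.ideal_add[OF I fg(3,4)] by simp
 qed
qed

lemma (in ring_hom_cring) genideal_image: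
 assumes G: "G \<subseteq> carrier R"
 shows "Idl\<^bsub>S\<^esub> (h ` (Idl\<^bsub>R\<^esub> G)) = Idl\<^bsub>S\<^esub> (h ` G)"
proof
 have c: "h ` G \<subseteq> carrier S" using G by auto
 show "Idl\<^bsub>S\<^esub> (h ` (Idl\<^bsub>R\<^esub> G)) \<subseteq> Idl\<^bsub>S\<^esub> (h ` G)"
  by (rule S.genideal_minimal[OF S.genideal_ideal[OF c]]) (use hom_genideal[OF G] in blast)
 show "Idl\<^bsub>S\<^esub> (h ` G) \<subseteq> Idl\<^bsub>S\<^esub> (h ` (Idl\<^bsub>R\<^esub> G))"
  by (rule S.genideal_mono) (use R.genideal_self[OF G] in blast)
qed

declare nat_pow_Suc [simp del]

section \<open>Elements of the completion as classes of Cauchy sequences\<close>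

locale adic_parameters = parameters
begin

abbreviation Pw :: "nat => 'a set" where "Pw k \<equiv> ideal_power R M k"
abbreviation A :: "(nat => 'a set) ring" where "A \<equiv> adic_completion R M"

text \<open>The rate is fixed: the k-th term matters modulo M^k only. Such sequences are exactly the
  choices of representatives for a point of the inverse limit, and identities in the completion are
  checked on them.\<close>

definition cauchy :: "(nat => 'a) => bool" where
 "cauchy r \<longleftrightarrow> (\<forall>k. r k \<in> carrier R) \<and> (\<forall>k. r (Suc k) \<ominus> r k \<in> Pw k)"

definition cls :: "(nat => 'a) => nat => 'a set" where
 "cls r = (\<lambda>k. Pw k +> r k)"

lemma Pw_ideal: "ideal (Pw k) R"
 by (rule ideal_power_ideal[OF M_ideal])

lemma Pw_carr: "f \<in> Pw k ==> f \<in> carrier R"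
 using ideal_sub[OF Pw_ideal] by blast

lemma Pw_antimono: "k \<le> l ==> Pw l \<subseteq> Pw k"
 by (rule ideal_power_antimono[OF M_ideal])

lemma Pw_1: "Pw (Suc 0) = M"
 using ideal_power_1[OF M_ideal] by simp

lemmas Pw_coset = coset_eq[OF Pw_ideal] coset_zero[OF Pw_ideal]

lemma coset_eq_Pw: "a \<in> carrier R ==> Pw k +> a = Pw k \<longleftrightarrow> a \<in> Pw k"
 using Pw_coset(1)[of a \<zero> k] Pw_coset(2)[of k] by (simp add: a_minus_def)

lemma coset_self: "a \<in> carrier R ==> a \<in> Pw k +> a"
 unfolding coset_mem[OF Pw_ideal] using ideal_zero[OF Pw_ideal] by (simp add: a_minus_def r_neg)

lemma cauchy_carr: "cauchy r ==> r k \<in> carrier R"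
 by (simp add: cauchy_def)

lemma cauchy_Suc: "cauchy r ==> r (Suc k) \<ominus> r k \<in> Pw k"
 by (simp add: cauchy_def)

lemma cauchy_le:
 assumes "cauchy r" "k \<le> l"
 shows "r l \<ominus> r k \<in> Pw k"
 using assms(2)
proof (induction l rule: dec_induct)
 case base
 have "r k \<ominus> r k = \<zero>" using cauchy_carr[OF assms(1), of k] by algebra
 thus ?case using ideal_zero[OF Pw_ideal] by simp
next
 case (step l)
 have "r (Suc l) \<ominus> r l \<in> Pw k" using cauchy_Suc[OF assms(1), of l] Pw_antimono[OF step(1)] by blast
 moreover have "r (Suc l) \<ominus> r k = (r (Suc l) \<ominus> r l) \<oplus> (r l \<ominus> r k)"
  using cauchy_carr[OF assms(1)] by algebra
 ultimately show ?case using ideal_add[OF Pw_ideal _ step.IH] by simp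
qed

lemma cauchyI: "(\<And>k. r k \<in> carrier R) ==> (\<And>k. r (Suc k) \<ominus> r k \<in> Pw k) ==> cauchy r"
 by (simp add: cauchy_def)

lemma carrier_A: "carrier A = cls ` {r. cauchy r}"
proof (intro subset_antisym subsetI)
 fix s assume "s \<in> carrier A"
 hence s: "\<And>k. s k \<in> carrier (R Quot Pw k)" "\<And>k. s (Suc k) \<subseteq> s k"
  by (auto simp: adic_completion_def)
 have "\<exists>a\<in>carrier R. s k = Pw k +> a" for k
  using s(1)[of k] by (auto simp: FactRing_def A_RCOSETS_def')
 then obtain r where r: "\<And>k. r k \<in> carrier R" "\<And>k. s k = Pw k +> r k" by metis
 have "r (Suc k) \<ominus> r k \<in> Pw k" for k
 proof -
  have "r (Suc k) \<in> s k" using coset_self[OF r(1)] r(2) s(2) by blast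
  thus ?thesis using coset_mem[OF Pw_ideal] r by metis
 qed
 hence "cauchy r" using r(1) by (intro cauchyI)
 moreover have "s = cls r" using r(2) by (auto simp: cls_def)
 ultimately show "s \<in> cls ` {r. cauchy r}" by blast
next
 fix s assume "s \<in> cls ` {r. cauchy r}"
 then obtain r where r: "cauchy r" "s = cls r" by blast
 have "Pw (Suc k) +> r (Suc k) \<subseteq> Pw k +> r k" for k
 proof
  fix b assume "b \<in> Pw (Suc k) +> r (Suc k)"
  hence b: "b \<in> carrier R" "b \<ominus> r (Suc k) \<in> Pw (Suc k)" using coset_mem[OF Pw_ideal] cauchy_carr[OF r(1)] by auto
  hence "b \<ominus> r (Suc k) \<in> Pw k" using Pw_antimono[of k "Suc k"] by auto
  hence "(b \<ominus> r (Suc k)) \<oplus> (r (Suc k) \<ominus> r k) \<in> Pw k" by (rule ideal_add[OF Pw_ideal _ cauchy_Suc[OF r(1)]])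
  moreover have "(b \<ominus> r (Suc k)) \<oplus> (r (Suc k) \<ominus> r k) = b \<ominus> r k"
   using b(1) cauchy_carr[OF r(1), of k] cauchy_carr[OF r(1), of "Suc k"] by algebra
  ultimately show "b \<in> Pw k +> r k" using coset_mem[OF Pw_ideal cauchy_carr[OF r(1), of k]] b(1) by simp
 qed
 moreover have "Pw k +> r k \<in> carrier (R Quot Pw k)" for k
  using cauchy_carr[OF r(1)] by (auto simp: FactRing_def A_RCOSETS_def')
 ultimately show "s \<in> carrier A" by (simp add: r(2) adic_completion_def cls_def)
qed

lemma cls_carr: "cauchy r ==> cls r \<in> carrier A"
 unfolding carrier_A by blast

lemma cls_E:
 assumes "s \<in> carrier A"
 obtains r where "cauchy r" "s = cls r"
 using assms unfolding carrier_A by blast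

lemma cls_eq: "cauchy r ==> cauchy r' ==> cls r = cls r' \<longleftrightarrow> (\<forall>k. r k \<ominus> r' k \<in> Pw k)"
 by (simp add: cls_def fun_eq_iff Pw_coset(1) cauchy_carr)

lemma cauchy_add: "cauchy r ==> cauchy r' ==> cauchy (\<lambda>k. r k \<oplus> r' k)"
proof (rule cauchyI)
 fix k assume c: "cauchy r" "cauchy r'"
 have "r (Suc k) \<oplus> r' (Suc k) \<ominus> (r k \<oplus> r' k) = (r (Suc k) \<ominus> r k) \<oplus> (r' (Suc k) \<ominus> r' k)"
  using cauchy_carr[OF c(1)] cauchy_carr[OF c(2)] by algebra
 thus "r (Suc k) \<oplus> r' (Suc k) \<ominus> (r k \<oplus> r' k) \<in> Pw k"
  using ideal_add[OF Pw_ideal cauchy_Suc[OF c(1)] cauchy_Suc[OF c(2)]] by simp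
qed (simp add: cauchy_carr)

lemma cauchy_mult: "cauchy r ==> cauchy r' ==> cauchy (\<lambda>k. r k \<otimes> r' k)"
proof (rule cauchyI)
 fix k assume c: "cauchy r" "cauchy r'"
 have "r (Suc k) \<otimes> r' (Suc k) \<ominus> (r k \<otimes> r' k) = r' (Suc k) \<otimes> (r (Suc k) \<ominus> r k) \<oplus> r k \<otimes> (r' (Suc k) \<ominus> r' k)"
  using cauchy_carr[OF c(1)] cauchy_carr[OF c(2)] by algebra
 thus "r (Suc k) \<otimes> r' (Suc k) \<ominus> (r k \<otimes> r' k) \<in> Pw k"
  using ideal_add[OF Pw_ideal ideal_mult[OF Pw_ideal _ cauchy_Suc[OF c(1)]] ideal_mult[OF Pw_ideal _ cauchy_Suc[OF c(2)]]]
   cauchy_carr[OF c(1)] cauchy_carr[OF c(2)] by simp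
qed (simp add: cauchy_carr)

lemma cauchy_const: "a \<in> carrier R ==> cauchy (\<lambda>_. a)"
 by (rule cauchyI) (simp_all add: a_minus_def r_neg ideal_zero[OF Pw_ideal])

lemma add_A: "cauchy r ==> cauchy r' ==> cls r \<oplus>\<^bsub>A\<^esub> cls r' = cls (\<lambda>k. r k \<oplus> r' k)"
 by (simp add: adic_completion_def cls_def fun_eq_iff FactRing_def cauchy_carr
   abelian_subgroup.a_rcos_sum[OF abelian_subgroupI3[OF ideal.axioms(1)[OF Pw_ideal] abelian_group_axioms]])

lemma mult_A: "cauchy r ==> cauchy r' ==> cls r \<otimes>\<^bsub>A\<^esub> cls r' = cls (\<lambda>k. r k \<otimes> r' k)"
 by (simp add: adic_completion_def cls_def fun_eq_iff FactRing_def cauchy_carr ideal.rcoset_mult_add[OF Pw_ideal])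

lemma one_A: "\<one>\<^bsub>A\<^esub> = cls (\<lambda>_. \<one>)"
 by (simp add: adic_completion_def cls_def fun_eq_iff FactRing_def)

lemma zero_A: "\<zero>\<^bsub>A\<^esub> = cls (\<lambda>_. \<zero>)"
 by (simp add: adic_completion_def cls_def fun_eq_iff FactRing_def Pw_coset(2))

lemma cring_A: "cring A"
proof (intro cringI abelian_groupI comm_monoidI)
 fix s t u assume "s \<in> carrier A" "t \<in> carrier A" "u \<in> carrier A"
 then obtain r r' r'' where r: "cauchy r" "s = cls r" "cauchy r'" "t = cls r'" "cauchy r''" "u = cls r''"
  by (metis cls_E)
 note c = cauchy_carr[OF r(1)] cauchy_carr[OF r(3)] cauchy_carr[OF r(5)]
 note a = r(1,3,5) cauchy_add cauchy_mult
 show "s \<oplus>\<^bsub>A\<^esub> t \<oplus>\<^bsub>A\<^esub> u = s \<oplus>\<^bsub>A\<^esub> (t \<oplus>\<^bsub>A\<^esub> u)" by (simp add: r add_A a a_assoc c)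
 show "s \<otimes>\<^bsub>A\<^esub> t \<otimes>\<^bsub>A\<^esub> u = s \<otimes>\<^bsub>A\<^esub> (t \<otimes>\<^bsub>A\<^esub> u)" by (simp add: r mult_A a m_assoc c)
 show "(s \<oplus>\<^bsub>A\<^esub> t) \<otimes>\<^bsub>A\<^esub> u = s \<otimes>\<^bsub>A\<^esub> u \<oplus>\<^bsub>A\<^esub> t \<otimes>\<^bsub>A\<^esub> u" by (simp add: r add_A mult_A a l_distr c)
next
 fix s t assume "s \<in> carrier A" "t \<in> carrier A"
 then obtain r r' where r: "cauchy r" "s = cls r" "cauchy r'" "t = cls r'" by (metis cls_E)
 note c = cauchy_carr[OF r(1)] cauchy_carr[OF r(3)]
 show "s \<oplus>\<^bsub>A\<^esub> t \<in> carrier A" by (simp add: r add_A cls_carr cauchy_add)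
 show "s \<otimes>\<^bsub>A\<^esub> t \<in> carrier A" by (simp add: r mult_A cls_carr cauchy_mult)
 show "s \<oplus>\<^bsub>A\<^esub> t = t \<oplus>\<^bsub>A\<^esub> s" by (simp add: r add_A a_comm c)
 show "s \<otimes>\<^bsub>A\<^esub> t = t \<otimes>\<^bsub>A\<^esub> s" by (simp add: r mult_A m_comm c)
next
 show "\<zero>\<^bsub>A\<^esub> \<in> carrier A" "\<one>\<^bsub>A\<^esub> \<in> carrier A" by (simp_all add: zero_A one_A cls_carr cauchy_const)
 fix s assume "s \<in> carrier A"
 then obtain r where r: "cauchy r" "s = cls r" by (metis cls_E)
 note c = cauchy_carr[OF r(1)]
 show "\<zero>\<^bsub>A\<^esub> \<oplus>\<^bsub>A\<^esub> s = s" by (simp add: r add_A zero_A cauchy_const c)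
 show "\<one>\<^bsub>A\<^esub> \<otimes>\<^bsub>A\<^esub> s = s" by (simp add: r mult_A one_A cauchy_const c)
 show "\<exists>t\<in>carrier A. t \<oplus>\<^bsub>A\<^esub> s = \<zero>\<^bsub>A\<^esub>"
 proof (rule bexI)
  have m: "cauchy (\<lambda>k. \<ominus> \<one> \<otimes> r k)" by (rule cauchy_mult[OF cauchy_const r(1)]) simp
  show "cls (\<lambda>k. \<ominus> \<one> \<otimes> r k) \<in> carrier A" by (rule cls_carr[OF m])
  have "\<ominus> \<one> \<otimes> r k \<oplus> r k = \<zero>" for k using c[of k] by algebra
  thus "cls (\<lambda>k. \<ominus> \<one> \<otimes> r k) \<oplus>\<^bsub>A\<^esub> s = \<zero>\<^bsub>A\<^esub>" by (simp add: r add_A zero_A m)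
 qed
qed

lemma uminus_A: "cauchy r ==> \<ominus>\<^bsub>A\<^esub> cls r = cls (\<lambda>k. \<ominus> r k)"
proof -
 assume r: "cauchy r"
 interpret A: cring A by (rule cring_A)
 note c = cauchy_carr[OF r]
 have e: "\<ominus> r k = \<ominus> \<one> \<otimes> r k" for k using c[of k] by algebra
 have m: "cauchy (\<lambda>k. \<ominus> r k)" unfolding e by (rule cauchy_mult[OF cauchy_const r]) simp
 have "cls (\<lambda>k. \<ominus> r k) \<oplus>\<^bsub>A\<^esub> cls r = \<zero>\<^bsub>A\<^esub>" by (simp add: add_A m r zero_A l_neg c)
 thus ?thesis using A.minus_equality[OF _ cls_carr[OF r] cls_carr[OF m]] by simp
qed

lemma cauchy_uminus: "cauchy r ==> cauchy (\<lambda>k. \<ominus> r k)"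
proof -
 assume r: "cauchy r"
 have e: "\<ominus> r k = \<ominus> \<one> \<otimes> r k" for k using cauchy_carr[OF r, of k] by algebra
 show ?thesis unfolding e by (rule cauchy_mult[OF cauchy_const r]) simp
qed

lemma cauchy_minus: "cauchy r ==> cauchy r' ==> cauchy (\<lambda>k. r k \<ominus> r' k)"
 unfolding a_minus_def by (intro cauchy_add cauchy_uminus)

lemma minus_A: "cauchy r ==> cauchy r' ==> cls r \<ominus>\<^bsub>A\<^esub> cls r' = cls (\<lambda>k. r k \<ominus> r' k)"
 unfolding a_minus_def by (simp add: uminus_A add_A cauchy_uminus)

text \<open>The kernel of the projection to R/M^k. That it is the k-th power of the maximal ideal of
  the completion is shown in \<open>FA_power\<close>.\<close>

definition FA :: "nat => (nat => 'a set) set" where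
 "FA k = {s \<in> carrier A. s k = Pw k}"

lemma cls_FA: "cauchy r ==> cls r \<in> FA k \<longleftrightarrow> r k \<in> Pw k"
 by (simp add: FA_def cls_carr) (simp add: cls_def coset_eq_Pw cauchy_carr)

lemma complete_A: "complete_filtered A FA"
proof -
 interpret A: cring A by (rule cring_A)
 show ?thesis
 proof (intro complete_filtered.intro complete_filtered_axioms.intro)
  show "cring A" by (rule cring_A)
 next
  fix k
  have "ideal {s. s \<in> carrier A \<and> s k = Pw k} A"
  proof (rule A.ideal_Collect)
   show "\<zero>\<^bsub>A\<^esub> \<in> carrier A \<and> \<zero>\<^bsub>A\<^esub> k = Pw k" using A.zero_closed by (simp add: zero_A cls_def Pw_coset(2))
   fix s assume s: "s \<in> carrier A \<and> s k = Pw k"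
   hence sF: "s \<in> FA k" by (simp add: FA_def)
   obtain r where r: "cauchy r" "s = cls r" by (rule cls_E[OF conjunct1[OF s]])
   have rk: "r k \<in> Pw k" using sF cls_FA[OF r(1)] r(2) by simp
   show "y \<otimes>\<^bsub>A\<^esub> s \<in> carrier A \<and> (y \<otimes>\<^bsub>A\<^esub> s) k = Pw k" if y: "y \<in> carrier A" for y
   proof -
    obtain r' where r': "cauchy r'" "y = cls r'" by (rule cls_E[OF y])
    have "r' k \<otimes> r k \<in> Pw k" by (rule ideal_mult[OF Pw_ideal cauchy_carr[OF r'(1)] rk])
    hence "y \<otimes>\<^bsub>A\<^esub> s \<in> FA k" using cls_FA[OF cauchy_mult[OF r'(1) r(1)]] by (simp add: r r' mult_A)
    thus ?thesis by (simp add: FA_def)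
   qed
   fix t assume t: "t \<in> carrier A \<and> t k = Pw k"
   hence tF: "t \<in> FA k" by (simp add: FA_def)
   obtain r' where r': "cauchy r'" "t = cls r'" by (rule cls_E[OF conjunct1[OF t]])
   have "r' k \<in> Pw k" using tF cls_FA[OF r'(1)] r'(2) by simp
   hence "r k \<oplus> r' k \<in> Pw k" by (rule ideal_add[OF Pw_ideal rk])
   hence "s \<oplus>\<^bsub>A\<^esub> t \<in> FA k" using cls_FA[OF cauchy_add[OF r(1) r'(1)]] by (simp add: r r' add_A)
   thus "s \<oplus>\<^bsub>A\<^esub> t \<in> carrier A \<and> (s \<oplus>\<^bsub>A\<^esub> t) k = Pw k" by (simp add: FA_def)
  qed simp
  thus "ideal (FA k) A" by (simp add: FA_def)
  show "FA (Suc k) \<subseteq> FA k"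
  proof
   fix s assume s: "s \<in> FA (Suc k)"
   then obtain r where r: "cauchy r" "s = cls r" using cls_E unfolding FA_def by blast
   have "r (Suc k) \<in> Pw k" using s cls_FA[OF r(1)] r(2) Pw_antimono[of k "Suc k"] by auto
   moreover have "r k = r (Suc k) \<ominus> (r (Suc k) \<ominus> r k)"
    using cauchy_carr[OF r(1), of k] cauchy_carr[OF r(1), of "Suc k"] by algebra
   ultimately have "r k \<in> Pw k" using ideal_minus[OF Pw_ideal _ cauchy_Suc[OF r(1)]] by metis
   thus "s \<in> FA k" using cls_FA[OF r(1)] r(2) by simp
  qed
 next
  fix s assume s: "\<And>k. s \<in> FA k"
  then obtain r where r: "cauchy r" "s = cls r" using cls_E unfolding FA_def by blast
  have "r k \<ominus> \<zero> \<in> Pw k" for k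
  proof -
   have "r k \<in> Pw k" using s[of k] cls_FA[OF r(1)] r(2) by simp
   thus ?thesis using ideal_minus[OF Pw_ideal _ ideal_zero[OF Pw_ideal]] by blast
  qed
  thus "s = \<zero>\<^bsub>A\<^esub>" unfolding r(2) zero_A using cls_eq[OF r(1) cauchy_const[OF zero_closed]] by simp
 next
  fix s :: "nat => nat => 'a set"
  assume s: "\<And>k. s k \<in> carrier A" "\<And>k. s (Suc k) \<ominus>\<^bsub>A\<^esub> s k \<in> FA k"
  have "\<exists>r. cauchy r \<and> s j = cls r" for j using s(1)[of j] cls_E by blast
  then obtain r where r: "\<And>j. cauchy (r j)" "\<And>j. s j = cls (r j)" by metis
  note c = cauchy_carr[OF r(1)]
  \<comment> \<open>The limit is represented by the diagonal sequence.\<close>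
  have l: "cauchy (\<lambda>k. r k k)"
  proof (rule cauchyI)
   fix k
   have "r (Suc k) k \<ominus> r k k \<in> Pw k"
    using s(2)[of k] cls_FA[OF cauchy_minus[OF r(1) r(1)], of "Suc k" k k] by (simp add: r minus_A)
   hence "(r (Suc k) (Suc k) \<ominus> r (Suc k) k) \<oplus> (r (Suc k) k \<ominus> r k k) \<in> Pw k"
    by (rule ideal_add[OF Pw_ideal cauchy_Suc[OF r(1)]])
   moreover have "(r (Suc k) (Suc k) \<ominus> r (Suc k) k) \<oplus> (r (Suc k) k \<ominus> r k k) = r (Suc k) (Suc k) \<ominus> r k k"
    using c[of "Suc k" "Suc k"] c[of "Suc k" k] c[of k k] by algebra
   ultimately show "r (Suc k) (Suc k) \<ominus> r k k \<in> Pw k" by simp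
  qed (rule c)
  have "cls (\<lambda>k. r k k) \<ominus>\<^bsub>A\<^esub> s k \<in> FA k" for k
  proof -
   have "r k k \<ominus> r k k = \<zero>" using c[of k k] by algebra
   thus ?thesis unfolding r(2) minus_A[OF l r(1)] using cls_FA[OF cauchy_minus[OF l r(1)], of k k] ideal_zero[OF Pw_ideal] by simp
  qed
  thus "\<exists>l\<in>carrier A. \<forall>k. l \<ominus>\<^bsub>A\<^esub> s k \<in> FA k" using cls_carr[OF l] by blast
 qed
qed

definition \<iota> :: "'a => nat => 'a set" where "\<iota> a = cls (\<lambda>_. a)"

lemma iota_hom: "\<iota> \<in> ring_hom R A"
 by (rule ring_hom_memI) (simp_all add: \<iota>_def cls_carr cauchy_const mult_A add_A one_A)

lemma iota_hom_cring: "ring_hom_cring R A \<iota>"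
 by (intro ring_hom_cring.intro cring_axioms cring_A ring_hom_cring_axioms.intro iota_hom)

lemma iota_FA: "a \<in> carrier R ==> \<iota> a \<in> FA k \<longleftrightarrow> a \<in> Pw k"
 unfolding \<iota>_def by (rule cls_FA[OF cauchy_const])

lemma iota_closed: "a \<in> carrier R ==> \<iota> a \<in> carrier A"
 unfolding \<iota>_def by (rule cls_carr[OF cauchy_const])

lemma iota_x: "\<iota> \<circ> x \<in> {..<n} \<rightarrow> carrier A"
 using x_closed by (auto simp: Pi_def intro: iota_closed)

lemma iota_approx:
 assumes "s \<in> carrier A"
 obtains a where "a \<in> carrier R" "s \<ominus>\<^bsub>A\<^esub> \<iota> a \<in> FA k"
proof -
 obtain r where r: "cauchy r" "s = cls r" using assms cls_E by blast
 have rk: "r k \<in> carrier R" by (rule cauchy_carr[OF r(1)])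
 have "r k \<ominus> r k = \<zero>" using rk by algebra
 hence "s \<ominus>\<^bsub>A\<^esub> \<iota> (r k) \<in> FA k"
  unfolding r(2) \<iota>_def minus_A[OF r(1) cauchy_const[OF rk]] cls_FA[OF cauchy_minus[OF r(1) cauchy_const[OF rk]]]
  using ideal_zero[OF Pw_ideal] by simp
 thus thesis using that rk by blast
qed

lemma mon_iota: "mon A (\<iota> \<circ> x) n al = \<iota> (mx al)"
proof -
 interpret h: ring_hom_cring R A \<iota> by (rule iota_hom_cring)
 have "\<iota> (mx al) = (\<Otimes>\<^bsub>A\<^esub>i\<in>{..<n}. (\<iota> \<circ> (\<lambda>i. x i [^] al i)) i)"
  unfolding mon_def using x_closed by (subst h.hom_finprod) (auto simp: o_def)
 also have "\<dots> = mon A (\<iota> \<circ> x) n al"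
  unfolding mon_def using x_closed by (intro h.S.finprod_cong') (auto simp: Pi_def h.hom_pow)
 finally show ?thesis ..
qed

text \<open>Finite generation of \<open>M\<close> enters here. An element of the (k+j)-th kernel is
  approximated by an element of M^(k+j), which is a combination of the finitely many monomials of
  degree \<open>k\<close> with coefficients in M^j. Repeating this for all j,
  \<open>limit_mem_genideal\<close> passes to the limit.\<close>

lemma FA_monomials: "FA k = Idl\<^bsub>A\<^esub> (mon A (\<iota> \<circ> x) n ` {al \<in> exps n. tdeg n al = k})"
proof
 interpret A: complete_filtered A FA by (rule complete_A)
 interpret h: ring_hom_cring R A \<iota> by (rule iota_hom_cring)
 let ?T = "mon A (\<iota> \<circ> x) n ` {al \<in> exps n. tdeg n al = k}"
 note ix = iota_x
 have T: "?T \<subseteq> carrier A" by (rule A.mon_image_closed[OF ix])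
 show "Idl\<^bsub>A\<^esub> ?T \<subseteq> FA k"
 proof (rule A.genideal_minimal[OF A.F_ideal], rule image_subsetI)
  fix al assume "al \<in> {al \<in> exps n. tdeg n al = k}"
  thus "mon A (\<iota> \<circ> x) n al \<in> FA k" unfolding mon_iota iota_FA[OF mx_closed] by (intro mx_power_M) auto
 qed
 show "FA k \<subseteq> Idl\<^bsub>A\<^esub> ?T"
 proof
  fix f assume f: "f \<in> FA k"
  have step: "\<exists>g'. g' \<in> FA (k + Suc j) \<and> g \<ominus>\<^bsub>A\<^esub> g' \<in> A.FT j ?T" if g: "g \<in> FA (k + j)" for g j
  proof -
   have gc: "g \<in> carrier A" using g A.F_carr by blast
   obtain a where a: "a \<in> carrier R" "g \<ominus>\<^bsub>A\<^esub> \<iota> a \<in> FA (k + Suc j)" by (rule iota_approx[OF gc])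
   have ac: "\<iota> a \<in> carrier A" by (rule iota_closed[OF a(1)])
   have "\<iota> a = g \<ominus>\<^bsub>A\<^esub> (g \<ominus>\<^bsub>A\<^esub> \<iota> a)" using gc ac by algebra
   moreover have "g \<ominus>\<^bsub>A\<^esub> \<iota> a \<in> FA (k + j)" using a(2) A.F_antimono[of "k + j" "k + Suc j"] by auto
   ultimately have "\<iota> a \<in> FA (k + j)" using A.ideal_minus[OF A.F_ideal g] by metis
   hence "a \<in> mI {al \<in> exps n. tdeg n al = k + j}" using iota_FA[OF a(1)] power_M by simp
   hence "\<iota> a \<in> Idl\<^bsub>A\<^esub> (\<iota> ` mx ` {al \<in> exps n. tdeg n al = k + j})" by (rule ring_hom_cring.hom_genideal[OF iota_hom_cring mx_sub])
   moreover have "\<iota> ` mx ` {al \<in> exps n. tdeg n al = k + j} \<subseteq> A.FT j ?T"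
   proof (intro subsetI, elim imageE)
    fix z y al assume z: "z = \<iota> y" "y = mx al" "al \<in> {al \<in> exps n. tdeg n al = k + j}"
    then obtain be ga where bg: "be \<in> exps n" "ga \<in> exps n" "al = be + ga" "tdeg n be = k"
     using exp_split[of al n k] by auto
    hence "tdeg n ga = j" using z(3) by auto
    hence "\<iota> (mx ga) \<in> FA j" unfolding iota_FA[OF mx_closed] using bg by (intro mx_power_M) auto
    moreover have "\<iota> (mx be) \<in> ?T" using bg unfolding mon_iota by blast
    moreover have "z = \<iota> (mx ga) \<otimes>\<^bsub>A\<^esub> \<iota> (mx be)"
     unfolding z(1,2) bg(3) mx_add
     using A.m_comm[OF iota_closed[OF mx_closed] iota_closed[OF mx_closed]] by simp
    ultimately show "z \<in> A.FT j ?T" using A.FT_memI[OF T] by blast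
   qed
   ultimately have "\<iota> a \<in> A.FT j ?T" using A.genideal_minimal[OF A.FT_ideal[OF T]] by blast
   moreover have "g \<ominus>\<^bsub>A\<^esub> (g \<ominus>\<^bsub>A\<^esub> \<iota> a) = \<iota> a" using gc ac by algebra
   ultimately have "g \<ominus>\<^bsub>A\<^esub> (g \<ominus>\<^bsub>A\<^esub> \<iota> a) \<in> A.FT j ?T" by simp
   thus ?thesis using a(2) by blast
  qed
  define F' where "F' = rec_nat f (\<lambda>j g. SOME g'. g' \<in> FA (k + Suc j) \<and> g \<ominus>\<^bsub>A\<^esub> g' \<in> A.FT j ?T)"
  have F'0: "F' 0 = f" and F'S: "F' (Suc j) = (SOME g'. g' \<in> FA (k + Suc j) \<and> F' j \<ominus>\<^bsub>A\<^esub> g' \<in> A.FT j ?T)" for j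
   by (simp_all add: F'_def)
  have inF: "F' j \<in> FA (k + j)" for j
  proof (induction j)
   case 0
   show ?case using f F'0 by simp
  next
   case (Suc j)
   show ?case unfolding F'S using someI_ex[OF step[OF Suc]] by blast
  qed
  have "F' j \<ominus>\<^bsub>A\<^esub> F' (Suc j) \<in> A.FT j ?T" for j
   unfolding F'S using someI_ex[OF step[OF inF]] by blast
  moreover have "F' j \<in> FA j" for j using inF[of j] A.F_antimono[of j "k + j"] by auto
  moreover have "finite ?T" using finite_exps_tdeg_eq by blast
  ultimately have "F' 0 \<in> Idl\<^bsub>A\<^esub> ?T" by (intro A.limit_mem_genideal[OF _ T]) 
  thus "f \<in> Idl\<^bsub>A\<^esub> ?T" using F'0 by simp
 qed
qed

lemma FA_1: "FA 1 = Idl\<^bsub>A\<^esub> ((\<iota> \<circ> x) ` {..<n})"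
proof -
 interpret A: cring A by (rule cring_A)
 note ix = iota_x
 have "ideal (Idl\<^bsub>A\<^esub> ((\<iota> \<circ> x) ` {..<n})) A" using ix by (intro A.genideal_ideal) auto
 thus ?thesis using A.ideal_power_monomials[OF ix refl, of 1] A.ideal_power_1 unfolding FA_monomials by simp
qed

lemma FA_power: "ideal_power A (FA 1) k = FA k"
proof -
 interpret A: cring A by (rule cring_A)
 note ix = iota_x
 show ?thesis using A.ideal_power_monomials[OF ix FA_1, of k] FA_monomials by simp
qed

lemma FA_local:
 assumes s: "s \<in> carrier A" "s \<notin> FA 1"
 shows "s \<in> Units A"
proof -
 interpret A: cring A by (rule cring_A)
 obtain r where r: "cauchy r" "s = cls r" using s cls_E by blast
 note c = cauchy_carr[OF r(1)]
 have r1: "r 1 \<notin> M" using s(2) cls_FA[OF r(1), of 1] r(2) Pw_1 by simp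
 have u: "r (Suc k) \<in> Units R" for k
 proof (rule M_local[OF c])
  have "r (Suc k) \<ominus> r 1 \<in> M" using cauchy_le[OF r(1), of 1 "Suc k"] Pw_1 by simp
  moreover have "r 1 = r (Suc k) \<ominus> (r (Suc k) \<ominus> r 1)" using c[of 1] c[of "Suc k"] by algebra
  ultimately show "r (Suc k) \<notin> M" using r1 ideal_minus[OF M_ideal] by metis
 qed
 \<comment> \<open>The shift avoids \<open>r 0\<close>, which is arbitrary since M^0 is the whole
   ring; from index 1 on all terms agree modulo \<open>M\<close> and are units.\<close>
 define t where "t k = inv (r (Suc k))" for k
 have tc: "t k \<in> carrier R" for k using u t_def by simp
 have rt: "r (Suc k) \<otimes> t k = \<one>" for k using u t_def by simp
 have t: "cauchy t"
 proof (rule cauchyI[OF tc])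
  fix k
  have "t (Suc k) \<ominus> t k = \<ominus> ((t (Suc k) \<otimes> t k) \<otimes> (r (Suc (Suc k)) \<ominus> r (Suc k)))"
  proof -
   have "\<ominus> ((t (Suc k) \<otimes> t k) \<otimes> (r (Suc (Suc k)) \<ominus> r (Suc k)))
    = t (Suc k) \<otimes> (r (Suc k) \<otimes> t k) \<ominus> (r (Suc (Suc k)) \<otimes> t (Suc k)) \<otimes> t k"
    using tc[of k] tc[of "Suc k"] c[of "Suc k"] c[of "Suc (Suc k)"] by algebra
   thus ?thesis unfolding rt using tc by simp
  qed
  moreover have "r (Suc (Suc k)) \<ominus> r (Suc k) \<in> Pw k"
   using cauchy_Suc[OF r(1), of "Suc k"] Pw_antimono[of k "Suc k"] by auto
  ultimately show "t (Suc k) \<ominus> t k \<in> Pw k"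
   using ideal_uminus[OF Pw_ideal ideal_mult[OF Pw_ideal]] tc by simp
 qed
 have "r k \<otimes> t k \<ominus> \<one> \<in> Pw k" for k
 proof -
  have "r k \<otimes> t k \<ominus> r (Suc k) \<otimes> t k = \<ominus> (t k \<otimes> (r (Suc k) \<ominus> r k))"
   using c[of k] c[of "Suc k"] tc[of k] by algebra
  thus ?thesis unfolding rt
   using ideal_uminus[OF Pw_ideal ideal_mult[OF Pw_ideal tc cauchy_Suc[OF r(1)]]] by simp
 qed
 hence "cls r \<otimes>\<^bsub>A\<^esub> cls t = \<one>\<^bsub>A\<^esub>"
  unfolding mult_A[OF r(1) t] one_A using cls_eq[OF cauchy_mult[OF r(1) t] cauchy_const[OF one_closed]] by simp
 thus ?thesis using A.m_comm[OF cls_carr[OF r(1)] cls_carr[OF t]] cls_carr[OF r(1)] cls_carr[OF t] r(2)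
  unfolding Units_def by auto
qed

lemma FA_proper: "FA 1 \<noteq> carrier A"
proof
 interpret A: cring A by (rule cring_A)
 assume "FA 1 = carrier A"
 hence "\<one>\<^bsub>A\<^esub> \<in> FA 1" by simp
 hence "\<one> \<in> M" using iota_FA[OF one_closed, of 1] one_A Pw_1 by (simp add: \<iota>_def)
 thus False using M_unit by blast
qed

lemma parameters_A: "parameters A (\<iota> \<circ> x) n (FA 1)"
proof (intro parameters.intro parameters_axioms.intro)
 show "\<iota> \<circ> x \<in> {..<n} \<rightarrow> carrier A" by (rule iota_x)
qed (use cring_A FA_1 FA_proper FA_local in auto)

text \<open>R/M^m is also the quotient of the completion by \<open>FA m\<close>, so chains above M^m
  lift: \<open>d i\<close> is the preimage of \<open>c i\<close>.\<close>

lemma growth_A: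
 assumes "growth R M k"
 shows "growth A (FA 1) k"
proof -
 interpret A: complete_filtered A FA by (rule complete_A)
 have "chain_above A (FA m) N" if ch: "chain_above R (Pw m) N" for m N
 proof -
  obtain c where c: "\<And>i. i \<le> N ==> ideal (c i) R" "\<And>i. i \<le> N ==> Pw m \<subseteq> c i"
   "\<And>i. i < N ==> c i \<subset> c (Suc i)" using ch unfolding chain_above_def by blast
  define d where "d i = {s. s \<in> carrier A \<and> s m \<subseteq> c i}" for i
  have cls_d: "cls r \<in> d i \<longleftrightarrow> r m \<in> c i" if r: "cauchy r" and i: "i \<le> N" for r i
  proof
   assume "cls r \<in> d i"
   thus "r m \<in> c i" using coset_self[OF cauchy_carr[OF r]] by (auto simp: d_def cls_def)
  next
   assume a: "r m \<in> c i"
   have "Pw m +> r m \<subseteq> c i"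
   proof
    fix b assume "b \<in> Pw m +> r m"
    hence "b \<in> carrier R" "b \<ominus> r m \<in> c i" using coset_mem[OF Pw_ideal] cauchy_carr[OF r] c(2)[OF i] by auto
    thus "b \<in> c i" using ideal_minusE1[OF c(1)[OF i] _ a] by blast
   qed
   thus "cls r \<in> d i" by (simp add: d_def cls_carr[OF r]) (simp add: cls_def)
  qed
  have dI: "ideal (d i) A" if i: "i \<le> N" for i
   unfolding d_def
  proof (rule A.ideal_Collect)
   have "cls (\<lambda>_. \<zero>) \<in> d i" using cls_d[OF cauchy_const[OF zero_closed] i] ideal_zero[OF c(1)[OF i]] by simp
   thus "\<zero>\<^bsub>A\<^esub> \<in> carrier A \<and> \<zero>\<^bsub>A\<^esub> m \<subseteq> c i" by (simp add: zero_A d_def)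
   fix s assume s: "s \<in> carrier A \<and> s m \<subseteq> c i"
   hence sd: "s \<in> d i" by (simp add: d_def)
   obtain r where r: "cauchy r" "s = cls r" by (rule cls_E[OF conjunct1[OF s]])
   have rm: "r m \<in> c i" using sd cls_d[OF r(1) i] r(2) by simp
   show "y \<otimes>\<^bsub>A\<^esub> s \<in> carrier A \<and> (y \<otimes>\<^bsub>A\<^esub> s) m \<subseteq> c i" if y: "y \<in> carrier A" for y
   proof -
    obtain r' where r': "cauchy r'" "y = cls r'" by (rule cls_E[OF y])
    have "r' m \<otimes> r m \<in> c i" by (rule ideal_mult[OF c(1)[OF i] cauchy_carr[OF r'(1)] rm])
    hence "y \<otimes>\<^bsub>A\<^esub> s \<in> d i" using cls_d[OF cauchy_mult[OF r'(1) r(1)] i] by (simp add: r r' mult_A)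
    thus ?thesis by (simp add: d_def)
   qed
   fix t assume t: "t \<in> carrier A \<and> t m \<subseteq> c i"
   hence td: "t \<in> d i" by (simp add: d_def)
   obtain r' where r': "cauchy r'" "t = cls r'" by (rule cls_E[OF conjunct1[OF t]])
   have "r' m \<in> c i" using td cls_d[OF r'(1) i] r'(2) by simp
   hence "r m \<oplus> r' m \<in> c i" by (rule ideal_add[OF c(1)[OF i] rm])
   hence "s \<oplus>\<^bsub>A\<^esub> t \<in> d i" using cls_d[OF cauchy_add[OF r(1) r'(1)] i] by (simp add: r r' add_A)
   thus "s \<oplus>\<^bsub>A\<^esub> t \<in> carrier A \<and> (s \<oplus>\<^bsub>A\<^esub> t) m \<subseteq> c i" by (simp add: d_def)
  qed simp
  have "FA m \<subseteq> d i" if "i \<le> N" for i using c(2)[OF that] by (auto simp: FA_def d_def)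
  moreover have "d i \<subset> d (Suc i)" if i: "i < N" for i
  proof -
   have le: "c i \<subseteq> c (Suc i)" using c(3)[OF i] by blast
   obtain a where a: "a \<in> c (Suc i)" "a \<notin> c i" using c(3)[OF i] by blast
   have ac: "a \<in> carrier R" using a(1) ideal_sub[OF c(1)[of "Suc i"]] i by auto
   have "cls (\<lambda>_. a) \<in> d (Suc i)" "cls (\<lambda>_. a) \<notin> d i" using cls_d[OF cauchy_const[OF ac]] a i by auto
   moreover have "d i \<subseteq> d (Suc i)" using le by (auto simp: d_def)
   ultimately show ?thesis by blast
  qed
  ultimately show ?thesis unfolding chain_above_def using dI by blast
 qed
 thus ?thesis using assms unfolding growth_def FA_power by blast
qed

end

section \<open>Complete regular local rings are Noetherian\<close>

locale complete_regular = regular_parameters R x n M + complete_filtered R "ideal_power R M"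
 for R (structure) and x n M

lemma heavier_upset:
 assumes "\<And>i. i < n ==> (0 :: real) < L i"
 shows "upset n {be \<in> exps n. w < wt n L be}"
 unfolding upset_def
proof (intro conjI ballI impI)
 fix al be assume *: "al \<in> {be \<in> exps n. w < wt n L be}" "be \<in> exps n" "al \<le> be"
 have "wt n L al \<le> wt n L be" using * assms by (intro wt_mono) (auto intro: less_imp_le)
 thus "be \<in> {be \<in> exps n. w < wt n L be}" using * by auto
qed auto

lemma upset_Un: "upset n S ==> upset n T ==> upset n (S \<union> T)"
 by (auto simp: upset_def)

lemma upset_generated: "upset n {be \<in> exps n. \<exists>ta\<in>T. ta \<le> be}"
 unfolding upset_def
proof (intro conjI ballI impI)
 fix al be assume *: "al \<in> {be \<in> exps n. \<exists>ta\<in>T. ta \<le> be}" "be \<in> exps n" "al \<le> be"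
 then obtain ta where "ta \<in> T" "ta \<le> al" by auto
 moreover from this have "ta \<le> be" using *(3) by (meson order_trans)
 ultimately show "be \<in> {be \<in> exps n. \<exists>ta\<in>T. ta \<le> be}" using *(2) by auto
qed auto

lemma wt_less:
 assumes "\<And>i. i < n ==> (0 :: real) < L i" "al \<le> be" "al \<noteq> be" "al \<in> exps n" "be \<in> exps n"
  "inj_on (wt n L) (exps n)"
 shows "wt n L al < wt n L be"
proof -
 have "wt n L al \<le> wt n L be" using assms(1,2) by (intro wt_mono) (auto intro: less_imp_le)
 moreover have "wt n L al \<noteq> wt n L be" using inj_onD[OF assms(6) _ assms(4,5)] assms(3) by blast
 ultimately show ?thesis by simp
qed

context parameters
begin

lemma mI_mult:
 assumes f: "f \<in> mI S" and g: "g \<in> mI T" and U: "\<And>al be. al \<in> S ==> be \<in> T ==> al + be \<in> U"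
 shows "f \<otimes> g \<in> mI U"
proof -
 have gc: "g \<in> carrier R" and fc: "f \<in> carrier R" using f g mI_carr by auto
 have "g \<otimes> f \<in> mI U"
 proof (rule genideal_mult[OF mx_sub f gc mI_ideal])
  fix z assume "z \<in> mx ` S"
  then obtain al where a: "al \<in> S" "z = mx al" by blast
  have "mx al \<otimes> g \<in> mI U"
  proof (rule genideal_mult[OF mx_sub g mx_closed mI_ideal])
   fix y assume "y \<in> mx ` T"
   then obtain be where b: "be \<in> T" "y = mx be" by blast
   show "mx al \<otimes> y \<in> mI U" unfolding b(2) mx_add[symmetric] by (rule mI_memI[OF U[OF a(1) b(1)]])
  qed
  thus "g \<otimes> z \<in> mI U" unfolding a(2) using m_comm[OF gc mx_closed[of al]] by simp
 qed
 thus ?thesis using m_comm[OF fc gc] by simp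
qed

lemma mI_le_power: "(\<And>al. al \<in> S ==> al \<in> exps n \<and> k \<le> tdeg n al) ==> mI S \<subseteq> ideal_power R M k"
 by (rule genideal_minimal[OF ideal_power_ideal[OF M_ideal]]) (use mx_power_M in blast)

end

context complete_regular
begin

text \<open>A standard basis argument as for power series: \<open>T\<close> consists of the minimal
  leading exponents of \<open>I\<close>, and the elements chosen for them generate \<open>I\<close>.
  The division does not stop, so it is cut into portions: \<open>peel\<close> removes all terms of
  weight below \<open>b\<close> in finitely many steps, and completeness sums up the
  portions.\<close>

lemma noetherian: "noetherian_ring R"
proof (rule noetherian_ringI)
 fix I assume I: "ideal I R"
 \<comment> \<open>All variables get weights between 1 and 2, so that weight at least 2j forces
   degree at least j.\<close>
 obtain L :: "nat => real" where L: "\<And>i. 1 < L i" "\<And>i. L i < 1 + 1" "inj_on (wt n L) (exps n)"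
  by (rule generic_weight[of 1 "\<lambda>_. 1" n]) auto
 have Lp: "0 < L i" for i using L(1)[of i] by simp
 let ?w = "wt n L"
 let ?U = "\<lambda>al. {be \<in> exps n. ?w al < ?w be}"
 have Ic: "I \<subseteq> carrier R" by (rule ideal_sub[OF I])
 define E where "E = {al \<in> exps n. \<exists>f\<in>I. \<exists>h\<in>mI (?U al). mx al = f \<oplus> h}"
 have "E \<subseteq> exps n" by (auto simp: E_def)
 then obtain T where T: "finite T" "T \<subseteq> E" "\<And>al. al \<in> E ==> \<exists>ta\<in>T. ta \<le> al"
  using minimal_exps by metis
 have "\<forall>ta\<in>T. \<exists>f. f \<in> I \<and> (\<exists>h\<in>mI (?U ta). mx ta = f \<oplus> h)" using T(2) unfolding E_def by blast
 from bchoice[OF this] obtain f where f': "\<forall>ta\<in>T. f ta \<in> I \<and> (\<exists>h\<in>mI (?U ta). mx ta = f ta \<oplus> h)" by blast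
 hence f: "\<And>ta. ta \<in> T ==> f ta \<in> I" "\<And>ta. ta \<in> T ==> \<exists>h\<in>mI (?U ta). mx ta = f ta \<oplus> h"
  by blast+
 have fT: "f ` T \<subseteq> carrier R" using f(1) Ic by blast
 \<comment> \<open>Multiples of the basis elements, graded by the weight of their leading monomials;
   this keeps track of how deep the coefficients used in a division lie.\<close>
 define G where "G w = Idl {mx ga \<otimes> f ta | ga ta. ga \<in> exps n \<and> ta \<in> T \<and> w \<le> ?w (ga + ta)}" for w
 have Gc: "{mx ga \<otimes> f ta | ga ta. ga \<in> exps n \<and> ta \<in> T \<and> w \<le> ?w (ga + ta)} \<subseteq> carrier R" for w
  using fT by auto
 have Gi: "ideal (G w) R" for w unfolding G_def by (rule genideal_ideal[OF Gc])
 have peel: "\<exists>g'\<in>I. g' \<in> mI {be \<in> exps n. b \<le> ?w be} \<and> g \<ominus> g' \<in> G a"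
  if "g \<in> I" "g \<in> mI S" "S \<subseteq> {be \<in> exps n. a \<le> ?w be}" "\<And>al. al \<in> S ==> ?U al \<subseteq> S" for g S a b
  using that
 proof (induction "card {be \<in> S. ?w be < b}" arbitrary: g S rule: less_induct)
  case less
  have fin: "finite {be \<in> S. ?w be < b}"
   by (rule finite_subset[OF _ finite_exps_wt[of n L b]]) (use less(4) Lp in auto)
  have gc: "g \<in> carrier R" using less(2) Ic by blast
  show ?case
  proof (cases "{be \<in> S. ?w be < b} = {}")
   case True
   hence "S \<subseteq> {be \<in> exps n. b \<le> ?w be}" using less(4) by force
   hence "g \<in> mI {be \<in> exps n. b \<le> ?w be}" using less(3) mI_mono by blast
   moreover have "g \<ominus> g = \<zero>" using gc by algebra
   hence "g \<ominus> g \<in> G a" using ideal_zero[OF Gi] by simp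
   ultimately show ?thesis using less(2) by blast
  next
   case False
   have Se: "S \<subseteq> exps n" using less(4) by auto
   obtain al where aS: "al \<in> S" and amin: "\<And>be. be \<in> S ==> be \<noteq> al ==> ?w al < ?w be"
    using least_exp[OF Lp L(3) Se] False by blast
   have ab: "?w al < b" using False amin by (metis (mono_tags, lifting) Collect_empty_eq less_trans)
   have ae: "al \<in> exps n" using aS Se by blast
   have S': "S - {al} = ?U al" using amin less(5)[OF aS] Se by auto
   have "insert al (?U al) = S" using S' aS by blast
   hence "g \<in> mI (insert al (?U al))" using less(3) by simp
   then obtain c h where ch: "c \<in> carrier R" "h \<in> mI (?U al)" "g = c \<otimes> mx al \<oplus> h"
    unfolding mI_insert by blast
   have hc: "h \<in> carrier R" using ch(2) by (rule mI_carr)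
   have "card {be \<in> ?U al. ?w be < b} < card {be \<in> S. ?w be < b}"
    using aS ab fin unfolding S'[symmetric] by (intro psubset_card_mono) auto
   note IH = less(1)[OF this]
   have Ua: "?U al \<subseteq> {be \<in> exps n. a \<le> ?w be}" using S' less(4) by blast
   have UU: "?U be \<subseteq> ?U al" if "be \<in> ?U al" for be using that by auto
   show ?thesis
   proof (cases "c \<in> M")
    case True
    have "c \<otimes> mx al \<in> mI (?U al)" by (rule mult_M_mI[OF True]) (use ae Lp in auto)
    hence "g \<in> mI (?U al)" unfolding ch(3) by (rule ideal_add[OF mI_ideal _ ch(2)])
    thus ?thesis using IH[OF less(2) _ Ua UU] by blast
   next
    case False
    hence u: "c \<in> Units R" using ch M_local by blast
    have ic: "inv c \<in> carrier R" using u by simp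
    have "mx al = inv c \<otimes> g \<oplus> (\<ominus> (inv c \<otimes> h))"
    proof -
     have "inv c \<otimes> g = (inv c \<otimes> c) \<otimes> mx al \<oplus> inv c \<otimes> h"
      unfolding ch(3) using ic ch(1) hc mx_closed[of al] by algebra
     hence "inv c \<otimes> g = mx al \<oplus> inv c \<otimes> h" using u by simp
     thus ?thesis using ic hc mx_closed[of al] by algebra
    qed
    moreover have "inv c \<otimes> g \<in> I" by (rule ideal_mult[OF I ic less(2)])
    moreover have "\<ominus> (inv c \<otimes> h) \<in> mI (?U al)"
     by (rule ideal_uminus[OF mI_ideal ideal_mult[OF mI_ideal ic ch(2)]])
    \<comment> \<open>With a unit coefficient, \<open>al\<close> is a leading exponent of
      \<open>I\<close>. It is therefore above some \<open>ta\<close> in \<open>T\<close>, and a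
      multiple of \<open>f ta\<close> cancels the term up to heavier ones.\<close>
    ultimately have "al \<in> E" using ae unfolding E_def by blast
    then obtain ta where t: "ta \<in> T" "ta \<le> al" using T(3) by blast
    obtain k where k: "k \<in> mI (?U ta)" "mx ta = f ta \<oplus> k" using f(2)[OF t(1)] by blast
    have kc: "k \<in> carrier R" using k(1) by (rule mI_carr)
    have fc: "f ta \<in> carrier R" using f(1)[OF t(1)] Ic by blast
    have e: "(al - ta) + ta = al" using exp_diff_add[OF t(2)] by (simp add: add.commute)
    define q where "q = c \<otimes> (mx (al - ta) \<otimes> f ta)"
    have qI: "q \<in> I" unfolding q_def
     by (rule ideal_mult[OF I ch(1) ideal_mult[OF I mx_closed f(1)[OF t(1)]]])
    have qG: "q \<in> G a"
    proof -
     have "mx (al - ta) \<otimes> f ta \<in> {mx ga \<otimes> f ta | ga ta. ga \<in> exps n \<and> ta \<in> T \<and> a \<le> ?w (ga + ta)}"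
     proof -
      have "a \<le> ?w ((al - ta) + ta)" unfolding e using aS less(4) by auto
      thus ?thesis using ae t(1) exps_diff by blast
     qed
     hence "mx (al - ta) \<otimes> f ta \<in> G a" unfolding G_def using genideal_self[OF Gc] by blast
     thus ?thesis unfolding q_def by (rule ideal_mult[OF Gi ch(1)])
    qed
    have qc: "q \<in> carrier R" using qI Ic by blast
    have "mx (al - ta) \<otimes> k \<in> mI (?U al)"
    proof (rule mI_mult[OF mI_memI[of _ "{al - ta}"] k(1)])
     fix ga be assume gb: "ga \<in> {al - ta}" "be \<in> ?U ta"
     have "?w al = ?w (al - ta) + ?w ta" using arg_cong[OF e, of ?w] by simp
     thus "ga + be \<in> ?U al" using gb ae by simp
    qed simp
    hence ck: "c \<otimes> (mx (al - ta) \<otimes> k) \<in> mI (?U al)" by (rule ideal_mult[OF mI_ideal ch(1)])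
    have "g \<ominus> q = h \<oplus> c \<otimes> (mx (al - ta) \<otimes> k)"
    proof -
     have "mx al = mx (al - ta) \<otimes> mx ta" by (rule mon_le[OF x_closed t(2)])
     hence "mx al = mx (al - ta) \<otimes> (f ta \<oplus> k)" using k(2) by simp
     thus ?thesis unfolding ch(3) q_def using ch(1) hc fc kc mx_closed[of "al - ta"] by algebra
    qed
    hence "g \<ominus> q \<in> mI (?U al)" using ideal_add[OF mI_ideal ch(2) ck] by simp
    then obtain g' where g': "g' \<in> I" "g' \<in> mI {be \<in> exps n. b \<le> ?w be}" "(g \<ominus> q) \<ominus> g' \<in> G a"
     using IH[OF ideal_minus[OF I less(2) qI] _ Ua UU] by blast
    have g'c: "g' \<in> carrier R" using g'(1) Ic by blast
    have "g \<ominus> g' = ((g \<ominus> q) \<ominus> g') \<oplus> q" using gc qc g'c by algebra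
    hence "g \<ominus> g' \<in> G a" using ideal_add[OF Gi g'(3) qG] by simp
    thus ?thesis using g' by blast
   qed
  qed
 qed
 have peel': "\<exists>g'. g' \<in> I \<and> g' \<in> mI {be \<in> exps n. b \<le> ?w be} \<and> g \<ominus> g' \<in> G a"
  if "g \<in> I" "g \<in> mI {be \<in> exps n. a \<le> ?w be}" for g a b
  using peel[OF that order_refl] by force
 \<comment> \<open>If \<open>ga + ta\<close> has weight at least 2(c + j), then \<open>ga\<close>
   keeps weight at least 2j, so that \<open>mx ga\<close> lies in M^j.\<close>
 obtain c :: nat where c: "\<And>ta. ta \<in> T ==> ?w ta \<le> 2 * real c"
 proof -
  obtain c :: nat where c: "Max (insert 0 (?w ` T)) \<le> real c" using real_arch_simple by blast
  have "?w ta \<le> Max (insert 0 (?w ` T))" if "ta \<in> T" for ta using T(1) that by (intro Max_ge) auto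
  hence "?w ta \<le> 2 * real c" if "ta \<in> T" for ta using c that by fastforce
  thus thesis using that by blast
 qed
 have "I = Idl (f ` T)"
 proof
  show "Idl (f ` T) \<subseteq> I" by (rule genideal_minimal[OF I]) (use f(1) in blast)
  have GT: "G a \<subseteq> Idl (f ` T)" for a
   unfolding G_def
  proof (rule genideal_minimal[OF genideal_ideal[OF fT]], rule subsetI)
   fix z assume "z \<in> {mx ga \<otimes> f ta | ga ta. ga \<in> exps n \<and> ta \<in> T \<and> a \<le> ?w (ga + ta)}"
   then obtain ga ta where z: "ta \<in> T" "z = mx ga \<otimes> f ta" by blast
   have "f ta \<in> Idl (f ` T)" using genideal_self[OF fT] z(1) by blast
   thus "z \<in> Idl (f ` T)" unfolding z(2) by (rule ideal_mult[OF genideal_ideal[OF fT] mx_closed])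
  qed
  show "I \<subseteq> Idl (f ` T)"
  proof
   fix g assume g: "g \<in> I"
   have "\<one> \<in> mI {be \<in> exps n. 0 \<le> ?w be}" using mI_memI[of 0 "{be \<in> exps n. 0 \<le> ?w be}"] by simp
   hence "mI {be \<in> exps n. 0 \<le> ?w be} = carrier R" by (rule ideal.one_imp_carrier[OF mI_ideal])
   hence "g \<in> mI {be \<in> exps n. 0 \<le> ?w be}" using g Ic by blast
   then obtain g0 where g0: "g0 \<in> I" "g0 \<in> mI {be \<in> exps n. 2 * real c \<le> ?w be}" "g \<ominus> g0 \<in> G 0"
    using peel'[OF g] by blast
   define P where "P j g' \<longleftrightarrow> g' \<in> I \<and> g' \<in> mI {be \<in> exps n. 2 * real (c + j) \<le> ?w be}" for j g'
   have ex: "\<exists>g'. P (Suc j) g' \<and> h \<ominus> g' \<in> G (2 * real (c + j))" if "P j h" for j h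
    using peel'[of h "2 * real (c + j)" "2 * real (c + Suc j)"] that unfolding P_def by blast
   define s where "s = rec_nat g0 (\<lambda>j h. SOME g'. P (Suc j) g' \<and> h \<ominus> g' \<in> G (2 * real (c + j)))"
   have s0: "s 0 = g0" and sS: "s (Suc j) = (SOME g'. P (Suc j) g' \<and> s j \<ominus> g' \<in> G (2 * real (c + j)))" for j
    by (simp_all add: s_def)
   have Ps: "P j (s j)" for j
   proof (induction j)
    case 0
    show ?case using g0 by (simp add: s0 P_def)
   next
    case (Suc j)
    show ?case unfolding sS using someI_ex[OF ex[OF Suc]] by blast
   qed
   have diff: "s j \<ominus> s (Suc j) \<in> G (2 * real (c + j))" for j
    unfolding sS using someI_ex[OF ex[OF Ps]] by blast
   have deg: "j \<le> tdeg n ga" if "2 * real j \<le> ?w ga" for j ga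
   proof -
    have "?w ga \<le> 2 * real (tdeg n ga)" using L(2) by (intro wt_tdeg_upper) (simp add: less_imp_le)
    thus ?thesis using that by linarith
   qed
   have "s 0 \<in> Idl (f ` T)"
   proof (rule limit_mem_genideal)
    show "finite (f ` T)" using T(1) by simp
    show "f ` T \<subseteq> carrier R" by (rule fT)
    show "s j \<in> ideal_power R M j" for j
    proof -
     have "mI {be \<in> exps n. 2 * real (c + j) \<le> ?w be} \<subseteq> ideal_power R M j"
      by (rule mI_le_power) (use deg in auto)
     thus ?thesis using Ps[of j] unfolding P_def by blast
    qed
    fix j
    have "G (2 * real (c + j)) \<subseteq> FT j (f ` T)"
     unfolding G_def
    proof (rule genideal_minimal[OF FT_ideal[OF fT]], rule subsetI)
     fix z assume "z \<in> {mx ga \<otimes> f ta | ga ta. ga \<in> exps n \<and> ta \<in> T \<and> 2 * real (c + j) \<le> ?w (ga + ta)}"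
     then obtain ga ta where z: "ga \<in> exps n" "ta \<in> T" "2 * real (c + j) \<le> ?w (ga + ta)" "z = mx ga \<otimes> f ta" by blast
     have "2 * real j \<le> ?w ga" using z(3) c[OF z(2)] by simp
     hence "mx ga \<in> ideal_power R M j" using deg z(1) by (intro mx_power_M) auto
     thus "z \<in> FT j (f ` T)" unfolding z(4) using z(2) by (intro FT_memI[OF fT]) auto
    qed
    thus "s j \<ominus> s (Suc j) \<in> FT j (f ` T)" using diff by blast
   qed
   hence "g0 \<in> Idl (f ` T)" using s0 by simp
   moreover have "g \<ominus> g0 \<in> Idl (f ` T)" using g0(3) GT by blast
   ultimately show "g \<in> Idl (f ` T)" using ideal_minusE1[OF genideal_ideal[OF fT]] g Ic by blast
  qed
 qed
 thus "\<exists>A\<subseteq>carrier R. finite A \<and> I = Idl A" using fT T(1) by blast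
qed

end

section \<open>Finite expansions\<close>

context cring
begin

lemma noetherian_maximal:
 assumes noeth: "noetherian_ring R" and C: "C \<noteq> {}" "\<And>I. I \<in> C ==> ideal I R"
 shows "\<exists>I\<in>C. \<forall>J\<in>C. \<not> I \<subset> J"
proof (rule ccontr)
 assume "\<not> ?thesis"
 hence ex: "\<exists>J. J \<in> C \<and> I \<subset> J" if "I \<in> C" for I using that by blast
 obtain I0 where I0: "I0 \<in> C" using C(1) by blast
 define f where "f = rec_nat I0 (\<lambda>_ I. SOME J. J \<in> C \<and> I \<subset> J)"
 have f0: "f 0 = I0" and fS: "f (Suc k) = (SOME J. J \<in> C \<and> f k \<subset> J)" for k by (simp_all add: f_def)
 have fC: "f k \<in> C" for k
 proof (induction k)
  case 0
  show ?case using I0 f0 by simp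
 next
  case (Suc k)
  show ?case unfolding fS using someI_ex[OF ex[OF Suc]] by blast
 qed
 have "f k \<subset> f (Suc k)" for k unfolding fS using someI_ex[OF ex[OF fC]] by blast
 thus False by (rule noetherian_no_ascending[OF noeth C(2)[OF fC]])
qed

lemma ideal_finsum:
 assumes I: "ideal I R" and "\<And>i. i \<in> T ==> h i \<in> I"
 shows "(\<Oplus>i\<in>T. h i) \<in> I"
proof (cases "finite T")
 case True
 thus ?thesis using assms(2)
 proof (induction T rule: finite_induct)
  case empty
  thus ?case using ideal_zero[OF I] by simp
 next
  case (insert i T)
  have "h \<in> T \<rightarrow> carrier R" "h i \<in> carrier R" using insert.prems ideal_sub[OF I] by auto
  hence "(\<Oplus>i\<in>insert i T. h i) = h i \<oplus> (\<Oplus>i\<in>T. h i)" using insert.hyps by simp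
  thus ?case using ideal_add[OF I] insert by simp
 qed
next
 case False
 thus ?thesis using ideal_zero[OF I] by (simp add: finsum_infinite)
qed

lemma genideal_finite_finsum:
 assumes "finite T" "m \<in> T \<rightarrow> carrier R" "f \<in> Idl (m ` T)"
 shows "\<exists>g\<in>T \<rightarrow> carrier R. f = (\<Oplus>t\<in>T. g t \<otimes> m t)"
 using assms
proof (induction T arbitrary: f rule: finite_induct)
 case empty
 thus ?case by (simp add: genideal_empty)
next
 case (insert t T)
 have mt: "m t \<in> carrier R" and mT: "m \<in> T \<rightarrow> carrier R" using insert.prems(1) by auto
 have mT': "m ` T \<subseteq> carrier R" using mT by auto
 have "f \<in> Idl (insert (m t) (m ` T))" using insert.prems(2) by simp
 then obtain a h where ah: "a \<in> carrier R" "h \<in> Idl (m ` T)" "f = a \<otimes> m t \<oplus> h"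
  using genideal_insert[OF mt mT'] by metis
 obtain g where g: "g \<in> T \<rightarrow> carrier R" "h = (\<Oplus>t\<in>T. g t \<otimes> m t)" using insert.IH[OF mT ah(2)] by blast
 let ?g = "g(t := a)"
 have "?g \<in> insert t T \<rightarrow> carrier R" using g(1) ah(1) by auto
 moreover have "(\<Oplus>s\<in>insert t T. ?g s \<otimes> m s) = ?g t \<otimes> m t \<oplus> (\<Oplus>s\<in>T. ?g s \<otimes> m s)"
  using insert.hyps mt mT g(1) ah(1) by (intro finsum_insert) (auto simp: Pi_def)
 moreover have "(\<Oplus>s\<in>T. ?g s \<otimes> m s) = (\<Oplus>s\<in>T. g s \<otimes> m s)"
  using insert.hyps mT g(1) by (intro finsum_cong') (auto simp: Pi_def)
 ultimately show ?case using ah(3) g(2) by (intro bexI[of _ ?g]) auto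
qed

lemma finsum_remove:
 assumes "finite T" "t \<in> T" "h \<in> T \<rightarrow> carrier R"
 shows "(\<Oplus>i\<in>T. h i) = h t \<oplus> (\<Oplus>i\<in>T - {t}. h i)"
proof -
 have "(\<Oplus>i\<in>insert t (T - {t}). h i) = h t \<oplus> (\<Oplus>i\<in>T - {t}. h i)"
  using assms by (intro finsum_insert) auto
 thus ?thesis using insert_Diff[OF assms(2)] by simp
qed

end

context regular_parameters
begin

definition expansion :: "'a => (nat => nat) set => ((nat => nat) => 'a) => bool" where
 "expansion f T g \<longleftrightarrow> finite T \<and> T \<subseteq> exps n \<and> g \<in> T \<rightarrow> Units R \<and> f = (\<Oplus>ta\<in>T. g ta \<otimes> mx ta)"

lemma expansion_remove:
 assumes "expansion f T g" "ta \<in> T"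
 shows "\<exists>h\<in>mI (T - {ta}). f = g ta \<otimes> mx ta \<oplus> h"
proof -
 have g: "finite T" "g \<in> T \<rightarrow> Units R" "f = (\<Oplus>ta\<in>T. g ta \<otimes> mx ta)" using assms by (auto simp: expansion_def)
 hence gc: "g i \<in> carrier R" if "i \<in> T" for i using that by (auto simp: Pi_def intro: Units_closed)
 have "f = g ta \<otimes> mx ta \<oplus> (\<Oplus>ta\<in>T - {ta}. g ta \<otimes> mx ta)"
  unfolding g(3) using gc by (intro finsum_remove[OF g(1) assms(2)]) auto
 moreover have "(\<Oplus>ta\<in>T - {ta}. g ta \<otimes> mx ta) \<in> mI (T - {ta})"
  using gc by (intro ideal_finsum[OF mI_ideal] ideal_mult[OF mI_ideal] mI_memI) auto
 ultimately show ?thesis by blast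
qed

text \<open>Take the lightest exponent \<open>al\<close> of the expansion outside \<open>S\<close>.
  All other exponents lie in the up-closed set generated by \<open>S\<close> and the remaining ones
  outside \<open>S\<close>. This set omits \<open>al\<close>, because an exponent below
  \<open>al\<close> is lighter. A unit multiple of \<open>mx al\<close> would then lie in the ideal
  of that set, against \<open>monomial_not_mem\<close>. In particular, any one expansion of f tells
  which monomial ideals contain f.\<close>

lemma expansion_mem_iff:
 assumes e: "expansion f T g" and S: "upset n S"
 shows "f \<in> mI S \<longleftrightarrow> T \<subseteq> S"
proof
 have g: "finite T" "T \<subseteq> exps n" "g \<in> T \<rightarrow> Units R" "f = (\<Oplus>ta\<in>T. g ta \<otimes> mx ta)" using e by (auto simp: expansion_def)
 show "f \<in> mI S" if "T \<subseteq> S"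
  unfolding g(4) using that g(3)
  by (intro ideal_finsum[OF mI_ideal] ideal_mult[OF mI_ideal] mI_memI) (auto simp: Pi_def intro: Units_closed)
 show "T \<subseteq> S" if f: "f \<in> mI S"
 proof (rule ccontr)
  assume "\<not> T \<subseteq> S"
  hence ne: "T - S \<noteq> {}" by blast
  obtain L where L: "\<And>i. 0 < L i" "inj_on (wt n L) (exps n)" using positive_generic_weight by blast
  have "T - S \<subseteq> exps n" using g(2) by blast
  then obtain al where a: "al \<in> T" "al \<notin> S" and amin: "\<And>be. be \<in> T - S ==> be \<noteq> al ==> wt n L al < wt n L be"
   using least_exp[OF L(1,2) _ ne] by blast
  have ae: "al \<in> exps n" using a g(2) by blast
  let ?S' = "S \<union> {be \<in> exps n. \<exists>ta\<in>T - S - {al}. ta \<le> be}"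
  have up: "upset n ?S'" by (rule upset_Un[OF S upset_generated])
  have an: "al \<notin> ?S'"
  proof
   assume "al \<in> ?S'"
   then obtain ta where t: "ta \<in> T - S" "ta \<noteq> al" "ta \<le> al" using a by auto
   hence "wt n L ta < wt n L al" using wt_less[OF L(1) t(3,2) _ ae L(2)] g(2) by blast
   thus False using amin[OF t(1,2)] by simp
  qed
  obtain h where h: "h \<in> mI (T - {al})" "f = g al \<otimes> mx al \<oplus> h" using expansion_remove[OF e a(1)] by blast
  have "T - {al} \<subseteq> ?S'" using g(2) by auto
  hence h': "h \<in> mI ?S'" using h(1) mI_mono by blast
  have ga: "g al \<in> Units R" using g(3) a(1) by auto
  have "f \<in> mI ?S'" using f mI_mono[of S ?S'] by blast
  hence fh: "g al \<otimes> mx al \<oplus> h \<in> mI ?S'" using h(2) by simp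
  have "g al \<otimes> mx al \<in> carrier R" using Units_closed[OF ga] by simp
  hence "g al \<otimes> mx al \<in> mI ?S'" by (rule ideal_addE1[OF mI_ideal fh h'])
  hence "mx al \<in> mI ?S'" by (rule unit_cancel[OF ga mx_closed mI_ideal])
  thus False using monomial_not_mem[OF up ae an] by blast
 qed
qed

text \<open>The ideals of the monomials not dividing \<open>mx al\<close>, for \<open>al\<close> in
  a finite down-closed set \<open>D\<close>, intersect in the ideal of the monomials outside
  \<open>D\<close>. Induction removes a maximal \<open>al\<close> from \<open>D\<close>: the
  coefficient of \<open>mx al\<close> is no unit by \<open>monomial_not_mem\<close>, and proper
  multiples of \<open>mx al\<close> have exponents outside \<open>D\<close> by maximality.\<close>

lemma mem_mI_complement:
 assumes f: "f \<in> carrier R" and D: "finite D" "D \<subseteq> exps n"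
  and down: "\<And>al be. al \<in> D ==> be \<in> exps n ==> be \<le> al ==> be \<in> D"
  and mem: "\<And>al. al \<in> D ==> f \<in> mI {be \<in> exps n. \<not> be \<le> al}"
 shows "f \<in> mI (exps n - D)"
 using D down mem
proof (induction D rule: finite_psubset_induct)
 case (psubset D)
 show ?case
 proof (cases "D = {}")
  case True
  have "mI (exps n) = carrier R" using mI_memI[of 0 "exps n"] by (intro ideal.one_imp_carrier[OF mI_ideal]) simp
  thus ?thesis using True f by simp
 next
  case False
  then obtain al where a: "al \<in> D" "\<And>be. be \<in> D ==> al \<le> be ==> al = be" using finite_has_maximal[OF psubset(1)] by metis
  let ?N = "{be \<in> exps n. \<not> be \<le> al}"
  have ae: "al \<in> exps n" using a(1) psubset(3) by blast
  have eq: "exps n - (D - {al}) = insert al (exps n - D)" using ae by blast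
  have "f \<in> mI (exps n - (D - {al}))"
  proof (rule psubset(2))
   show "D - {al} \<subset> D" using a(1) by blast
   show "ga \<in> D - {al}" if "be \<in> D - {al}" "ga \<in> exps n" "ga \<le> be" for be ga
    using that psubset(4)[of be ga] a(2)[of be] by blast
  qed (use psubset(3,5) in auto)
  then obtain c h where ch: "c \<in> carrier R" "h \<in> mI (exps n - D)" "f = c \<otimes> mx al \<oplus> h" unfolding eq mI_insert by blast
  have "c \<in> M"
  proof (rule ccontr)
   assume "c \<notin> M"
   hence u: "c \<in> Units R" by (rule M_local[OF ch(1)])
   have "h \<in> mI ?N" using ch(2) mI_mono[of "exps n - D" ?N] psubset(4)[OF a(1)] by blast
   moreover have "c \<otimes> mx al \<oplus> h \<in> mI ?N" using psubset(5)[OF a(1)] ch(3) by simp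
   ultimately have "c \<otimes> mx al \<in> mI ?N" using ideal_addE1[OF mI_ideal] ch(1) by simp
   hence "mx al \<in> mI ?N" by (rule unit_cancel[OF u mx_closed mI_ideal])
   moreover have "upset n ?N" unfolding upset_def by (auto intro: order_trans)
   ultimately show False using monomial_not_mem ae by blast
  qed
  hence "c \<otimes> mx al \<in> mI (exps n - D)"
  proof (rule mult_M_mI)
   fix i assume i: "i < n"
   have "al \<le> unit_exp i + al" "al \<noteq> unit_exp i + al" by (auto simp: le_fun_def plus_fun_apply unit_exp_def fun_eq_iff)
   moreover have "unit_exp i + al \<in> exps n" using i ae by auto
   ultimately show "unit_exp i + al \<in> exps n - D" using a(2) by blast
  qed
  thus ?thesis unfolding ch(3) by (rule ideal_add[OF mI_ideal _ ch(2)])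
 qed
qed

text \<open>The exponents of the expansion are the minimal \<open>al\<close> for which \<open>f\<close> is not generated by the
 monomials not dividing \<open>mx al\<close>; this makes every coefficient a unit.\<close>

theorem expansion_exists:
 assumes noeth: "noetherian_ring R" and f: "f \<in> carrier R"
 shows "\<exists>T g. expansion f T g"
proof -
 let ?N = "\<lambda>al. {be \<in> exps n. \<not> be \<le> al}"
 define E where "E = {al \<in> exps n. f \<notin> mI (?N al)}"
 have E: "be \<in> E" if "al \<in> E" "be \<in> exps n" "al \<le> be" for al be
  using that mI_mono[of "?N be" "?N al"] unfolding E_def by (auto dest: order_trans)
 have "E \<subseteq> exps n" by (auto simp: E_def)
 then obtain T where T: "finite T" "T \<subseteq> E" "\<And>al. al \<in> E ==> \<exists>ta\<in>T. ta \<le> al" "\<And>\<sigma> ta. \<sigma> \<in> T ==> ta \<in> T ==> \<sigma> \<le> ta ==> \<sigma> = ta"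
  using minimal_exps by metis
 have Te: "T \<subseteq> exps n" using T(2) by (auto simp: E_def)
 \<comment> \<open>By Krull's intersection theorem it suffices to argue modulo every M^m, where only
   finitely many exponents remain.\<close>
 have "f \<in> mI T"
 proof (rule krull_intersection[OF noeth mI_ideal f])
  fix m
  let ?D = "{al \<in> exps n. tdeg n al < m} - E" and ?I = "mI T \<union> ideal_power R M m"
  have I: "?I \<subseteq> carrier R" using mI_carr ideal_sub[OF ideal_power_ideal[OF M_ideal]] by blast
  have "f \<in> mI (exps n - ?D)"
  proof (rule mem_mI_complement[OF f])
   show "be \<in> ?D" if "al \<in> ?D" "be \<in> exps n" "be \<le> al" for al be
    using that E[of be al] tdeg_mono[OF that(3), of n] by auto
  qed (use finite_exps_tdeg in \<open>auto simp: E_def\<close>)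
  moreover have "mx ` (exps n - ?D) \<subseteq> Idl ?I"
  proof (rule image_subsetI)
   fix be assume b: "be \<in> exps n - ?D"
   have "mx be \<in> ?I"
   proof (cases "be \<in> E")
    case True
    thus ?thesis using T(3) mI_memI' by blast
   next
    case False
    thus ?thesis using b mx_power_M[of be m] by auto
   qed
   thus "mx be \<in> Idl ?I" using genideal_self[OF I] by blast
  qed
  ultimately show "f \<in> Idl ?I" using genideal_minimal[OF genideal_ideal[OF I]] by blast
 qed
 then obtain g where g: "g \<in> T \<rightarrow> carrier R" "f = (\<Oplus>ta\<in>T. g ta \<otimes> mx ta)"
  using genideal_finite_finsum[OF T(1), of mx f] by auto
 \<comment> \<open>A coefficient in \<open>M\<close> would move its term to monomials not dividing
   \<open>mx ta\<close>. The other terms are there already, as \<open>T\<close> is an antichain, and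
   \<open>ta\<close> would not belong to \<open>E\<close>.\<close>
 have "g ta \<in> Units R" if t: "ta \<in> T" for ta
 proof (rule ccontr)
  assume "g ta \<notin> Units R"
  hence gM: "g ta \<in> M" using M_local g(1) t by blast
  have te: "ta \<in> exps n" using t Te by blast
  have "g ta \<otimes> mx ta \<in> mI (?N ta)"
  proof (rule mult_M_mI[OF gM])
   fix i assume "i < n"
   moreover have "\<not> unit_exp i + ta \<le> ta" by (auto simp: le_fun_def plus_fun_apply unit_exp_def)
   ultimately show "unit_exp i + ta \<in> ?N ta" using te by simp
  qed
  moreover have "(\<Oplus>\<sigma>\<in>T - {ta}. g \<sigma> \<otimes> mx \<sigma>) \<in> mI (?N ta)"
   using g(1) T(4)[OF _ t] Te by (intro ideal_finsum[OF mI_ideal] ideal_mult[OF mI_ideal] mI_memI) auto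
  moreover have "f = g ta \<otimes> mx ta \<oplus> (\<Oplus>\<sigma>\<in>T - {ta}. g \<sigma> \<otimes> mx \<sigma>)"
   unfolding g(2) using g(1) by (intro finsum_remove[OF T(1) t]) auto
  ultimately have "f \<in> mI (?N ta)" using ideal_add[OF mI_ideal, of "g ta \<otimes> mx ta"] by simp
  thus False using t T(2) by (auto simp: E_def)
 qed
 thus ?thesis using g(2) T(1) Te unfolding expansion_def by blast
qed

section \<open>Krull dimension\<close>

text \<open>Modulo the ideal, an element outside it has a leading term with unit coefficient, whose
  exponent vanishes in the first k coordinates. The exponents of two leading terms add up to an
  exponent of the same kind that is not heavier than their sum, so by
  \<open>monomial_not_mem\<close> the product stays outside.\<close>

lemma coordinate_prime:
 assumes noeth: "noetherian_ring R" and k: "k \<le> n"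
 shows "primeideal (Idl (x ` {..<k})) R"
proof -
 let ?V = "{al \<in> exps n. \<exists>i<k. 0 < al i}"
 obtain L where L: "\<And>i. 0 < L i" "inj_on (wt n L) (exps n)" using positive_generic_weight by blast
 let ?w = "wt n L"
 let ?U = "\<lambda>al. {be \<in> exps n. ?w al < ?w be}"
 have xk: "x ` {..<k} \<subseteq> carrier R" using x_image k by auto
 have V: "upset n ?V" unfolding upset_def by (auto simp: le_fun_def) (meson less_le_trans)
 have eq: "Idl (x ` {..<k}) = mI ?V"
 proof
  show "Idl (x ` {..<k}) \<subseteq> mI ?V"
  proof (rule genideal_minimal[OF mI_ideal], rule image_subsetI)
   fix i assume i: "i \<in> {..<k}"
   have "mx (unit_exp i) \<in> mI ?V" using i k by (intro mI_memI) (auto simp: unit_exp_def exps_def)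
   thus "x i \<in> mI ?V" using mon_unit[OF x_closed, of i] i k by simp
  qed
  show "mI ?V \<subseteq> Idl (x ` {..<k})"
  proof (rule genideal_minimal[OF genideal_ideal[OF xk]], rule image_subsetI)
   fix al assume "al \<in> ?V"
   then obtain i where i: "i < k" "0 < al i" by blast
   have "unit_exp i \<le> al" using i by (auto simp: le_fun_def unit_exp_def)
   hence "mx al = mx (al - unit_exp i) \<otimes> x i" using mon_le[OF x_closed] mon_unit[OF x_closed, of i] i k by simp
   moreover have "x i \<in> Idl (x ` {..<k})" using genideal_self[OF xk] i by blast
   ultimately show "mx al \<in> Idl (x ` {..<k})" using ideal_mult[OF genideal_ideal[OF xk] mx_closed] by simp
  qed
 qed
 show ?thesis
 proof (rule primeidealI[OF genideal_ideal[OF xk] cring_axioms])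
  show "carrier R \<noteq> Idl (x ` {..<k})"
  proof
   assume "carrier R = Idl (x ` {..<k})"
   hence "mx 0 \<in> mI ?V" unfolding eq by (metis mx_closed)
   thus False using monomial_not_mem[OF V exps_zero] by auto
  qed
  fix a b assume ab: "a \<in> carrier R" "b \<in> carrier R" "a \<otimes> b \<in> Idl (x ` {..<k})"
  show "a \<in> Idl (x ` {..<k}) \<or> b \<in> Idl (x ` {..<k})"
  proof (rule ccontr)
   assume "\<not> ?thesis"
   hence n: "a \<notin> mI ?V" "b \<notin> mI ?V" using eq by auto
   have lead: "\<exists>al\<in>exps n. al \<notin> ?V \<and> (\<exists>g\<in>Units R. \<exists>h\<in>mI (?V \<union> ?U al). f = g \<otimes> mx al \<oplus> h)"
    if f: "f \<in> carrier R" "f \<notin> mI ?V" for f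
   proof -
    obtain T g where e: "expansion f T g" using expansion_exists[OF noeth f(1)] by blast
    hence T: "finite T" "T \<subseteq> exps n" "g \<in> T \<rightarrow> Units R" by (auto simp: expansion_def)
    have ne: "T - ?V \<noteq> {}" using f(2) expansion_mem_iff[OF e V] by blast
    have "T - ?V \<subseteq> exps n" using T(2) by blast
    then obtain al where a: "al \<in> T - ?V" "\<And>be. be \<in> T - ?V ==> be \<noteq> al ==> ?w al < ?w be"
     using least_exp[OF L(1,2) _ ne] by blast
    have ae: "al \<in> exps n" using a T(2) by blast
    have "T - {al} \<subseteq> ?V \<union> ?U al" using a(2) T(2) by blast
    hence "mI (T - {al}) \<subseteq> mI (?V \<union> ?U al)" by (rule mI_mono)
    moreover obtain h where "h \<in> mI (T - {al})" "f = g al \<otimes> mx al \<oplus> h"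
     using expansion_remove[OF e, of al] a(1) by blast
    moreover have "g al \<in> Units R" using T(3) a(1) by auto
    ultimately show ?thesis using a(1) ae by blast
   qed
   obtain al g h where A: "al \<in> exps n" "al \<notin> ?V" "g \<in> Units R" "h \<in> mI (?V \<union> ?U al)" "a = g \<otimes> mx al \<oplus> h"
    using lead[OF ab(1) n(1)] by blast
   obtain be g' h' where B: "be \<in> exps n" "be \<notin> ?V" "g' \<in> Units R" "h' \<in> mI (?V \<union> ?U be)" "b = g' \<otimes> mx be \<oplus> h'"
    using lead[OF ab(2) n(2)] by blast
   let ?S = "?V \<union> ?U (al + be)"
   have Vadd: "ga + \<delta> \<in> ?V" "\<delta> + ga \<in> ?V" if "ga \<in> ?V" "\<delta> \<in> exps n" for ga \<delta>
    using that by (auto simp: plus_fun_apply exps_def)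
   have c: "g \<in> carrier R" "g' \<in> carrier R" "h \<in> carrier R" "h' \<in> carrier R"
    using A B mI_carr Units_closed by auto
   have "mx al \<otimes> h' \<in> mI ?S"
   proof (rule mI_mult[OF mI_memI[of al "{al}"] B(4)])
    fix ga \<delta> assume gd: "ga \<in> {al}" "\<delta> \<in> ?V \<union> ?U be"
    show "ga + \<delta> \<in> ?S"
    proof (cases "\<delta> \<in> ?V")
     case True
     thus ?thesis using Vadd(2)[OF True] gd A(1) by blast
    next
     case False
     hence "\<delta> \<in> ?U be" using gd(2) by blast
     hence "al + \<delta> \<in> ?U (al + be)" using A(1) by simp
     thus ?thesis using gd(1) by blast
    qed
   qed simp
   hence 1: "g \<otimes> (mx al \<otimes> h') \<in> mI ?S" by (rule ideal_mult[OF mI_ideal c(1)])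
   have "b \<in> mI (insert be (?V \<union> ?U be))" unfolding mI_insert using B c by blast
   hence 2: "h \<otimes> b \<in> mI ?S"
   proof (rule mI_mult[OF A(4)])
    fix ga \<delta> assume gd: "ga \<in> ?V \<union> ?U al" "\<delta> \<in> insert be (?V \<union> ?U be)"
    have de: "\<delta> \<in> exps n" "ga \<in> exps n" using gd B(1) by auto
    consider "ga \<in> ?V" | "\<delta> \<in> ?V" | "?w al < ?w ga" "?w be \<le> ?w \<delta>" using gd by force
    thus "ga + \<delta> \<in> ?S"
    proof cases
     case 1
     thus ?thesis using Vadd(1)[OF 1 de(1)] by blast
    next
     case 2
     thus ?thesis using Vadd(2)[OF 2 de(2)] by blast
    next
     case 3
     hence "ga + \<delta> \<in> ?U (al + be)" using de by simp
     thus ?thesis by blast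
    qed
   qed
   have "a \<otimes> b = (g \<otimes> g') \<otimes> mx (al + be) \<oplus> (g \<otimes> (mx al \<otimes> h') \<oplus> h \<otimes> b)"
    unfolding A(5) B(5) mx_add using c mx_closed[of al] mx_closed[of be] by algebra
   moreover have "a \<otimes> b \<in> mI ?S" using ab(3) mI_mono[of ?V ?S] unfolding eq by blast
   moreover have "g \<otimes> (mx al \<otimes> h') \<oplus> h \<otimes> b \<in> mI ?S" by (rule ideal_add[OF mI_ideal 1 2])
   moreover have "(g \<otimes> g') \<otimes> mx (al + be) \<in> carrier R" using c by simp
   ultimately have "(g \<otimes> g') \<otimes> mx (al + be) \<in> mI ?S" using ideal_addE1[OF mI_ideal, of "(g \<otimes> g') \<otimes> mx (al + be)"] by simp
   hence "mx (al + be) \<in> mI ?S"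
    by (rule unit_cancel[OF Units_m_closed[OF A(3) B(3)] mx_closed mI_ideal])
   moreover have "upset n ?S" using L(1) by (intro upset_Un V heavier_upset)
   moreover have "al + be \<notin> ?S" using A(1,2) B(1,2) by (auto simp: plus_fun_apply)
   ultimately show False using monomial_not_mem A(1) B(1) exps_add by blast
  qed
 qed
qed

text \<open>A chain of k prime steps gives growth of degree k, which \<open>growth_le\<close> bounds
  by \<open>n\<close>; the coordinate primes attain the bound. The result is needed for the
  completion, since a regular system of parameters is defined with the dimension.\<close>

theorem krull_dim_eq:
 assumes noeth: "noetherian_ring R"
 shows "krull_dim R = enat n"
 unfolding krull_dim_def
proof (rule antisym)
 let ?A = "{enat k | k. \<exists>p :: nat => 'a set. (\<forall>i\<le>k. primeideal (p i) R) \<and> (\<forall>i<k. p i \<subset> p (Suc i))}"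
 show "Sup ?A \<le> enat n"
 proof (rule Sup_least)
  fix e assume "e \<in> ?A"
  then obtain k p where k: "e = enat k" "\<And>i. i \<le> k ==> primeideal (p i) R" "\<And>i. i < k ==> p i \<subset> p (Suc i)"
   by blast
  have "growth R M k" by (rule prime_chain_growth[OF noeth, of k p]) (rule k(2), assumption, rule k(3), assumption)
  thus "e \<le> enat n" unfolding k(1) using growth_le by simp
 qed
 have strict: "Idl (x ` {..<i}) \<subset> Idl (x ` {..<Suc i})" if i: "i < n" for i
 proof -
  have "x ` {..<Suc i} \<subseteq> carrier R" using x_image i by auto
  hence "x i \<in> Idl (x ` {..<Suc i})" using genideal_self by blast
  moreover have "x i \<notin> Idl (x ` {..<i})"
  proof
   let ?V = "{al \<in> exps n. \<exists>j<i. 0 < al j}"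
   assume "x i \<in> Idl (x ` {..<i})"
   moreover have "Idl (x ` {..<i}) \<subseteq> mI ?V"
   proof (rule genideal_minimal[OF mI_ideal], rule image_subsetI)
    fix j assume j: "j \<in> {..<i}"
    have "mx (unit_exp j) \<in> mI ?V" using i j by (intro mI_memI) (auto simp: unit_exp_def exps_def)
    thus "x j \<in> mI ?V" using mon_unit[OF x_closed, of j] i j by simp
   qed
   ultimately have "mx (unit_exp i) \<in> mI ?V" using mon_unit[OF x_closed i] by auto
   moreover have "upset n ?V" unfolding upset_def by (auto simp: le_fun_def) (meson less_le_trans)
   moreover have "unit_exp i \<notin> ?V" by (auto simp: unit_exp_def)
   ultimately show False using monomial_not_mem exps_unit[OF i] by blast
  qed
  moreover have "Idl (x ` {..<i}) \<subseteq> Idl (x ` {..<Suc i})" by (rule genideal_mono) auto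
  ultimately show ?thesis by blast
 qed
 have "enat n \<in> ?A"
  using coordinate_prime[OF noeth] strict by (intro CollectI exI[of _ n] conjI refl exI[of _ "\<lambda>i. Idl (x ` {..<i})"]) auto
 thus "enat n \<le> Sup ?A" by (rule Sup_upper)
qed

end

section \<open>Separating a point from a closed convex set\<close>

lemma compact_box: "compact {q :: nat => real. \<forall>i. q i \<in> (if i < e then {- B..B} else {0})}"
proof -
 let ?K = "PiE UNIV (\<lambda>i. if i < e then {- B..B} else {0 :: real})"
 have "compactin (powertop_real UNIV) ?K"
  unfolding compactin_PiE by (rule disjI2) (auto simp: compactin_euclidean_iff)
 hence "compact ?K" unfolding euclidean_product_topology compactin_euclidean_iff .
 moreover have "?K = {q. \<forall>i. q i \<in> (if i < e then {- B..B} else {0})}" by (auto simp: PiE_def Pi_def)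
 ultimately show ?thesis by simp
qed

text \<open>The normal vector is m - p for a point m of \<open>D\<close> nearest to
  \<open>p\<close>. Such a point exists because the points of \<open>D\<close> no farther from
  \<open>p\<close> than a fixed \<open>q0\<close> lie in a compact box in the first e
  coordinates.\<close>

lemma separate_point:
 fixes p :: "nat => real"
 assumes D: "closedin (Euclidean_space e) D" "pointwise_convex D" "D \<noteq> {}"
  and p: "p \<in> topspace (Euclidean_space e)" "p \<notin> D"
 shows "\<exists>c t. (\<Sum>i<e. c i * p i) < t \<and> (\<forall>q\<in>D. t \<le> (\<Sum>i<e. c i * q i))"
proof -
 have clD: "closed D" using D(1) by (rule closedin_Euclidean_imp_closed)
 have Dz: "q i = 0" if "q \<in> D" "i \<ge> e" for q i
  using closedin_subset[OF D(1)] that by (auto simp: topspace_Euclidean_space)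
 have pz: "p i = 0" if "i \<ge> e" for i using p(1) that by (auto simp: topspace_Euclidean_space)
 define \<phi> where "\<phi> q = (\<Sum>i<e. (q i - p i)\<^sup>2)" for q :: "nat => real"
 have cont: "continuous_on S \<phi>" for S
  unfolding \<phi>_def by (intro continuous_intros continuous_on_subset[OF continuous_on_product_coordinates]) auto
 obtain q0 where q0: "q0 \<in> D" using D(3) by blast
 \<comment> \<open>Bounds every coordinate of a point at squared distance at most
   \<open>\<phi> q0\<close> from \<open>p\<close>; the summand 1 covers coordinate differences below
   1, which exceed their squares.\<close>
 define B where "B = (\<Sum>i<e. \<bar>p i\<bar>) + \<phi> q0 + 1"
 have \<phi>0: "0 \<le> \<phi> q" for q unfolding \<phi>_def by (intro sum_nonneg) auto
 let ?K = "{q. \<forall>i. q i \<in> (if i < e then {- B..B} else {0})}"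
 have inK: "q \<in> ?K" if q: "q \<in> D" "\<phi> q \<le> \<phi> q0" for q
 proof (rule CollectI, rule allI)
  fix i
  show "q i \<in> (if i < e then {- B..B} else {0})"
  proof (cases "i < e")
   case True
   have "(q i - p i)\<^sup>2 \<le> \<phi> q" unfolding \<phi>_def using True by (intro member_le_sum) auto
   hence s: "(q i - p i)\<^sup>2 \<le> \<phi> q0" using q(2) by simp
   have "\<bar>q i - p i\<bar> \<le> \<phi> q0 + 1"
   proof (cases "\<bar>q i - p i\<bar> \<le> 1")
    case True
    thus ?thesis using \<phi>0[of q0] by simp
   next
    case False
    hence "\<bar>q i - p i\<bar> * 1 \<le> \<bar>q i - p i\<bar> * \<bar>q i - p i\<bar>" by (intro mult_left_mono) auto
    thus ?thesis using s by (simp add: power2_eq_square)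
   qed
   moreover have "\<bar>p i\<bar> \<le> (\<Sum>i<e. \<bar>p i\<bar>)" using True by (intro member_le_sum) auto
   ultimately have "\<bar>q i\<bar> \<le> B" unfolding B_def by linarith
   thus ?thesis using True by (simp add: abs_le_iff)
  qed (use Dz[OF q(1)] in auto)
 qed
 have "compact (D \<inter> ?K)" using clD compact_box[of e B] by (rule closed_Int_compact)
 moreover have "q0 \<in> D \<inter> ?K" using inK[OF q0] q0 by blast
 ultimately obtain m where m: "m \<in> D \<inter> ?K" "\<forall>q\<in>D \<inter> ?K. \<phi> m \<le> \<phi> q"
  using continuous_attains_inf[OF _ _ cont, of "D \<inter> ?K"] by blast
 have min: "\<phi> m \<le> \<phi> q" if "q \<in> D" for q
 proof (cases "\<phi> q \<le> \<phi> q0")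
  case True
  thus ?thesis using m(2) inK[OF that] that by blast
 next
  case False
  moreover have "\<phi> m \<le> \<phi> q0" using m(2) \<open>q0 \<in> D \<inter> ?K\<close> by blast
  ultimately show ?thesis by simp
 qed
 define c where "c i = m i - p i" for i
 have mD: "m \<in> D" using m(1) by blast
 have key: "0 \<le> (\<Sum>i<e. c i * (q i - m i))" if q: "q \<in> D" for q
 proof (rule ccontr)
  define a where "a = (\<Sum>i<e. c i * (q i - m i))"
  define d where "d = (\<Sum>i<e. (q i - m i)\<^sup>2)"
  assume "\<not> 0 \<le> (\<Sum>i<e. c i * (q i - m i))"
  hence a: "a < 0" by (simp add: a_def)
  have d: "0 \<le> d" unfolding d_def by (intro sum_nonneg) auto
  have ineq: "0 \<le> 2 * t * a + t\<^sup>2 * d" if t: "t \<in> {0..1}" for t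
  proof -
   have "(\<lambda>i. (1 - t) * m i + t * q i) \<in> D"
    using D(2) mD q t unfolding pointwise_convex_def by blast
   from min[OF this] have "\<phi> m \<le> (\<Sum>i<e. (c i + t * (q i - m i))\<^sup>2)"
    unfolding \<phi>_def c_def by (simp add: algebra_simps)
   also have "\<dots> = (\<Sum>i<e. (c i)\<^sup>2 + 2 * t * (c i * (q i - m i)) + t\<^sup>2 * (q i - m i)\<^sup>2)"
    by (intro sum.cong) (auto simp: power2_eq_square algebra_simps)
   also have "\<dots> = \<phi> m + 2 * t * a + t\<^sup>2 * d"
    by (simp add: \<phi>_def c_def a_def d_def sum.distrib sum_distrib_left)
   finally show ?thesis by simp
  qed
  \<comment> \<open>A step from m towards q that is short enough for the negative linear term to
    outweigh the quadratic one.\<close>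
  define t where "t = min 1 (- a / (d + 1))"
  have t: "0 < t" "t \<le> 1" using a d by (auto simp: t_def field_simps)
  have "t * d \<le> - a"
  proof -
   have "t \<le> - a / (d + 1)" by (simp add: t_def)
   hence "t * (d + 1) \<le> - a" using d pos_le_divide_eq[of "d + 1" t "- a"] by linarith
   thus ?thesis using t by (simp add: algebra_simps)
  qed
  hence "t * (t * d) \<le> t * (- a)" using t by (intro mult_left_mono) auto
  hence "t\<^sup>2 * d \<le> - (t * a)" by (simp add: power2_eq_square algebra_simps)
  hence "2 * t * a + t\<^sup>2 * d \<le> t * a" by (simp add: algebra_simps)
  moreover have "t * a < 0" using t a by (simp add: mult_less_0_iff)
  moreover have "0 \<le> 2 * t * a + t\<^sup>2 * d" by (rule ineq) (use t in simp)
  ultimately show False by linarith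
 qed
 have "m \<noteq> p" using mD p(2) by blast
 then obtain j where j: "m j \<noteq> p j" by blast
 hence "j < e" using Dz[OF mD] pz by (metis not_less)
 hence "(c j)\<^sup>2 \<le> (\<Sum>i<e. (c i)\<^sup>2)" by (intro member_le_sum) auto
 moreover have "0 < (c j)\<^sup>2" using j by (simp add: c_def)
 ultimately have pos: "0 < (\<Sum>i<e. (c i)\<^sup>2)" by linarith
 have "(\<Sum>i<e. (c i)\<^sup>2) = (\<Sum>i<e. c i * m i) - (\<Sum>i<e. c i * p i)"
  unfolding sum_subtractf[symmetric] by (intro sum.cong) (auto simp: c_def power2_eq_square algebra_simps)
 hence "(\<Sum>i<e. c i * p i) < (\<Sum>i<e. c i * m i)" using pos by simp
 moreover have "(\<Sum>i<e. c i * m i) \<le> (\<Sum>i<e. c i * q i)" if "q \<in> D" for q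
  using key[OF that] by (simp add: right_diff_distrib sum_subtractf)
 ultimately show ?thesis by blast
qed

section \<open>The polyhedron in terms of monomial ideals\<close>

definition join_exp :: "nat => nat => nat list \<times> nat list => nat => nat" where
 "join_exp e r AB = (\<lambda>i. if i < e then fst AB ! i else if i < e + r then snd AB ! (i - e) else 0)"

definition split_exp :: "nat => nat => (nat => nat) => nat list \<times> nat list" where
 "split_exp e r al = (map al [0..<e], map (\<lambda>j. al (e + j)) [0..<r])"

definition ydeg :: "nat => nat => (nat => nat) => nat" where
 "ydeg e r al = (\<Sum>j<r. al (e + j))"

text \<open>The \<open>i\<close>-th \<open>u\<close>-variable has weight \<open>L i\<close>, each \<open>y\<close>-variable has weight \<open>\<rho>\<close>: the half space \<open>L \<bullet> p \<ge> \<rho>\<close>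
 contains the polyhedron iff \<open>J\<close> lies in the ideal generated by the monomials with such exponents.\<close>

definition heavy :: "nat => nat => nat => (nat => real) => real => (nat => nat) set" where
 "heavy e r b L \<rho> = {al \<in> exps (e + r). \<rho> * real b \<le> wt e L al + \<rho> * real (ydeg e r al)}"

lemma join_split: "al \<in> exps (e + r) ==> join_exp e r (split_exp e r al) = al"
 by (auto simp: join_exp_def split_exp_def exps_def fun_eq_iff)

lemma split_join: "length A = e ==> length B = r ==> split_exp e r (join_exp e r (A, B)) = (A, B)"
 by (auto simp: join_exp_def split_exp_def intro!: nth_equalityI)

lemma join_exps: "join_exp e r AB \<in> exps (e + r)"
 by (auto simp: join_exp_def exps_def)

lemma ydeg_join: "length B = r ==> ydeg e r (join_exp e r (A, B)) = sum_list B"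
 by (simp add: ydeg_def join_exp_def sum_list_sum_nth atLeast0LessThan)

lemma wt_join: "wt e L (join_exp e r (A, B)) = (\<Sum>i<e. L i * real (A ! i))"
 by (simp add: wt_def join_exp_def)

lemma ydeg_mono: "al \<le> be ==> ydeg e r al \<le> ydeg e r be"
 by (simp add: ydeg_def le_fun_def sum_mono)

lemma ydeg_add [simp]: "ydeg e r (al + be) = ydeg e r al + ydeg e r be"
 by (simp add: ydeg_def plus_fun_apply sum.distrib)

lemma upset_heavy:
 assumes "\<And>i. i < e ==> 0 \<le> L i" "0 \<le> \<rho>"
 shows "upset (e + r) (heavy e r b L \<rho>)"
 unfolding upset_def
proof (intro conjI ballI impI)
 fix al be assume *: "al \<in> heavy e r b L \<rho>" "be \<in> exps (e + r)" "al \<le> be"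
 have "wt e L al \<le> wt e L be" using assms(1) *(3) by (rule wt_mono)
 moreover have "\<rho> * real (ydeg e r al) \<le> \<rho> * real (ydeg e r be)"
  using ydeg_mono[OF *(3), of e r] assms(2) by (intro mult_left_mono) auto
 ultimately show "be \<in> heavy e r b L \<rho>" using * by (auto simp: heavy_def)
qed (auto simp: heavy_def)

locale split_parameters = regular_parameters R "\<lambda>i. (us @ ys) ! i" "length us + length ys" M
 for R (structure) and us ys :: "'a list" and M +
 assumes noeth: "noetherian_ring R"
begin

abbreviation "e \<equiv> length us"
abbreviation "r \<equiv> length ys"

lemma us_closed: "set us \<subseteq> carrier R"
proof
 fix a assume "a \<in> set us"
 then obtain i where "i < e" "a = us ! i" by (metis in_set_conv_nth)
 thus "a \<in> carrier R" using x_closed by (auto simp: Pi_def nth_append dest!: spec[of _ i])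
qed

lemma ys_closed: "set ys \<subseteq> carrier R"
proof
 fix a assume "a \<in> set ys"
 then obtain i where "i < r" "a = ys ! i" by (metis in_set_conv_nth)
 thus "a \<in> carrier R" using x_closed by (auto simp: Pi_def nth_append dest!: spec[of _ "e + i"])
qed

lemma monomial_join:
 "monomial R us A \<otimes> monomial R ys B = mx (join_exp e r (A, B))"
proof -
 let ?f = "\<lambda>i. (us @ ys) ! i [^] join_exp e r (A, B) i"
 have cu: "us ! i \<in> carrier R" if "i < e" for i using us_closed nth_mem[OF that] by blast
 have cy: "ys ! i \<in> carrier R" if "i < r" for i using ys_closed nth_mem[OF that] by blast
 have d: "{..<e + r} = {..<e} \<union> (\<lambda>j. e + j) ` {..<r}"
 proof (intro subset_antisym subsetI)
  fix i assume i: "i \<in> {..<e + r}"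
  show "i \<in> {..<e} \<union> (\<lambda>j. e + j) ` {..<r}"
  proof (cases "i < e")
   case False
   hence "i = e + (i - e)" "i - e \<in> {..<r}" using i by auto
   thus ?thesis by blast
  qed simp
 qed auto
 have "mx (join_exp e r (A, B)) = (\<Otimes>i\<in>{..<e} \<union> (\<lambda>j. e + j) ` {..<r}. ?f i)"
  unfolding mon_def d ..
 also have "\<dots> = (\<Otimes>i\<in>{..<e}. ?f i) \<otimes> (\<Otimes>i\<in>(\<lambda>j. e + j) ` {..<r}. ?f i)"
  using cu cy by (intro finprod_Un_disjoint) (auto simp: nth_append)
 also have "(\<Otimes>i\<in>(\<lambda>j. e + j) ` {..<r}. ?f i) = (\<Otimes>j\<in>{..<r}. ?f (e + j))"
  using cy by (intro finprod_reindex) (auto simp: nth_append)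
 also have "\<dots> = monomial R ys B"
  unfolding monomial_def using cy by (intro finprod_cong') (auto simp: join_exp_def nth_append)
 also have "(\<Otimes>i\<in>{..<e}. ?f i) = monomial R us A"
  unfolding monomial_def using cu by (intro finprod_cong') (auto simp: join_exp_def nth_append)
 finally show ?thesis ..
qed

lemma is_expansion_expansion:
 assumes "is_expansion R us ys f C"
 shows "expansion f (join_exp e r ` {AB. C AB \<noteq> \<zero>}) (C \<circ> split_exp e r)"
proof -
 let ?D = "{AB. C AB \<noteq> \<zero>}"
 have C: "finite ?D" "\<And>A B. C (A, B) \<noteq> \<zero> ==> length A = e \<and> length B = r \<and> C (A, B) \<in> Units R"
  "f = (\<Oplus>AB\<in>?D. C AB \<otimes> monomial R us (fst AB) \<otimes> monomial R ys (snd AB))"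
  using assms unfolding is_expansion_def by auto
 have sj: "split_exp e r (join_exp e r AB) = AB" if "AB \<in> ?D" for AB
  using C(2)[of "fst AB" "snd AB"] that split_join[of "fst AB" e "snd AB" r] by simp
 have inj: "inj_on (join_exp e r) ?D" by (rule inj_on_inverseI[of _ "split_exp e r"]) (rule sj)
 have Cu: "C AB \<in> Units R" if "AB \<in> ?D" for AB using C(2)[of "fst AB" "snd AB"] that by simp
 have Cc: "C AB \<in> carrier R" if "AB \<in> ?D" for AB using Units_closed[OF Cu[OF that]] .
 have mc: "monomial R us A \<in> carrier R" "monomial R ys B \<in> carrier R" for A B
  unfolding monomial_def using us_closed ys_closed by (auto intro!: finprod_closed nth_mem dest: nth_mem)
 have "(\<Oplus>ta\<in>join_exp e r ` ?D. (C \<circ> split_exp e r) ta \<otimes> mx ta)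
   = (\<Oplus>AB\<in>?D. (C \<circ> split_exp e r) (join_exp e r AB) \<otimes> mx (join_exp e r AB))"
  using Cc sj by (intro finsum_reindex[OF _ inj]) auto
 also have "\<dots> = (\<Oplus>AB\<in>?D. C AB \<otimes> monomial R us (fst AB) \<otimes> monomial R ys (snd AB))"
 proof (rule finsum_cong')
  show "(\<lambda>AB. C AB \<otimes> monomial R us (fst AB) \<otimes> monomial R ys (snd AB)) \<in> ?D \<rightarrow> carrier R"
   using Cc mc by auto
  fix AB assume AB: "AB \<in> ?D"
  have "mx (join_exp e r AB) = monomial R us (fst AB) \<otimes> monomial R ys (snd AB)"
   using monomial_join[of "fst AB" "snd AB"] by simp
  thus "(C \<circ> split_exp e r) (join_exp e r AB) \<otimes> mx (join_exp e r AB)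
    = C AB \<otimes> monomial R us (fst AB) \<otimes> monomial R ys (snd AB)"
   using sj[OF AB] Cc[OF AB] mc by (simp add: m_assoc)
 qed simp
 finally have "f = (\<Oplus>ta\<in>join_exp e r ` ?D. (C \<circ> split_exp e r) ta \<otimes> mx ta)" using C(3) by simp
 moreover have "C \<circ> split_exp e r \<in> join_exp e r ` ?D \<rightarrow> Units R" using Cu sj by auto
 moreover have "join_exp e r ` ?D \<subseteq> exps (e + r)" using join_exps by blast
 ultimately show ?thesis unfolding expansion_def using C(1) by blast
qed

lemma is_expansion_exists:
 assumes "f \<in> carrier R"
 shows "\<exists>C. is_expansion R us ys f C"
proof -
 obtain T g where e: "expansion f T g" using expansion_exists[OF noeth assms] by blast
 hence T: "finite T" "T \<subseteq> exps (e + r)" "g \<in> T \<rightarrow> Units R" "f = (\<Oplus>ta\<in>T. g ta \<otimes> mx ta)"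
  by (auto simp: expansion_def)
 define C where "C AB = (if AB \<in> split_exp e r ` T then g (join_exp e r AB) else \<zero>)" for AB
 have js: "join_exp e r (split_exp e r ta) = ta" if "ta \<in> T" for ta using join_split T(2) that by blast
 have inj: "inj_on (split_exp e r) T" by (rule inj_on_inverseI[of _ "join_exp e r"]) (rule js)
 have z: "\<zero> \<notin> Units R" using M_unit ideal_zero[OF M_ideal] by blast
 have gu: "g ta \<in> Units R" if "ta \<in> T" for ta using T(3) that by auto
 have gc: "g ta \<in> carrier R" if "ta \<in> T" for ta using Units_closed[OF gu[OF that]] .
 have D: "{AB. C AB \<noteq> \<zero>} = split_exp e r ` T"
 proof (intro subset_antisym subsetI)
  fix AB assume "AB \<in> split_exp e r ` T"
  then obtain ta where t: "ta \<in> T" "AB = split_exp e r ta" by blast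
  hence "C AB = g ta" using js by (auto simp: C_def)
  thus "AB \<in> {AB. C AB \<noteq> \<zero>}" using gu[OF t(1)] z by auto
 qed (auto simp: C_def split: if_splits)
 have mc: "monomial R us A \<in> carrier R" "monomial R ys B \<in> carrier R" for A B
  unfolding monomial_def using us_closed ys_closed by (auto intro!: finprod_closed nth_mem dest: nth_mem)
 have Cs: "C (split_exp e r ta) = g ta" if "ta \<in> T" for ta using js that by (auto simp: C_def)
 have "f = (\<Oplus>ta\<in>T. C (split_exp e r ta) \<otimes> monomial R us (fst (split_exp e r ta)) \<otimes> monomial R ys (snd (split_exp e r ta)))"
  unfolding T(4)
 proof (rule finsum_cong')
  show "(\<lambda>ta. C (split_exp e r ta) \<otimes> monomial R us (fst (split_exp e r ta)) \<otimes> monomial R ys (snd (split_exp e r ta))) \<in> T \<rightarrow> carrier R"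
   using gc Cs mc by auto
  fix ta assume t: "ta \<in> T"
  have "mx ta = monomial R us (fst (split_exp e r ta)) \<otimes> monomial R ys (snd (split_exp e r ta))"
   using monomial_join[of "fst (split_exp e r ta)" "snd (split_exp e r ta)"] js[OF t] by simp
  thus "g ta \<otimes> mx ta = C (split_exp e r ta) \<otimes> monomial R us (fst (split_exp e r ta)) \<otimes> monomial R ys (snd (split_exp e r ta))"
   using Cs[OF t] gc[OF t] mc by (simp add: m_assoc)
 qed simp
 also have "\<dots> = (\<Oplus>AB\<in>split_exp e r ` T. C AB \<otimes> monomial R us (fst AB) \<otimes> monomial R ys (snd AB))"
  using gc Cs mc by (intro finsum_reindex[OF _ inj, symmetric]) auto
 finally have "f = (\<Oplus>AB\<in>{AB. C AB \<noteq> \<zero>}. C AB \<otimes> monomial R us (fst AB) \<otimes> monomial R ys (snd AB))"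
  unfolding D .
 moreover have "length A = e \<and> length B = r \<and> C (A, B) \<in> Units R" if "C (A, B) \<noteq> \<zero>" for A B
 proof -
  have "(A, B) \<in> split_exp e r ` T" using that D by blast
  then obtain ta where "ta \<in> T" "(A, B) = split_exp e r ta" by blast
  thus ?thesis using Cs gu by (auto simp: split_exp_def)
 qed
 moreover have "finite {AB. C AB \<noteq> \<zero>}" unfolding D using T(1) by simp
 ultimately show ?thesis unfolding is_expansion_def by blast
qed

text \<open>The dual description by half spaces. It refers to \<open>J\<close> only through
  containments in monomial ideals, hence depends neither on generators nor on expansions.\<close>

definition newton :: "'a set => nat => (nat => real) set" where
 "newton J b = {p \<in> orthant e. \<forall>L \<rho>. (\<forall>i. 0 \<le> L i) \<longrightarrow> 0 < \<rho> \<longrightarrow> J \<subseteq> mI (heavy e r b L \<rho>) \<longrightarrow>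
   \<rho> \<le> (\<Sum>i<e. L i * p i)}"

lemma newton_closed: "closedin (Euclidean_space e) (newton J b)"
proof -
 have "closed {p :: nat => real. \<rho> \<le> (\<Sum>i<e. L i * p i)}" for L \<rho>
  by (intro closed_Collect_le continuous_intros continuous_on_product_coordinates)
 moreover have "closed {p :: nat => real. 0 \<le> p i}" for i
  by (intro closed_Collect_le continuous_intros continuous_on_product_coordinates)
 ultimately have "closed ((\<Inter>i. {p :: nat => real. 0 \<le> p i}) \<inter>
   (\<Inter>(L, \<rho>)\<in>{(L, \<rho>). (\<forall>i. 0 \<le> L i) \<and> 0 < \<rho> \<and> J \<subseteq> mI (heavy e r b L \<rho>)}. {p. \<rho> \<le> (\<Sum>i<e. L i * p i)}))"
  by (intro closed_Int closed_INT ballI) auto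
 hence "closedin (powertop_real UNIV) ((\<Inter>i. {p :: nat => real. 0 \<le> p i}) \<inter>
   (\<Inter>(L, \<rho>)\<in>{(L, \<rho>). (\<forall>i. 0 \<le> L i) \<and> 0 < \<rho> \<and> J \<subseteq> mI (heavy e r b L \<rho>)}. {p. \<rho> \<le> (\<Sum>i<e. L i * p i)}))"
  unfolding euclidean_product_topology closed_closedin .
 moreover have "newton J b = ((\<Inter>i. {p :: nat => real. 0 \<le> p i}) \<inter>
   (\<Inter>(L, \<rho>)\<in>{(L, \<rho>). (\<forall>i. 0 \<le> L i) \<and> 0 < \<rho> \<and> J \<subseteq> mI (heavy e r b L \<rho>)}. {p. \<rho> \<le> (\<Sum>i<e. L i * p i)})) \<inter> {x. \<forall>i\<ge>e. x i = 0}"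
  unfolding newton_def orthant_def topspace_Euclidean_space by blast
 ultimately show ?thesis unfolding Euclidean_space_def closedin_subtopology by blast
qed

lemma newton_convex: "pointwise_convex (newton J b)"
 unfolding pointwise_convex_def
proof (intro ballI)
 fix v w t assume v: "v \<in> newton J b" and w: "w \<in> newton J b" and t: "t \<in> {0..1 :: real}"
 let ?z = "\<lambda>i. (1 - t) * v i + t * w i"
 have "?z \<in> orthant e" using v w t by (auto simp: newton_def orthant_def topspace_Euclidean_space)
 moreover have "\<rho> \<le> (\<Sum>i<e. L i * ?z i)"
  if L: "\<forall>i. 0 \<le> L i" "0 < \<rho>" "J \<subseteq> mI (heavy e r b L \<rho>)" for L \<rho>
 proof -
  have "\<rho> \<le> (\<Sum>i<e. L i * v i)" "\<rho> \<le> (\<Sum>i<e. L i * w i)" using v w L unfolding newton_def by blast+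
  hence "(1 - t) * \<rho> + t * \<rho> \<le> (1 - t) * (\<Sum>i<e. L i * v i) + t * (\<Sum>i<e. L i * w i)"
   using t by (intro add_mono mult_left_mono) auto
  also have "\<dots> = (\<Sum>i<e. L i * ?z i)"
   by (simp add: sum_distrib_left sum.distrib[symmetric] algebra_simps)
  finally show ?thesis by (simp add: algebra_simps)
 qed
 ultimately show "?z \<in> newton J b" unfolding newton_def by blast
qed

lemma join_heavy_iff:
 assumes "length B = r"
 shows "join_exp e r (A, B) \<in> heavy e r b L \<rho> \<longleftrightarrow> \<rho> * (real b - real (sum_list B)) \<le> (\<Sum>i<e. L i * real (A ! i))"
 by (simp add: heavy_def join_exps wt_join ydeg_join[OF assms] algebra_simps)

theorem polyhedron_of_expansions_eq:
 assumes fs: "set fs \<subseteq> carrier R" "Idl (set fs) = J" and ex: "list_all2 (is_expansion R us ys) fs Cs"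
 shows "polyhedron_of_expansions R e b Cs = newton J b"
proof -
 have exC: "\<exists>f\<in>set fs. is_expansion R us ys f C" if "C \<in> set Cs" for C
  using ex that by (metis in_set_conv_nth list_all2_conv_all_nth)
 have exf: "\<exists>C\<in>set Cs. is_expansion R us ys f C" if "f \<in> set fs" for f
  using ex that by (metis in_set_conv_nth list_all2_conv_all_nth)
 have mem: "J \<subseteq> mI S \<longleftrightarrow> (\<forall>C\<in>set Cs. \<forall>A B. C (A, B) \<noteq> \<zero> \<longrightarrow> join_exp e r (A, B) \<in> S)"
  if S: "upset (e + r) S" for S
 proof
  assume J: "J \<subseteq> mI S"
  show "\<forall>C\<in>set Cs. \<forall>A B. C (A, B) \<noteq> \<zero> \<longrightarrow> join_exp e r (A, B) \<in> S"
  proof (intro ballI allI impI)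
   fix C A B assume C: "C \<in> set Cs" "C (A, B) \<noteq> \<zero>"
   obtain f where f: "f \<in> set fs" "is_expansion R us ys f C" using exC[OF C(1)] by blast
   have "f \<in> mI S" using J f(1) genideal_self[OF fs(1)] fs(2) by blast
   hence "join_exp e r ` {AB. C AB \<noteq> \<zero>} \<subseteq> S"
    using expansion_mem_iff[OF is_expansion_expansion[OF f(2)] S] by blast
   thus "join_exp e r (A, B) \<in> S" using C(2) by blast
  qed
 next
  assume *: "\<forall>C\<in>set Cs. \<forall>A B. C (A, B) \<noteq> \<zero> \<longrightarrow> join_exp e r (A, B) \<in> S"
  have "set fs \<subseteq> mI S"
  proof
   fix f assume f: "f \<in> set fs"
   obtain C where C: "C \<in> set Cs" "is_expansion R us ys f C" using exf[OF f] by blast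
   have "join_exp e r ` {AB. C AB \<noteq> \<zero>} \<subseteq> S" using * C(1) by auto
   thus "f \<in> mI S" using expansion_mem_iff[OF is_expansion_expansion[OF C(2)] S] by blast
  qed
  thus "J \<subseteq> mI S" unfolding fs(2)[symmetric] by (rule genideal_minimal[OF mI_ideal])
 qed
 have len: "length A = e \<and> length B = r" if "C \<in> set Cs" "C (A, B) \<noteq> \<zero>" for C A B
  using exC[OF that(1)] that(2) unfolding is_expansion_def by blast
 have origin: "(\<lambda>i. if i < e then real (A ! i) / (real b - real (sum_list B)) else 0) \<in> shifted_orthant e b (A, B)"
  for A B
 proof -
  have z: "(\<lambda>_. 0) \<in> orthant e" by (simp add: orthant_def topspace_Euclidean_space)
  show ?thesis unfolding shifted_orthant_def by (rule CollectI, rule exI[of _ "\<lambda>_. 0"]) (use z in \<open>auto simp: fun_eq_iff\<close>)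
 qed
 show ?thesis
 proof
  have "shifted_orthant e b (A, B) \<subseteq> newton J b"
   if C: "C \<in> set Cs" "C (A, B) \<noteq> \<zero> \<and> sum_list B < b" for C A B
  proof
   fix q assume "q \<in> shifted_orthant e b (A, B)"
   then obtain v where v: "v \<in> orthant e"
    "q = (\<lambda>i. (if i < e then real (A ! i) / (real b - real (sum_list B)) else 0) + v i)"
    unfolding shifted_orthant_def fst_conv snd_conv by blast
   have bB: "0 < real b - real (sum_list B)" using C(2) by simp
   have "q \<in> orthant e" using v(1) bB unfolding v(2) by (auto simp: orthant_def topspace_Euclidean_space)
   moreover have "\<rho> \<le> (\<Sum>i<e. L i * q i)"
    if L: "\<forall>i. 0 \<le> L i" "0 < \<rho>" "J \<subseteq> mI (heavy e r b L \<rho>)" for L \<rho>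
   proof -
    have "upset (e + r) (heavy e r b L \<rho>)" using L by (intro upset_heavy) auto
    hence "join_exp e r (A, B) \<in> heavy e r b L \<rho>" using L(3) mem C by blast
    hence h: "\<rho> * (real b - real (sum_list B)) \<le> (\<Sum>i<e. L i * real (A ! i))"
     using join_heavy_iff len[OF C(1)] C(2) by blast
    have "\<rho> \<le> (\<Sum>i<e. L i * real (A ! i)) / (real b - real (sum_list B))"
     using h bB by (simp add: field_simps)
    also have "\<dots> = (\<Sum>i<e. L i * (real (A ! i) / (real b - real (sum_list B))))"
     by (simp add: sum_divide_distrib)
    also have "\<dots> \<le> (\<Sum>i<e. L i * q i)"
     using L(1) v(1) unfolding v(2) by (intro sum_mono mult_left_mono) (auto simp: orthant_def)
    finally show ?thesis .
   qed
   ultimately show "q \<in> newton J b" unfolding newton_def by blast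
  qed
  thus "polyhedron_of_expansions R e b Cs \<subseteq> newton J b"
   unfolding polyhedron_of_expansions_def
   using newton_closed newton_convex by (intro Inter_lower) (auto simp: newton_def)
 next
  show "newton J b \<subseteq> polyhedron_of_expansions R e b Cs"
   unfolding polyhedron_of_expansions_def
  proof (rule Inter_greatest)
   fix D assume "D \<in> {D. D \<subseteq> orthant e \<and> closedin (Euclidean_space e) D \<and> pointwise_convex D \<and>
     (\<forall>C \<in> set Cs. \<forall>A B. C (A, B) \<noteq> \<zero> \<and> sum_list B < b \<longrightarrow> shifted_orthant e b (A, B) \<subseteq> D)}"
   hence D: "D \<subseteq> orthant e" "closedin (Euclidean_space e) D" "pointwise_convex D"
    "\<And>C A B. C \<in> set Cs ==> C (A, B) \<noteq> \<zero> ==> sum_list B < b ==> shifted_orthant e b (A, B) \<subseteq> D"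
    by auto
   show "newton J b \<subseteq> D"
   proof
    fix p assume p: "p \<in> newton J b"
    have po: "p \<in> orthant e" using p by (simp add: newton_def)
    show "p \<in> D"
    proof (cases "\<exists>C\<in>set Cs. \<exists>A B. C (A, B) \<noteq> \<zero> \<and> sum_list B < b")
     case False
     \<comment> \<open>No exponent contributes a point, and the empty polyhedron is cut out by the
       impossible inequality 0 \<ge> 1.\<close>
     let ?L = "\<lambda>_ :: nat. 0 :: real"
     have "J \<subseteq> mI (heavy e r b ?L 1)"
     proof (subst mem)
      show "upset (e + r) (heavy e r b ?L 1)" by (rule upset_heavy) auto
      show "\<forall>C\<in>set Cs. \<forall>A B. C (A, B) \<noteq> \<zero> \<longrightarrow> join_exp e r (A, B) \<in> heavy e r b ?L 1"
      proof (intro ballI allI impI)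
       fix C A B assume C: "C \<in> set Cs" "C (A, B) \<noteq> \<zero>"
       hence "b \<le> sum_list B" using False by (meson not_le)
       thus "join_exp e r (A, B) \<in> heavy e r b ?L 1"
        using join_heavy_iff[of B A b ?L 1] len[OF C] by simp
      qed
     qed
     hence "1 \<le> (\<Sum>i<e. ?L i * p i)" using p unfolding newton_def by force
     thus ?thesis by simp
    next
     case True
     then obtain C A B where C: "C \<in> set Cs" "C (A, B) \<noteq> \<zero>" "sum_list B < b" by blast
     show ?thesis
     proof (rule ccontr)
      assume "p \<notin> D"
      have Dne: "D \<noteq> {}" using D(4)[OF C] origin by blast
      have pt: "p \<in> topspace (Euclidean_space e)" using po by (simp add: orthant_def)
      obtain c t where ct: "(\<Sum>i<e. c i * p i) < t" "\<forall>q\<in>D. t \<le> (\<Sum>i<e. c i * q i)"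
       using separate_point[OF D(2,3) Dne pt \<open>p \<notin> D\<close>] by blast
      have cpos: "0 \<le> c j" if j: "j < e" for j
      proof (rule ccontr)
       assume "\<not> 0 \<le> c j"
       hence cj: "c j < 0" by simp
       let ?o = "\<lambda>i. if i < e then real (A ! i) / (real b - real (sum_list B)) else 0"
       define s where "s = (\<Sum>i<e. c i * ?o i)"
       \<comment> \<open>Moving this far along the j-th axis brings the functional down to t - 1 or
         less.\<close>
       define k where "k = max 0 ((t - s - 1) / c j)"
       have "(\<lambda>i. if i = j then k else 0) \<in> orthant e"
        using j by (auto simp: orthant_def topspace_Euclidean_space k_def)
       hence "(\<lambda>i. ?o i + (if i = j then k else 0)) \<in> shifted_orthant e b (A, B)"
        unfolding shifted_orthant_def fst_conv snd_conv
        by (intro CollectI exI[of _ "\<lambda>i. if i = j then k else 0"] conjI refl)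
       from bspec[OF ct(2) subsetD[OF D(4)[OF C] this]]
       have "t \<le> (\<Sum>i<e. c i * (?o i + (if i = j then k else 0)))" .
       also have "\<dots> = s + (\<Sum>i<e. if i = j then c i * k else 0)"
        unfolding s_def sum.distrib[symmetric] by (intro sum.cong) (auto simp: algebra_simps)
       also have "\<dots> = s + c j * k" using j by simp
       also have "\<dots> \<le> s + (t - s - 1)"
       proof -
        have "(t - s - 1) / c j \<le> k" by (simp add: k_def)
        hence "c j * k \<le> c j * ((t - s - 1) / c j)" using cj by (intro mult_left_mono_neg) auto
        thus ?thesis using cj by simp
       qed
       finally show False by simp
      qed
      \<comment> \<open>Set to zero from e on, since \<open>newton\<close> asks for nonnegative
        weights at every index.\<close>
      define L where "L i = (if i < e then c i else 0)" for i
      have L0: "0 \<le> L i" for i using cpos by (simp add: L_def)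
      have Lc: "(\<Sum>i<e. L i * q i) = (\<Sum>i<e. c i * q i)" for q by (intro sum.cong) (auto simp: L_def)
      have "0 \<le> (\<Sum>i<e. c i * p i)" using cpos po by (intro sum_nonneg mult_nonneg_nonneg) (auto simp: orthant_def)
      hence t0: "0 < t" using ct(1) by simp
      have "J \<subseteq> mI (heavy e r b L t)"
      proof (subst mem)
       show "upset (e + r) (heavy e r b L t)" using L0 t0 by (intro upset_heavy) auto
       show "\<forall>C\<in>set Cs. \<forall>A B. C (A, B) \<noteq> \<zero> \<longrightarrow> join_exp e r (A, B) \<in> heavy e r b L t"
       proof (intro ballI allI impI)
        fix C A B assume C: "C \<in> set Cs" "C (A, B) \<noteq> \<zero>"
        have "t * (real b - real (sum_list B)) \<le> (\<Sum>i<e. L i * real (A ! i))"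
        proof (cases "sum_list B < b")
         case True
         have "t \<le> (\<Sum>i<e. c i * (if i < e then real (A ! i) / (real b - real (sum_list B)) else 0))"
          by (rule bspec[OF ct(2) subsetD[OF D(4)[OF C True] origin]])
         also have "\<dots> = (\<Sum>i<e. L i * real (A ! i)) / (real b - real (sum_list B))"
          unfolding sum_divide_distrib by (intro sum.cong) (auto simp: L_def)
         finally show ?thesis using True by (simp add: field_simps)
        next
         case False
         hence "t * (real b - real (sum_list B)) \<le> 0" using t0 by (simp add: mult_le_0_iff)
         also have "0 \<le> (\<Sum>i<e. L i * real (A ! i))" using L0 by (intro sum_nonneg) auto
         finally show ?thesis .
        qed
        thus "join_exp e r (A, B) \<in> heavy e r b L t" using join_heavy_iff len[OF C] by blast
       qed
      qed
      hence "t \<le> (\<Sum>i<e. L i * p i)" using p L0 t0 unfolding newton_def by blast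
      thus False using ct(1) Lc by simp
     qed
    qed
   qed
  qed
 qed
qed

text \<open>The arbitrary choice in \<open>polyhedron\<close> is harmless: each admissible pair of
  generators and expansions gives \<open>newton J b\<close>, and at least one such pair
  exists.\<close>

theorem polyhedron_eq:
 assumes F: "finite F" "F \<subseteq> carrier R" "J = Idl F"
 shows "polyhedron R J b us ys = newton J b"
proof -
 obtain fs where fs: "set fs = F" using finite_list[OF F(1)] by blast
 have "\<exists>Cs. list_all2 (is_expansion R us ys) gs Cs" if "set gs \<subseteq> carrier R" for gs
  using that
 proof (induction gs)
  case (Cons g gs)
  then obtain Cs where "list_all2 (is_expansion R us ys) gs Cs" by auto
  moreover obtain C where "is_expansion R us ys g C" using is_expansion_exists[of g] Cons by auto
  ultimately show ?case by (intro exI[of _ "C # Cs"]) simp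
 qed (auto intro: exI[of _ "[]"])
 then obtain Cs where Cs: "list_all2 (is_expansion R us ys) fs Cs" using fs F(2) by blast
 let ?P = "\<lambda>D. \<exists>fs Cs. set fs \<subseteq> carrier R \<and> Idl (set fs) = J \<and>
    list_all2 (is_expansion R us ys) fs Cs \<and> D = polyhedron_of_expansions R e b Cs"
 have "?P (polyhedron_of_expansions R e b Cs)" using fs F(2,3) Cs by blast
 hence "?P (polyhedron R J b us ys)" unfolding polyhedron_def by (rule someI)
 thus ?thesis using polyhedron_of_expansions_eq by blast
qed

end

section \<open>Change of coordinates\<close>

definition scale_exp :: "nat => (nat => nat) => nat => nat" where
 "scale_exp k A = (\<lambda>i. k * A i)"

lemma scale_exp_0 [simp]: "scale_exp 0 A = 0"
 by (auto simp: scale_exp_def)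

lemma scale_exp_Suc: "scale_exp (Suc k) A = A + scale_exp k A"
 by (auto simp: scale_exp_def plus_fun_apply)

lemma scale_exps [simp]: "A \<in> exps n ==> scale_exp k A \<in> exps n"
 by (auto simp: exps_def scale_exp_def)

lemma wt_scale: "wt n L (scale_exp k A) = real k * wt n L A"
 by (simp add: wt_def scale_exp_def sum_distrib_left algebra_simps)

lemma exps_mono: "m \<le> n ==> A \<in> exps m ==> A \<in> exps n"
 by (auto simp: exps_def)

lemma ydeg_exps: "A \<in> exps e ==> ydeg e r A = 0"
 by (simp add: ydeg_def exps_def)

lemma sum_split_add: "(\<Sum>i<m + k. f i) = (\<Sum>i<m. f i) + (\<Sum>j<k. f (m + j))" for f :: "nat => real"
 by (induction k) auto

lemma wt_ydeg: "wt (e + r) (\<lambda>i. if i < e then L i else \<rho>) al = wt e L al + \<rho> * real (ydeg e r al)"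
 by (simp add: wt_def sum_split_add ydeg_def sum_distrib_left)

lemma tdeg_ydeg: "tdeg (e + r) al = tdeg e al + ydeg e r al"
 unfolding tdeg_def ydeg_def by (induction r) auto

context cring
begin

lemma mon_Suc:
 assumes "z \<in> {..<Suc m} \<rightarrow> carrier R"
 shows "mon R z (Suc m) al = z m [^] al m \<otimes> mon R z m al"
 unfolding mon_def lessThan_Suc using assms by (intro finprod_insert) (auto simp: Pi_def)

lemma mon_cong:
 assumes "\<And>i. i < n ==> z i = z' i" "\<And>i. i < n ==> al i = be i" "z' \<in> {..<n} \<rightarrow> carrier R"
 shows "mon R z n al = mon R z' n be"
 unfolding mon_def using assms by (intro finprod_cong') (auto simp: Pi_def)

lemma mon_extend:
 assumes "A \<in> exps m" "z \<in> {..<m + k} \<rightarrow> carrier R"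
 shows "mon R z (m + k) A = mon R z m A"
 using assms(2)
proof (induction k)
 case (Suc k)
 have z: "z \<in> {..<m + k} \<rightarrow> carrier R" "z \<in> {..<m} \<rightarrow> carrier R" using Suc(2) by (auto simp: Pi_def)
 have "mon R z (Suc (m + k)) A = z (m + k) [^] A (m + k) \<otimes> mon R z (m + k) A"
  using Suc(2) by (intro mon_Suc) simp
 thus ?case using Suc(1)[OF z(1)] assms(1) z(2) by (simp add: exps_def)
qed simp

lemma mon_split_var:
 assumes z: "z \<in> {..<n} \<rightarrow> carrier R" and q: "q < n"
 shows "mon R z n al = mon R z n (al(q := 0)) \<otimes> z q [^] al q"
proof -
 have "mon R z n al = (\<Otimes>i\<in>{..<n}. z i [^] (al(q := 0)) i \<otimes> (if q = i then z i [^] al i else \<one>))"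
  unfolding mon_def using z by (intro finprod_cong') (auto simp: Pi_def)
 also have "\<dots> = mon R z n (al(q := 0)) \<otimes> (\<Otimes>i\<in>{..<n}. if q = i then z i [^] al i else \<one>)"
  unfolding mon_def using z by (intro finprod_multf) (auto simp: Pi_def)
 also have "(\<Otimes>i\<in>{..<n}. if q = i then z i [^] al i else \<one>) = z q [^] al q"
  using finprod_singleton[of q "{..<n}" "\<lambda>i. z i [^] al i"] z q by (auto simp: Pi_def)
 finally show ?thesis .
qed

lemma mon_update:
 assumes z: "z \<in> {..<n} \<rightarrow> carrier R" and q: "q < n" and v: "v \<in> carrier R"
 shows "mon R (z(q := v)) n al = mon R z n (al(q := 0)) \<otimes> v [^] al q"
proof -
 have z': "z(q := v) \<in> {..<n} \<rightarrow> carrier R" using z v by (auto simp: Pi_def)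
 have "mon R (z(q := v)) n (al(q := 0)) = mon R z n (al(q := 0))"
  unfolding mon_def using z by (intro finprod_cong') (auto simp: Pi_def)
 thus ?thesis using mon_split_var[OF z' q, of al] by simp
qed

lemma mon_scale:
 assumes z: "z \<in> {..<n} \<rightarrow> carrier R"
 shows "mon R z n A [^] k = mon R z n (scale_exp k A)"
proof (induction k)
 case 0
 show ?case by (simp only: scale_exp_0 mon_zero nat_pow_0)
next
 case (Suc k)
 thus ?case using z m_comm[of "mon R z n A" "mon R z n (scale_exp k A)"]
  by (simp add: scale_exp_Suc mon_add[OF z] nat_pow_Suc)
qed

lemma power_diff_ideal:
 assumes I: "ideal I R" and c: "c \<in> I" and w: "w \<in> carrier R"
 shows "(c \<oplus> w) [^] (k :: nat) \<ominus> w [^] k \<in> I"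
proof (induction k)
 case 0
 show ?case using ideal_zero[OF I] by (simp add: a_minus_def r_neg)
next
 case (Suc k)
 have cc: "c \<in> carrier R" using c ideal_sub[OF I] by blast
 let ?P = "(c \<oplus> w) [^] k" and ?Q = "w [^] k"
 have PQ: "?P \<in> carrier R" "?Q \<in> carrier R" using cc w by auto
 have "?P \<otimes> (c \<oplus> w) \<ominus> ?Q \<otimes> w = ?P \<otimes> c \<oplus> w \<otimes> (?P \<ominus> ?Q)" using PQ cc w by algebra
 moreover have "?P \<otimes> c \<oplus> w \<otimes> (?P \<ominus> ?Q) \<in> I"
  by (intro ideal_add[OF I] ideal_mult[OF I]) (use PQ c w Suc in auto)
 ultimately show ?case by (simp add: nat_pow_Suc)
qed

text \<open>In a multiplicative filtration by real numbers, monomials have at least the weight that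
  their exponents suggest. It is applied to the filtration of one coordinate system and the
  monomials of another.\<close>

lemma mon_filtered:
 fixes W :: "real => 'a set"
 assumes W: "\<And>\<sigma>. ideal (W \<sigma>) R" "\<And>f g \<sigma> ta. f \<in> W \<sigma> ==> g \<in> W ta ==> f \<otimes> g \<in> W (\<sigma> + ta)" "\<one> \<in> W 0"
  and z: "\<And>i. i < m ==> z i \<in> W (w i)"
 shows "mon R z m al \<in> W (wt m w al)"
 using z
proof (induction m)
 case 0
 have "mon R z 0 al = \<one>" by (simp add: mon_def)
 thus ?case using W(3) by (simp add: wt_def)
next
 case (Suc m)
 have zc: "z i \<in> carrier R" if "i < Suc m" for i using Suc(2)[OF that] ideal_sub[OF W(1)] by blast
 have zm: "z m \<in> W (w m)" using Suc(2)[of m] by simp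
 have pow: "z m [^] k \<in> W (w m * real k)" for k :: nat
 proof (induction k)
  case 0
  show ?case using W(3) by simp
 next
  case (Suc k)
  have "z m [^] k \<otimes> z m \<in> W (w m * real k + w m)" by (rule W(2)[OF Suc zm])
  thus ?case by (simp add: nat_pow_Suc algebra_simps)
 qed
 have "mon R z m al \<in> W (wt m w al)" using Suc by simp
 hence "z m [^] al m \<otimes> mon R z m al \<in> W (w m * real (al m) + wt m w al)" by (rule W(2)[OF pow])
 moreover have "mon R z (Suc m) al = z m [^] al m \<otimes> mon R z m al" using zc by (intro mon_Suc) auto
 ultimately show ?case by (simp add: wt_def algebra_simps)
qed

end

section \<open>Coordinate systems extending a fixed u and their weight filtrations\<close>

locale regular_local = cring R for R (structure) + fixes M :: "'a set" and n :: nat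
 assumes maxideal: "ideal M R" "M \<noteq> carrier R" "\<And>a. a \<in> carrier R ==> a \<notin> M ==> a \<in> Units R"
  and growth_n: "growth R M n"
  and noeth: "noetherian_ring R"

locale pair_setup = regular_local R M n for R (structure) and M n +
 fixes us :: "'a list" and J F :: "'a set" and b :: nat
 assumes F: "finite F" "F \<subseteq> carrier R" "J = Idl F"
begin

abbreviation e :: nat where "e \<equiv> length us"

text \<open>Regular systems of parameters extending \<open>us\<close>, with the dimension expressed
  by the number \<open>n\<close>.\<close>

definition rsp :: "'a list => bool" where
 "rsp ys \<longleftrightarrow> set us \<union> set ys \<subseteq> carrier R \<and> Idl (set us \<union> set ys) = M \<and> length us + length ys = n"

definition gI :: "'a list => (nat => nat) set => 'a set" where
 "gI ys S = Idl (mon R (\<lambda>i. (us @ ys) ! i) (length us + length ys) ` S)"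

text \<open>The monomial filtration at level s, in which u_i has weight \<open>L i\<close> and each
  y_j has weight \<open>\<rho>\<close>. At level \<rho> b it tests the half space given by
  \<open>L\<close> and \<open>\<rho>\<close>.\<close>

definition Fw :: "'a list => (nat => real) => real => real => 'a set" where
 "Fw ys L \<rho> s = gI ys {al \<in> exps (length us + length ys). s \<le> wt (length us) L al + \<rho> * real (ydeg (length us) (length ys) al)}"

definition newt :: "'a list => (nat => real) set" where
 "newt ys = {p \<in> orthant e. \<forall>L \<rho>. (\<forall>i. 0 \<le> L i) \<longrightarrow> 0 < \<rho> \<longrightarrow> J \<subseteq> Fw ys L \<rho> (\<rho> * real b) \<longrightarrow>
   \<rho> \<le> (\<Sum>i<e. L i * p i)}"

definition um :: "(nat => nat) => 'a" where
 "um A = mon R (\<lambda>i. us ! i) e A"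

definition shift :: "'a list => 'a list => (nat => nat) => 'a list" where
 "shift ys cs A = map (\<lambda>j. ys ! j \<oplus> cs ! j \<otimes> um A) [0..<length ys]"

text \<open>This is what the minimality of the number of forms defining the directrix excludes.\<close>

definition degenerate :: "nat => bool" where
 "degenerate r \<longleftrightarrow> (\<exists>ts p. length ts = r \<and> p < r \<and> set ts \<subseteq> M \<and>
   J \<subseteq> Idl (set us \<union> monomial R ts ` {B. length B = r \<and> sum_list B = b \<and> B ! p = 0} \<union> ideal_power R M (Suc b)))"

lemma rsp_split: "rsp ys ==> split_parameters R us ys M"
proof -
 assume y: "rsp ys"
 have im: "(\<lambda>i. (us @ ys) ! i) ` {..<length us + length ys} = set us \<union> set ys"
  by (metis atLeast0LessThan length_append list.set_map map_nth set_append set_upt)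
 show ?thesis
 proof (intro split_parameters.intro regular_parameters.intro parameters.intro parameters_axioms.intro
   regular_parameters_axioms.intro split_parameters_axioms.intro)
  show "(\<lambda>i. (us @ ys) ! i) \<in> {..<e + length ys} \<rightarrow> carrier R" using y im unfolding rsp_def by blast
  show "M = Idl ((\<lambda>i. (us @ ys) ! i) ` {..<e + length ys})" using y unfolding im rsp_def by simp
  show "growth R M (e + length ys)" using y growth_n unfolding rsp_def by simp
 qed (use maxideal noeth cring_axioms in auto)
qed

lemma rsp_carrier: "rsp ys ==> set us \<subseteq> carrier R" "rsp ys ==> set ys \<subseteq> carrier R"
 by (auto simp: rsp_def)

lemma rsp_nth: "rsp ys ==> i < e ==> us ! i \<in> carrier R" "rsp ys ==> j < length ys ==> ys ! j \<in> carrier R"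
 using rsp_carrier nth_mem by blast+

lemma rsp_M: "rsp ys ==> set us \<subseteq> M" "rsp ys ==> set ys \<subseteq> M"
 unfolding rsp_def using genideal_self[of "set us \<union> set ys"] by auto

lemma gI_ideal: "rsp ys ==> ideal (gI ys S) R"
 unfolding gI_def using parameters.mI_ideal[of R "\<lambda>i. (us @ ys) ! i" "length us + length ys" M S]
  rsp_split split_parameters.axioms(1) regular_parameters.axioms(1) by blast

lemma Fw_ideal: "rsp ys ==> ideal (Fw ys L \<rho> s) R"
 unfolding Fw_def by (rule gI_ideal)

lemma Fw_carr: "rsp ys ==> f \<in> Fw ys L \<rho> s ==> f \<in> carrier R"
 using ideal_sub[OF Fw_ideal] by blast

lemma gI_mono: "S \<subseteq> T ==> gI ys S \<subseteq> gI ys T"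
 unfolding gI_def by (rule genideal_mono) (rule image_mono)

lemma Fw_antimono: "s \<le> ta ==> Fw ys L \<rho> ta \<subseteq> Fw ys L \<rho> s"
 unfolding Fw_def by (rule gI_mono) auto

lemma Fw_mult:
 assumes "rsp ys" "f \<in> Fw ys L \<rho> s" "g \<in> Fw ys L \<rho> ta"
 shows "f \<otimes> g \<in> Fw ys L \<rho> (s + ta)"
proof -
 interpret sp: split_parameters R us ys M by (rule rsp_split[OF assms(1)])
 show ?thesis unfolding Fw_def gI_def
  by (rule sp.mI_mult[OF assms(2)[unfolded Fw_def gI_def] assms(3)[unfolded Fw_def gI_def]])
    (auto simp: algebra_simps)
qed

lemma gI_memI: "rsp ys ==> al \<in> S ==> mon R (\<lambda>i. (us @ ys) ! i) (length us + length ys) al \<in> gI ys S"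
proof -
 assume "rsp ys" "al \<in> S"
 interpret sp: split_parameters R us ys M by (rule rsp_split[OF \<open>rsp ys\<close>])
 show ?thesis unfolding gI_def by (rule sp.mI_memI[OF \<open>al \<in> S\<close>])
qed

lemma Fw_one: "rsp ys ==> \<one> \<in> Fw ys L \<rho> 0"
proof -
 assume y: "rsp ys"
 interpret sp: split_parameters R us ys M by (rule rsp_split[OF y])
 have "sp.mx 0 \<in> Fw ys L \<rho> 0" unfolding Fw_def by (rule gI_memI[OF y]) (simp add: ydeg_def)
 thus ?thesis by simp
qed

lemma Fw_us: "rsp ys ==> i < e ==> us ! i \<in> Fw ys L \<rho> (L i)"
proof -
 assume y: "rsp ys" and i: "i < e"
 interpret sp: split_parameters R us ys M by (rule rsp_split[OF y])
 have d: "ydeg e (length ys) (unit_exp i) = 0" using i by (simp add: ydeg_def unit_exp_def)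
 have w: "wt e L (unit_exp i) = L i" using i by (rule wt_unit)
 have "sp.mx (unit_exp i) \<in> Fw ys L \<rho> (L i)"
  unfolding Fw_def by (rule gI_memI[OF y]) (use i d w in simp)
 thus ?thesis using mon_unit[OF sp.x_closed, of i] i by (simp add: nth_append)
qed

lemma Fw_ys: "rsp ys ==> j < length ys ==> ys ! j \<in> Fw ys L \<rho> \<rho>"
proof -
 assume y: "rsp ys" and j: "j < length ys"
 interpret sp: split_parameters R us ys M by (rule rsp_split[OF y])
 have d: "ydeg e (length ys) (unit_exp (e + j)) = 1" using j by (simp add: ydeg_def unit_exp_def)
 have w: "wt e L (unit_exp (e + j)) = 0" by (simp add: wt_def unit_exp_def)
 have "sp.mx (unit_exp (e + j)) \<in> Fw ys L \<rho> \<rho>"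
  unfolding Fw_def by (rule gI_memI[OF y]) (use j d w in simp)
 thus ?thesis using mon_unit[OF sp.x_closed, of "e + j"] j by (simp add: nth_append)
qed

lemma mon_Fw:
 assumes y: "rsp ys" and z: "\<And>i. i < m ==> z i \<in> Fw ys L \<rho> (w i)"
 shows "mon R z m al \<in> Fw ys L \<rho> (wt m w al)"
 by (rule mon_filtered[of "Fw ys L \<rho>"]) (use Fw_ideal[OF y] Fw_mult[OF y] Fw_one[OF y] z in auto)

lemma um_Fw: "rsp ys ==> um A \<in> Fw ys L \<rho> (wt e L A)"
 unfolding um_def by (rule mon_Fw) (use Fw_us in auto)

lemma um_closed: "rsp ys ==> um A \<in> carrier R"
 using um_Fw Fw_carr by blast

lemma mon_change_Fw:
 assumes y: "rsp ys" and len: "length ys' = length ys" and z: "\<And>j. j < length ys ==> ys' ! j \<in> Fw ys L \<rho> \<rho>"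
 shows "mon R (\<lambda>i. (us @ ys') ! i) (length us + length ys') al
  \<in> Fw ys L \<rho> (wt e L al + \<rho> * real (ydeg e (length ys) al))"
proof -
 have "mon R (\<lambda>i. (us @ ys') ! i) (length us + length ys') al
  \<in> Fw ys L \<rho> (wt (length us + length ys') (\<lambda>i. if i < e then L i else \<rho>) al)"
 proof (rule mon_Fw[OF y])
  fix i assume i: "i < length us + length ys'"
  show "(us @ ys') ! i \<in> Fw ys L \<rho> (if i < e then L i else \<rho>)"
   using Fw_us[OF y, of i] z[of "i - e"] i len by (simp add: nth_append)
 qed
 thus ?thesis unfolding wt_ydeg len .
qed

text \<open>The filtration is multiplicative, so only the weights of the new elements matter. All
  comparisons of polyhedra for different systems go through this inclusion.\<close>

lemma Fw_change:
 assumes y: "rsp ys" and len: "length ys' = length ys" and z: "\<And>j. j < length ys ==> ys' ! j \<in> Fw ys L \<rho> \<rho>"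
 shows "Fw ys' L \<rho> s \<subseteq> Fw ys L \<rho> s"
 unfolding Fw_def[of ys'] gI_def
proof (rule genideal_minimal[OF Fw_ideal[OF y]], rule image_subsetI)
 fix al assume "al \<in> {al \<in> exps (e + length ys'). s \<le> wt e L al + \<rho> * real (ydeg e (length ys') al)}"
 hence "s \<le> wt e L al + \<rho> * real (ydeg e (length ys) al)" using len by simp
 thus "mon R (\<lambda>i. (us @ ys') ! i) (e + length ys') al \<in> Fw ys L \<rho> s"
  using mon_change_Fw[OF y len z] Fw_antimono by blast
qed

lemma newton_newt: "rsp ys ==> split_parameters.newton R us ys J b = newt ys"
proof -
 assume y: "rsp ys"
 interpret sp: split_parameters R us ys M by (rule rsp_split[OF y])
 show ?thesis unfolding sp.newton_def newt_def Fw_def heavy_def gI_def ..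
qed

lemma rsp_change:
 assumes y: "rsp ys" and len: "length ys' = length ys"
  and z: "\<And>j. j < length ys ==> ys' ! j \<in> carrier R \<and> ys' ! j \<ominus> ys ! j \<in> Idl (set us)"
 shows "rsp ys'"
proof -
 have uc: "set us \<subseteq> carrier R" and yc: "set ys \<subseteq> carrier R" using rsp_carrier[OF y] by auto
 have y'c: "set ys' \<subseteq> carrier R"
 proof
  fix a assume "a \<in> set ys'"
  thus "a \<in> carrier R" using z len by (metis in_set_conv_nth)
 qed
 have c: "set us \<union> set ys \<subseteq> carrier R" "set us \<union> set ys' \<subseteq> carrier R" using uc yc y'c by auto
 note I = genideal_ideal[OF c(1)] and I' = genideal_ideal[OF c(2)]
 have us: "Idl (set us) \<subseteq> Idl (set us \<union> set ys)" "Idl (set us) \<subseteq> Idl (set us \<union> set ys')" by (auto intro!: genideal_mono)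
 have d: "ys' ! j \<ominus> ys ! j \<in> Idl (set us)" "ys' ! j \<in> carrier R" "ys ! j \<in> carrier R" if "j < length ys" for j
  using z[OF that] rsp_nth(2)[OF y that] by auto
 have "Idl (set us \<union> set ys') \<subseteq> Idl (set us \<union> set ys)"
 proof (rule genideal_minimal[OF I], rule Un_least)
  show "set us \<subseteq> Idl (set us \<union> set ys)" using genideal_self[OF c(1)] by blast
  show "set ys' \<subseteq> Idl (set us \<union> set ys)"
  proof
   fix a assume "a \<in> set ys'"
   then obtain j where j: "j < length ys" "a = ys' ! j" using len by (metis in_set_conv_nth)
   have "ys ! j \<in> Idl (set us \<union> set ys)" using genideal_self[OF c(1)] nth_mem[OF j(1)] by blast
   moreover have "ys' ! j \<ominus> ys ! j \<in> Idl (set us \<union> set ys)" using d(1)[OF j(1)] us(1) by blast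
   ultimately show "a \<in> Idl (set us \<union> set ys)" unfolding j(2) using ideal_minusE1[OF I] d(2)[OF j(1)] by blast
  qed
 qed
 moreover have "Idl (set us \<union> set ys) \<subseteq> Idl (set us \<union> set ys')"
 proof (rule genideal_minimal[OF I'], rule Un_least)
  show "set us \<subseteq> Idl (set us \<union> set ys')" using genideal_self[OF c(2)] by blast
  show "set ys \<subseteq> Idl (set us \<union> set ys')"
  proof
   fix a assume "a \<in> set ys"
   then obtain j where j: "j < length ys" "a = ys ! j" by (metis in_set_conv_nth)
   have "ys' ! j \<in> Idl (set us \<union> set ys')" using genideal_self[OF c(2)] nth_mem[of j ys'] j(1) len by auto
   moreover have "ys' ! j \<ominus> ys ! j \<in> Idl (set us \<union> set ys')" using d(1)[OF j(1)] us(2) by blast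
   ultimately have "ys' ! j \<ominus> (ys' ! j \<ominus> ys ! j) \<in> Idl (set us \<union> set ys')" by (rule ideal_minus[OF I'])
   moreover have "ys' ! j \<ominus> (ys' ! j \<ominus> ys ! j) = ys ! j" using d(2,3)[OF j(1)] by algebra
   ultimately show "a \<in> Idl (set us \<union> set ys')" unfolding j(2) by simp
  qed
 qed
 ultimately have "Idl (set us \<union> set ys') = Idl (set us \<union> set ys)" by blast
 thus ?thesis using y c(2) len unfolding rsp_def by simp
qed

lemma um_us: "rsp ys ==> A \<in> exps e ==> A \<noteq> 0 ==> um A \<in> Idl (set us)"
proof -
 assume y: "rsp ys" and A: "A \<in> exps e" "A \<noteq> 0"
 have "tdeg e A > 0" using A tdeg_eq_0 by blast
 then obtain i where i: "i < e" "unit_exp i \<le> A" using exp_pos[OF A(1)] by blast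
 have uc: "(\<lambda>i. us ! i) \<in> {..<e} \<rightarrow> carrier R" using rsp_nth(1)[OF y] by auto
 have "um A = mon R (\<lambda>i. us ! i) e (A - unit_exp i) \<otimes> us ! i"
  unfolding um_def using mon_le[OF uc i(2)] mon_unit[OF uc i(1)] by simp
 moreover have "us ! i \<in> Idl (set us)" using genideal_self[OF rsp_carrier(1)[OF y]] nth_mem[OF i(1)] by blast
 ultimately show ?thesis using ideal_mult[OF genideal_ideal[OF rsp_carrier(1)[OF y]] mon_closed[OF uc]] by simp
qed

lemma length_shift [simp]: "length (shift ys cs A) = length ys"
 by (simp add: shift_def)

lemma nth_shift: "j < length ys ==> shift ys cs A ! j = ys ! j \<oplus> cs ! j \<otimes> um A"
 by (simp add: shift_def)

lemma rsp_shift: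
 assumes y: "rsp ys" and cs: "length cs = length ys" "set cs \<subseteq> carrier R" and A: "A \<in> exps e" "A \<noteq> 0"
 shows "rsp (shift ys cs A)"
proof (rule rsp_change[OF y length_shift])
 fix j assume j: "j < length ys"
 have c: "ys ! j \<in> carrier R" "cs ! j \<in> carrier R" "um A \<in> carrier R"
  using rsp_nth(2)[OF y j] um_closed[OF y] cs j nth_mem[of j cs] by auto
 have "shift ys cs A ! j \<ominus> ys ! j = cs ! j \<otimes> um A" unfolding nth_shift[OF j] using c by algebra
 thus "shift ys cs A ! j \<in> carrier R \<and> shift ys cs A ! j \<ominus> ys ! j \<in> Idl (set us)"
  using c ideal_mult[OF genideal_ideal[OF rsp_carrier(1)[OF y]] c(2) um_us[OF y A]] nth_shift[OF j] by simp
qed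

lemma upset_Fw:
 assumes "\<And>i. 0 \<le> L i" "0 \<le> \<rho>"
 shows "upset (e + r) {al \<in> exps (e + r). s \<le> wt e L al + \<rho> * real (ydeg e r al)}"
 unfolding upset_def
proof (intro conjI ballI impI)
 fix al be assume *: "al \<in> {al \<in> exps (e + r). s \<le> wt e L al + \<rho> * real (ydeg e r al)}" "be \<in> exps (e + r)" "al \<le> be"
 have "wt e L al \<le> wt e L be" by (rule wt_mono[OF assms(1) *(3)])
 moreover have "\<rho> * real (ydeg e r al) \<le> \<rho> * real (ydeg e r be)"
  using ydeg_mono[OF *(3), of e r] assms(2) by (intro mult_left_mono) auto
 ultimately show "be \<in> {al \<in> exps (e + r). s \<le> wt e L al + \<rho> * real (ydeg e r al)}" using * by auto
qed auto

section \<open>A translation that does not change the initial forms\<close>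

text \<open>If both \<open>f(T)\<close> and \<open>f(T\<^sub>p + a u\<^sup>A)\<close> have only pure initial forms in \<open>T\<close>, then comparing the
 coefficients of the highest power of \<open>u\<^sup>A\<close> shows that the initial form does not involve \<open>T\<^sub>p\<close>.\<close>

lemma translation_reducible:
 assumes y: "rsp ts" and p: "p < length ts" and a: "a \<in> Units R" and A: "A \<in> exps e" "A \<noteq> 0"
  and L: "\<And>i. 0 < L i" and rho: "\<rho> = wt e L A" "\<rho> < \<rho>2"
  and J1: "f \<in> Fw ts L \<rho>2 (\<rho>2 * real b)" and J2: "f \<in> Fw (ts[p := ts ! p \<oplus> a \<otimes> um A]) L \<rho>2 (\<rho>2 * real b)"
 shows "f \<in> gI ts ({al \<in> exps (e + length ts). (\<forall>i<e. al i = 0) \<and> ydeg e (length ts) al = b \<and> al (e + p) = 0} \<union>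
   {al \<in> exps (e + length ts). \<rho> * real b < wt e L al + \<rho> * real (ydeg e (length ts) al)})"
proof -
 interpret sp: split_parameters R us ts M by (rule rsp_split[OF y])
 define r where "r = length ts"
 define q where "q = e + p"
 \<comment> \<open>The weight for which T_p and u^A are equally heavy, so that the translation is
   homogeneous.\<close>
 define \<omega> where "\<omega> al = wt e L al + \<rho> * real (ydeg e r al)" for al
 have qn: "q < e + r" using p by (simp add: q_def r_def)
 define x where "x = (\<lambda>i. (us @ ts) ! i)"
 define v where "v = x q \<oplus> a \<otimes> um A"
 define ts' where "ts' = ts[p := v]"
 have xq: "x q = ts ! p" by (simp add: x_def q_def nth_append)
 have xc: "x \<in> {..<e + r} \<rightarrow> carrier R" unfolding x_def r_def by (rule sp.x_closed)
 have ac: "a \<in> carrier R" using a by (rule Units_closed)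
 have umc: "um A \<in> carrier R" by (rule um_closed[OF y])
 have xqc: "x q \<in> carrier R" using xc qn by auto
 have vc: "v \<in> carrier R" unfolding v_def using ac umc xqc by simp
 have lt': "length ts' = r" by (simp add: ts'_def r_def)
 have y': "rsp ts'"
 proof (rule rsp_change[OF y])
  show "length ts' = length ts" using lt' r_def by simp
  fix j assume j: "j < length ts"
  have tj: "ts ! j \<in> carrier R" by (rule rsp_nth(2)[OF y j])
  note iu = genideal_ideal[OF rsp_carrier(1)[OF y]]
  show "ts' ! j \<in> carrier R \<and> ts' ! j \<ominus> ts ! j \<in> Idl (set us)"
  proof (cases "j = p")
   case True
   have "v \<ominus> ts ! p = a \<otimes> um A" unfolding v_def xq using tj True ac umc by algebra
   thus ?thesis using True j vc ideal_mult[OF iu ac um_us[OF y A]] by (simp add: ts'_def)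
  next
   case False
   thus ?thesis using tj ideal_zero[OF iu] by (simp add: ts'_def a_minus_def r_neg)
  qed
 qed
 interpret sp': split_parameters R us ts' M by (rule rsp_split[OF y'])
 define m' where "m' = mon R (\<lambda>i. (us @ ts') ! i) (length us + length ts')"
 have m': "m' be = sp.mx (be(q := 0)) \<otimes> v [^] be q" for be
 proof -
  have "m' be = mon R (x(q := v)) (e + r) be"
   unfolding m'_def lt' using xc vc p
   by (intro mon_cong) (auto simp: x_def q_def ts'_def nth_append nth_list_update Pi_def r_def)
  thus ?thesis using mon_update[OF xc qn vc] unfolding x_def r_def by simp
 qed
 have umx: "um A = sp.mx A"
 proof -
  have "sp.mx A = mon R x e A" using mon_extend[OF A(1) xc] by (simp add: x_def r_def)
  also have "\<dots> = um A"
   unfolding um_def using rsp_nth(1)[OF y] by (intro mon_cong) (auto simp: x_def nth_append)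
  finally show ?thesis ..
 qed
 have An: "A \<in> exps (e + r)" using A(1) exps_mono[of e "e + r"] by simp
 have rho0: "0 < \<rho>"
 proof -
  have t: "tdeg e A > 0" using A tdeg_eq_0 by blast
  obtain i where i: "i < e" "unit_exp i \<le> A" using exp_pos[OF A(1) t] by blast
  have "wt e L (unit_exp i) \<le> wt e L A" using L i by (intro wt_mono) (auto intro: less_imp_le)
  thus ?thesis using L[of i] wt_unit[OF i(1), of L] rho(1) by simp
 qed
 have wt0: "0 \<le> wt e L al" for al using L by (intro wt_nonneg) (auto intro: less_imp_le)
 have \<omega>_add: "\<omega> (al + be) = \<omega> al + \<omega> be" for al be by (simp add: \<omega>_def algebra_simps)
 have \<omega>_alt: "\<omega> al = wt (e + r) (\<lambda>i. if i < e then L i else \<rho>) al" for al by (simp add: \<omega>_def wt_ydeg)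
 have Lpos: "0 < (if i < e then L i else \<rho>)" for i using L rho0 by simp
 have \<omega>_mono: "\<omega> al \<le> \<omega> be" if "al \<le> be" for al be
  unfolding \<omega>_alt by (rule wt_mono[OF less_imp_le[OF Lpos] that])
 have \<omega>_unit: "0 < \<omega> (unit_exp i)" if "i < e + r" for i
  unfolding \<omega>_alt wt_unit[OF that] by (rule Lpos)
 have \<omega>_eq: "al = be" if ab: "al \<le> be" "\<omega> be \<le> \<omega> al" "al \<in> exps (e + r)" "be \<in> exps (e + r)" for al be
 proof -
  have s: "al + (be - al) = be" by (rule exp_diff_add[OF ab(1)])
  have "be - al = 0"
  proof (rule ccontr)
   assume "be - al \<noteq> 0"
   hence "tdeg (e + r) (be - al) > 0" using tdeg_eq_0 exps_diff[OF ab(4)] by blast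
   then obtain i where i: "i < e + r" "unit_exp i \<le> be - al" using exp_pos[OF exps_diff[OF ab(4)]] by blast
   have "0 < \<omega> (be - al)" using \<omega>_unit[OF i(1)] \<omega>_mono[OF i(2)] by linarith
   thus False using arg_cong[OF s, of \<omega>] \<omega>_add[of al "be - al"] ab(2) by linarith
  qed
  thus ?thesis using s by simp
 qed
 define N where "N = {al \<in> exps (e + r). \<rho> * real b < \<omega> al}"
 define P0 where "P0 = {al \<in> exps (e + r). (\<forall>i<e. al i = 0) \<and> ydeg e r al = b \<and> al q = 0}"
 define T1 where "T1 = {al \<in> exps (e + r). (\<forall>i<e. al i = 0) \<and> ydeg e r al = b \<and> 0 < al q}"
 define V where "V = {al \<in> exps (e + r). 0 < al q}"
 \<comment> \<open>The exponent that results from substituting u^A for T_p. Modulo T_p, the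
   translated monomial with exponent \<open>be\<close> is a power of the unit \<open>a\<close> times
   the monomial with exponent \<open>\<kappa> be\<close>.\<close>
 define \<kappa> where "\<kappa> be = be(q := 0) + scale_exp (be q) A" for be
 have wtP: "wt e L al = 0" if "\<forall>i<e. al i = 0" for al using that by (simp add: wt_def)
 have \<omega>P: "\<omega> al = \<rho> * real b" if "al \<in> P0 \<union> T1" for al using that wtP by (auto simp: \<omega>_def P0_def T1_def)
 have \<omega>A: "\<omega> (scale_exp k A) = real k * \<rho>" for k
  using ydeg_exps[OF scale_exps[OF A(1)]] by (simp add: \<omega>_def wt_scale rho(1))
 have split_q: "be = be(q := 0) + scale_exp (be q) (unit_exp q)" for be :: "nat => nat"
  by (auto simp: fun_eq_iff plus_fun_apply scale_exp_def unit_exp_def)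
 have \<omega>q: "\<omega> (scale_exp k (unit_exp q)) = real k * \<rho>" for k
 proof -
  have "\<omega> (scale_exp k (unit_exp q)) = real k * \<omega> (unit_exp q)" unfolding \<omega>_alt by (rule wt_scale)
  moreover have "\<omega> (unit_exp q) = \<rho>" unfolding \<omega>_alt wt_unit[OF qn] by (simp add: q_def)
  ultimately show ?thesis by simp
 qed
 have \<omega>\<kappa>: "\<omega> (\<kappa> be) = \<omega> be" for be
  using arg_cong[OF split_q[of be], of \<omega>] unfolding \<kappa>_def \<omega>_add \<omega>A \<omega>q by simp
 have q0e: "be(q := 0) \<in> exps (e + r)" if "be \<in> exps (e + r)" for be using that by (auto simp: exps_def)
 have \<kappa>e: "\<kappa> be \<in> exps (e + r)" if "be \<in> exps (e + r)" for be
  unfolding \<kappa>_def by (intro exps_add q0e that scale_exps An)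
 have Ag: "A i = 0" if "i \<ge> e" for i using A(1) that by (simp add: exps_def)
 have \<kappa>q: "\<kappa> be q = 0" for be using Ag[of q] by (simp add: \<kappa>_def plus_fun_apply scale_exp_def q_def)
 obtain i0 where i0: "i0 < e" "0 < A i0"
 proof -
  have "\<exists>i. A i \<noteq> 0" using A(2) by (auto simp: fun_eq_iff)
  thus thesis using that Ag by (metis not_less neq0_conv)
 qed
 have \<kappa>u: "\<kappa> be i = be q * A i" if "be \<in> T1" "i < e" for be i
  using that by (simp add: \<kappa>_def plus_fun_apply scale_exp_def T1_def q_def)
 have \<kappa>inj: "be = al" if ab: "be \<in> T1" "al \<in> T1" "\<kappa> be = \<kappa> al" for al be
 proof
  fix i
  have k: "be q = al q" using \<kappa>u[OF ab(1) i0(1)] \<kappa>u[OF ab(2) i0(1)] ab(3) i0(2) by simp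
  have "\<kappa> be i = \<kappa> al i" using ab(3) by simp
  thus "be i = al i" using k by (cases "i = q") (auto simp: \<kappa>_def plus_fun_apply)
 qed
 have Vid: "x q \<in> sp.mI V"
 proof -
  have "unit_exp q \<in> V" using qn by (auto simp: V_def unit_exp_def exps_def)
  hence "sp.mx (unit_exp q) \<in> sp.mI V" by (rule sp.mI_memI)
  thus ?thesis using mon_unit[OF xc qn] by (simp add: x_def r_def)
 qed
 define w where "w = a \<otimes> um A"
 have wc: "w \<in> carrier R" unfolding w_def using ac umc by simp
 have cong: "m' be \<ominus> (a [^] be q) \<otimes> sp.mx (\<kappa> be) \<in> sp.mI V" for be
 proof -
  have "w [^] be q = a [^] be q \<otimes> sp.mx (scale_exp (be q) A)"
   unfolding w_def using nat_pow_distrib[OF ac umc] mon_scale[OF sp.x_closed] umx by simp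
  moreover have "sp.mx (\<kappa> be) = sp.mx (be(q := 0)) \<otimes> sp.mx (scale_exp (be q) A)"
   unfolding \<kappa>_def by (rule sp.mx_add)
  ultimately have e1: "(a [^] be q) \<otimes> sp.mx (\<kappa> be) = sp.mx (be(q := 0)) \<otimes> w [^] be q"
   using ac sp.mx_closed by (simp add: m_lcomm)
  have "v [^] be q \<ominus> w [^] be q \<in> sp.mI V"
   unfolding v_def w_def[symmetric] by (rule power_diff_ideal[OF sp.mI_ideal Vid wc])
  hence "sp.mx (be(q := 0)) \<otimes> (v [^] be q \<ominus> w [^] be q) \<in> sp.mI V"
   by (rule ideal_mult[OF sp.mI_ideal sp.mx_closed])
  moreover have "sp.mx (be(q := 0)) \<otimes> (v [^] be q \<ominus> w [^] be q) = m' be \<ominus> (a [^] be q) \<otimes> sp.mx (\<kappa> be)"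
   unfolding m' e1 using sp.mx_closed[of "be(q := 0)"] nat_pow_closed[OF vc] nat_pow_closed[OF wc] by algebra
  ultimately show ?thesis by simp
 qed
 have m'c: "m' be \<in> carrier R" for be unfolding m' using vc by simp
 have m'P0: "m' be = sp.mx be" if "be \<in> P0" for be
 proof -
  have "be q = 0" using that by (simp add: P0_def)
  hence "be(q := 0) = be" by auto
  thus ?thesis unfolding m' using \<open>be q = 0\<close> by simp
 qed
 have ts'Fw: "ts' ! j \<in> Fw ts L \<rho> \<rho>" if j: "j < length ts" for j
 proof (cases "j = p")
  case True
  have "a \<otimes> um A \<in> Fw ts L \<rho> \<rho>" using ideal_mult[OF Fw_ideal[OF y] ac um_Fw[OF y, of A L \<rho>]] rho(1) by simp
  hence "ts ! p \<oplus> a \<otimes> um A \<in> Fw ts L \<rho> \<rho>" by (rule ideal_add[OF Fw_ideal[OF y] Fw_ys[OF y p]])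
  thus ?thesis using True j by (simp add: ts'_def v_def xq)
 next
  case False
  thus ?thesis using Fw_ys[OF y j] by (simp add: ts'_def)
 qed
 have m'N: "m' be \<in> sp.mI S" if S: "\<And>ga. ga \<in> exps (e + r) ==> \<omega> be \<le> \<omega> ga ==> ga \<in> S" for be S
 proof -
  have "m' be \<in> Fw ts L \<rho> (\<omega> be)"
   using mon_change_Fw[OF y _ ts'Fw, of be] lt' unfolding m'_def \<omega>_def r_def by simp
  moreover have "Fw ts L \<rho> (\<omega> be) \<subseteq> gI ts S"
   unfolding Fw_def by (rule gI_mono) (use S in \<open>auto simp: \<omega>_def r_def\<close>)
  ultimately show ?thesis unfolding gI_def by blast
 qed
 \<comment> \<open>As \<rho> < \<rho>2, an exponent in the \<rho>2-half space has \<omega> above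
   \<rho> b, unless it is a pure monomial of degree b in the T_j.\<close>
 have hv: "{al \<in> exps (e + r). \<rho>2 * real b \<le> wt e L al + \<rho>2 * real (ydeg e r al)} \<subseteq> T1 \<union> P0 \<union> N"
 proof
  fix al assume "al \<in> {al \<in> exps (e + r). \<rho>2 * real b \<le> wt e L al + \<rho>2 * real (ydeg e r al)}"
  hence al: "al \<in> exps (e + r)" "\<rho>2 * (real b - real (ydeg e r al)) \<le> wt e L al" by (auto simp: algebra_simps)
  consider "ydeg e r al < b" | "ydeg e r al = b" | "b < ydeg e r al" by linarith
  thus "al \<in> T1 \<union> P0 \<union> N"
  proof cases
   case 1
   hence "\<rho> * (real b - real (ydeg e r al)) < \<rho>2 * (real b - real (ydeg e r al))"
    using rho(2) by (intro mult_strict_right_mono) auto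
   hence "al \<in> N" using al by (auto simp: N_def \<omega>_def algebra_simps)
   thus ?thesis by blast
  next
   case 2
   show ?thesis
   proof (cases "\<forall>i<e. al i = 0")
    case True
    thus ?thesis using 2 al(1) by (auto simp: T1_def P0_def)
   next
    case False
    then obtain i where i: "i < e" "al i \<noteq> 0" by blast
    hence "unit_exp i \<le> al" by (auto simp: le_fun_def unit_exp_def)
    hence "wt e L (unit_exp i) \<le> wt e L al" using L by (intro wt_mono) (auto intro: less_imp_le)
    hence "0 < wt e L al" using L[of i] wt_unit[OF i(1), of L] by simp
    hence "al \<in> N" using 2 al(1) by (auto simp: N_def \<omega>_def)
    thus ?thesis by blast
   qed
  next
   case 3
   hence "\<rho> * real b < \<rho> * real (ydeg e r al)" using rho0 by simp
   hence "al \<in> N" using al(1) wt0[of al] by (auto simp: N_def \<omega>_def)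
   thus ?thesis by blast
  qed
 qed
 have m'S: "m' be \<in> sp.mI S" if b: "be \<in> P0 \<union> N" and S: "P0 \<union> N \<subseteq> S" for be S
 proof (cases "be \<in> P0")
  case True
  show ?thesis unfolding m'P0[OF True] by (rule sp.mI_memI) (use True S in blast)
 next
  case False
  hence "be \<in> N" using b by blast
  thus ?thesis using S by (intro m'N) (force simp: N_def)
 qed
 define H where "H = {al \<in> exps (e + r). \<rho>2 * real b \<le> wt e L al + \<rho>2 * real (ydeg e r al)}"
 have "0 \<le> L i" for i using L[of i] by simp
 hence upH: "upset (e + r) H" unfolding H_def using rho rho0 by (intro upset_Fw) auto
 obtain T g where ex: "sp'.expansion f T g" using sp'.expansion_exists[OF noeth Fw_carr[OF y J1]] by blast
 hence T: "finite T" "g \<in> T \<rightarrow> Units R" "f = (\<Oplus>be\<in>T. g be \<otimes> m' be)"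
  unfolding sp'.expansion_def m'_def by blast+
 have gc: "g be \<in> carrier R" if "be \<in> T" for be using T(2) that Units_closed by blast
 have "f \<in> sp'.mI H"
  using J2 unfolding Fw_def gI_def ts'_def[symmetric] v_def[unfolded xq, symmetric] lt' H_def .
 hence "T \<subseteq> H" using sp'.expansion_mem_iff[OF ex upH[folded lt']] by blast
 hence TH: "T \<subseteq> T1 \<union> P0 \<union> N" using hv unfolding H_def by blast
 have "al \<notin> T1" if aT': "al \<in> T" for al
 proof
  assume aT: "al \<in> T1"
  have ae: "al \<in> exps (e + r)" using aT by (simp add: T1_def)
  define S where "S = {be \<in> exps (e + r). \<rho> * real b \<le> \<omega> be \<and> be \<noteq> \<kappa> al} \<union> V"
  have wk: "\<omega> (\<kappa> al) = \<rho> * real b" using \<omega>\<kappa> \<omega>P aT by simp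
  have up: "upset (e + r) S"
   unfolding upset_def
  proof (intro conjI ballI impI)
   show "S \<subseteq> exps (e + r)" by (auto simp: S_def V_def)
   fix be ga assume bg: "be \<in> S" "ga \<in> exps (e + r)" "be \<le> ga"
   show "ga \<in> S"
   proof (cases "be \<in> V")
    case True
    hence "0 < ga q" using bg(3) by (auto simp: V_def le_fun_def intro: less_le_trans)
    thus ?thesis using bg(2) by (simp add: S_def V_def)
   next
    case False
    hence b: "be \<in> exps (e + r)" "\<rho> * real b \<le> \<omega> be" "be \<noteq> \<kappa> al" using bg(1) by (auto simp: S_def)
    have "\<omega> be \<le> \<omega> ga" using \<omega>_mono bg(3) by blast
    moreover have "ga \<noteq> \<kappa> al"
    proof
     assume g: "ga = \<kappa> al"
     hence "\<omega> ga \<le> \<omega> be" using wk b(2) by simp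
     hence "be = ga" using \<omega>_eq[OF bg(3) _ b(1) bg(2)] by blast
     thus False using g b(3) by simp
    qed
    ultimately show ?thesis using b(2) bg(2) by (simp add: S_def)
   qed
  qed
  have ks: "\<kappa> al \<notin> S" using \<kappa>q[of al] by (simp add: S_def V_def)
  have VS: "sp.mI V \<subseteq> sp.mI S" by (rule sp.mI_mono) (simp add: S_def)
  \<comment> \<open>\<open>\<kappa> al\<close> involves some u_i, whereas the initial monomials of f
    in the untranslated system are free of u. So f does not contain the monomial of
    \<open>\<kappa> al\<close>.\<close>
  have ku: "\<kappa> al i0 \<noteq> 0" using \<kappa>u[OF aT i0(1)] i0(2) aT by (simp add: T1_def)
  have PS: "be \<in> S" if "be \<in> T1 \<union> P0 \<union> N" for be
  proof (cases "be \<in> N")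
   case True
   thus ?thesis using wk by (auto simp: S_def N_def)
  next
   case False
   hence b: "be \<in> P0 \<union> T1" using that by blast
   hence "be i0 = 0" using i0(1) by (auto simp: P0_def T1_def)
   hence "be \<noteq> \<kappa> al" using ku by auto
   moreover have "be \<in> exps (e + r)" using b by (auto simp: P0_def T1_def)
   ultimately show ?thesis using \<omega>P[OF b] by (simp add: S_def)
  qed
  have fS: "f \<in> sp.mI S"
  proof -
   have "f \<in> sp.mI H" using J1 unfolding Fw_def gI_def r_def H_def .
   moreover have "H \<subseteq> S" using hv PS unfolding H_def by blast
   ultimately show ?thesis using sp.mI_mono by blast
  qed
  have rest: "m' be \<in> sp.mI S" if b: "be \<in> T" "be \<noteq> al" for be
  proof (cases "be \<in> T1")
   case True
   hence "\<kappa> be \<noteq> \<kappa> al" using \<kappa>inj[OF _ aT] b(2) by blast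
   moreover have "\<omega> (\<kappa> be) = \<rho> * real b" using \<omega>\<kappa> \<omega>P True by simp
   moreover have "\<kappa> be \<in> exps (e + r)" using True by (intro \<kappa>e) (simp add: T1_def)
   ultimately have "\<kappa> be \<in> S" by (simp add: S_def)
   hence "(a [^] be q) \<otimes> sp.mx (\<kappa> be) \<in> sp.mI S"
    using ac by (intro ideal_mult[OF sp.mI_ideal] sp.mI_memI) auto
   thus ?thesis using ideal_minusE1[OF sp.mI_ideal _ _ m'c] cong[of be] VS by blast
  next
   case False
   thus ?thesis using m'S[of be S] PS TH b(1) by blast
  qed
  have gu: "g al \<in> Units R" using T(2) aT' by blast
  have "f = g al \<otimes> m' al \<oplus> (\<Oplus>be\<in>T - {al}. g be \<otimes> m' be)"
   unfolding T(3) using gc m'c by (intro finsum_remove[OF T(1) aT']) auto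
  hence "g al \<otimes> m' al \<oplus> (\<Oplus>be\<in>T - {al}. g be \<otimes> m' be) \<in> sp.mI S" using fS by simp
  moreover have "(\<Oplus>be\<in>T - {al}. g be \<otimes> m' be) \<in> sp.mI S"
   using gc rest by (intro ideal_finsum[OF sp.mI_ideal] ideal_mult[OF sp.mI_ideal]) auto
  ultimately have "g al \<otimes> m' al \<in> sp.mI S"
   using ideal_addE1[OF sp.mI_ideal] gc[OF aT'] m'c by blast
  hence mS: "m' al \<in> sp.mI S" by (rule unit_cancel[OF gu m'c sp.mI_ideal])
  have pc: "a [^] al q \<otimes> sp.mx (\<kappa> al) \<in> carrier R" using ac by simp
  have "m' al \<ominus> (m' al \<ominus> (a [^] al q) \<otimes> sp.mx (\<kappa> al)) \<in> sp.mI S"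
   by (rule ideal_minus[OF sp.mI_ideal mS subsetD[OF VS cong]])
  moreover have "m' al \<ominus> (m' al \<ominus> (a [^] al q) \<otimes> sp.mx (\<kappa> al)) = (a [^] al q) \<otimes> sp.mx (\<kappa> al)"
   using m'c[of al] pc by algebra
  ultimately have "(a [^] al q) \<otimes> sp.mx (\<kappa> al) \<in> sp.mI S" by simp
  hence "sp.mx (\<kappa> al) \<in> sp.mI S"
   by (rule unit_cancel[OF Units_pow_closed[OF a] sp.mx_closed sp.mI_ideal])
  thus False using sp.monomial_not_mem[OF up[unfolded r_def]] ks \<kappa>e[OF ae] unfolding r_def by blast
 qed
 hence "T \<subseteq> P0 \<union> N" using TH by blast
 hence "f \<in> sp.mI (P0 \<union> N)"
  unfolding T(3) using gc m'S by (intro ideal_finsum[OF sp.mI_ideal] ideal_mult[OF sp.mI_ideal]) auto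
 thus ?thesis unfolding gI_def P0_def N_def \<omega>_def r_def q_def .
qed

end

section \<open>Solving vertices\<close>

context pair_setup
begin

lemma monomial_closed: "set ts \<subseteq> carrier R ==> monomial R ts B \<in> carrier R"
 unfolding monomial_def by (intro finprod_closed) (auto simp: subset_iff)

text \<open>Monomials that contain some u_i lie in the ideal of u, and pure monomials heavier than
  \<rho> b have degree above b, hence lie in M^(b+1). What remains are the monomials of degree b
  without T_p.\<close>

lemma reducible_degenerate:
 assumes y: "rsp ts" and p: "p < length ts" and rho: "0 < \<rho>"
  and J: "J \<subseteq> gI ts ({al \<in> exps (e + length ts). (\<forall>i<e. al i = 0) \<and> ydeg e (length ts) al = b \<and> al (e + p) = 0} \<union>
   {al \<in> exps (e + length ts). \<rho> * real b < wt e L al + \<rho> * real (ydeg e (length ts) al)})"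
 shows "degenerate (length ts)"
proof -
 interpret sp: split_parameters R us ts M by (rule rsp_split[OF y])
 let ?B = "{B. length B = length ts \<and> sum_list B = b \<and> B ! p = 0}"
 let ?G = "set us \<union> monomial R ts ` ?B \<union> ideal_power R M (Suc b)"
 have tc: "set ts \<subseteq> carrier R" by (rule rsp_carrier(2)[OF y])
 have G: "?G \<subseteq> carrier R"
  using rsp_carrier(1)[OF y] monomial_closed[OF tc] ideal_sub[OF ideal_power_ideal[OF maxideal(1)]] by blast
 have self: "?G \<subseteq> Idl ?G" by (rule genideal_self[OF G])
 note I = genideal_ideal[OF G]
 have "gI ts ({al \<in> exps (e + length ts). (\<forall>i<e. al i = 0) \<and> ydeg e (length ts) al = b \<and> al (e + p) = 0} \<union>
   {al \<in> exps (e + length ts). \<rho> * real b < wt e L al + \<rho> * real (ydeg e (length ts) al)}) \<subseteq> Idl ?G"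
  unfolding gI_def
 proof (rule genideal_minimal[OF I], rule image_subsetI)
  fix al assume a: "al \<in> {al \<in> exps (e + length ts). (\<forall>i<e. al i = 0) \<and> ydeg e (length ts) al = b \<and> al (e + p) = 0} \<union>
   {al \<in> exps (e + length ts). \<rho> * real b < wt e L al + \<rho> * real (ydeg e (length ts) al)}"
  hence ae: "al \<in> exps (e + length ts)" by blast
  show "sp.mx al \<in> Idl ?G"
  proof (cases "\<forall>i<e. al i = 0")
   case False
   then obtain i where i: "i < e" "al i \<noteq> 0" by blast
   hence le: "unit_exp i \<le> al" by (auto simp: le_fun_def unit_exp_def)
   have "sp.mx al = sp.mx (al - unit_exp i) \<otimes> us ! i"
    using mon_le[OF sp.x_closed le] mon_unit[OF sp.x_closed, of i] i(1) by (simp add: nth_append)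
   moreover have "us ! i \<in> Idl ?G" using self nth_mem[OF i(1)] by blast
   ultimately show ?thesis using ideal_mult[OF I sp.mx_closed] by simp
  next
   case z: True
   hence w: "wt e L al = 0" by (simp add: wt_def)
   show ?thesis
   proof (cases "ydeg e (length ts) al = b \<and> al (e + p) = 0")
    case True
    let ?A = "fst (split_exp e (length ts) al)" and ?Y = "snd (split_exp e (length ts) al)"
    have "sp.mx al = monomial R us ?A \<otimes> monomial R ts ?Y"
     using sp.monomial_join[of ?A ?Y] join_split[OF ae] by simp
    moreover have "monomial R us ?A = \<one>"
     unfolding monomial_def using z by (intro finprod_one_eqI) (auto simp: split_exp_def)
    moreover have "?Y \<in> ?B" using True p
     by (auto simp: split_exp_def ydeg_def sum_list_sum_nth atLeast0LessThan)
    ultimately show ?thesis using self monomial_closed[OF tc] by auto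
   next
    case False
    hence "\<rho> * real b < \<rho> * real (ydeg e (length ts) al)" using a w by auto
    hence "Suc b \<le> ydeg e (length ts) al" using rho by simp
    hence "Suc b \<le> tdeg (e + length ts) al" by (simp add: tdeg_ydeg)
    hence "sp.mx al \<in> ideal_power R M (Suc b)" by (rule sp.mx_power_M[OF ae])
    thus ?thesis using self by blast
   qed
  qed
 qed
 hence "J \<subseteq> Idl ?G" using J by blast
 thus ?thesis unfolding degenerate_def using p rsp_M(2)[OF y] by blast
qed

text \<open>The linear change t_j = y_j - (c_j / c_p) y_p for j \<noteq> p, with t_p = y_p, turns
  the translation in direction \<open>cs\<close> into one that moves t_p alone, as
  \<open>translation_reducible\<close> requires.\<close>

lemma direction_degenerate:
 assumes y: "rsp ys" and cs: "length cs = length ys" "set cs \<subseteq> carrier R" and p: "p < length ys" "cs ! p \<in> Units R"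
  and A: "A \<in> exps e" "A \<noteq> 0" and L: "\<And>i. 0 < L i" and rho: "wt e L A < \<rho>2"
  and J1: "J \<subseteq> Fw ys L \<rho>2 (\<rho>2 * real b)" and J2: "J \<subseteq> Fw (shift ys cs A) L \<rho>2 (\<rho>2 * real b)"
 shows "degenerate (length ys)"
proof -
 define r where "r = length ys"
 define k where "k = inv (cs ! p)"
 define ts where "ts = map (\<lambda>j. if j = p then ys ! p else ys ! j \<ominus> (cs ! j \<otimes> k) \<otimes> ys ! p) [0..<r]"
 define z where "z = um A"
 define ts' where "ts' = ts[p := ts ! p \<oplus> cs ! p \<otimes> z]"
 have lts: "length ts = r" by (simp add: ts_def)
 have pr: "p < r" using p by (simp add: r_def)
 have zc: "z \<in> carrier R" unfolding z_def by (rule um_closed[OF y])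
 have kc: "k \<in> carrier R" unfolding k_def using p(2) by simp
 have csc: "cs ! j \<in> carrier R" if "j < r" for j using cs that nth_mem[of j cs] r_def by auto
 have yc: "ys ! j \<in> carrier R" if "j < r" for j using rsp_nth(2)[OF y] that r_def by simp
 have kp: "k \<otimes> cs ! p = \<one>" unfolding k_def using p(2) by simp
 have tsp: "ts ! p = ys ! p" using pr by (simp add: ts_def)
 have tsj: "ts ! j = ys ! j \<ominus> (cs ! j \<otimes> k) \<otimes> ys ! p" if "j < r" "j \<noteq> p" for j using that by (simp add: ts_def)
 have tc: "ts ! j \<in> carrier R" if "j < r" for j
  using tsp tsj[OF that] yc[OF that] yc[OF pr] csc[OF that] kc by (cases "j = p") auto
 have ysj: "ys ! j = ts ! j \<oplus> (cs ! j \<otimes> k) \<otimes> ts ! p" if "j < r" "j \<noteq> p" for j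
  unfolding tsj[OF that] tsp using yc[OF that(1)] yc[OF pr] csc[OF that(1)] kc by algebra
 have yset: "set ts \<subseteq> carrier R" using tc lts by (metis in_set_conv_nth subsetI)
 have c: "set us \<union> set ys \<subseteq> carrier R" "set us \<union> set ts \<subseteq> carrier R" using rsp_carrier[OF y] yset by auto
 note I = genideal_ideal[OF c(1)] and I' = genideal_ideal[OF c(2)]
 note self = genideal_self[OF c(1)] and self' = genideal_self[OF c(2)]
 have yt: "rsp ts"
 proof -
  have "Idl (set us \<union> set ts) \<subseteq> Idl (set us \<union> set ys)"
  proof (rule genideal_minimal[OF I], rule Un_least)
   show "set us \<subseteq> Idl (set us \<union> set ys)" using self by blast
   show "set ts \<subseteq> Idl (set us \<union> set ys)"
   proof
    fix t assume "t \<in> set ts"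
    then obtain j where j: "j < r" "t = ts ! j" using lts by (metis in_set_conv_nth)
    have yj: "ys ! i \<in> Idl (set us \<union> set ys)" if "i < r" for i using self nth_mem[of i ys] that r_def by blast
    show "t \<in> Idl (set us \<union> set ys)"
    proof (cases "j = p")
     case True
     thus ?thesis using j tsp yj pr by simp
    next
     case False
     show ?thesis unfolding j(2) tsj[OF j(1) False]
      by (intro ideal_minus[OF I] ideal_mult[OF I] yj j(1) pr m_closed csc kc)
    qed
   qed
  qed
  moreover have "Idl (set us \<union> set ys) \<subseteq> Idl (set us \<union> set ts)"
  proof (rule genideal_minimal[OF I'], rule Un_least)
   show "set us \<subseteq> Idl (set us \<union> set ts)" using self' by blast
   show "set ys \<subseteq> Idl (set us \<union> set ts)"
   proof
    fix t assume "t \<in> set ys"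
    then obtain j where j: "j < r" "t = ys ! j" using r_def by (metis in_set_conv_nth)
    have tj: "ts ! i \<in> Idl (set us \<union> set ts)" if "i < r" for i using self' nth_mem[of i ts] that lts by blast
    show "t \<in> Idl (set us \<union> set ts)"
    proof (cases "j = p")
     case True
     thus ?thesis using j tsp[symmetric] tj pr by simp
    next
     case False
     show ?thesis unfolding j(2) ysj[OF j(1) False]
      by (intro ideal_add[OF I'] ideal_mult[OF I'] tj j(1) pr m_closed csc kc)
    qed
   qed
  qed
  ultimately have "Idl (set us \<union> set ts) = Idl (set us \<union> set ys)" by blast
  thus ?thesis using y c(2) lts unfolding rsp_def r_def by simp
 qed
 have ts'p: "ts' ! p = ts ! p \<oplus> cs ! p \<otimes> z" using pr lts by (simp add: ts'_def)
 have ts'j: "ts' ! j = ts ! j" if "j \<noteq> p" for j using that by (simp add: ts'_def)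
 have lts': "length ts' = r" by (simp add: ts'_def lts)
 note iu = genideal_ideal[OF rsp_carrier(1)[OF y]]
 have zu: "z \<in> Idl (set us)" unfolding z_def by (rule um_us[OF y A])
 have yt': "rsp ts'"
 proof (rule rsp_change[OF yt])
  show "length ts' = length ts" using lts lts' by simp
  fix j assume "j < length ts"
  hence j: "j < r" using lts by simp
  show "ts' ! j \<in> carrier R \<and> ts' ! j \<ominus> ts ! j \<in> Idl (set us)"
  proof (cases "j = p")
   case True
   have "(ts ! p \<oplus> cs ! p \<otimes> z) \<ominus> ts ! p = cs ! p \<otimes> z" using tc[OF pr] csc[OF pr] zc by algebra
   thus ?thesis using True ts'p tc[OF pr] csc[OF pr] zc ideal_mult[OF iu csc[OF pr] zu] by simp
  next
   case False
   thus ?thesis using ts'j tc[OF j] ideal_zero[OF iu] by (simp add: a_minus_def r_neg)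
  qed
 qed
 have tF: "ts ! j \<in> Fw ts L \<rho>2 \<rho>2" if "j < r" for j using Fw_ys[OF yt] that lts by simp
 have t'F: "ts' ! j \<in> Fw ts' L \<rho>2 \<rho>2" if "j < r" for j using Fw_ys[OF yt'] that lts' by simp
 have "Fw ys L \<rho>2 (\<rho>2 * real b) \<subseteq> Fw ts L \<rho>2 (\<rho>2 * real b)"
 proof (rule Fw_change[OF yt])
  show "length ys = length ts" using lts r_def by simp
  fix j assume "j < length ts"
  hence j: "j < r" using lts by simp
  show "ys ! j \<in> Fw ts L \<rho>2 \<rho>2"
  proof (cases "j = p")
   case True
   thus ?thesis using tF[OF pr] tsp by simp
  next
   case False
   show ?thesis unfolding ysj[OF j False]
    by (intro ideal_add[OF Fw_ideal[OF yt]] ideal_mult[OF Fw_ideal[OF yt]] tF j pr m_closed csc kc)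
  qed
 qed
 hence J1': "J \<subseteq> Fw ts L \<rho>2 (\<rho>2 * real b)" using J1 by blast
 have "Fw (shift ys cs A) L \<rho>2 (\<rho>2 * real b) \<subseteq> Fw ts' L \<rho>2 (\<rho>2 * real b)"
 proof (rule Fw_change[OF yt'])
  show "length (shift ys cs A) = length ts'" using lts' r_def by simp
  fix j assume "j < length ts'"
  hence j: "j < r" using lts' by simp
  hence sj: "shift ys cs A ! j = ys ! j \<oplus> cs ! j \<otimes> z" unfolding z_def r_def by (rule nth_shift)
  show "shift ys cs A ! j \<in> Fw ts' L \<rho>2 \<rho>2"
  proof (cases "j = p")
   case True
   thus ?thesis using t'F[OF pr] ts'p tsp sj by simp
  next
   case False
   have "ys ! j \<oplus> cs ! j \<otimes> z = ts ! j \<oplus> (cs ! j \<otimes> k) \<otimes> (ts ! p \<oplus> cs ! p \<otimes> z)"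
   proof -
    have "ts ! j \<oplus> (cs ! j \<otimes> k) \<otimes> (ts ! p \<oplus> cs ! p \<otimes> z)
     = (ts ! j \<oplus> (cs ! j \<otimes> k) \<otimes> ts ! p) \<oplus> (cs ! j \<otimes> (k \<otimes> cs ! p)) \<otimes> z"
     using tc[OF j] tc[OF pr] csc[OF j] csc[OF pr] kc zc by algebra
    also have "\<dots> = ys ! j \<oplus> cs ! j \<otimes> z" unfolding kp ysj[OF j False, symmetric] using csc[OF j] by simp
    finally show ?thesis ..
   qed
   hence e: "shift ys cs A ! j = ts' ! j \<oplus> (cs ! j \<otimes> k) \<otimes> ts' ! p" unfolding sj ts'p ts'j[OF False] .
   show ?thesis unfolding e
    by (intro ideal_add[OF Fw_ideal[OF yt']] ideal_mult[OF Fw_ideal[OF yt']] t'F j pr m_closed csc kc)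
  qed
 qed
 hence J2': "J \<subseteq> Fw ts' L \<rho>2 (\<rho>2 * real b)" using J2 by blast
 have pt: "p < length ts" using pr lts by simp
 have rho0: "0 < wt e L A"
 proof -
  have t: "tdeg e A > 0" using A tdeg_eq_0 by blast
  obtain i where i: "i < e" "unit_exp i \<le> A" using exp_pos[OF A(1) t] by blast
  have "wt e L (unit_exp i) \<le> wt e L A" using L i by (intro wt_mono) (auto intro: less_imp_le)
  thus ?thesis using L[of i] wt_unit[OF i(1), of L] by simp
 qed
 have "degenerate (length ts)"
 proof (rule reducible_degenerate[OF yt pt rho0], rule subsetI)
  fix f assume f: "f \<in> J"
  show "f \<in> gI ts ({al \<in> exps (e + length ts). (\<forall>i<e. al i = 0) \<and> ydeg e (length ts) al = b \<and> al (e + p) = 0} \<union>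
   {al \<in> exps (e + length ts). wt e L A * real b < wt e L al + wt e L A * real (ydeg e (length ts) al)})"
  proof (rule translation_reducible[OF yt pt p(2) A L refl rho])
   show "f \<in> Fw ts L \<rho>2 (\<rho>2 * real b)" using f J1' by blast
   show "f \<in> Fw (ts[p := ts ! p \<oplus> cs ! p \<otimes> um A]) L \<rho>2 (\<rho>2 * real b)"
    using f J2' unfolding ts'_def z_def by blast
  qed
 qed
 thus ?thesis using lts r_def by simp
qed

section \<open>Finite sums of monomials in u and the normal form of a system\<close>

definition usum :: "(nat => nat) set => ((nat => nat) => 'a) => 'a" where
 "usum T g = (\<Oplus>ta\<in>T. g ta \<otimes> um ta)"

definition unit_coeffs :: "(nat => nat) set => ((nat => nat) => 'a) => bool" where
 "unit_coeffs T g \<longleftrightarrow> finite T \<and> T \<subseteq> exps e \<and> g \<in> T \<rightarrow> Units R"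

lemma unit_coeffs_carr: "unit_coeffs T g ==> ta \<in> T ==> g ta \<in> carrier R"
 unfolding unit_coeffs_def using Units_closed by blast

lemma usum_ideal:
 assumes "ideal I R" "unit_coeffs T g" "\<And>ta. ta \<in> T ==> um ta \<in> I"
 shows "usum T g \<in> I"
 unfolding usum_def
 by (intro ideal_finsum[OF assms(1)] ideal_mult[OF assms(1)] unit_coeffs_carr[OF assms(2)] assms(3))

lemma usum_closed: "rsp ys ==> unit_coeffs T g ==> usum T g \<in> carrier R"
 using usum_ideal[OF oneideal] um_closed by blast

lemma usum_Fw:
 assumes y: "rsp ys" and T: "unit_coeffs T g" and w: "\<And>ta. ta \<in> T ==> s \<le> wt e L ta"
 shows "usum T g \<in> Fw ys L \<rho> s"
proof (rule usum_ideal[OF Fw_ideal[OF y] T])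
 fix ta assume "ta \<in> T"
 thus "um ta \<in> Fw ys L \<rho> s" using um_Fw[OF y, of ta L \<rho>] Fw_antimono[OF w] by blast
qed

lemma um_mx: "rsp ys ==> A \<in> exps e ==> um A = mon R (\<lambda>i. (us @ ys) ! i) (e + length ys) A"
proof -
 assume y: "rsp ys" and A: "A \<in> exps e"
 interpret sp: split_parameters R us ys M by (rule rsp_split[OF y])
 have "sp.mx A = mon R (\<lambda>i. (us @ ys) ! i) e A" by (rule mon_extend[OF A sp.x_closed])
 also have "\<dots> = um A" unfolding um_def using rsp_nth(1)[OF y] by (intro mon_cong) (auto simp: nth_append)
 finally show ?thesis ..
qed

text \<open>The terms without any y_j in an expansion of f; membership of f in \<open>M\<close>
  excludes the exponent 0.\<close>

lemma u_part:
 assumes y: "rsp ys" and f: "f \<in> M"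
 shows "\<exists>T g. unit_coeffs T g \<and> 0 \<notin> T \<and> f \<ominus> usum T g \<in> Idl (set ys)"
proof -
 interpret sp: split_parameters R us ys M by (rule rsp_split[OF y])
 let ?n = "e + length ys"
 have fc: "f \<in> carrier R" using f ideal_sub[OF maxideal(1)] by blast
 obtain T' g where ex: "sp.expansion f T' g" using sp.expansion_exists[OF noeth fc] by blast
 hence T': "finite T'" "T' \<subseteq> exps ?n" "g \<in> T' \<rightarrow> Units R" "f = (\<Oplus>ta\<in>T'. g ta \<otimes> sp.mx ta)"
  by (auto simp: sp.expansion_def)
 define T where "T = T' \<inter> exps e"
 have uc: "unit_coeffs T g" using T' by (auto simp: unit_coeffs_def T_def)
 have gc: "g ta \<in> carrier R" if "ta \<in> T'" for ta using T'(3) that Units_closed by blast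
 have up: "upset ?n {al \<in> exps ?n. 0 < tdeg ?n al}"
  unfolding upset_def using tdeg_mono by (auto intro: less_le_trans)
 have "M = sp.mI {al \<in> exps ?n. tdeg ?n al = 1}" using sp.power_M[of 1] ideal_power_1[OF maxideal(1)] by simp
 also have "\<dots> \<subseteq> sp.mI {al \<in> exps ?n. 0 < tdeg ?n al}" by (rule sp.mI_mono) auto
 finally have "T' \<subseteq> {al \<in> exps ?n. 0 < tdeg ?n al}" using sp.expansion_mem_iff[OF ex up] f by blast
 hence "0 \<notin> T" by (auto simp: T_def)
 moreover have "f \<ominus> usum T g \<in> Idl (set ys)"
 proof -
  note I = genideal_ideal[OF rsp_carrier(2)[OF y]]
  have "f = (\<Oplus>ta\<in>T \<union> (T' - T). g ta \<otimes> sp.mx ta)" unfolding T'(4) T_def by (simp add: Un_Diff_Int Int_Diff_Un)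
  also have "\<dots> = (\<Oplus>ta\<in>T. g ta \<otimes> sp.mx ta) \<oplus> (\<Oplus>ta\<in>T' - T. g ta \<otimes> sp.mx ta)"
   using T'(1) gc by (intro finsum_Un_disjoint) (auto simp: T_def)
  also have "(\<Oplus>ta\<in>T. g ta \<otimes> sp.mx ta) = usum T g"
   unfolding usum_def using um_mx[OF y] gc by (intro finsum_cong') (auto simp: T_def um_closed[OF y])
  finally have fe: "f = usum T g \<oplus> (\<Oplus>ta\<in>T' - T. g ta \<otimes> sp.mx ta)" .
  have rest: "(\<Oplus>ta\<in>T' - T. g ta \<otimes> sp.mx ta) \<in> Idl (set ys)"
  proof (rule ideal_finsum[OF I], rule ideal_mult[OF I])
   fix ta assume t: "ta \<in> T' - T"
   show "g ta \<in> carrier R" using gc t by blast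
   have te: "ta \<in> exps ?n" "ta \<notin> exps e" using t T'(2) by (auto simp: T_def)
   then obtain i where i: "e \<le> i" "ta i \<noteq> 0" by (auto simp: exps_def)
   hence i2: "i < ?n" using te(1) by (auto simp: exps_def not_less[symmetric])
   have le: "unit_exp i \<le> ta" using i by (auto simp: le_fun_def unit_exp_def)
   have "sp.mx ta = sp.mx (ta - unit_exp i) \<otimes> ys ! (i - e)"
    using mon_le[OF sp.x_closed le] mon_unit[OF sp.x_closed i2] i(1) by (simp add: nth_append)
   moreover have "ys ! (i - e) \<in> Idl (set ys)"
    using genideal_self[OF rsp_carrier(2)[OF y]] nth_mem[of "i - e" ys] i(1) i2 by auto
   ultimately show "sp.mx ta \<in> Idl (set ys)" using ideal_mult[OF I sp.mx_closed] by simp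
  qed
  have "f \<ominus> usum T g = (\<Oplus>ta\<in>T' - T. g ta \<otimes> sp.mx ta)"
  proof -
   have cancel: "(a \<oplus> c) \<ominus> a = c" if "a \<in> carrier R" "c \<in> carrier R" for a c using that by algebra
   have "(\<Oplus>ta\<in>T' - T. g ta \<otimes> sp.mx ta) \<in> carrier R" using rest ideal_sub[OF I] by blast
   from cancel[OF usum_closed[OF y uc] this] show ?thesis using fe by simp
  qed
  thus ?thesis using rest by simp
 qed
 ultimately show ?thesis using uc by blast
qed

text \<open>By \<open>expansion_mem_iff\<close>, a sum with unit coefficients lies in the ideal of
  the y_j only if each of its exponents involves some y_j.\<close>

lemma u_part_unique:
 assumes y: "rsp ys" and T: "unit_coeffs T g" and m: "usum T g \<in> Idl (set ys)"
 shows "T = {}"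
proof -
 interpret sp: split_parameters R us ys M by (rule rsp_split[OF y])
 let ?n = "e + length ys"
 let ?S = "{al \<in> exps ?n. 0 < ydeg e (length ys) al}"
 have up: "upset ?n ?S" unfolding upset_def using ydeg_mono by (auto intro: less_le_trans)
 have Te: "finite T" "T \<subseteq> exps e" "g \<in> T \<rightarrow> Units R" using T by (auto simp: unit_coeffs_def)
 have "usum T g = (\<Oplus>ta\<in>T. g ta \<otimes> sp.mx ta)"
  unfolding usum_def using um_mx[OF y] unit_coeffs_carr[OF T] Te(2) by (intro finsum_cong') auto
 moreover have "T \<subseteq> exps ?n" using Te(2) exps_mono[of e ?n] by auto
 ultimately have ex: "sp.expansion (usum T g) T g" unfolding sp.expansion_def using Te by blast
 have "Idl (set ys) \<subseteq> sp.mI ?S"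
 proof (rule genideal_minimal[OF sp.mI_ideal], rule subsetI)
  fix a assume "a \<in> set ys"
  then obtain j where j: "j < length ys" "a = ys ! j" by (metis in_set_conv_nth)
  have "unit_exp (e + j) \<in> ?S" using j(1) by (auto simp: ydeg_def unit_exp_def exps_def)
  hence "sp.mx (unit_exp (e + j)) \<in> sp.mI ?S" by (rule sp.mI_memI)
  thus "a \<in> sp.mI ?S" using mon_unit[OF sp.x_closed, of "e + j"] j by (simp add: nth_append)
 qed
 hence "T \<subseteq> ?S" using sp.expansion_mem_iff[OF ex up] m by blast
 thus ?thesis using Te(2) ydeg_exps by fastforce
qed

text \<open>Modulo the ideal of \<open>yh\<close>, each y_j is a finite sum of monomials in u with
  unit coefficients. Subtracting it gives \<open>yt\<close>, which generates the same ideal as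
  \<open>yh\<close>. A competing system is thereby replaced by a translate of y by elements of the
  ideal of u.\<close>

lemma normal_form:
 assumes y: "rsp ys" and yh: "rsp yh"
 shows "\<exists>T g yt. length yt = length ys \<and> rsp yt \<and>
  (\<forall>j<length ys. unit_coeffs (T j) (g j) \<and> 0 \<notin> T j \<and> yt ! j = ys ! j \<ominus> usum (T j) (g j)) \<and>
  (\<forall>L \<rho> s. Fw yh L \<rho> s \<subseteq> Fw yt L \<rho> s)"
proof -
 have len: "length yh = length ys" using y yh unfolding rsp_def by simp
 have "\<forall>j. \<exists>Tg. j < length ys \<longrightarrow> unit_coeffs (fst Tg) (snd Tg) \<and> 0 \<notin> fst Tg \<and> ys ! j \<ominus> usum (fst Tg) (snd Tg) \<in> Idl (set yh)"
 proof
  fix j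
  show "\<exists>Tg. j < length ys \<longrightarrow> unit_coeffs (fst Tg) (snd Tg) \<and> 0 \<notin> fst Tg \<and> ys ! j \<ominus> usum (fst Tg) (snd Tg) \<in> Idl (set yh)"
  proof (cases "j < length ys")
   case True
   have "ys ! j \<in> M" using rsp_M(2)[OF y] nth_mem[OF True] by blast
   then obtain T g where "unit_coeffs T g" "0 \<notin> T" "ys ! j \<ominus> usum T g \<in> Idl (set yh)" using u_part[OF yh] by blast
   thus ?thesis by (intro exI[of _ "(T, g)"]) simp
  qed simp
 qed
 from choice[OF this] obtain Tg where Tg: "\<And>j. j < length ys ==> unit_coeffs (fst (Tg j)) (snd (Tg j)) \<and> 0 \<notin> fst (Tg j) \<and>
   ys ! j \<ominus> usum (fst (Tg j)) (snd (Tg j)) \<in> Idl (set yh)" by blast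
 define us' where "us' j = usum (fst (Tg j)) (snd (Tg j))" for j
 define yt where "yt = map (\<lambda>j. ys ! j \<ominus> us' j) [0..<length ys]"
 have lyt: "length yt = length ys" by (simp add: yt_def)
 have ytj: "yt ! j = ys ! j \<ominus> us' j" if "j < length ys" for j using that by (simp add: yt_def)
 have uc: "us' j \<in> carrier R" if "j < length ys" for j unfolding us'_def using usum_closed[OF y] Tg[OF that] by blast
 note iu = genideal_ideal[OF rsp_carrier(1)[OF y]]
 have uu: "us' j \<in> Idl (set us)" if j: "j < length ys" for j
  unfolding us'_def
 proof (rule usum_ideal[OF iu])
  show T: "unit_coeffs (fst (Tg j)) (snd (Tg j))" using Tg[OF j] by blast
  fix ta assume t: "ta \<in> fst (Tg j)"
  hence "ta \<in> exps e" "ta \<noteq> 0" using T Tg[OF j] unfolding unit_coeffs_def by blast+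
  thus "um ta \<in> Idl (set us)" by (rule um_us[OF y])
 qed
 have yt: "rsp yt"
 proof (rule rsp_change[OF y lyt])
  fix j assume j: "j < length ys"
  have c: "ys ! j \<in> carrier R" using rsp_nth(2)[OF y j] .
  have "yt ! j \<ominus> ys ! j = \<ominus> us' j" unfolding ytj[OF j] using c uc[OF j] by algebra
  thus "yt ! j \<in> carrier R \<and> yt ! j \<ominus> ys ! j \<in> Idl (set us)"
   using ideal_uminus[OF iu uu[OF j]] ytj[OF j] c uc[OF j] by simp
 qed
 note ih = genideal_ideal[OF rsp_carrier(2)[OF yh]] and it = genideal_ideal[OF rsp_carrier(2)[OF yt]]
 have tle: "Idl (set yt) \<subseteq> Idl (set yh)"
 proof (rule genideal_minimal[OF ih], rule subsetI)
  fix a assume "a \<in> set yt"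
  then obtain j where "j < length ys" "a = yt ! j" using lyt by (metis in_set_conv_nth)
  thus "a \<in> Idl (set yh)" using Tg[of j] ytj[of j] unfolding us'_def by simp
 qed
 \<comment> \<open>The u-part of \<open>yh ! j\<close> modulo the ideal of \<open>yt\<close> lies in
   the ideal of \<open>yh\<close>, so it is empty by uniqueness.\<close>
 have hle: "yh ! j \<in> Idl (set yt)" if j: "j < length yh" for j
 proof -
  have jh: "yh ! j \<in> set yh" by (rule nth_mem[OF j])
  hence "yh ! j \<in> M" using rsp_M(2)[OF yh] by blast
  then obtain T g where T: "unit_coeffs T g" "yh ! j \<ominus> usum T g \<in> Idl (set yt)" using u_part[OF yt] by blast
  have yc: "yh ! j \<in> carrier R" by (rule rsp_nth(2)[OF yh j])
  have sc: "usum T g \<in> carrier R" by (rule usum_closed[OF y T(1)])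
  have "yh ! j \<in> Idl (set yh)" using genideal_self[OF rsp_carrier(2)[OF yh]] jh by blast
  moreover have "yh ! j \<ominus> usum T g \<in> Idl (set yh)" using T(2) tle by blast
  ultimately have "yh ! j \<ominus> (yh ! j \<ominus> usum T g) \<in> Idl (set yh)" by (rule ideal_minus[OF ih])
  moreover have "yh ! j \<ominus> (yh ! j \<ominus> usum T g) = usum T g" using yc sc by algebra
  ultimately have "T = {}" using u_part_unique[OF yh T(1)] by simp
  hence "usum T g = \<zero>" by (simp add: usum_def)
  thus ?thesis using T(2) yc by (simp add: a_minus_def)
 qed
 have "Fw yh L \<rho> s \<subseteq> Fw yt L \<rho> s" for L \<rho> s
 proof (rule Fw_change[OF yt])
  show "length yh = length yt" using len lyt by simp
  fix j assume "j < length yt"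
  hence j: "j < length yh" using len lyt by simp
  have "Idl (set yt) \<subseteq> Fw yt L \<rho> \<rho>"
  proof (rule genideal_minimal[OF Fw_ideal[OF yt]], rule subsetI)
   fix a assume "a \<in> set yt"
   then obtain i where "i < length yt" "a = yt ! i" by (metis in_set_conv_nth)
   thus "a \<in> Fw yt L \<rho> \<rho>" using Fw_ys[OF yt] by simp
  qed
  thus "yh ! j \<in> Fw yt L \<rho> \<rho>" using hle[OF j] by blast
 qed
 thus ?thesis using lyt yt Tg ytj unfolding us'_def
  by (intro exI[of _ "\<lambda>j. fst (Tg j)"] exI[of _ "\<lambda>j. snd (Tg j)"] exI[of _ yt]) blast
qed

section \<open>Testing the polyhedron with generic half spaces\<close>

lemma Fw_rho:
 assumes L: "\<And>i. 0 \<le> L i" and r: "0 \<le> \<rho>'" "\<rho>' \<le> \<rho>"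
 shows "Fw ys L \<rho> (\<rho> * real b) \<subseteq> Fw ys L \<rho>' (\<rho>' * real b)"
 unfolding Fw_def
proof (rule gI_mono, rule subsetI)
 fix al assume "al \<in> {al \<in> exps (e + length ys). \<rho> * real b \<le> wt e L al + \<rho> * real (ydeg e (length ys) al)}"
 hence a: "al \<in> exps (e + length ys)" "\<rho> * (real b - real (ydeg e (length ys) al)) \<le> wt e L al"
  by (auto simp: algebra_simps)
 have "\<rho>' * (real b - real (ydeg e (length ys) al)) \<le> wt e L al"
 proof (cases "ydeg e (length ys) al \<le> b")
  case True
  hence "\<rho>' * (real b - real (ydeg e (length ys) al)) \<le> \<rho> * (real b - real (ydeg e (length ys) al))"
   using r by (intro mult_right_mono) auto
  thus ?thesis using a(2) by linarith
 next
  case False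
  hence "\<rho>' * (real b - real (ydeg e (length ys) al)) \<le> 0" using r(1) by (simp add: mult_le_0_iff)
  moreover have "0 \<le> wt e L al" using L by (intro wt_nonneg)
  ultimately show ?thesis by linarith
 qed
 thus "al \<in> {al \<in> exps (e + length ys). \<rho>' * real b \<le> wt e L al + \<rho>' * real (ydeg e (length ys) al)}"
  using a(1) by (auto simp: algebra_simps)
qed

text \<open>Raising the weights enlarges the ideal that has to contain \<open>J\<close>, and the
  slack of the inequality at \<open>p\<close> leaves room for a small generic raise.\<close>

lemma newt_perturb:
 assumes p: "p \<in> orthant e" and L0: "\<And>i. 0 \<le> L0 i" and J: "J \<subseteq> Fw ys L0 \<rho> (\<rho> * real b)"
  and lt: "(\<Sum>i<e. L0 i * p i) < \<rho>"
 shows "\<exists>L. (\<forall>i. 0 < L i) \<and> inj_on (wt e L) (exps e) \<and> J \<subseteq> Fw ys L \<rho> (\<rho> * real b) \<and> (\<Sum>i<e. L i * p i) < \<rho>"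
proof -
 have pp: "0 \<le> p i" for i using p by (simp add: orthant_def)
 have sp: "0 \<le> (\<Sum>i<e. p i)" using pp by (intro sum_nonneg)
 define \<epsilon> where "\<epsilon> = (\<rho> - (\<Sum>i<e. L0 i * p i)) / ((\<Sum>i<e. p i) + 1)"
 have eps: "0 < \<epsilon>" unfolding \<epsilon>_def using lt sp by simp
 obtain L where L: "\<And>i. L0 i < L i" "\<And>i. L i < L0 i + \<epsilon>" "inj_on (wt e L) (exps e)"
  by (rule generic_weight[OF eps, of L0 e]) blast
 have "(\<Sum>i<e. L i * p i) \<le> (\<Sum>i<e. (L0 i + \<epsilon>) * p i)"
  using L(2) pp by (intro sum_mono mult_right_mono) (auto intro: less_imp_le)
 also have "\<dots> = (\<Sum>i<e. L0 i * p i) + \<epsilon> * (\<Sum>i<e. p i)"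
  by (simp add: distrib_right sum.distrib sum_distrib_left)
 also have "\<dots> < (\<Sum>i<e. L0 i * p i) + \<epsilon> * ((\<Sum>i<e. p i) + 1)" using eps by (simp add: algebra_simps)
 also have "\<dots> = \<rho>" unfolding \<epsilon>_def using sp by simp
 finally have 1: "(\<Sum>i<e. L i * p i) < \<rho>" .
 have "Fw ys L0 \<rho> (\<rho> * real b) \<subseteq> Fw ys L \<rho> (\<rho> * real b)"
  unfolding Fw_def
 proof (rule gI_mono, rule subsetI)
  fix al assume a: "al \<in> {al \<in> exps (e + length ys). \<rho> * real b \<le> wt e L0 al + \<rho> * real (ydeg e (length ys) al)}"
  have "wt e L0 al \<le> wt e L al"
   unfolding wt_def using L(1) by (intro sum_mono mult_right_mono) (auto intro: less_imp_le)
  thus "al \<in> {al \<in> exps (e + length ys). \<rho> * real b \<le> wt e L al + \<rho> * real (ydeg e (length ys) al)}"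
   using a by auto
 qed
 hence "J \<subseteq> Fw ys L \<rho> (\<rho> * real b)" using J by blast
 moreover have "0 < L i" for i using L(1)[of i] L0[of i] by linarith
 ultimately show ?thesis using 1 L(3) by blast
qed

definition pt :: "(nat => nat) => nat => real" where "pt A = (\<lambda>i. real (A i))"

lemma pt_orthant: "A \<in> exps e ==> pt A \<in> orthant e"
 by (auto simp: pt_def orthant_def topspace_Euclidean_space exps_def)

lemma pt_sum: "(\<Sum>i<e. L i * pt A i) = wt e L A"
 by (simp add: pt_def wt_def)

lemma newt_outside:
 assumes "p \<in> orthant e" "p \<notin> newt ys"
 shows "\<exists>L \<rho>. (\<forall>i. 0 < L i) \<and> inj_on (wt e L) (exps e) \<and> 0 < \<rho> \<and> J \<subseteq> Fw ys L \<rho> (\<rho> * real b) \<and> (\<Sum>i<e. L i * p i) < \<rho>"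
proof -
 obtain L0 \<rho> where L0: "\<forall>i. 0 \<le> L0 i" "0 < \<rho>" "J \<subseteq> Fw ys L0 \<rho> (\<rho> * real b)" "\<not> \<rho> \<le> (\<Sum>i<e. L0 i * p i)"
  using assms unfolding newt_def by blast
 have lt: "(\<Sum>i<e. L0 i * p i) < \<rho>" using L0(4) by simp
 show ?thesis using newt_perturb[OF assms(1) L0(1)[rule_format] L0(3) lt] L0(2) by blast
qed

lemma newtD:
 assumes "p \<in> newt ys" "\<And>i. 0 < L i" "0 < \<rho>" "J \<subseteq> Fw ys L \<rho> (\<rho> * real b)"
 shows "\<rho> \<le> (\<Sum>i<e. L i * p i)"
proof -
 have "\<forall>i. 0 \<le> L i" using assms(2) by (simp add: less_imp_le)
 thus ?thesis using assms(1,3,4) unfolding newt_def by blast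
qed

text \<open>The exponents in expansions of the generators of \<open>J\<close> decide all
  containments in monomial ideals at once. Having them as one finite set allows minima over them in
  \<open>solvable_vertex\<close>.\<close>

lemma J_gI_iff:
 assumes y: "rsp ys"
 shows "\<exists>Xs. finite Xs \<and> Xs \<subseteq> exps (e + length ys) \<and> (\<forall>S. upset (e + length ys) S \<longrightarrow> (J \<subseteq> gI ys S \<longleftrightarrow> Xs \<subseteq> S))"
proof -
 interpret sp: split_parameters R us ys M by (rule rsp_split[OF y])
 have "\<forall>f\<in>F. \<exists>T. \<exists>g. sp.expansion f T g" using sp.expansion_exists[OF noeth] F(2) by blast
 from bchoice[OF this] obtain T where T: "\<forall>f\<in>F. \<exists>g. sp.expansion f (T f) g" by blast
 have "J \<subseteq> gI ys S \<longleftrightarrow> (\<Union>f\<in>F. T f) \<subseteq> S" if S: "upset (e + length ys) S" for S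
 proof -
  have "J \<subseteq> gI ys S \<longleftrightarrow> F \<subseteq> gI ys S"
   unfolding F(3) using genideal_self[OF F(2)] genideal_minimal[OF gI_ideal[OF y], of F] by blast
  also have "\<dots> \<longleftrightarrow> (\<forall>f\<in>F. T f \<subseteq> S)" unfolding gI_def using T sp.expansion_mem_iff[OF _ S] by blast
  finally show ?thesis by blast
 qed
 moreover have "finite (\<Union>f\<in>F. T f)" using F(1) T unfolding sp.expansion_def by blast
 moreover have "(\<Union>f\<in>F. T f) \<subseteq> exps (e + length ys)" using T unfolding sp.expansion_def by blast
 ultimately show ?thesis by blast
qed

text \<open>Choose generic weights separating a point of \<open>newt ys\<close> from
  \<open>newt yh\<close>. The passage from y to the normal form of \<open>yh\<close> must use a
  monomial in u of weight below \<rho>h, and \<open>A\<close> is the lightest one. After the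
  translation by its coefficients the remaining differences are heavier, which puts \<open>A\<close>
  outside the new polyhedron. If no exponent of \<open>J\<close> contributed a point on the
  hyperplane through \<open>A\<close>, then for both systems \<open>J\<close> would satisfy a
  strictly stronger inequality, and \<open>direction_degenerate\<close> would apply.\<close>

theorem solvable_vertex:
 assumes y: "rsp ys" and yh: "rsp yh" and nd: "\<not> degenerate (length ys)" and nle: "\<not> newt ys \<subseteq> newt yh"
 shows "\<exists>A cs. A \<in> exps e \<and> A \<noteq> 0 \<and> length cs = length ys \<and> set cs \<subseteq> carrier R \<and>
  pt A \<in> newt ys \<and> pt A \<notin> newt (shift ys cs A)"
proof -
 define r where "r = length ys"
 obtain p where p: "p \<in> newt ys" "p \<notin> newt yh" using nle by blast
 have po: "p \<in> orthant e" using p(1) by (simp add: newt_def)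
 obtain L \<rho>h where L: "\<forall>i. 0 < L i" "inj_on (wt e L) (exps e)" "0 < \<rho>h"
  "J \<subseteq> Fw yh L \<rho>h (\<rho>h * real b)" "(\<Sum>i<e. L i * p i) < \<rho>h" using newt_outside[OF po p(2)] by blast
 have Lp: "0 < L i" for i using L(1) by blast
 have L0: "0 \<le> L i" for i using Lp[of i] by simp
 have nJ: "\<not> J \<subseteq> Fw ys L \<rho>h (\<rho>h * real b)" using newtD[of p ys L \<rho>h, OF p(1) Lp L(3)] L(5) by auto
 obtain T g yt where nf: "length yt = length ys" "rsp yt"
  "\<forall>j<length ys. unit_coeffs (T j) (g j) \<and> 0 \<notin> T j \<and> yt ! j = ys ! j \<ominus> usum (T j) (g j)"
  "\<forall>L \<rho> s. Fw yh L \<rho> s \<subseteq> Fw yt L \<rho> s" using normal_form[OF y yh] by blast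
 have uc: "unit_coeffs (T j) (g j)" "0 \<notin> T j" "yt ! j = ys ! j \<ominus> usum (T j) (g j)" if "j < r" for j
  using nf(3) that r_def by blast+
 have Jt: "J \<subseteq> Fw yt L \<rho>h (\<rho>h * real b)" using L(4) nf(4) by blast
 have ysF: "J \<subseteq> Fw ys L \<rho> (\<rho> * real b)"
  if rho: "0 \<le> \<rho>" "\<rho> \<le> \<rho>h" and w: "\<And>j ta. j < r ==> ta \<in> T j ==> \<rho> \<le> wt e L ta" for \<rho>
 proof -
  have "Fw yt L \<rho> (\<rho> * real b) \<subseteq> Fw ys L \<rho> (\<rho> * real b)"
  proof (rule Fw_change[OF y nf(1)])
   fix j assume j: "j < length ys"
   hence jr: "j < r" by (simp add: r_def)
   show "yt ! j \<in> Fw ys L \<rho> \<rho>" unfolding uc(3)[OF jr]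
    by (rule ideal_minus[OF Fw_ideal[OF y] Fw_ys[OF y j] usum_Fw[OF y uc(1)[OF jr] w[OF jr]]])
  qed
  thus ?thesis using Jt Fw_rho[of L \<rho> \<rho>h, OF L0 rho] by blast
 qed
 define \<Phi> where "\<Phi> = (\<Union>j<r. T j)"
 have \<Phi>: "finite \<Phi>" "\<Phi> \<subseteq> exps e" "0 \<notin> \<Phi>" using uc unfolding \<Phi>_def unit_coeffs_def by auto
 have "\<exists>ta\<in>\<Phi>. wt e L ta < \<rho>h"
 proof (rule ccontr)
  assume "\<not> ?thesis"
  hence "\<rho>h \<le> wt e L ta" if "j < r" "ta \<in> T j" for j ta using that unfolding \<Phi>_def by force
  hence "J \<subseteq> Fw ys L \<rho>h (\<rho>h * real b)" using L(3) by (intro ysF) auto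
  thus False using nJ by blast
 qed
 then obtain ta0 where t0: "ta0 \<in> \<Phi>" "wt e L ta0 < \<rho>h" by blast
 have ne: "\<Phi> \<noteq> {}" using t0 by blast
 obtain A where A: "A \<in> \<Phi>" and Alt: "\<And>ta. ta \<in> \<Phi> ==> ta \<noteq> A ==> wt e L A < wt e L ta"
  using least_exp[OF Lp L(2) \<Phi>(2) ne] by blast
 define \<rho> where "\<rho> = wt e L A"
 have Amin: "\<rho> \<le> wt e L ta" if "ta \<in> \<Phi>" for ta using Alt[OF that] \<rho>_def by (cases "ta = A") auto
 have Ae: "A \<in> exps e" "A \<noteq> 0" using A \<Phi> by auto
 have rho: "\<rho> < \<rho>h" using Amin[OF t0(1)] t0(2) by simp
 have rho0: "0 \<le> \<rho>" unfolding \<rho>_def using L0 by (intro wt_nonneg)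
 obtain q where q: "q < r" "A \<in> T q" using A unfolding \<Phi>_def by blast
 \<comment> \<open>The normal form subtracts its sums, so the translation adds the negatives of the
   coefficients of u^A; components without u^A stay fixed.\<close>
 define cs where "cs = map (\<lambda>j. if A \<in> T j then \<ominus> (g j A) else \<zero>) [0..<r]"
 have lcs: "length cs = length ys" by (simp add: cs_def r_def)
 have gu: "g j A \<in> Units R" if "j < r" "A \<in> T j" for j using uc(1)[OF that(1)] that(2) unfolding unit_coeffs_def by blast
 have csc: "set cs \<subseteq> carrier R" using Units_closed[OF gu] by (auto simp: cs_def)
 have csq: "cs ! q \<in> Units R"
 proof -
  have gc: "g q A \<in> carrier R" by (rule Units_closed[OF gu[OF q]])
  have "\<ominus> (g q A) \<notin> M"
  proof
   assume "\<ominus> (g q A) \<in> M"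
   hence "\<ominus> (\<ominus> (g q A)) \<in> M" by (rule ideal_uminus[OF maxideal(1)])
   hence gM: "g q A \<in> M" using gc by simp
   have "inv (g q A) \<otimes> g q A \<in> M" by (rule ideal_mult[OF maxideal(1) Units_inv_closed[OF gu[OF q]] gM])
   hence "\<one> \<in> M" using gu[OF q] by simp
   thus False using ideal.one_imp_carrier[OF maxideal(1)] maxideal(2) by blast
  qed
  thus ?thesis using maxideal(3)[of "\<ominus> (g q A)"] gc q by (simp add: cs_def)
 qed
 define y' where "y' = shift ys cs A"
 have ry': "rsp y'" unfolding y'_def by (rule rsp_shift[OF y lcs csc Ae])
 have yt_y': "yt ! j = y' ! j \<ominus> usum (T j - {A}) (g j)" "unit_coeffs (T j - {A}) (g j)" if j: "j < r" for j
 proof -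
  show uc': "unit_coeffs (T j - {A}) (g j)" using uc(1)[OF j] unfolding unit_coeffs_def by auto
  have yc: "ys ! j \<in> carrier R" using rsp_nth(2)[OF y] j r_def by simp
  have sc: "usum (T j - {A}) (g j) \<in> carrier R" by (rule usum_closed[OF y uc'])
  have umc: "um ta \<in> carrier R" for ta by (rule um_closed[OF y])
  have y'j: "y' ! j = ys ! j \<oplus> cs ! j \<otimes> um A" unfolding y'_def using nth_shift[of j ys cs A] j r_def by simp
  show "yt ! j = y' ! j \<ominus> usum (T j - {A}) (g j)"
  proof (cases "A \<in> T j")
   case True
   have gc: "g j A \<in> carrier R" by (rule Units_closed[OF gu[OF j True]])
   have "finite (T j)" using uc(1)[OF j] by (simp add: unit_coeffs_def)
   hence "usum (T j) (g j) = g j A \<otimes> um A \<oplus> usum (T j - {A}) (g j)"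
    unfolding usum_def using unit_coeffs_carr[OF uc(1)[OF j]] umc by (intro finsum_remove[OF _ True]) auto
   moreover have "cs ! j = \<ominus> (g j A)" using True j by (simp add: cs_def)
   ultimately show ?thesis unfolding uc(3)[OF j] y'j using yc sc gc umc[of A] by algebra
  next
   case False
   hence "cs ! j = \<zero>" "T j - {A} = T j" using j by (auto simp: cs_def)
   thus ?thesis unfolding uc(3)[OF j] y'j using yc umc[of A] by simp
  qed
 qed
 \<comment> \<open>The next weight at which the translated system and the normal form can differ,
   capped by \<open>\<rho>h\<close>.\<close>
 define \<rho>2 where "\<rho>2 = Min (insert \<rho>h (wt e L ` (\<Phi> - {A})))"
 have fin: "finite (insert \<rho>h (wt e L ` (\<Phi> - {A})))" using \<Phi>(1) by simp
 have r2: "\<rho>2 \<le> \<rho>h" "\<And>ta. ta \<in> \<Phi> ==> ta \<noteq> A ==> \<rho>2 \<le> wt e L ta" unfolding \<rho>2_def using fin by (auto intro!: Min_le)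
 have r2l: "\<rho> < \<rho>2"
  unfolding \<rho>2_def
 proof (subst Min_gr_iff[OF fin])
  show "\<forall>a\<in>insert \<rho>h (wt e L ` (\<Phi> - {A})). \<rho> < a"
  proof
   fix a assume a: "a \<in> insert \<rho>h (wt e L ` (\<Phi> - {A}))"
   show "\<rho> < a"
   proof (cases "a = \<rho>h")
    case False
    then obtain ta where t: "ta \<in> \<Phi>" "ta \<noteq> A" "a = wt e L ta" using a by blast
    thus ?thesis using Alt[OF t(1,2)] t(3) \<rho>_def by simp
   qed (use rho in simp)
  qed
 qed simp
 have Jy': "J \<subseteq> Fw y' L \<rho>' (\<rho>' * real b)" if r': "0 \<le> \<rho>'" "\<rho>' \<le> \<rho>2" for \<rho>'
 proof -
  have "Fw yt L \<rho>' (\<rho>' * real b) \<subseteq> Fw y' L \<rho>' (\<rho>' * real b)"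
  proof (rule Fw_change[OF ry'])
   show "length yt = length y'" using nf(1) by (simp add: y'_def)
   fix j assume j: "j < length y'"
   hence jr: "j < r" by (simp add: r_def y'_def)
   have w: "\<rho>' \<le> wt e L ta" if "ta \<in> T j - {A}" for ta
   proof -
    have "ta \<in> \<Phi>" "ta \<noteq> A" using that jr by (auto simp: \<Phi>_def)
    thus ?thesis using r2(2)[of ta] r'(2) by simp
   qed
   show "yt ! j \<in> Fw y' L \<rho>' \<rho>'" unfolding yt_y'(1)[OF jr]
    by (rule ideal_minus[OF Fw_ideal[OF ry'] Fw_ys[OF ry' j] usum_Fw[OF ry' yt_y'(2)[OF jr] w]])
  qed
  moreover have "\<rho>' \<le> \<rho>h" using r'(2) r2(1) by simp
  ultimately show ?thesis using Jt Fw_rho[of L \<rho>' \<rho>h, OF L0 r'(1)] by blast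
 qed
 have out: "pt A \<notin> newt y'"
 proof
  assume "pt A \<in> newt y'"
  hence "\<rho>2 \<le> (\<Sum>i<e. L i * pt A i)" using newtD[of "pt A" y' L \<rho>2, OF _ Lp] Jy'[of \<rho>2] rho0 r2l by simp
  thus False using r2l unfolding pt_sum \<rho>_def by simp
 qed
 have Jys: "J \<subseteq> Fw ys L \<rho> (\<rho> * real b)" using rho0 rho Amin by (intro ysF) (auto simp: \<Phi>_def)
 obtain Xs where Xs: "finite Xs" "Xs \<subseteq> exps (e + length ys)"
  "\<And>S. upset (e + length ys) S ==> J \<subseteq> gI ys S \<longleftrightarrow> Xs \<subseteq> S" using J_gI_iff[OF y] by blast
 have XsF: "J \<subseteq> Fw ys L' s t \<longleftrightarrow> Xs \<subseteq> {al \<in> exps (e + r). t \<le> wt e L' al + s * real (ydeg e r al)}"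
  if "\<And>i. 0 \<le> L' i" "0 \<le> s" for L' s t
  unfolding Fw_def r_def by (rule Xs(3)[OF upset_Fw[OF that]])
 have inn: "pt A \<in> newt ys"
 proof (cases "\<exists>al\<in>Xs. ydeg e r al < b \<and> wt e L al = \<rho> * (real b - real (ydeg e r al))")
  case True
  then obtain al where a: "al \<in> Xs" "ydeg e r al < b" "wt e L al = \<rho> * (real b - real (ydeg e r al))" by blast
  define d where "d = b - ydeg e r al"
  have d: "0 < d" "real d = real b - real (ydeg e r al)" using a(2) by (auto simp: d_def)
  define alu where "alu = (\<lambda>i. if i < e then al i else 0)"
  have wu: "wt e L' alu = wt e L' al" for L' by (simp add: wt_def alu_def)
  \<comment> \<open>By injectivity of the weight, the u-part of this exponent is (b - |B|) times
    \<open>A\<close>, so the point that it contributes to the polyhedron is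
    \<open>A\<close>.\<close>
  have "wt e L alu = wt e L (scale_exp d A)" unfolding wu wt_scale a(3) d(2) \<rho>_def by simp
  moreover have "alu \<in> exps e" by (simp add: alu_def exps_def)
  ultimately have eq: "alu = scale_exp d A" using inj_onD[OF L(2)] scale_exps[OF Ae(1)] by blast
  show ?thesis
   unfolding newt_def
  proof (intro CollectI conjI allI impI)
   show "pt A \<in> orthant e" by (rule pt_orthant[OF Ae(1)])
   fix L' :: "nat => real" and \<rho>' :: real assume L': "\<forall>i. 0 \<le> L' i" "0 < \<rho>'" "J \<subseteq> Fw ys L' \<rho>' (\<rho>' * real b)"
   have "Xs \<subseteq> {al \<in> exps (e + r). \<rho>' * real b \<le> wt e L' al + \<rho>' * real (ydeg e r al)}"
    using XsF[of L' \<rho>'] L' by simp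
   hence "\<rho>' * real b \<le> wt e L' alu + \<rho>' * real (ydeg e r al)" using a(1) wu by auto
   hence "real d * \<rho>' \<le> real d * wt e L' A" unfolding eq wt_scale d(2) by (simp add: algebra_simps)
   hence "\<rho>' \<le> wt e L' A" using d(1) by simp
   thus "\<rho>' \<le> (\<Sum>i<e. L' i * pt A i)" unfolding pt_sum .
  qed
 next
  case none: False
  let ?D = "\<lambda>al. real b - real (ydeg e r al)"
  let ?Z = "insert \<rho>2 ((\<lambda>al. wt e L al / ?D al) ` {al \<in> Xs. ydeg e r al < b})"
  \<comment> \<open>Some room above \<open>\<rho>\<close>: finitely many exponents have |B| < b, and
    none of them gives a point on the hyperplane.\<close>
  define \<rho>3 where "\<rho>3 = Min ?Z"
  have finZ: "finite ?Z" using Xs(1) by simp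
  have r3: "\<rho>3 \<le> \<rho>2" "\<And>al. al \<in> Xs ==> ydeg e r al < b ==> \<rho>3 \<le> wt e L al / ?D al"
   unfolding \<rho>3_def by (intro Min_le[OF finZ], blast)+
  have r3l: "\<rho> < \<rho>3"
   unfolding \<rho>3_def
  proof (subst Min_gr_iff[OF finZ])
   show "\<forall>z\<in>?Z. \<rho> < z"
   proof
    fix z assume z: "z \<in> ?Z"
    show "\<rho> < z"
    proof (cases "z = \<rho>2")
     case False
     then obtain al where a: "al \<in> Xs" "ydeg e r al < b" "z = wt e L al / ?D al" using z by blast
     have D: "0 < ?D al" using a(2) by simp
     have "Xs \<subseteq> {al \<in> exps (e + r). \<rho> * real b \<le> wt e L al + \<rho> * real (ydeg e r al)}"
      using XsF[of L \<rho>, OF L0 rho0] Jys by blast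
     hence "\<rho> * ?D al \<le> wt e L al" using a(1) by (auto simp: algebra_simps)
     moreover have "wt e L al \<noteq> \<rho> * ?D al" using none a(1,2) by blast
     ultimately have "\<rho> * ?D al < wt e L al" by simp
     thus ?thesis unfolding a(3) using D by (simp add: pos_less_divide_eq)
    qed (use r2l in simp)
   qed
  qed simp
  have r30: "0 \<le> \<rho>3" using r3l rho0 by simp
  have "Xs \<subseteq> {al \<in> exps (e + r). \<rho>3 * real b \<le> wt e L al + \<rho>3 * real (ydeg e r al)}"
  proof
   fix al assume a: "al \<in> Xs"
   have "\<rho>3 * ?D al \<le> wt e L al"
   proof (cases "ydeg e r al < b")
    case True
    hence "0 < ?D al" by simp
    thus ?thesis using r3(2)[OF a True] by (simp add: pos_le_divide_eq)
   next
    case False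
    hence "\<rho>3 * ?D al \<le> 0" using r30 by (simp add: mult_le_0_iff)
    moreover have "0 \<le> wt e L al" using L0 by (intro wt_nonneg)
    ultimately show ?thesis by linarith
   qed
   thus "al \<in> {al \<in> exps (e + r). \<rho>3 * real b \<le> wt e L al + \<rho>3 * real (ydeg e r al)}"
    using a Xs(2) r_def by (auto simp: algebra_simps)
  qed
  hence J3: "J \<subseteq> Fw ys L \<rho>3 (\<rho>3 * real b)" using XsF[of L \<rho>3, OF L0 r30] by blast
  have J3': "J \<subseteq> Fw (shift ys cs A) L \<rho>3 (\<rho>3 * real b)" using Jy'[OF r30 r3(1)] unfolding y'_def .
  have "degenerate (length ys)"
   using direction_degenerate[OF y lcs csc _ csq Ae Lp _ J3 J3'] q(1) r3l r_def \<rho>_def by blast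
  thus ?thesis using nd by blast
 qed
 show ?thesis using Ae lcs csc inn out unfolding y'_def by blast
qed

end

section \<open>Preparation by successive translations\<close>

lemma (in cring) telescope_ideal:
 assumes I: "ideal I R" and s: "\<And>k. s k \<in> carrier R" and d: "\<And>i. k \<le> i ==> s (Suc i) \<ominus> s i \<in> I" and kl: "k \<le> l"
 shows "s l \<ominus> s k \<in> I"
 using kl
proof (induction l rule: dec_induct)
 case base
 thus ?case using s[of k] ideal_zero[OF I] by (simp add: a_minus_def r_neg)
next
 case (step i)
 have "s (Suc i) \<ominus> s k = (s (Suc i) \<ominus> s i) \<oplus> (s i \<ominus> s k)" using s[of "Suc i"] s[of i] s[of k] by algebra
 thus ?case using ideal_add[OF I d[OF step(1)] step(3)] by simp
qed

text \<open>Completeness without a prescribed rate, obtained from \<open>F_complete\<close> along a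
  subsequence.\<close>

lemma (in complete_filtered) cauchy_limit:
 assumes s: "\<And>k. s k \<in> carrier R" and c: "\<And>N. \<exists>K. \<forall>k\<ge>K. s (Suc k) \<ominus> s k \<in> F N"
 shows "\<exists>l\<in>carrier R. \<forall>N. \<exists>K. \<forall>k\<ge>K. l \<ominus> s k \<in> F N"
proof -
 have "\<forall>N. \<exists>K. \<forall>k\<ge>K. s (Suc k) \<ominus> s k \<in> F N" using c by blast
 from choice[OF this] obtain K where K: "\<And>N k. K N \<le> k ==> s (Suc k) \<ominus> s k \<in> F N" by blast
 \<comment> \<open>Partial sums make the indices nondecreasing in \<open>N\<close>.\<close>
 define \<kappa> where "\<kappa> N = (\<Sum>i\<le>N. K i)" for N
 have kK: "K N \<le> \<kappa> N" for N unfolding \<kappa>_def by (rule member_le_sum) auto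
 have km: "\<kappa> N \<le> \<kappa> (Suc N)" for N by (simp add: \<kappa>_def)
 have tele: "s k \<ominus> s (\<kappa> N) \<in> F N" if k: "\<kappa> N \<le> k" for k N
  by (rule telescope_ideal[OF F_ideal s _ k]) (rule K, use kK[of N] in simp)
 obtain l where l: "l \<in> carrier R" "\<forall>N. l \<ominus> s (\<kappa> N) \<in> F N"
  using F_complete[of "\<lambda>N. s (\<kappa> N)"] s tele[OF km] by blast
 have "l \<ominus> s k \<in> F N" if k: "\<kappa> N \<le> k" for k N
 proof -
  have "l \<ominus> s k = (l \<ominus> s (\<kappa> N)) \<ominus> (s k \<ominus> s (\<kappa> N))" using l(1) s[of k] s[of "\<kappa> N"] by algebra
  thus ?thesis using ideal_minus[OF F_ideal l(2)[rule_format] tele[OF k]] by simp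
 qed
 thus ?thesis using l(1) by blast
qed

context pair_setup
begin

lemma rsp_length: "rsp ys ==> rsp yh ==> length ys = length yh"
 unfolding rsp_def by simp

text \<open>\<open>N\<close> depends only on s and the smallest weight of a variable, hence is
  uniform in \<open>ys\<close>. This matters where it is used for systems that vary with the stage
  of the construction.\<close>

lemma power_le_Fw:
 assumes L: "\<And>i. 0 < L i" and rho: "0 < \<rho>"
 shows "\<exists>N. \<forall>ys. rsp ys \<longrightarrow> ideal_power R M N \<subseteq> Fw ys L \<rho> s"
proof -
 define w where "w i = (if i < e then L i else \<rho>)" for i
 have w0: "0 < w i" for i using L rho by (simp add: w_def)
 obtain c where c: "0 < c" "\<And>i. i < n ==> c \<le> w i" using min_weight[of n w] w0 by blast
 obtain N :: nat where N: "s / c \<le> real N" using real_arch_simple by blast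
 have "ideal_power R M N \<subseteq> Fw ys L \<rho> s" if y: "rsp ys" for ys
 proof -
  interpret sp: split_parameters R us ys M by (rule rsp_split[OF y])
  have n: "n = e + length ys" using y by (simp add: rsp_def)
  show ?thesis
   unfolding sp.power_M Fw_def gI_def
  proof (rule sp.mI_mono, rule subsetI)
   fix al assume "al \<in> {al \<in> exps (e + length ys). tdeg (e + length ys) al = N}"
   hence a: "al \<in> exps n" "tdeg n al = N" using n by auto
   have "s \<le> c * real N" using N c(1) by (simp add: field_simps)
   also have "\<dots> \<le> wt n w al" using wt_tdeg_lower[of n c w al] c(2) a(2) by simp
   also have "\<dots> = wt e L al + \<rho> * real (ydeg e (length ys) al)" unfolding n w_def by (rule wt_ydeg)
   finally show "al \<in> {al \<in> exps (e + length ys). s \<le> wt e L al + \<rho> * real (ydeg e (length ys) al)}"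
    using a n by simp
  qed
 qed
 thus ?thesis by blast
qed

text \<open>It suffices that every half space valid for \<open>ys\<close> remains valid for
  \<open>ys'\<close>, and by \<open>newt_outside\<close> positive weights are enough.\<close>

lemma newt_change:
 assumes y': "rsp ys'" and len: "length ys = length ys'"
  and z: "\<And>L \<rho> j. (\<And>i. 0 < L i) ==> 0 < \<rho> ==> J \<subseteq> Fw ys L \<rho> (\<rho> * real b) ==> j < length ys' ==> ys ! j \<in> Fw ys' L \<rho> \<rho>"
 shows "newt ys' \<subseteq> newt ys"
proof
 fix p assume p: "p \<in> newt ys'"
 hence po: "p \<in> orthant e" by (simp add: newt_def)
 show "p \<in> newt ys"
 proof (rule ccontr)
  assume "p \<notin> newt ys"
  from newt_outside[OF po this] obtain L \<rho> where L: "\<forall>i. 0 < L i" "0 < \<rho>" "J \<subseteq> Fw ys L \<rho> (\<rho> * real b)" "(\<Sum>i<e. L i * p i) < \<rho>" by blast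
  have Lp: "0 < L i" for i using L(1) by blast
  have "Fw ys L \<rho> (\<rho> * real b) \<subseteq> Fw ys' L \<rho> (\<rho> * real b)"
   by (rule Fw_change[OF y' len]) (rule z[of L \<rho>, OF Lp L(2,3)])
  hence "J \<subseteq> Fw ys' L \<rho> (\<rho> * real b)" using L(3) by blast
  thus False using newtD[of p ys' L \<rho>, OF p Lp L(2)] L(4) by simp
 qed
qed

text \<open>Every half space that contains the old polyhedron contains \<open>A\<close>, so u^A has
  weight at least \<rho> and the translation respects the filtration.\<close>

lemma shift_newt:
 assumes y: "rsp ys" and cs: "length cs = length ys" "set cs \<subseteq> carrier R" and A: "A \<in> exps e" "A \<noteq> 0" and v: "pt A \<in> newt ys"
 shows "newt (shift ys cs A) \<subseteq> newt ys"
proof -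
 have y': "rsp (shift ys cs A)" by (rule rsp_shift[OF y cs A])
 show ?thesis
 proof (rule newt_change[OF y'])
  fix L :: "nat => real" and \<rho> :: real and j
  assume Lp: "\<And>i. 0 < L i" and r: "0 < \<rho>" and J: "J \<subseteq> Fw ys L \<rho> (\<rho> * real b)" and j: "j < length (shift ys cs A)"
  have jy: "j < length ys" using j by simp
  have c: "cs ! j \<in> carrier R" "ys ! j \<in> carrier R" using cs jy nth_mem[of j cs] rsp_nth(2)[OF y jy] by auto
  have umc: "um A \<in> carrier R" by (rule um_closed[OF y])
  have "\<rho> \<le> wt e L A" using newtD[of "pt A" ys L \<rho>, OF v Lp r J] unfolding pt_sum .
  hence u: "um A \<in> Fw (shift ys cs A) L \<rho> \<rho>" using um_Fw[OF y', of A L \<rho>] Fw_antimono by blast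
  have "ys ! j = shift ys cs A ! j \<ominus> cs ! j \<otimes> um A" unfolding nth_shift[OF jy] using c umc by algebra
  thus "ys ! j \<in> Fw (shift ys cs A) L \<rho> \<rho>"
   using ideal_minus[OF Fw_ideal[OF y'] Fw_ys[OF y' j] ideal_mult[OF Fw_ideal[OF y'] c(1) u]] by simp
 qed simp
qed

definition solving :: "'a list => (nat => nat) => 'a list => bool" where
 "solving ys A cs \<longleftrightarrow> A \<in> exps e \<and> A \<noteq> 0 \<and> length cs = length ys \<and> set cs \<subseteq> carrier R \<and>
   pt A \<in> newt ys \<and> pt A \<notin> newt (shift ys cs A)"

lemma solving_exists:
 assumes "rsp ys" "\<not> degenerate (length ys)" "rsp yh" "\<not> newt ys \<subseteq> newt yh"
 shows "\<exists>A cs. solving ys A cs"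
 using solvable_vertex[OF assms(1,3,2,4)] unfolding solving_def .

lemma shift_diff:
 assumes y: "rsp ys" and s: "solving ys A cs" and j: "j < length ys"
 shows "shift ys cs A ! j \<ominus> ys ! j = cs ! j \<otimes> um A" "cs ! j \<in> carrier R"
proof -
 show c: "cs ! j \<in> carrier R" using s j nth_mem[of j cs] unfolding solving_def by auto
 show "shift ys cs A ! j \<ominus> ys ! j = cs ! j \<otimes> um A"
  unfolding nth_shift[OF j] using c rsp_nth(2)[OF y j] um_closed[OF y, of A] by algebra
qed

end

text \<open>Either some system congruent to \<open>ys\<close> modulo u admits no removable point,
  and \<open>solving_exists\<close> shows that its polyhedron is minimal, or translations can be
  continued forever and their limit is taken.\<close>

theorem (in pair_setup) prepared_coordinates:
 assumes cf: "complete_filtered R (ideal_power R M)" and y: "rsp ys" and nd: "\<not> degenerate (length ys)"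
 shows "\<exists>yt. rsp yt \<and> (\<forall>j<length ys. yt ! j \<ominus> ys ! j \<in> Idl (set us)) \<and> (\<forall>yh. rsp yh \<longrightarrow> newt yt \<subseteq> newt yh)"
proof -
 interpret cf: complete_filtered R "ideal_power R M" by (rule cf)
 define r where "r = length ys"
 define cnt where "cnt = to_nat_on (exps e)"
 have cnt: "inj_on cnt (exps e)" unfolding cnt_def by (rule inj_on_to_nat_on[OF countable_exps])
 note iu = genideal_ideal[OF rsp_carrier(1)[OF y]]
 define good where "good zs \<longleftrightarrow> rsp zs \<and> (\<forall>j<r. zs ! j \<ominus> ys ! j \<in> Idl (set us))" for zs
 have goodlen: "length zs = r" if "good zs" for zs using that rsp_length[OF _ y] unfolding good_def r_def by blast
 have good0: "good ys"
  unfolding good_def using y rsp_nth(2)[OF y] ideal_zero[OF iu] by (simp add: r_def a_minus_def r_neg)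
 have good_Suc: "good (shift zs cs A)" if z: "good zs" "solving zs A cs" for zs cs A
  unfolding good_def
 proof (intro conjI allI impI)
  have rz: "rsp zs" using z(1) by (simp add: good_def)
  have sA: "length cs = length zs" "set cs \<subseteq> carrier R" "A \<in> exps e" "A \<noteq> 0" using z(2) unfolding solving_def by blast+
  show "rsp (shift zs cs A)" by (rule rsp_shift[OF rz sA])
  fix j assume j: "j < r"
  have jz: "j < length zs" using j goodlen[OF z(1)] by simp
  have c: "shift zs cs A ! j \<in> carrier R" using rsp_nth(2)[OF rsp_shift[OF rz sA]] jz by simp
  have zc: "zs ! j \<in> carrier R" "ys ! j \<in> carrier R" using rsp_nth(2)[OF rz jz] rsp_nth(2)[OF y] j r_def by auto
  have "shift zs cs A ! j \<ominus> zs ! j \<in> Idl (set us)"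
   unfolding shift_diff(1)[OF rz z(2) jz] by (rule ideal_mult[OF iu shift_diff(2)[OF rz z(2) jz] um_us[OF y sA(3,4)]])
  moreover have "zs ! j \<ominus> ys ! j \<in> Idl (set us)" using z(1) j by (simp add: good_def)
  ultimately have "(shift zs cs A ! j \<ominus> zs ! j) \<oplus> (zs ! j \<ominus> ys ! j) \<in> Idl (set us)" by (rule ideal_add[OF iu])
  moreover have "(shift zs cs A ! j \<ominus> zs ! j) \<oplus> (zs ! j \<ominus> ys ! j) = shift zs cs A ! j \<ominus> ys ! j"
   using c zc by algebra
  ultimately show "shift zs cs A ! j \<ominus> ys ! j \<in> Idl (set us)" by simp
 qed
 show ?thesis
 proof (cases "\<exists>zs. good zs \<and> \<not> (\<exists>A cs. solving zs A cs)")
  case True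
  then obtain zs where z: "good zs" "\<not> (\<exists>A cs. solving zs A cs)" by blast
  have rz: "rsp zs" using z(1) by (simp add: good_def)
  have ndz: "\<not> degenerate (length zs)" using nd goodlen[OF z(1)] r_def by simp
  have "newt zs \<subseteq> newt yh" if "rsp yh" for yh using solving_exists[OF rz ndz that] z(2) by blast
  thus ?thesis using z(1) unfolding good_def r_def by blast
 next
  case False
  define least where "least zs A cs \<longleftrightarrow> solving zs A cs \<and> (\<forall>B ds. solving zs B ds \<longrightarrow> cnt A \<le> cnt B)" for zs A cs
  have ex_least: "\<exists>A cs. least zs A cs" if "good zs" for zs
  proof -
   let ?P = "\<lambda>k. \<exists>A cs. solving zs A cs \<and> cnt A = k"
   have ex: "\<exists>k. ?P k" using False that by blast
   obtain A cs where A: "solving zs A cs" "cnt A = (LEAST k. ?P k)" using LeastI_ex[OF ex] by blast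
   have "cnt A \<le> cnt B" if "solving zs B ds" for B ds unfolding A(2) using that by (intro Least_le) blast
   thus ?thesis using A(1) unfolding least_def by blast
  qed
  have "\<exists>Y. \<forall>k::nat. good (Y k) \<and> (\<exists>A cs. least (Y k) A cs \<and> Y (Suc k) = shift (Y k) cs A)"
  proof (rule dependent_nat_choice[of "\<lambda>_. good" "\<lambda>_ Z Z'. \<exists>A cs. least Z A cs \<and> Z' = shift Z cs A"])
   show "\<exists>Y. good Y" using good0 by blast
   fix Y and k :: nat assume g: "good Y"
   obtain A cs where l: "least Y A cs" using ex_least[OF g] by blast
   have "good (shift Y cs A)" using good_Suc[OF g] l unfolding least_def by blast
   thus "\<exists>Y'. good Y' \<and> (\<exists>A cs. least Y A cs \<and> Y' = shift Y cs A)" using l by blast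
  qed
  then obtain Y where Y: "\<And>k. good (Y k)" "\<forall>k. \<exists>Acs. least (Y k) (fst Acs) (snd Acs) \<and> Y (Suc k) = shift (Y k) (snd Acs) (fst Acs)"
   by (auto simp: split_paired_Ex)
  from choice[OF Y(2)] obtain Acs where Acs: "\<And>k. least (Y k) (fst (Acs k)) (snd (Acs k)) \<and> Y (Suc k) = shift (Y k) (snd (Acs k)) (fst (Acs k))" by blast
  define A where "A k = fst (Acs k)" for k
  define cs where "cs k = snd (Acs k)" for k
  have YS: "Y (Suc k) = shift (Y k) (cs k) (A k)" for k using Acs by (simp add: A_def cs_def)
  have sol: "solving (Y k) (A k) (cs k)" for k using Acs unfolding A_def cs_def least_def by blast
  have least: "cnt (A k) \<le> cnt B" if "solving (Y k) B ds" for k B ds using Acs[of k] that unfolding A_def cs_def least_def by blast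
  have rY: "rsp (Y k)" for k using Y(1) by (simp add: good_def)
  have lY: "length (Y k) = r" for k by (rule goodlen[OF Y(1)])
  have Ae: "A k \<in> exps e" "A k \<noteq> 0" "length (cs k) = length (Y k)" "set (cs k) \<subseteq> carrier R"
   "pt (A k) \<in> newt (Y k)" "pt (A k) \<notin> newt (Y (Suc k))" for k
   using sol[of k] unfolding solving_def YS by blast+
  have anti: "newt (Y l) \<subseteq> newt (Y k)" if "k \<le> l" for k l
  proof (rule lift_Suc_antimono_le[of "\<lambda>k. newt (Y k)", OF _ that])
   show "newt (Y (Suc k)) \<subseteq> newt (Y k)" for k unfolding YS by (rule shift_newt[OF rY Ae(3,4,1,2,5)])
  qed
  \<comment> \<open>A removed point stays removed because the polyhedra decrease.\<close>
  have Aneq: "A k \<noteq> A l" if "k < l" for k l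
  proof
   assume "A k = A l"
   hence "pt (A k) \<in> newt (Y l)" using Ae(5)[of l] by simp
   hence "pt (A k) \<in> newt (Y (Suc k))" using anti[of "Suc k" l] that by auto
   thus False using Ae(6) by blast
  qed
  hence Ainj: "inj A" by (intro injI) (metis linorder_neqE_nat)
  \<comment> \<open>The exponents used are distinct, and only finitely many have degree below
    \<open>N\<close>.\<close>
  have large: "\<exists>K. \<forall>k\<ge>K. N \<le> tdeg e (A k)" for N
  proof -
   have "finite (A -` {al \<in> exps e. tdeg e al < N})" by (rule finite_vimageI[OF finite_exps_tdeg Ainj])
   then obtain K where K: "\<forall>k\<in>A -` {al \<in> exps e. tdeg e al < N}. k < K"
    using finite_nat_set_iff_bounded by blast
   have "N \<le> tdeg e (A k)" if "K \<le> k" for k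
   proof (rule ccontr)
    assume "\<not> N \<le> tdeg e (A k)"
    hence "k \<in> A -` {al \<in> exps e. tdeg e al < N}" using Ae(1)[of k] by simp
    thus False using K that by auto
   qed
   thus ?thesis by blast
  qed
  have step: "Y (Suc k) ! j \<ominus> Y k ! j = cs k ! j \<otimes> um (A k)" "cs k ! j \<in> carrier R" if j: "j < r" for k j
   using shift_diff[OF rY sol, of j] j lY unfolding YS by simp_all
  have Yc: "Y k ! j \<in> carrier R" if "j < r" for k j using rsp_nth(2)[OF rY] lY that by simp
  have small: "\<exists>K. \<forall>k\<ge>K. Y (Suc k) ! j \<ominus> Y k ! j \<in> ideal_power R M N" if j: "j < r" for j N
  proof -
   interpret sp: split_parameters R us ys M by (rule rsp_split[OF y])
   obtain K where K: "\<And>k. K \<le> k ==> N \<le> tdeg e (A k)" using large by blast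
   have "um (A k) \<in> ideal_power R M N" if k: "K \<le> k" for k
   proof -
    have "tdeg e (A k) \<le> tdeg (e + length ys) (A k)" by (simp add: tdeg_ydeg)
    hence "N \<le> tdeg (e + length ys) (A k)" using K[OF k] by simp
    thus ?thesis unfolding um_mx[OF y Ae(1)]
     by (rule sp.mx_power_M[OF exps_mono[OF _ Ae(1)], rotated]) simp
   qed
   hence "Y (Suc k) ! j \<ominus> Y k ! j \<in> ideal_power R M N" if k: "K \<le> k" for k
    unfolding step(1)[OF j] by (rule ideal_mult[OF ideal_power_ideal[OF maxideal(1)] step(2)[OF j]]) (rule k)
   thus ?thesis by blast
  qed
  have "\<forall>j. \<exists>l. j < r \<longrightarrow> l \<in> carrier R \<and> (\<forall>N. \<exists>K. \<forall>k\<ge>K. l \<ominus> Y k ! j \<in> ideal_power R M N)"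
  proof
   fix j
   show "\<exists>l. j < r \<longrightarrow> l \<in> carrier R \<and> (\<forall>N. \<exists>K. \<forall>k\<ge>K. l \<ominus> Y k ! j \<in> ideal_power R M N)"
   proof (cases "j < r")
    case True
    thus ?thesis using cf.cauchy_limit[of "\<lambda>k. Y k ! j", OF Yc[OF True] small[OF True]] by blast
   qed simp
  qed
  from choice[OF this] obtain l where l: "\<And>j. j < r ==> l j \<in> carrier R"
   "\<And>j N. j < r ==> \<exists>K. \<forall>k\<ge>K. l j \<ominus> Y k ! j \<in> ideal_power R M N" by blast
  define yt where "yt = map l [0..<r]"
  have yt: "length yt = r" "\<And>j. j < r ==> yt ! j = l j" by (simp_all add: yt_def)
  \<comment> \<open>The ideal of u is closed, by Krull's intersection theorem, so the congruence
    passes to the limit.\<close>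
  have ldiff: "l j \<ominus> ys ! j \<in> Idl (set us)" if j: "j < r" for j
  proof -
   interpret sp: split_parameters R us ys M by (rule rsp_split[OF y])
   have yc: "ys ! j \<in> carrier R" using rsp_nth(2)[OF y] j r_def by simp
   show ?thesis
   proof (rule sp.krull_intersection[OF noeth iu])
    show "l j \<ominus> ys ! j \<in> carrier R" using l(1)[OF j] yc by simp
    fix m
    obtain k where k: "l j \<ominus> Y k ! j \<in> ideal_power R M m" using l(2)[OF j] by blast
    have c: "Idl (set us) \<union> ideal_power R M m \<subseteq> carrier R"
     using ideal_sub[OF iu] ideal_sub[OF ideal_power_ideal[OF maxideal(1)]] by blast
    note self = genideal_self[OF c] and I = genideal_ideal[OF c]
    have "l j \<ominus> Y k ! j \<in> Idl (Idl (set us) \<union> ideal_power R M m)" using self k by blast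
    moreover have "Y k ! j \<ominus> ys ! j \<in> Idl (Idl (set us) \<union> ideal_power R M m)"
     using self Y(1)[of k] j unfolding good_def by blast
    ultimately have "(l j \<ominus> Y k ! j) \<oplus> (Y k ! j \<ominus> ys ! j) \<in> Idl (Idl (set us) \<union> ideal_power R M m)" by (rule ideal_add[OF I])
    moreover have "(l j \<ominus> Y k ! j) \<oplus> (Y k ! j \<ominus> ys ! j) = l j \<ominus> ys ! j" using l(1)[OF j] Yc[OF j, of k] yc by algebra
    ultimately show "l j \<ominus> ys ! j \<in> Idl (Idl (set us) \<union> ideal_power R M m)" by simp
   qed
  qed
  have ryt: "rsp yt"
  proof (rule rsp_change[OF y])
   show "length yt = length ys" using yt r_def by simp
   fix j assume "j < length ys"
   hence j: "j < r" by (simp add: r_def)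
   show "yt ! j \<in> carrier R \<and> yt ! j \<ominus> ys ! j \<in> Idl (set us)" using l(1)[OF j] ldiff[OF j] yt(2)[OF j] by simp
  qed
  \<comment> \<open>All translations after stage k use points of \<open>newt (Y k)\<close>. Hence
    the limit differs from \<open>Y k\<close> by elements of weight at least \<rho>, up to a high
    power of \<open>M\<close>, which has that weight as well.\<close>
  have below: "newt yt \<subseteq> newt (Y k)" for k
  proof (rule newt_change[OF ryt])
   show "length (Y k) = length yt" using lY yt by simp
   fix L :: "nat => real" and \<rho> :: real and j
   assume Lp: "\<And>i. 0 < L i" and r: "0 < \<rho>" and J: "J \<subseteq> Fw (Y k) L \<rho> (\<rho> * real b)" and "j < length yt"
   hence j: "j < r" using yt by simp
   note FI = Fw_ideal[OF ryt, of L \<rho> \<rho>]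
   obtain N where N: "\<forall>ys. rsp ys \<longrightarrow> ideal_power R M N \<subseteq> Fw ys L \<rho> \<rho>" using power_le_Fw[of L \<rho> \<rho>, OF Lp r] by blast
   obtain K where K: "\<forall>k\<ge>K. l j \<ominus> Y k ! j \<in> ideal_power R M N" using l(2)[OF j] by blast
   define m where "m = max k K"
   have 1: "l j \<ominus> Y m ! j \<in> Fw yt L \<rho> \<rho>" using K[rule_format, of m] N[rule_format, OF ryt] unfolding m_def by auto
   have 2: "Y m ! j \<ominus> Y k ! j \<in> Fw yt L \<rho> \<rho>"
   proof (rule telescope_ideal[OF FI])
    show "Y i ! j \<in> carrier R" for i by (rule Yc[OF j])
    show "k \<le> m" by (simp add: m_def)
    fix i assume i: "k \<le> i"
    have "pt (A i) \<in> newt (Y k)" using Ae(5)[of i] anti[OF i] by blast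
    hence "\<rho> \<le> wt e L (A i)" using newtD[of "pt (A i)" "Y k" L \<rho>, OF _ Lp r J] unfolding pt_sum by blast
    hence "um (A i) \<in> Fw yt L \<rho> \<rho>" using um_Fw[OF ryt, of "A i" L \<rho>] Fw_antimono by blast
    thus "Y (Suc i) ! j \<ominus> Y i ! j \<in> Fw yt L \<rho> \<rho>" unfolding step(1)[OF j] by (rule ideal_mult[OF FI step(2)[OF j]])
   qed
   have 3: "l j \<in> Fw yt L \<rho> \<rho>" using Fw_ys[OF ryt] yt j by metis
   have "Y k ! j = l j \<ominus> ((l j \<ominus> Y m ! j) \<oplus> (Y m ! j \<ominus> Y k ! j))" using l(1)[OF j] Yc[OF j, of m] Yc[OF j, of k] by algebra
   thus "Y k ! j \<in> Fw yt L \<rho> \<rho>" using ideal_minus[OF FI 3 ideal_add[OF FI 1 2]] by simp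
  qed
  have "newt yt \<subseteq> newt yh" if yh: "rsp yh" for yh
  proof (rule ccontr)
   assume n: "\<not> newt yt \<subseteq> newt yh"
   have "\<not> degenerate (length yt)" using nd yt r_def by simp
   from solving_exists[OF ryt this yh n] obtain B ds where "solving yt B ds" by blast
   hence B: "B \<in> exps e" "B \<noteq> 0" "length ds = length yt" "set ds \<subseteq> carrier R" "pt B \<in> newt yt" "pt B \<notin> newt (shift yt ds B)"
    unfolding solving_def by blast+
   have rsh: "rsp (shift yt ds B)" by (rule rsp_shift[OF ryt B(3,4,1,2)])
   have rshY: "rsp (shift (Y k) ds B)" for k by (rule rsp_shift[OF rY _ B(4,1,2)]) (use B(3) yt lY in simp)
   obtain L \<rho> where L: "\<forall>i. 0 < L i" "0 < \<rho>" "J \<subseteq> Fw (shift yt ds B) L \<rho> (\<rho> * real b)" "(\<Sum>i<e. L i * pt B i) < \<rho>"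
    using newt_outside[OF pt_orthant[OF B(1)] B(6)] by blast
   have Lp: "0 < L i" for i using L(1) by blast
   obtain N where N: "\<forall>ys. rsp ys \<longrightarrow> ideal_power R M N \<subseteq> Fw ys L \<rho> \<rho>" using power_le_Fw[of L \<rho> \<rho>, OF Lp L(2)] by blast
   have "\<forall>j. \<exists>K. j < r \<longrightarrow> (\<forall>k\<ge>K. l j \<ominus> Y k ! j \<in> ideal_power R M N)" using l(2) by blast
   from choice[OF this] obtain K where K: "\<And>j k. j < r ==> K j \<le> k ==> l j \<ominus> Y k ! j \<in> ideal_power R M N" by blast
   define K0 where "K0 = (\<Sum>j<r. K j)"
   have KK: "K j \<le> K0" if "j < r" for j unfolding K0_def using that by (intro member_le_sum) auto
   \<comment> \<open>For late k, \<open>Y k\<close> and \<open>yt\<close> differ by elements of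
     weight at least \<rho>, so the half space that excludes \<open>B\<close> after translating
     \<open>yt\<close> also excludes it after translating \<open>Y k\<close>.\<close>
   have "solving (Y k) B ds" if k: "K0 \<le> k" for k
    unfolding solving_def
   proof (intro conjI)
    show "length ds = length (Y k)" using B(3) yt lY by simp
    show "pt B \<in> newt (Y k)" using B(5) below by blast
    show "pt B \<notin> newt (shift (Y k) ds B)"
    proof
     assume pB: "pt B \<in> newt (shift (Y k) ds B)"
     have "Fw (shift yt ds B) L \<rho> (\<rho> * real b) \<subseteq> Fw (shift (Y k) ds B) L \<rho> (\<rho> * real b)"
     proof (rule Fw_change[OF rshY])
      show "length (shift yt ds B) = length (shift (Y k) ds B)" using yt lY by simp
      fix j assume j': "j < length (shift (Y k) ds B)"
      hence j: "j < r" using lY by simp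
      note FI = Fw_ideal[OF rshY, of k L \<rho> \<rho>]
      have d: "ds ! j \<in> carrier R" using B(3,4) yt(1) j nth_mem[of j ds] by auto
      have umc: "um B \<in> carrier R" by (rule um_closed[OF y])
      have "K j \<le> k" using KK[OF j] k by simp
      hence "l j \<ominus> Y k ! j \<in> Fw (shift (Y k) ds B) L \<rho> \<rho>" using K[OF j] N rshY[of k] by blast
      hence "shift (Y k) ds B ! j \<oplus> (l j \<ominus> Y k ! j) \<in> Fw (shift (Y k) ds B) L \<rho> \<rho>"
       by (rule ideal_add[OF FI Fw_ys[OF rshY j']])
      moreover have "shift (Y k) ds B ! j \<oplus> (l j \<ominus> Y k ! j) = shift yt ds B ! j"
      proof -
       have e1: "shift (Y k) ds B ! j = Y k ! j \<oplus> ds ! j \<otimes> um B" by (rule nth_shift) (use j lY in simp)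
       have e2: "shift yt ds B ! j = l j \<oplus> ds ! j \<otimes> um B" using nth_shift[of j yt ds B] j yt by simp
       show ?thesis unfolding e1 e2 using d umc l(1)[OF j] Yc[OF j, of k] by algebra
      qed
      ultimately show "shift yt ds B ! j \<in> Fw (shift (Y k) ds B) L \<rho> \<rho>" by simp
     qed
     hence "J \<subseteq> Fw (shift (Y k) ds B) L \<rho> (\<rho> * real b)" using L(3) by blast
     thus False using newtD[of "pt B" "shift (Y k) ds B" L \<rho>, OF pB Lp L(2)] L(4) by simp
    qed
   qed (use B in auto)
   hence bound: "cnt (A k) \<le> cnt B" if "K0 \<le> k" for k using least that by blast
   \<comment> \<open>The exponents A_k have distinct numbers, yet all late ones are numbered at most
     \<open>cnt B\<close>.\<close>
   have "inj (\<lambda>k. cnt (A k))"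
    using inj_onD[OF cnt _ Ae(1) Ae(1)] injD[OF Ainj] by (intro injI) blast
   hence "finite ((\<lambda>k. cnt (A k)) -` {..cnt B})" by (rule finite_vimageI[OF finite_atMost])
   moreover have "{K0..} \<subseteq> (\<lambda>k. cnt (A k)) -` {..cnt B}" using bound by auto
   ultimately have "finite {K0..}" by (rule finite_subset[rotated])
   thus False using infinite_Ici by blast
  qed
  thus ?thesis using ryt ldiff yt r_def by metis
 qed
qed

section \<open>The associated graded ring\<close>

locale graded_setup = cring R for R (structure) +
 fixes M :: "'a set"
 assumes M_ideal: "ideal M R"
begin

abbreviation pw :: "nat => 'a set" where "pw k \<equiv> ideal_power R M k"
abbreviation gr :: "(nat => 'a set) ring" where "gr \<equiv> assoc_graded R M"
abbreviation gc :: "nat => 'a => nat => 'a set" where "gc \<equiv> graded_class R M"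

lemma pw_ideal: "ideal (pw k) R"
 by (rule ideal_power_ideal[OF M_ideal])

lemma pw_carr: "f \<in> pw k ==> f \<in> carrier R"
 using ideal_sub[OF pw_ideal] by blast

lemmas pw_coset_eq = coset_eq[OF pw_ideal]
lemmas pw_coset_zero = coset_zero[OF pw_ideal]

lemma pw_mult: "a \<in> pw k ==> b \<in> pw l ==> a \<otimes> b \<in> pw (k + l)"
proof (induction l arbitrary: b)
 case 0
 thus ?case using ideal.I_r_closed[OF pw_ideal 0(1) pw_carr[OF 0(2)]] by simp
next
 case (Suc l)
 have "pw (Suc l) \<subseteq> {b \<in> carrier R. a \<otimes> b \<in> pw (k + Suc l)}"
  unfolding ideal_power_Suc[of M l]
 proof (rule ideal_prod_minimal)
  show "ideal {b \<in> carrier R. a \<otimes> b \<in> pw (k + Suc l)} R"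
  proof (rule ideal_Collect)
   note I = pw_ideal[of "k + Suc l"] and ac = pw_carr[OF Suc(2)]
   show "\<zero> \<in> carrier R \<and> a \<otimes> \<zero> \<in> pw (k + Suc l)" using ac ideal_zero[OF I] by simp
   fix c assume c: "c \<in> carrier R \<and> a \<otimes> c \<in> pw (k + Suc l)"
   show "y \<otimes> c \<in> carrier R \<and> a \<otimes> (y \<otimes> c) \<in> pw (k + Suc l)" if y: "y \<in> carrier R" for y
    using ideal_mult[OF I y, of "a \<otimes> c"] c y ac by (simp add: m_lcomm)
   show "c \<oplus> d \<in> carrier R \<and> a \<otimes> (c \<oplus> d) \<in> pw (k + Suc l)" if "d \<in> carrier R \<and> a \<otimes> d \<in> pw (k + Suc l)" for d
    using ideal_add[OF I, of "a \<otimes> c" "a \<otimes> d"] c that ac by (simp add: r_distr)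
  qed auto
  fix c d assume cd: "c \<in> pw l" "d \<in> M"
  have dc: "d \<in> carrier R" "c \<in> carrier R" "a \<in> carrier R" using cd pw_carr Suc(2) ideal_sub[OF M_ideal] by auto
  have "a \<otimes> c \<otimes> d \<in> pw (Suc (k + l))"
   unfolding ideal_power_Suc[of M "k + l"] by (rule ideal_prod.prod[OF Suc(1)[OF Suc(2) cd(1)] cd(2)])
  thus "c \<otimes> d \<in> {b \<in> carrier R. a \<otimes> b \<in> pw (k + Suc l)}" using dc by (simp add: m_assoc)
 qed
 thus ?case using Suc(3) by blast
qed

text \<open>The Rees algebra: polynomials whose coefficient in degree a lies in M^a. It is a subring
  of \<open>UP R\<close> and maps onto the associated graded ring by \<open>cl\<close>; the ring
  axioms of the latter are obtained in this way.\<close>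

definition rees :: "(nat => 'a) set" where
 "rees = {p. (\<forall>a. p a \<in> pw a) \<and> finite {a. p a \<noteq> \<zero>}}"

definition cl :: "(nat => 'a) => nat => 'a set" where
 "cl p = (\<lambda>a. pw (Suc a) +> p a)"

definition conv :: "(nat => 'a) => (nat => 'a) => nat => 'a" where
 "conv p q = (\<lambda>n. \<Oplus>i\<in>{..n}. p i \<otimes> q (n - i))"

lemma reesD: "p \<in> rees ==> p a \<in> pw a" "p \<in> rees ==> p a \<in> carrier R"
 using pw_carr by (auto simp: rees_def)

lemma cl_eq: "p \<in> rees ==> q \<in> rees ==> cl p = cl q \<longleftrightarrow> (\<forall>a. p a \<ominus> q a \<in> pw (Suc a))"
 unfolding cl_def fun_eq_iff using pw_coset_eq[OF reesD(2) reesD(2)] by auto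

lemma carrier_gr: "carrier gr = cl ` rees"
proof
 show "carrier gr \<subseteq> cl ` rees"
 proof
  fix s assume "s \<in> carrier gr"
  hence s: "\<forall>a. \<exists>x. x \<in> pw a \<and> s a = pw (Suc a) +> x" "finite {a. s a \<noteq> pw (Suc a)}"
   by (auto simp: assoc_graded_def)
  \<comment> \<open>Zero cosets are represented by zero, so that the support stays finite.\<close>
  have "\<forall>a. \<exists>x. x \<in> pw a \<and> s a = pw (Suc a) +> x \<and> (s a = pw (Suc a) \<longrightarrow> x = \<zero>)"
  proof
   fix a show "\<exists>x. x \<in> pw a \<and> s a = pw (Suc a) +> x \<and> (s a = pw (Suc a) \<longrightarrow> x = \<zero>)"
   proof (cases "s a = pw (Suc a)")
    case True
    thus ?thesis using ideal_zero[OF pw_ideal] pw_coset_zero by (intro exI[of _ \<zero>]) simp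
   next
    case False
    thus ?thesis using s(1) by blast
   qed
  qed
  from choice[OF this] obtain p where p: "\<And>a. p a \<in> pw a" "\<And>a. s a = pw (Suc a) +> p a" "\<And>a. s a = pw (Suc a) ==> p a = \<zero>"
   by blast
  have "{a. p a \<noteq> \<zero>} \<subseteq> {a. s a \<noteq> pw (Suc a)}" using p(3) by blast
  hence "p \<in> rees" unfolding rees_def using p(1) finite_subset s(2) by blast
  moreover have "s = cl p" unfolding cl_def using p(2) by blast
  ultimately show "s \<in> cl ` rees" by blast
 qed
 show "cl ` rees \<subseteq> carrier gr"
 proof (rule image_subsetI)
  fix p assume p: "p \<in> rees"
  have "{a. cl p a \<noteq> pw (Suc a)} \<subseteq> {a. p a \<noteq> \<zero>}" unfolding cl_def using pw_coset_zero by auto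
  hence "finite {a. cl p a \<noteq> pw (Suc a)}" using p finite_subset unfolding rees_def by blast
  thus "cl p \<in> carrier gr" using reesD(1)[OF p] by (auto simp: assoc_graded_def cl_def)
 qed
qed

text \<open>The product in \<open>assoc_graded\<close> is a union over all representatives; this
  makes it a single coset.\<close>

lemma conv_cong:
 assumes p: "p \<in> rees" and q: "q \<in> rees"
  and x: "\<And>i. i \<le> n ==> x i \<in> pw (Suc i) +> p i" and y: "\<And>i. i \<le> n ==> y i \<in> pw (Suc i) +> q i"
 shows "conv x y n \<in> carrier R \<and> conv x y n \<ominus> conv p q n \<in> pw (Suc n)"
proof -
 have xd: "x i \<in> carrier R" "x i \<ominus> p i \<in> pw (Suc i)" if "i \<le> n" for i
  using x[OF that] coset_mem[OF pw_ideal reesD(2)[OF p]] by auto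
 have yd: "y i \<in> carrier R" "y i \<ominus> q i \<in> pw (Suc i)" if "i \<le> n" for i
  using y[OF that] coset_mem[OF pw_ideal reesD(2)[OF q]] by auto
 have c: "p i \<in> carrier R" "q i \<in> carrier R" for i using reesD p q by auto
 have yp: "y i \<in> pw i" if i: "i \<le> n" for i
 proof -
  have "(y i \<ominus> q i) \<oplus> q i \<in> pw i"
   using ideal_add[OF pw_ideal] yd(2)[OF i] ideal_power_Suc_le[OF M_ideal] reesD(1)[OF q] by blast
  moreover have "(y i \<ominus> q i) \<oplus> q i = y i" using yd(1)[OF i] c(2)[of i] by algebra
  ultimately show ?thesis by simp
 qed
 have d: "x i \<otimes> y (n - i) \<ominus> p i \<otimes> q (n - i) \<in> pw (Suc n)" if i: "i \<le> n" for i
 proof -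
  have 1: "(x i \<ominus> p i) \<otimes> y (n - i) \<in> pw (Suc n)" using pw_mult[OF xd(2)[OF i] yp[of "n - i"]] i by simp
  have 2: "p i \<otimes> (y (n - i) \<ominus> q (n - i)) \<in> pw (Suc n)" using pw_mult[OF reesD(1)[OF p, of i] yd(2)[of "n - i"]] i by simp
  have "x i \<otimes> y (n - i) \<ominus> p i \<otimes> q (n - i) = (x i \<ominus> p i) \<otimes> y (n - i) \<oplus> p i \<otimes> (y (n - i) \<ominus> q (n - i))"
   using xd(1)[OF i] yd(1)[of "n - i"] c(1)[of i] c(2)[of "n - i"] by simp algebra
  thus ?thesis using ideal_add[OF pw_ideal 1 2] by simp
 qed
 have xc: "conv x y n \<in> carrier R" unfolding conv_def using xd(1) yd(1) by (intro finsum_closed) auto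
 have "conv x y n = (\<Oplus>i\<in>{..n}. p i \<otimes> q (n - i) \<oplus> (x i \<otimes> y (n - i) \<ominus> p i \<otimes> q (n - i)))"
  unfolding conv_def
 proof (rule finsum_cong')
  fix i assume "i \<in> {..n}"
  hence i: "i \<le> n" by simp
  show "x i \<otimes> y (n - i) = p i \<otimes> q (n - i) \<oplus> (x i \<otimes> y (n - i) \<ominus> p i \<otimes> q (n - i))"
   using xd(1)[OF i] yd(1)[of "n - i"] c(1)[of i] c(2)[of "n - i"] by simp algebra
 qed (use c xd(1) yd(1) in auto)
 also have "\<dots> = conv p q n \<oplus> (\<Oplus>i\<in>{..n}. x i \<otimes> y (n - i) \<ominus> p i \<otimes> q (n - i))"
  unfolding conv_def using c xd(1) yd(1) by (intro finsum_addf) auto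
 finally have e: "conv x y n = conv p q n \<oplus> (\<Oplus>i\<in>{..n}. x i \<otimes> y (n - i) \<ominus> p i \<otimes> q (n - i))" .
 have r: "(\<Oplus>i\<in>{..n}. x i \<otimes> y (n - i) \<ominus> p i \<otimes> q (n - i)) \<in> pw (Suc n)" by (intro ideal_finsum[OF pw_ideal]) (use d in auto)
 have pc: "conv p q n \<in> carrier R" unfolding conv_def using c by (intro finsum_closed) auto
 have cancel: "(a \<oplus> t) \<ominus> a = t" if "a \<in> carrier R" "t \<in> carrier R" for a t using that by algebra
 show ?thesis using xc r cancel[OF pc pw_carr[OF r]] e by simp
qed

lemma mult_gr:
 assumes p: "p \<in> rees" and q: "q \<in> rees"
 shows "cl p \<otimes>\<^bsub>gr\<^esub> cl q = cl (conv p q)"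
proof
 fix n
 have pc: "conv p q n \<in> carrier R" unfolding conv_def using reesD(2)[OF p] reesD(2)[OF q] by (intro finsum_closed) auto
 have "(cl p \<otimes>\<^bsub>gr\<^esub> cl q) n = (\<Union>x\<in>Pi {..n} (cl p). \<Union>y\<in>Pi {..n} (cl q). pw (Suc n) +> conv x y n)"
  by (simp add: assoc_graded_def conv_def)
 also have "\<dots> = pw (Suc n) +> conv p q n"
 proof -
  have eq: "pw (Suc n) +> conv x y n = pw (Suc n) +> conv p q n" if "x \<in> Pi {..n} (cl p)" "y \<in> Pi {..n} (cl q)" for x y
  proof -
   have "conv x y n \<in> carrier R \<and> conv x y n \<ominus> conv p q n \<in> pw (Suc n)"
    by (rule conv_cong[OF p q]) (use that in \<open>auto simp: cl_def\<close>)
   thus ?thesis using pw_coset_eq pc by blast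
  qed
  have "p \<in> Pi {..n} (cl p)" "q \<in> Pi {..n} (cl q)"
   using reesD(2)[OF p] reesD(2)[OF q] ideal_zero[OF pw_ideal] by (auto simp: cl_def coset_mem[OF pw_ideal] a_minus_def r_neg)
  thus ?thesis using eq by blast
 qed
 finally show "(cl p \<otimes>\<^bsub>gr\<^esub> cl q) n = cl (conv p q) n" by (simp add: cl_def)
qed

lemma add_gr: "p \<in> rees ==> q \<in> rees ==> cl p \<oplus>\<^bsub>gr\<^esub> cl q = cl (\<lambda>a. p a \<oplus> q a)"
proof
 fix n assume pq: "p \<in> rees" "q \<in> rees"
 have "(pw (Suc n) +> p n) <+> (pw (Suc n) +> q n) = pw (Suc n) +> (p n \<oplus> q n)"
  by (rule abelian_subgroup.a_rcos_sum[OF abelian_subgroupI3[OF ideal.axioms(1)[OF pw_ideal] is_abelian_group]])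
    (use reesD(2) pq in auto)
 thus "(cl p \<oplus>\<^bsub>gr\<^esub> cl q) n = cl (\<lambda>a. p a \<oplus> q a) n" by (simp add: assoc_graded_def cl_def)
qed

lemma one_gr: "\<one>\<^bsub>gr\<^esub> = cl (\<lambda>n. if n = 0 then \<one> else \<zero>)"
 by (rule ext) (simp add: assoc_graded_def cl_def pw_coset_zero)

lemma zero_gr: "\<zero>\<^bsub>gr\<^esub> = cl (\<lambda>_. \<zero>)"
 by (rule ext) (simp add: assoc_graded_def cl_def pw_coset_zero)

lemma rees_up: "rees \<subseteq> up R"
proof
 fix p assume p: "p \<in> rees"
 obtain k where k: "\<forall>a\<in>{a. p a \<noteq> \<zero>}. a < k" using p finite_nat_set_iff_bounded unfolding rees_def by blast
 have "bound \<zero> k p"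
 proof
  fix m assume "k < m"
  thus "p m = \<zero>" using k by (metis (mono_tags) mem_Collect_eq not_less_iff_gr_or_eq)
 qed
 thus "p \<in> up R" using reesD(2)[OF p] by blast
qed

lemma mult_UP: "p \<in> up R ==> q \<in> up R ==> p \<otimes>\<^bsub>UP R\<^esub> q = conv p q"
 by (simp add: UP_def conv_def)

lemma add_UP: "p \<in> up R ==> q \<in> up R ==> p \<oplus>\<^bsub>UP R\<^esub> q = (\<lambda>a. p a \<oplus> q a)"
 by (simp add: UP_def)

lemma UP_R: "UP_cring R"
 by (unfold_locales)

lemma rees_subring: "subring rees (UP R)"
proof -
 interpret U: UP_cring R "UP R" by (rule UP_R) simp
 have carr: "carrier (UP R) = up R" by (simp add: UP_def)
 show ?thesis
 proof (rule U.P.subringI)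
  show "rees \<subseteq> carrier (UP R)" unfolding carr by (rule rees_up)
  have "{a. (if a = 0 then \<one> else \<zero>) \<noteq> \<zero>} \<subseteq> {0::nat}" by auto
  hence "finite {a::nat. (if a = 0 then \<one> else \<zero>) \<noteq> \<zero>}" by (rule finite_subset) simp
  moreover have "(if a = 0 then \<one> else \<zero>) \<in> pw a" for a
   using ideal_zero[OF pw_ideal, of a] ideal_power_0[of M] one_closed by (cases "a = 0") (simp_all only: if_True if_False simp_thms)
  ultimately show "\<one>\<^bsub>UP R\<^esub> \<in> rees" by (simp add: UP_def rees_def)
 next
  fix p assume p: "p \<in> rees"
  hence pu: "p \<in> up R" using rees_up by blast
  have i: "\<ominus>\<^bsub>UP R\<^esub> p = (\<lambda>a. \<ominus> p a)"
  proof (rule U.P.minus_equality)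
   have nu: "(\<lambda>a. \<ominus> p a) \<in> up R" by (rule up_a_inv_closed[OF pu])
   thus "(\<lambda>a. \<ominus> p a) \<in> carrier (UP R)" unfolding carr .
   show "p \<in> carrier (UP R)" using pu carr by simp
   show "(\<lambda>a. \<ominus> p a) \<oplus>\<^bsub>UP R\<^esub> p = \<zero>\<^bsub>UP R\<^esub>"
    unfolding add_UP[OF nu pu] using reesD(2)[OF p] by (simp add: UP_def l_neg)
  qed
  have "{a. \<ominus> p a \<noteq> \<zero>} \<subseteq> {a. p a \<noteq> \<zero>}" by auto
  hence "finite {a. \<ominus> p a \<noteq> \<zero>}" using p finite_subset unfolding rees_def by blast
  thus "\<ominus>\<^bsub>UP R\<^esub> p \<in> rees" unfolding i using reesD(1)[OF p] ideal_uminus[OF pw_ideal] by (auto simp: rees_def)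
 next
  fix p q assume p: "p \<in> rees" and q: "q \<in> rees"
  have pu: "p \<in> up R" "q \<in> up R" using rees_up p q by auto
  have "p \<otimes>\<^bsub>UP R\<^esub> q \<in> carrier (UP R)" by (rule U.UP_mult_closed) (use pu carr in auto)
  hence cu: "conv p q \<in> up R" unfolding mult_UP[OF pu] carr .
  obtain k where k: "bound \<zero> k (conv p q)" using bound_upD[OF cu] by blast
  have "{a. conv p q a \<noteq> \<zero>} \<subseteq> {..k}" using bound_below[OF k] by auto
  hence "finite {a. conv p q a \<noteq> \<zero>}" by (rule finite_subset) simp
  moreover have "conv p q n \<in> pw n" for n
   unfolding conv_def
  proof (rule ideal_finsum[OF pw_ideal])
   fix i assume "i \<in> {..n}"
   thus "p i \<otimes> q (n - i) \<in> pw n" using pw_mult[OF reesD(1)[OF p, of i] reesD(1)[OF q, of "n - i"]] by simp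
  qed
  ultimately show "p \<otimes>\<^bsub>UP R\<^esub> q \<in> rees" unfolding mult_UP[OF pu] by (simp add: rees_def)
  have "{a. p a \<oplus> q a \<noteq> \<zero>} \<subseteq> {a. p a \<noteq> \<zero>} \<union> {a. q a \<noteq> \<zero>}" by auto
  hence "finite {a. p a \<oplus> q a \<noteq> \<zero>}" using p q finite_subset unfolding rees_def by blast
  thus "p \<oplus>\<^bsub>UP R\<^esub> q \<in> rees"
   unfolding add_UP[OF pu] using reesD(1)[OF p] reesD(1)[OF q] ideal_add[OF pw_ideal] by (auto simp: rees_def)
 qed
qed

lemma cl_hom: "cl \<in> ring_hom (UP R\<lparr>carrier := rees\<rparr>) gr"
proof (rule ring_hom_memI)
 fix p q assume "p \<in> carrier (UP R\<lparr>carrier := rees\<rparr>)" "q \<in> carrier (UP R\<lparr>carrier := rees\<rparr>)"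
 hence pq: "p \<in> rees" "q \<in> rees" "p \<in> up R" "q \<in> up R" using rees_up by auto
 show "cl (p \<otimes>\<^bsub>UP R\<lparr>carrier := rees\<rparr>\<^esub> q) = cl p \<otimes>\<^bsub>gr\<^esub> cl q"
  using mult_gr[OF pq(1,2)] mult_UP[OF pq(3,4)] by simp
 show "cl (p \<oplus>\<^bsub>UP R\<lparr>carrier := rees\<rparr>\<^esub> q) = cl p \<oplus>\<^bsub>gr\<^esub> cl q"
  using add_gr[OF pq(1,2)] add_UP[OF pq(3,4)] by simp
next
 show "cl \<one>\<^bsub>UP R\<lparr>carrier := rees\<rparr>\<^esub> = \<one>\<^bsub>gr\<^esub>" by (simp add: one_gr UP_def)
qed (simp add: carrier_gr)

lemma cring_gr: "cring gr"
proof -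
 interpret U: UP_cring R "UP R" by (rule UP_R) simp
 have carr: "carrier (UP R) = up R" by (simp add: UP_def)
 interpret Re: ring "UP R\<lparr>carrier := rees\<rparr>" by (rule U.P.subring_is_ring[OF rees_subring])
 have z: "cl \<zero>\<^bsub>UP R\<lparr>carrier := rees\<rparr>\<^esub> = \<zero>\<^bsub>gr\<^esub>" by (simp add: zero_gr UP_def)
 have "ring (gr\<lparr>carrier := cl ` rees, zero := \<zero>\<^bsub>gr\<^esub>\<rparr>)"
  using Re.ring_hom_imp_img_ring[OF cl_hom] unfolding z by simp
 hence r: "ring gr" by (simp add: carrier_gr[symmetric])
 have "comm_monoid gr"
 proof (rule monoid.monoid_comm_monoidI[OF ring.is_monoid[OF r]])
  fix s t assume "s \<in> carrier gr" "t \<in> carrier gr"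
  then obtain p q where pq: "p \<in> rees" "q \<in> rees" "s = cl p" "t = cl q" unfolding carrier_gr by blast
  have pu: "p \<in> up R" "q \<in> up R" using pq rees_up by auto
  have "p \<otimes>\<^bsub>UP R\<^esub> q = q \<otimes>\<^bsub>UP R\<^esub> p" using U.P.m_comm[of p q] pu unfolding carr by blast
  thus "s \<otimes>\<^bsub>gr\<^esub> t = t \<otimes>\<^bsub>gr\<^esub> s"
   unfolding pq(3,4) mult_gr[OF pq(1,2)] mult_gr[OF pq(2,1)] mult_UP[OF pu] mult_UP[OF pu(2,1)] by simp
 qed
 thus ?thesis using r unfolding cring_def by blast
qed

end

section \<open>Spaces of forms under isomorphisms\<close>

lemma (in ring_hom_cring) hom_generate_ring:
 assumes H: "H \<subseteq> carrier R"
 shows "h ` generate_ring R H = generate_ring S (h ` H)"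
proof
 have c: "x \<in> carrier R" if "x \<in> generate_ring R H" for x using R.generate_ring_in_carrier[OF H that] .
 have "h x \<in> generate_ring S (h ` H)" if "x \<in> generate_ring R H" for x
  using that
 proof induction
  case (eng_add x y)
  thus ?case using generate_ring.eng_add[OF eng_add(3,4)] c by simp
 next
  case (eng_mult x y)
  thus ?case using generate_ring.eng_mult[OF eng_mult(3,4)] c by simp
 next
  case (a_inv x)
  thus ?case using generate_ring.a_inv[OF a_inv(2)] c by simp
 qed (auto intro: generate_ring.one generate_ring.incl)
 thus "h ` generate_ring R H \<subseteq> generate_ring S (h ` H)" by blast
 have "x \<in> h ` generate_ring R H" if "x \<in> generate_ring S (h ` H)" for x
  using that
 proof induction
  case one
  show ?case using generate_ring.one[of R H] hom_one by (metis imageI)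
 next
  case (incl x)
  thus ?case using generate_ring.incl[of _ H R] by blast
 next
  case (a_inv x)
  then obtain a where "a \<in> generate_ring R H" "x = h a" by blast
  thus ?case using generate_ring.a_inv[of a R H] c hom_a_inv by (metis imageI)
 next
  case (eng_add x y)
  then obtain a a' where "a \<in> generate_ring R H" "x = h a" "a' \<in> generate_ring R H" "y = h a'" by blast
  thus ?case using generate_ring.eng_add[of a R H a'] c hom_add by (metis imageI)
 next
  case (eng_mult x y)
  then obtain a a' where "a \<in> generate_ring R H" "x = h a" "a' \<in> generate_ring R H" "y = h a'" by blast
  thus ?case using generate_ring.eng_mult[of a R H a'] c hom_mult by (metis imageI)
 qed
 thus "generate_ring S (h ` H) \<subseteq> h ` generate_ring R H" by blast
qed

text \<open>\<open>K\<close>, \<open>L\<close> and \<open>I\<close> stand for the constants, the linear forms and the initial ideal in a graded ring \<open>G\<close>.\<close>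

definition form_space :: "('a, 'm) ring_scheme => 'a set => 'a set => 'a set => 'a set => bool" where
 "form_space G K L I V \<longleftrightarrow> V \<subseteq> L \<and> subalgebra K V G \<and> Idl\<^bsub>G\<^esub> (I \<inter> generate_ring G (K \<union> V)) = I"

lemma (in ring_hom_cring) ring_hom_ring_h: "ring_hom_ring R S h"
 by (rule ring_hom_ringI2[OF R.ring_axioms S.ring_axioms homh])

lemma ring_iso_cring:
 assumes Ga: "cring Ga" and Gb: "cring Gb" and f: "f \<in> ring_iso Ga Gb"
 shows "ring_hom_cring Ga Gb f" "inj_on f (carrier Ga)" "f ` carrier Ga = carrier Gb"
  "inv_into (carrier Ga) f \<in> ring_iso Gb Ga"
proof -
 show "ring_hom_cring Ga Gb f" using Ga Gb f by (simp add: ring_hom_cring_def ring_hom_cring_axioms_def ring_iso_def)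
 show "inj_on f (carrier Ga)" "f ` carrier Ga = carrier Gb" using f by (auto simp: ring_iso_def bij_betw_def)
 show "inv_into (carrier Ga) f \<in> ring_iso Gb Ga" by (rule ring_iso_set_sym[OF cring.axioms(1)[OF Ga] f])
qed

lemma ring_iso_genideal:
 assumes Ga: "cring Ga" and Gb: "cring Gb" and f: "f \<in> ring_iso Ga Gb" and G: "G \<subseteq> carrier Ga"
 shows "f ` (Idl\<^bsub>Ga\<^esub> G) = Idl\<^bsub>Gb\<^esub> (f ` G)"
proof
 note i = ring_iso_cring[OF Ga Gb f]
 interpret f: ring_hom_cring Ga Gb f by (rule i(1))
 define g where "g = inv_into (carrier Ga) f"
 interpret g: ring_hom_cring Gb Ga g unfolding g_def by (rule ring_iso_cring(1)[OF Gb Ga i(4)])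
 show "f ` (Idl\<^bsub>Ga\<^esub> G) \<subseteq> Idl\<^bsub>Gb\<^esub> (f ` G)" using f.hom_genideal[OF G] by blast
 have c: "f ` G \<subseteq> carrier Gb" using G by auto
 show "Idl\<^bsub>Gb\<^esub> (f ` G) \<subseteq> f ` (Idl\<^bsub>Ga\<^esub> G)"
 proof
  fix y assume y: "y \<in> Idl\<^bsub>Gb\<^esub> (f ` G)"
  hence yc: "y \<in> carrier Gb" using f.S.ideal_sub[OF f.S.genideal_ideal[OF c]] by blast
  have "g y \<in> Idl\<^bsub>Ga\<^esub> (g ` f ` G)" by (rule g.hom_genideal[OF c y])
  moreover have "g ` f ` G = G" unfolding g_def by (rule inv_into_image_cancel[OF i(2) G])
  moreover have "f (g y) = y" unfolding g_def using yc i(3) by (simp add: f_inv_into_f)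
  ultimately show "y \<in> f ` (Idl\<^bsub>Ga\<^esub> G)" by (metis imageI)
 qed
qed

lemma form_space_iso:
 assumes Ga: "cring Ga" and Gb: "cring Gb" and f: "f \<in> ring_iso Ga Gb" and K: "K \<subseteq> carrier Ga" and I: "I \<subseteq> carrier Ga"
  and V: "form_space Ga K L I V"
 shows "form_space Gb (f ` K) (f ` L) (f ` I) (f ` V)"
proof -
 note i = ring_iso_cring[OF Ga Gb f]
 interpret f: ring_hom_cring Ga Gb f by (rule i(1))
 have sub: "subalgebra K V Ga" using V by (simp add: form_space_def)
 have Vc: "V \<subseteq> carrier Ga" by (rule f.R.subalgebra_in_carrier[OF sub])
 have KV: "K \<union> V \<subseteq> carrier Ga" using K Vc by blast
 have gc: "generate_ring Ga (K \<union> V) \<subseteq> carrier Ga" by (rule f.R.generate_ring_incl[OF KV])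
 have "f ` I \<inter> generate_ring Gb (f ` K \<union> f ` V) = f ` (I \<inter> generate_ring Ga (K \<union> V))"
  unfolding inj_on_image_Int[OF i(2) I gc] f.hom_generate_ring[OF KV] image_Un ..
 hence "Idl\<^bsub>Gb\<^esub> (f ` I \<inter> generate_ring Gb (f ` K \<union> f ` V)) = f ` (Idl\<^bsub>Ga\<^esub> (I \<inter> generate_ring Ga (K \<union> V)))"
  using ring_iso_genideal[OF Ga Gb f, of "I \<inter> generate_ring Ga (K \<union> V)"] I by auto
 thus ?thesis using V ring_hom_ring.img_is_subalgebra[OF f.ring_hom_ring_h K sub] unfolding form_space_def by auto
qed

section \<open>Homogeneous classes and the initial ideal\<close>

context graded_setup
begin

lemma generating_forms_iff:
 "generating_forms R M J b V \<longleftrightarrow> form_space gr (graded_part R M 0) (graded_part R M 1) (initial_ideal R M J b) V"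
 by (simp add: generating_forms_def form_space_def)

text \<open>The homogeneous element x t^a of the Rees algebra.\<close>

definition hm :: "nat => 'a => nat => 'a" where
 "hm a x = (\<lambda>n. if n = a then x else \<zero>)"

lemma hm_rees: "x \<in> pw a ==> hm a x \<in> rees"
proof -
 assume x: "x \<in> pw a"
 have "{n. hm a x n \<noteq> \<zero>} \<subseteq> {a}" by (auto simp: hm_def)
 hence "finite {n. hm a x n \<noteq> \<zero>}" by (rule finite_subset) simp
 thus ?thesis using x ideal_zero[OF pw_ideal] by (simp add: rees_def hm_def)
qed

lemma gc_cl: "gc a x = cl (hm a x)"
 by (rule ext) (simp add: graded_class_def cl_def hm_def pw_coset_zero)

lemma gc_closed: "x \<in> pw a ==> gc a x \<in> carrier gr"
 unfolding gc_cl carrier_gr using hm_rees by blast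

lemma gc_eq: "x \<in> pw a ==> y \<in> pw a ==> gc a x = gc a y \<longleftrightarrow> x \<ominus> y \<in> pw (Suc a)"
proof -
 assume xy: "x \<in> pw a" "y \<in> pw a"
 have "\<zero> \<ominus> \<zero> \<in> pw k" for k using ideal_zero[OF pw_ideal] by (simp add: a_minus_def)
 thus ?thesis unfolding gc_cl cl_eq[OF hm_rees[OF xy(1)] hm_rees[OF xy(2)]] by (auto simp: hm_def)
qed

lemma gc_add: "x \<in> pw a ==> y \<in> pw a ==> gc a x \<oplus>\<^bsub>gr\<^esub> gc a y = gc a (x \<oplus> y)"
proof -
 assume xy: "x \<in> pw a" "y \<in> pw a"
 have "(\<lambda>n. hm a x n \<oplus> hm a y n) = hm a (x \<oplus> y)" by (rule ext) (simp add: hm_def)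
 thus ?thesis unfolding gc_cl add_gr[OF hm_rees[OF xy(1)] hm_rees[OF xy(2)]] by simp
qed

lemma gc_0: "gc a \<zero> = \<zero>\<^bsub>gr\<^esub>"
 unfolding gc_cl zero_gr by (rule arg_cong[of _ _ cl]) (auto simp: hm_def)

lemma gc_zero: "x \<in> pw (Suc a) ==> gc a x = \<zero>\<^bsub>gr\<^esub>"
proof -
 assume x: "x \<in> pw (Suc a)"
 have "x \<in> pw a" using x ideal_power_Suc_le[OF M_ideal] by blast
 moreover have "x \<ominus> \<zero> \<in> pw (Suc a)" using x pw_carr[OF x] by (simp add: a_minus_def)
 ultimately show ?thesis using gc_eq[of x a \<zero>] ideal_zero[OF pw_ideal] unfolding gc_0 by blast
qed

lemma gc_one: "gc 0 \<one> = \<one>\<^bsub>gr\<^esub>"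
 unfolding gc_cl one_gr hm_def ..

lemma gc_mult: "x \<in> pw a ==> y \<in> pw c ==> gc a x \<otimes>\<^bsub>gr\<^esub> gc c y = gc (a + c) (x \<otimes> y)"
proof -
 assume xy: "x \<in> pw a" "y \<in> pw c"
 interpret U: UP_cring R "UP R" by (rule UP_R) simp
 have m: "UnivPoly.monom (UP R) z k = hm k z" if "z \<in> carrier R" for z k
  using that by (simp add: UP_def hm_def)
 have xyc: "x \<in> carrier R" "y \<in> carrier R" using xy pw_carr by auto
 have up: "hm a x \<in> up R" "hm c y \<in> up R" using hm_rees[OF xy(1)] hm_rees[OF xy(2)] rees_up by auto
 have "conv (hm a x) (hm c y) = hm (a + c) (x \<otimes> y)"
  using U.monom_mult[OF xyc, of a c] unfolding m[OF xyc(1)] m[OF xyc(2)] m[OF m_closed[OF xyc]] mult_UP[OF up] ..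
 thus ?thesis unfolding gc_cl mult_gr[OF hm_rees[OF xy(1)] hm_rees[OF xy(2)]] by simp
qed

lemma gc_uminus: "x \<in> pw a ==> \<ominus>\<^bsub>gr\<^esub> gc a x = gc a (\<ominus> x)"
proof -
 assume x: "x \<in> pw a"
 interpret G: cring gr by (rule cring_gr)
 have i: "\<ominus> x \<in> pw a" by (rule ideal_uminus[OF pw_ideal x])
 have "gc a (\<ominus> x) \<oplus>\<^bsub>gr\<^esub> gc a x = \<zero>\<^bsub>gr\<^esub>"
  unfolding gc_add[OF i x] l_neg[OF pw_carr[OF x]] by (rule gc_0)
 thus ?thesis using G.minus_equality[OF _ gc_closed[OF x] gc_closed[OF i]] by simp
qed

lemma graded_part_sub: "graded_part R M a \<subseteq> carrier gr"
 unfolding graded_part_def using gc_closed by blast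

lemma subfield_graded_part_0:
 assumes proper: "M \<noteq> carrier R" and loc: "\<And>a. a \<in> carrier R ==> a \<notin> M ==> a \<in> Units R"
 shows "subfield (graded_part R M 0) gr" "\<one>\<^bsub>gr\<^esub> \<noteq> \<zero>\<^bsub>gr\<^esub>"
proof -
 interpret G: cring gr by (rule cring_gr)
 have p0: "pw 0 = carrier R" by (rule ideal_power_0)
 have p1: "pw (Suc 0) = M" using ideal_power_1[OF M_ideal] by simp
 have K: "graded_part R M 0 = gc 0 ` carrier R" by (simp only: graded_part_def p0)
 have o: "\<one> \<in> pw 0" "\<zero> \<in> pw 0" unfolding p0 by simp_all
 show ne: "\<one>\<^bsub>gr\<^esub> \<noteq> \<zero>\<^bsub>gr\<^esub>"
 proof
  assume "\<one>\<^bsub>gr\<^esub> = \<zero>\<^bsub>gr\<^esub>"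
  hence "\<one> \<ominus> \<zero> \<in> M" using gc_eq[OF o] unfolding gc_one gc_0 p1 by simp
  hence "\<one> \<in> M" by (simp add: a_minus_def)
  thus False using ideal.one_imp_carrier[OF M_ideal] proper by blast
 qed
 have mult: "gc 0 x \<otimes>\<^bsub>gr\<^esub> gc 0 y = gc 0 (x \<otimes> y)" if "x \<in> carrier R" "y \<in> carrier R" for x y
  using gc_mult[of x 0 y 0] that unfolding p0 by simp
 have "subring (graded_part R M 0) gr"
 proof (rule G.subringI[OF graded_part_sub])
  show "\<one>\<^bsub>gr\<^esub> \<in> graded_part R M 0" unfolding K gc_one[symmetric] by simp
  fix k assume "k \<in> graded_part R M 0"
  then obtain x where x: "x \<in> carrier R" "k = gc 0 x" unfolding K by blast
  show "\<ominus>\<^bsub>gr\<^esub> k \<in> graded_part R M 0" unfolding x(2) K using gc_uminus[of x 0] x(1) p0 by auto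
  fix k' assume "k' \<in> graded_part R M 0"
  then obtain x' where x': "x' \<in> carrier R" "k' = gc 0 x'" unfolding K by blast
  show "k \<otimes>\<^bsub>gr\<^esub> k' \<in> graded_part R M 0" unfolding x(2) x'(2) K mult[OF x(1) x'(1)] using x(1) x'(1) by simp
  show "k \<oplus>\<^bsub>gr\<^esub> k' \<in> graded_part R M 0" unfolding x(2) x'(2) K using gc_add[of x 0 x'] x(1) x'(1) p0 by auto
 qed
 hence sc: "subcring (graded_part R M 0) gr" by (rule G.subcringI')
 show "subfield (graded_part R M 0) gr"
 proof (rule G.subfieldI[OF sc], rule equalityI, rule_tac [!] subsetI)
  fix k assume "k \<in> Units (gr\<lparr>carrier := graded_part R M 0\<rparr>)"
  then obtain k' where k: "k \<in> graded_part R M 0" "k' \<in> graded_part R M 0" "k' \<otimes>\<^bsub>gr\<^esub> k = \<one>\<^bsub>gr\<^esub>" by (auto simp: Units_def)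
  have "k' \<in> carrier gr" using k(2) graded_part_sub by blast
  hence "k \<noteq> \<zero>\<^bsub>gr\<^esub>" using k(3) ne G.r_null[of k'] by metis
  thus "k \<in> graded_part R M 0 - {\<zero>\<^bsub>gr\<^esub>}" using k(1) by simp
 next
  fix k assume k: "k \<in> graded_part R M 0 - {\<zero>\<^bsub>gr\<^esub>}"
  then obtain x where x: "x \<in> carrier R" "k = gc 0 x" unfolding K by blast
  have "x \<notin> M" using gc_zero[of x 0] k x(2) unfolding p1 by blast
  hence u: "x \<in> Units R" by (rule loc[OF x(1)])
  have "gc 0 (inv x) \<otimes>\<^bsub>gr\<^esub> k = \<one>\<^bsub>gr\<^esub>" "k \<otimes>\<^bsub>gr\<^esub> gc 0 (inv x) = \<one>\<^bsub>gr\<^esub>"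
   unfolding x(2) using mult u x(1) gc_one by auto
  moreover have "gc 0 (inv x) \<in> graded_part R M 0" unfolding K using u by blast
  ultimately show "k \<in> Units (gr\<lparr>carrier := graded_part R M 0\<rparr>)" using k by (auto simp: Units_def)
 qed
qed

text \<open>Since the generators lie in M^b and only classes of degree b are taken, the class of a
  multiple a g is the degree 0 class of a times the degree b class of g.\<close>

lemma initial_ideal_generated:
 assumes G: "G \<subseteq> pw b"
 shows "initial_ideal R M (Idl G) b = Idl\<^bsub>gr\<^esub> (gc b ` G)"
proof -
 interpret G: cring gr by (rule cring_gr)
 have Gc: "G \<subseteq> carrier R" using G pw_carr by blast
 have c: "gc b ` G \<subseteq> carrier gr" using G gc_closed by blast
 note I = G.genideal_ideal[OF c]
 have "Idl G \<subseteq> {f. f \<in> pw b \<and> gc b f \<in> Idl\<^bsub>gr\<^esub> (gc b ` G)}"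
 proof (rule genideal_minimal, rule ideal_Collect)
  show "f \<in> carrier R" if "f \<in> pw b \<and> gc b f \<in> Idl\<^bsub>gr\<^esub> (gc b ` G)" for f using that pw_carr by blast
  show "\<zero> \<in> pw b \<and> gc b \<zero> \<in> Idl\<^bsub>gr\<^esub> (gc b ` G)"
   using ideal_zero[OF pw_ideal] G.ideal_zero[OF I] unfolding gc_0 by blast
  fix f assume f: "f \<in> pw b \<and> gc b f \<in> Idl\<^bsub>gr\<^esub> (gc b ` G)"
  show "f \<oplus> g \<in> pw b \<and> gc b (f \<oplus> g) \<in> Idl\<^bsub>gr\<^esub> (gc b ` G)" if g: "g \<in> pw b \<and> gc b g \<in> Idl\<^bsub>gr\<^esub> (gc b ` G)" for g
   using f g gc_add[of f b g] ideal_add[OF pw_ideal, of f b g] G.ideal_add[OF I, of "gc b f" "gc b g"] by simp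
  show "a \<otimes> f \<in> pw b \<and> gc b (a \<otimes> f) \<in> Idl\<^bsub>gr\<^esub> (gc b ` G)" if a: "a \<in> carrier R" for a
  proof -
   have a0: "a \<in> pw 0" using a unfolding ideal_power_0 .
   have "gc 0 a \<otimes>\<^bsub>gr\<^esub> gc b f \<in> Idl\<^bsub>gr\<^esub> (gc b ` G)"
    by (rule G.ideal_mult[OF I gc_closed[OF a0]]) (use f in blast)
   thus ?thesis using gc_mult[OF a0, of f b] f ideal_mult[OF pw_ideal a, of f b] by simp
  qed
 next
  show "G \<subseteq> {f. f \<in> pw b \<and> gc b f \<in> Idl\<^bsub>gr\<^esub> (gc b ` G)}" using G G.genideal_self[OF c] by blast
 qed
 hence "gc b ` (Idl G) \<subseteq> Idl\<^bsub>gr\<^esub> (gc b ` G)" by blast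
 moreover have "gc b ` G \<subseteq> gc b ` (Idl G)" using genideal_self[OF Gc] by blast
 ultimately show ?thesis
  unfolding initial_ideal_def using G.genideal_minimal[OF I] G.genideal_mono by blast
qed

end

section \<open>Homomorphisms inducing isomorphisms of graded rings\<close>

text \<open>The two conditions make \<open>h\<close> induce bijections from M^k/M^(k+1) to
  N^k/N^(k+1) for every k. The instance used is the map from R/(u) to its counterpart over the
  completion.\<close>

locale graded_map = A: graded_setup R M + B: graded_setup S N + ring_hom_cring R S h
 for R :: "('a, 'm) ring_scheme" and M and S :: "('c, 'n) ring_scheme" and N and h +
 assumes power_iff: "\<And>a k. a \<in> carrier R ==> h a \<in> ideal_power S N k \<longleftrightarrow> a \<in> ideal_power R M k"
  and power_approx: "\<And>z k. z \<in> ideal_power S N k ==> \<exists>a\<in>ideal_power R M k. z \<ominus>\<^bsub>S\<^esub> h a \<in> ideal_power S N (Suc k)"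
begin

lemma h_rees: "p \<in> A.rees ==> h \<circ> p \<in> B.rees"
proof -
 assume p: "p \<in> A.rees"
 have "{a. (h \<circ> p) a \<noteq> \<zero>\<^bsub>S\<^esub>} \<subseteq> {a. p a \<noteq> \<zero>\<^bsub>R\<^esub>}" by auto
 hence "finite {a. (h \<circ> p) a \<noteq> \<zero>\<^bsub>S\<^esub>}" using p finite_subset unfolding A.rees_def by blast
 thus ?thesis using power_iff[OF A.reesD(2)[OF p]] A.reesD(1)[OF p] by (simp add: B.rees_def)
qed

lemma h_cl_eq: "p \<in> A.rees ==> q \<in> A.rees ==> B.cl (h \<circ> p) = B.cl (h \<circ> q) \<longleftrightarrow> A.cl p = A.cl q"
proof -
 assume pq: "p \<in> A.rees" "q \<in> A.rees"
 have eq: "h (p a) \<ominus>\<^bsub>S\<^esub> h (q a) \<in> ideal_power S N (Suc a) \<longleftrightarrow> p a \<ominus>\<^bsub>R\<^esub> q a \<in> ideal_power R M (Suc a)" for a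
 proof -
  have c: "p a \<in> carrier R" "q a \<in> carrier R" using A.reesD(2) pq by auto
  hence "h (p a) \<ominus>\<^bsub>S\<^esub> h (q a) = h (p a \<ominus>\<^bsub>R\<^esub> q a)" by (simp add: a_minus_def)
  thus ?thesis using power_iff[of "p a \<ominus>\<^bsub>R\<^esub> q a" "Suc a"] c by (simp only: A.minus_closed)
 qed
 show ?thesis
  unfolding B.cl_eq[OF h_rees[OF pq(1)] h_rees[OF pq(2)]] A.cl_eq[OF pq] o_apply by (rule all_cong1[OF eq])
qed

definition \<phi> :: "(nat => 'a set) => nat => 'c set" where
 "\<phi> s = B.cl (h \<circ> (SOME p. p \<in> A.rees \<and> A.cl p = s))"

lemma phi_cl: "p \<in> A.rees ==> \<phi> (A.cl p) = B.cl (h \<circ> p)"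
proof -
 assume p: "p \<in> A.rees"
 let ?q = "SOME q. q \<in> A.rees \<and> A.cl q = A.cl p"
 have "?q \<in> A.rees \<and> A.cl ?q = A.cl p" by (rule someI[of _ p]) (use p in simp)
 thus ?thesis unfolding \<phi>_def using h_cl_eq[of ?q p] p by blast
qed

lemma phi_surj: "t \<in> carrier B.gr ==> \<exists>p\<in>A.rees. t = B.cl (h \<circ> p)"
proof -
 assume "t \<in> carrier B.gr"
 then obtain q where q: "q \<in> B.rees" "t = B.cl q" unfolding B.carrier_gr by blast
 have "\<forall>a. \<exists>x. x \<in> ideal_power R M a \<and> q a \<ominus>\<^bsub>S\<^esub> h x \<in> ideal_power S N (Suc a) \<and> (q a = \<zero>\<^bsub>S\<^esub> \<longrightarrow> x = \<zero>\<^bsub>R\<^esub>)"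
 proof
  fix a show "\<exists>x. x \<in> ideal_power R M a \<and> q a \<ominus>\<^bsub>S\<^esub> h x \<in> ideal_power S N (Suc a) \<and> (q a = \<zero>\<^bsub>S\<^esub> \<longrightarrow> x = \<zero>\<^bsub>R\<^esub>)"
  proof (cases "q a = \<zero>\<^bsub>S\<^esub>")
   case True
   thus ?thesis using A.ideal_zero[OF A.pw_ideal] B.ideal_zero[OF B.pw_ideal]
    by (intro exI[of _ "\<zero>\<^bsub>R\<^esub>"]) (simp add: a_minus_def)
  next
   case False
   thus ?thesis using power_approx[OF B.reesD(1)[OF q(1)], of a] by blast
  qed
 qed
 from choice[OF this] obtain p where p: "\<And>a. p a \<in> ideal_power R M a" "\<And>a. q a \<ominus>\<^bsub>S\<^esub> h (p a) \<in> ideal_power S N (Suc a)"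
  "\<And>a. q a = \<zero>\<^bsub>S\<^esub> ==> p a = \<zero>\<^bsub>R\<^esub>" by blast
 have "{a. p a \<noteq> \<zero>\<^bsub>R\<^esub>} \<subseteq> {a. q a \<noteq> \<zero>\<^bsub>S\<^esub>}" using p(3) by blast
 hence "p \<in> A.rees" using q(1) finite_subset p(1) unfolding A.rees_def B.rees_def by blast
 moreover have "B.cl q = B.cl (h \<circ> p)" unfolding B.cl_eq[OF q(1) h_rees[OF \<open>p \<in> A.rees\<close>]] using p(2) by simp
 ultimately show ?thesis using q(2) by blast
qed

lemma phi_iso: "\<phi> \<in> ring_iso A.gr B.gr"
 unfolding ring_iso_def
proof (intro CollectI conjI)
 show "\<phi> \<in> ring_hom A.gr B.gr"
 proof (rule ring_hom_memI)
  show "\<phi> s \<in> carrier B.gr" if "s \<in> carrier A.gr" for s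
   using that h_rees unfolding A.carrier_gr B.carrier_gr by (auto simp: phi_cl)
  fix s t assume "s \<in> carrier A.gr" "t \<in> carrier A.gr"
  then obtain p q where pq: "p \<in> A.rees" "q \<in> A.rees" "s = A.cl p" "t = A.cl q" unfolding A.carrier_gr by blast
  note r = A.rees_up
  have pu: "p \<in> up R" "q \<in> up R" using pq r by auto
  have cr: "A.conv p q \<in> A.rees"
   using subringE(6)[OF A.rees_subring pq(1,2)] A.mult_UP[OF pu] by simp
  have ar: "(\<lambda>a. p a \<oplus>\<^bsub>R\<^esub> q a) \<in> A.rees"
   using subringE(7)[OF A.rees_subring pq(1,2)] A.add_UP[OF pu] by simp
  have "h \<circ> A.conv p q = B.conv (h \<circ> p) (h \<circ> q)"
  proof
   fix n
   have "h (A.conv p q n) = (\<Oplus>\<^bsub>S\<^esub>i\<in>{..n}. h (p i \<otimes>\<^bsub>R\<^esub> q (n - i)))"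
    unfolding A.conv_def using A.reesD(2)[OF pq(1)] A.reesD(2)[OF pq(2)]
    by (subst hom_finsum) (auto simp: o_def)
   also have "\<dots> = B.conv (h \<circ> p) (h \<circ> q) n"
    unfolding B.conv_def using A.reesD(2)[OF pq(1)] A.reesD(2)[OF pq(2)] by (intro B.finsum_cong') auto
   finally show "(h \<circ> A.conv p q) n = B.conv (h \<circ> p) (h \<circ> q) n" by simp
  qed
  thus "\<phi> (s \<otimes>\<^bsub>A.gr\<^esub> t) = \<phi> s \<otimes>\<^bsub>B.gr\<^esub> \<phi> t"
   unfolding pq(3,4) A.mult_gr[OF pq(1,2)] phi_cl[OF pq(1)] phi_cl[OF pq(2)] phi_cl[OF cr]
    B.mult_gr[OF h_rees[OF pq(1)] h_rees[OF pq(2)]] by simp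
  have "h \<circ> (\<lambda>a. p a \<oplus>\<^bsub>R\<^esub> q a) = (\<lambda>a. (h \<circ> p) a \<oplus>\<^bsub>S\<^esub> (h \<circ> q) a)"
   using A.reesD(2)[OF pq(1)] A.reesD(2)[OF pq(2)] by auto
  thus "\<phi> (s \<oplus>\<^bsub>A.gr\<^esub> t) = \<phi> s \<oplus>\<^bsub>B.gr\<^esub> \<phi> t"
   unfolding pq(3,4) A.add_gr[OF pq(1,2)] phi_cl[OF pq(1)] phi_cl[OF pq(2)] phi_cl[OF ar]
    B.add_gr[OF h_rees[OF pq(1)] h_rees[OF pq(2)]] by simp
 next
  have o: "\<one>\<^bsub>R\<^esub> \<in> A.pw 0" unfolding A.ideal_power_0 by simp
  have "h \<circ> A.hm 0 \<one>\<^bsub>R\<^esub> = B.hm 0 \<one>\<^bsub>S\<^esub>" by (auto simp: A.hm_def B.hm_def)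
  thus "\<phi> \<one>\<^bsub>A.gr\<^esub> = \<one>\<^bsub>B.gr\<^esub>"
   unfolding A.gc_one[symmetric] B.gc_one[symmetric] A.gc_cl B.gc_cl phi_cl[OF A.hm_rees[OF o]] by simp
 qed
 show "bij_betw \<phi> (carrier A.gr) (carrier B.gr)"
  unfolding bij_betw_def
 proof
  show "inj_on \<phi> (carrier A.gr)"
   unfolding A.carrier_gr by (intro inj_onI) (auto simp: phi_cl h_cl_eq)
  show "\<phi> ` carrier A.gr = carrier B.gr"
  proof
   show "\<phi> ` carrier A.gr \<subseteq> carrier B.gr" using h_rees unfolding A.carrier_gr B.carrier_gr by (auto simp: phi_cl)
   show "carrier B.gr \<subseteq> \<phi> ` carrier A.gr"
   proof
    fix t assume "t \<in> carrier B.gr"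
    then obtain p where "p \<in> A.rees" "t = B.cl (h \<circ> p)" using phi_surj by blast
    thus "t \<in> \<phi> ` carrier A.gr" unfolding A.carrier_gr using phi_cl by force
   qed
  qed
 qed
qed

lemma phi_gc: "x \<in> A.pw a ==> \<phi> (A.gc a x) = B.gc a (h x)"
proof -
 assume x: "x \<in> A.pw a"
 have "h \<circ> A.hm a x = B.hm a (h x)" by (auto simp: A.hm_def B.hm_def)
 thus ?thesis unfolding A.gc_cl B.gc_cl phi_cl[OF A.hm_rees[OF x]] by simp
qed

lemma phi_graded_part: "\<phi> ` graded_part R M a = graded_part S N a"
proof
 show "\<phi> ` graded_part R M a \<subseteq> graded_part S N a"
 proof
  fix t assume "t \<in> \<phi> ` graded_part R M a"
  then obtain x where x: "x \<in> A.pw a" "t = B.gc a (h x)" unfolding graded_part_def using phi_gc by auto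
  thus "t \<in> graded_part S N a" unfolding graded_part_def using power_iff[OF A.pw_carr[OF x(1)]] by blast
 qed
 show "graded_part S N a \<subseteq> \<phi> ` graded_part R M a"
 proof
  fix t assume "t \<in> graded_part S N a"
  then obtain z where z: "z \<in> B.pw a" "t = B.gc a z" unfolding graded_part_def by blast
  obtain x where x: "x \<in> A.pw a" "z \<ominus>\<^bsub>S\<^esub> h x \<in> B.pw (Suc a)" using power_approx[OF z(1)] by blast
  have "h x \<in> B.pw a" using power_iff[OF A.pw_carr[OF x(1)]] x(1) by blast
  hence "t = \<phi> (A.gc a x)" using B.gc_eq[OF z(1)] x(2) z(2) phi_gc[OF x(1)] by simp
  thus "t \<in> \<phi> ` graded_part R M a" unfolding graded_part_def using x(1) by blast
 qed
qed

text \<open>Each ingredient of the definition is transported by the isomorphism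
  \<open>\<phi>\<close> of graded rings; minimality in the target is checked by pulling spaces back
  along its inverse.\<close>

theorem defines_directrix_image:
 assumes proper: "M \<noteq> carrier R" and loc: "\<And>a. a \<in> carrier R ==> a \<notin> M ==> a \<in> Units R"
  and J: "ideal J R" "J \<subseteq> A.pw b" and J': "J' = Idl\<^bsub>S\<^esub> (h ` J)" and N: "h ` M \<subseteq> N"
  and d: "defines_directrix R M J b ys"
 shows "defines_directrix S N J' b (map h ys)"
proof -
 interpret GA: cring A.gr by (rule A.cring_gr)
 interpret GB: cring B.gr by (rule B.cring_gr)
 note i = ring_iso_cring[OF A.cring_gr B.cring_gr phi_iso]
 interpret f: ring_hom_cring A.gr B.gr \<phi> by (rule i(1))
 define g where "g = inv_into (carrier A.gr) \<phi>"
 have g: "g \<in> ring_iso B.gr A.gr" unfolding g_def by (rule i(4))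
 have gf: "g ` \<phi> ` Ga = Ga" if "Ga \<subseteq> carrier A.gr" for Ga
  unfolding g_def by (rule inv_into_image_cancel[OF i(2) that])
 have fg: "\<phi> ` g ` Ga = Ga" if "Ga \<subseteq> carrier B.gr" for Ga
  unfolding g_def by (rule image_inv_into_cancel[OF i(3) that])
 let ?K = "graded_part R M 0" and ?L = "graded_part R M 1"
 let ?I = "initial_ideal R M J b"
 let ?V = "ring.Span A.gr ?K (map (A.gc 1) ys)"
 have ysM: "set ys \<subseteq> M" and ind: "GA.independent ?K (map (A.gc 1) ys)" and
  V: "generating_forms R M J b ?V" "\<And>W. generating_forms R M J b W ==> ?V \<subseteq> W"
  using d by (auto simp: defines_directrix_def Let_def directrix_forms_def)
 have p1: "A.pw 1 = M" by (rule A.ideal_power_1[OF A.M_ideal])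
 have yc: "set (map (A.gc 1) ys) \<subseteq> carrier A.gr" using ysM A.gc_closed[of _ 1] unfolding p1 by auto
 have maps: "map (B.gc 1) (map h ys) = map \<phi> (map (A.gc 1) ys)" using ysM phi_gc[of _ 1] unfolding p1 by auto
 have Kc: "?K \<subseteq> carrier A.gr" by (rule A.graded_part_sub)
 have span: "GB.Span (graded_part S N 0) (map (B.gc 1) (map h ys)) = \<phi> ` ?V"
  unfolding maps phi_graded_part[symmetric] by (rule ring_hom_ring.Span_hom[OF f.ring_hom_ring_h Kc yc])
 have Jc: "h ` J \<subseteq> B.pw b" using J(2) power_iff[OF A.pw_carr] by blast
 have gJ: "A.gc b ` J \<subseteq> carrier A.gr" using J(2) A.gc_closed by blast
 have Ic: "?I \<subseteq> carrier A.gr" unfolding initial_ideal_def by (rule GA.ideal_sub[OF GA.genideal_ideal[OF gJ]])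
 have init: "initial_ideal S N J' b = \<phi> ` ?I"
 proof -
  have "initial_ideal S N J' b = Idl\<^bsub>B.gr\<^esub> (B.gc b ` h ` J)" unfolding J' by (rule B.initial_ideal_generated[OF Jc])
  also have "B.gc b ` h ` J = \<phi> ` A.gc b ` J" using J(2) phi_gc by (force simp: image_image)
  also have "Idl\<^bsub>B.gr\<^esub> (\<phi> ` A.gc b ` J) = \<phi> ` ?I"
   unfolding initial_ideal_def by (rule ring_iso_genideal[OF A.cring_gr B.cring_gr phi_iso gJ, symmetric])
  finally show ?thesis .
 qed
 have ind': "GB.independent (graded_part S N 0) (map (B.gc 1) (map h ys))"
  unfolding maps phi_graded_part[symmetric]
 proof (rule ring_hom_ring.inj_hom_preserves_independent[OF f.ring_hom_ring_h A.subfield_graded_part_0(1)[OF proper loc] _ _ ind])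
  show "\<one>\<^bsub>B.gr\<^esub> \<noteq> \<zero>\<^bsub>B.gr\<^esub>"
   using A.subfield_graded_part_0(2)[OF proper loc] inj_onD[OF i(2)] f.hom_one f.hom_zero GA.one_closed GA.zero_closed by metis
  show "inj_on \<phi> ?V" using inj_on_subset[OF i(2)] GA.Span_in_carrier[OF Kc yc] by blast
 qed
 have g1: "generating_forms S N J' b (\<phi> ` ?V)"
  unfolding B.generating_forms_iff init phi_graded_part[symmetric]
  by (rule form_space_iso[OF A.cring_gr B.cring_gr phi_iso Kc Ic]) (use V(1) A.generating_forms_iff in blast)
 have g2: "\<phi> ` ?V \<subseteq> W" if W: "generating_forms S N J' b W" for W
 proof -
  have W': "form_space B.gr (\<phi> ` ?K) (\<phi> ` ?L) (\<phi> ` ?I) W"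
   using W unfolding B.generating_forms_iff init phi_graded_part .
  have c: "\<phi> ` ?K \<subseteq> carrier B.gr" "\<phi> ` ?I \<subseteq> carrier B.gr" using Kc Ic i(3) by blast+
  have "form_space A.gr ?K ?L ?I (g ` W)"
   using form_space_iso[OF B.cring_gr A.cring_gr g c W'] unfolding gf[OF Kc] gf[OF Ic] gf[OF A.graded_part_sub] .
  hence "?V \<subseteq> g ` W" using V(2) A.generating_forms_iff by blast
  hence "\<phi> ` ?V \<subseteq> \<phi> ` g ` W" by blast
  moreover have "W \<subseteq> carrier B.gr" using W' GB.subalgebra_in_carrier unfolding form_space_def by blast
  ultimately show ?thesis using fg by simp
 qed
 have "set (map h ys) \<subseteq> N" using ysM N by auto
 thus ?thesis
  unfolding defines_directrix_def Let_def directrix_forms_def span using ind' g1 g2 by blast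
qed

end

section \<open>A bound for the number of forms defining the directrix\<close>

lemma (in ring) span_base:
 assumes K: "subfield K R" and U: "set Us \<subseteq> carrier R"
 shows "\<exists>Vs. independent K Vs \<and> Span K Vs = Span K Us \<and> length Vs \<le> length Us"
 using U
proof (induction Us)
 case Nil
 show ?case by (intro exI[of _ "[]"]) simp
next
 case (Cons u Us)
 then obtain Vs where Vs: "independent K Vs" "Span K Vs = Span K Us" "length Vs \<le> length Us" by auto
 show ?case
 proof (cases "u \<in> Span K Us")
  case True
  have Uc: "set Us \<subseteq> carrier R" "set (u # Us) \<subseteq> carrier R" using Cons(2) by auto
  have "set (u # Us) \<subseteq> Span K Us" using True Span_base_incl[OF K Uc(1)] by simp
  hence "Span K (u # Us) \<subseteq> Span K Us" by (rule mono_Span_subset[OF K _ Uc(1)])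
  moreover have "Span K Us \<subseteq> Span K (u # Us)"
   by (rule mono_Span_subset[OF K _ Uc(2)]) (use Span_base_incl[OF K Uc(2)] in auto)
  ultimately have "Span K (u # Us) = Span K Us" by (rule equalityI)
  thus ?thesis using Vs by (intro exI[of _ Vs]) (simp del: Span.simps)
 next
  case False
  have "independent K (u # Vs)" using li_Cons[of u K Vs] Cons(2) Vs False by simp
  moreover have "Span K (u # Vs) = Span K (u # Us)" using Vs(2) by simp
  ultimately show ?thesis using Vs(3) by (intro exI[of _ "u # Vs"]) (simp del: Span.simps)
 qed
qed

context graded_setup
begin

lemma subalgebra_graded_part: "subalgebra (graded_part R M 0) (graded_part R M a) gr"
proof -
 interpret G: cring gr by (rule cring_gr)
 have p0: "pw 0 = carrier R" by (rule ideal_power_0)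
 have "subgroup (graded_part R M a) (add_monoid gr)"
 proof (rule G.add.subgroupI)
  show "graded_part R M a \<subseteq> carrier gr" by (rule graded_part_sub)
  show "graded_part R M a \<noteq> {}" unfolding graded_part_def using ideal_zero[OF pw_ideal] by blast
  fix s assume "s \<in> graded_part R M a"
  then obtain x where x: "x \<in> pw a" "s = gc a x" unfolding graded_part_def by blast
  show "\<ominus>\<^bsub>gr\<^esub> s \<in> graded_part R M a"
   unfolding x(2) gc_uminus[OF x(1)] graded_part_def using ideal_uminus[OF pw_ideal x(1)] by blast
  fix t assume "t \<in> graded_part R M a"
  then obtain y where y: "y \<in> pw a" "t = gc a y" unfolding graded_part_def by blast
  show "s \<oplus>\<^bsub>gr\<^esub> t \<in> graded_part R M a"
   unfolding x(2) y(2) gc_add[OF x(1) y(1)] graded_part_def using ideal_add[OF pw_ideal x(1) y(1)] by blast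
 qed
 moreover have "k \<otimes>\<^bsub>gr\<^esub> v \<in> graded_part R M a" if kv: "k \<in> graded_part R M 0" "v \<in> graded_part R M a" for k v
 proof -
  obtain x y where xy: "x \<in> pw 0" "k = gc 0 x" "y \<in> pw a" "v = gc a y" using kv unfolding graded_part_def by blast
  have "x \<otimes> y \<in> pw a" using ideal_mult[OF pw_ideal _ xy(3)] xy(1) unfolding p0 by blast
  thus ?thesis unfolding xy(2,4) gc_mult[OF xy(1,3)] graded_part_def by simp
 qed
 ultimately show ?thesis by (simp add: subalgebra_def subalgebra_axioms_def)
qed

text \<open>The classes of the members of \<open>ts\<close> other than the p-th generate a subring
  that contains the degree b classes of all of \<open>J\<close>. So their span V generates the
  initial ideal in the sense of \<open>generating_forms\<close>. By minimality the independent
  classes of \<open>ys\<close> lie in V, which is spanned by fewer than \<open>length ts\<close>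
  forms.\<close>

lemma directrix_length_less:
 assumes proper: "M \<noteq> carrier R" and loc: "\<And>a. a \<in> carrier R ==> a \<notin> M ==> a \<in> Units R"
  and d: "defines_directrix R M J b ys" and Jc: "J \<subseteq> carrier R"
  and ts: "set ts \<subseteq> M" and p: "p < length ts"
  and J: "J \<subseteq> Idl (monomial R ts ` {B. length B = length ts \<and> sum_list B = b \<and> B ! p = 0} \<union> pw (Suc b))"
 shows "length ys < length ts"
proof -
 interpret G: cring gr by (rule cring_gr)
 let ?K = "graded_part R M 0"
 have p0: "pw 0 = carrier R" by (rule ideal_power_0)
 have p1: "pw 1 = M" by (rule ideal_power_1[OF M_ideal])
 note sf = subfield_graded_part_0[OF proper loc]
 define zs where "zs = take p ts @ drop (Suc p) ts"
 define Zs where "Zs = map (gc 1) zs"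
 have lz: "length Zs < length ts" using p by (simp add: Zs_def zs_def)
 have zM: "set zs \<subseteq> M" using ts set_take_subset[of p ts] set_drop_subset[of "Suc p" ts] by (auto simp: zs_def)
 have Zp: "set Zs \<subseteq> graded_part R M 1" using zM unfolding Zs_def graded_part_def p1 by auto
 have Zc: "set Zs \<subseteq> carrier gr" using Zp graded_part_sub by blast
 define V where "V = G.Span ?K Zs"
 have Vp: "V \<subseteq> graded_part R M 1" unfolding V_def by (rule G.subalgebra_Span_incl[OF sf(1) subalgebra_graded_part Zp])
 have KV: "?K \<union> V \<subseteq> carrier gr" using Vp graded_part_sub by blast
 define H where "H = generate_ring gr (?K \<union> V)"
 have Hc: "H \<subseteq> carrier gr" unfolding H_def by (rule G.generate_ring_incl[OF KV])
 have Hsub: "subring H gr" unfolding H_def by (rule G.generate_ring_is_subring[OF KV])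
 have KH: "?K \<subseteq> H" and VH: "V \<subseteq> H" unfolding H_def by (auto intro: generate_ring.incl)
 \<comment> \<open>Elements of M^k are tracked together with the condition that their degree k class
   lies in \<open>H\<close>; the products and sums that build up \<open>J\<close> preserve
   it.\<close>
 have good_mult: "x \<otimes> y \<in> pw (k + l) \<and> gc (k + l) (x \<otimes> y) \<in> H"
  if "x \<in> pw k" "gc k x \<in> H" "y \<in> pw l" "gc l y \<in> H" for x y k l
  using pw_mult[OF that(1,3)] subringE(6)[OF Hsub that(2,4)] gc_mult[OF that(1,3)] by simp
 have good_one: "\<one> \<in> pw 0 \<and> gc 0 \<one> \<in> H" using subringE(3)[OF Hsub] by (simp only: gc_one p0 one_closed simp_thms)
 have tsc: "ts ! i \<in> carrier R" if "i < length ts" for i using ts nth_mem[OF that] ideal_sub[OF M_ideal] by blast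
 have good_ts: "ts ! i \<in> pw 1 \<and> gc 1 (ts ! i) \<in> H" if i: "i < length ts" "i \<noteq> p" for i
 proof -
  have "ts ! i \<in> set zs"
  proof (cases "i < p")
   case True
   thus ?thesis using i p nth_mem[of i "take p ts"] by (simp add: zs_def)
  next
   case False
   hence "drop (Suc p) ts ! (i - Suc p) = ts ! i" "i - Suc p < length (drop (Suc p) ts)" using i by auto
   thus ?thesis using nth_mem[of "i - Suc p" "drop (Suc p) ts"] by (simp add: zs_def)
  qed
  hence "gc 1 (ts ! i) \<in> set Zs" by (simp add: Zs_def)
  hence "gc 1 (ts ! i) \<in> H" using G.Span_base_incl[OF sf(1) Zc] VH unfolding V_def by blast
  moreover have "ts ! i \<in> pw 1" unfolding p1 using ts nth_mem[OF i(1)] by blast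
  ultimately show ?thesis by blast
 qed
 have good_pow: "x [^] k \<in> pw k \<and> gc k (x [^] k) \<in> H" if x: "x \<in> pw 1" "gc 1 x \<in> H" for x and k :: nat
 proof (induction k)
  case 0
  show ?case using good_one by simp
 next
  case (Suc k)
  thus ?case using good_mult[of "x [^] k" k x 1] x by (simp add: nat_pow_Suc)
 qed
 have good_monomial: "monomial R ts B \<in> pw b \<and> gc b (monomial R ts B) \<in> H"
  if B: "length B = length ts" "sum_list B = b" "B ! p = 0" for B
 proof -
  have tP: "(!) ts \<in> {..<m} \<rightarrow> carrier R" if "m \<le> length ts" for m using tsc that by auto
  have "mon R ((!) ts) m ((!) B) \<in> pw (\<Sum>i<m. B ! i) \<and> gc (\<Sum>i<m. B ! i) (mon R ((!) ts) m ((!) B)) \<in> H" if "m \<le> length ts" for m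
   using that
  proof (induction m)
   case 0
   show ?case using good_one by (simp add: mon_def)
  next
   case (Suc m)
   have IH: "mon R ((!) ts) m ((!) B) \<in> pw (\<Sum>i<m. B ! i)" "gc (\<Sum>i<m. B ! i) (mon R ((!) ts) m ((!) B)) \<in> H" using Suc by auto
   have "ts ! m [^] (B ! m) \<in> pw (B ! m) \<and> gc (B ! m) (ts ! m [^] (B ! m)) \<in> H"
   proof (cases "m = p")
    case True
    thus ?thesis using B(3) good_one by simp
   next
    case False
    thus ?thesis using good_pow good_ts[of m] Suc(2) by simp
   qed
   moreover have "mon R ((!) ts) (Suc m) ((!) B) = ts ! m [^] (B ! m) \<otimes> mon R ((!) ts) m ((!) B)"
    by (rule mon_Suc[OF tP[OF Suc(2)]])
   ultimately show ?case using good_mult[of "ts ! m [^] (B ! m)" "B ! m" _ "\<Sum>i<m. B ! i"] IH by (simp add: add.commute)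
  qed
  from this[of "length ts"] show ?thesis using B by (simp add: monomial_def mon_def sum_list_sum_nth atLeast0LessThan)
 qed
 have Jgood: "J \<subseteq> {f. f \<in> pw b \<and> gc b f \<in> H}"
 proof (rule order.trans[OF J], rule genideal_minimal, rule ideal_Collect)
  show "f \<in> carrier R" if "f \<in> pw b \<and> gc b f \<in> H" for f using that pw_carr by blast
  show "\<zero> \<in> pw b \<and> gc b \<zero> \<in> H" using ideal_zero[OF pw_ideal] subringE(2)[OF Hsub] unfolding gc_0 by blast
  fix f assume f: "f \<in> pw b \<and> gc b f \<in> H"
  show "f \<oplus> g \<in> pw b \<and> gc b (f \<oplus> g) \<in> H" if g: "g \<in> pw b \<and> gc b g \<in> H" for g
   using f g gc_add[of f b g] ideal_add[OF pw_ideal, of f b g] subringE(7)[OF Hsub, of "gc b f" "gc b g"] by simp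
  show "a \<otimes> f \<in> pw b \<and> gc b (a \<otimes> f) \<in> H" if a: "a \<in> carrier R" for a
  proof -
   have a0: "a \<in> pw 0" using a unfolding p0 .
   have "gc 0 a \<in> H" using KH a0 unfolding graded_part_def by blast
   thus ?thesis using good_mult[OF a0, of f b] f by simp
  qed
 next
  show "monomial R ts ` {B. length B = length ts \<and> sum_list B = b \<and> B ! p = 0} \<union> pw (Suc b) \<subseteq> {f. f \<in> pw b \<and> gc b f \<in> H}"
  proof (rule Un_least)
   show "monomial R ts ` {B. length B = length ts \<and> sum_list B = b \<and> B ! p = 0} \<subseteq> {f. f \<in> pw b \<and> gc b f \<in> H}"
    using good_monomial by blast
   have "f \<in> pw b \<and> gc b f \<in> H" if f: "f \<in> pw (Suc b)" for f
    using gc_zero[OF f] subringE(2)[OF Hsub] ideal_power_Suc_le[OF M_ideal] f by auto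
   thus "pw (Suc b) \<subseteq> {f. f \<in> pw b \<and> gc b f \<in> H}" by blast
  qed
 qed
 have gJ: "gc b ` J \<subseteq> carrier gr" using Jgood Hc by blast
 note I = G.genideal_ideal[OF gJ]
 have "generating_forms R M J b V"
  unfolding generating_forms_iff form_space_def
 proof (intro conjI)
  show "V \<subseteq> graded_part R M 1" by (rule Vp)
  show "subalgebra ?K V gr" unfolding V_def by (rule G.Span_is_subalgebra[OF sf(1) Zc])
  show "Idl\<^bsub>gr\<^esub> (initial_ideal R M J b \<inter> generate_ring gr (?K \<union> V)) = initial_ideal R M J b"
  proof
   show "Idl\<^bsub>gr\<^esub> (initial_ideal R M J b \<inter> generate_ring gr (?K \<union> V)) \<subseteq> initial_ideal R M J b"
    unfolding initial_ideal_def by (rule G.genideal_minimal[OF I]) blast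
   have "gc b ` J \<subseteq> initial_ideal R M J b \<inter> generate_ring gr (?K \<union> V)"
    unfolding initial_ideal_def using G.genideal_self[OF gJ] Jgood unfolding H_def by blast
   thus "initial_ideal R M J b \<subseteq> Idl\<^bsub>gr\<^esub> (initial_ideal R M J b \<inter> generate_ring gr (?K \<union> V))"
    unfolding initial_ideal_def[of R M J b] by (rule G.genideal_mono)
  qed
 qed
 hence "G.Span ?K (map (gc 1) ys) \<subseteq> V" and ind: "G.independent ?K (map (gc 1) ys)"
  using d by (auto simp: defines_directrix_def Let_def directrix_forms_def)
 moreover obtain Vs where Vs: "G.independent ?K Vs" "G.Span ?K Vs = V" "length Vs \<le> length Zs"
  using G.span_base[OF sf(1) Zc] unfolding V_def by blast
 ultimately have "set (map (gc 1) ys) \<subseteq> G.Span ?K Vs"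
  using G.Span_base_incl[OF sf(1) G.independent_in_carrier[OF ind]] by blast
 from G.independent_length_le[OF sf(1) ind Vs(1) this] show ?thesis using Vs(3) lz by simp
qed

end

section \<open>Quotients\<close>

context ring_hom_cring
begin

lemma ideal_preimage:
 assumes J: "ideal J S"
 shows "ideal {a. a \<in> carrier R \<and> h a \<in> J} R"
proof (rule R.ideal_Collect)
 show "\<zero>\<^bsub>R\<^esub> \<in> carrier R \<and> h \<zero>\<^bsub>R\<^esub> \<in> J" using S.ideal_zero[OF J] by simp
 fix a assume a: "a \<in> carrier R \<and> h a \<in> J"
 show "a \<oplus>\<^bsub>R\<^esub> c \<in> carrier R \<and> h (a \<oplus>\<^bsub>R\<^esub> c) \<in> J" if "c \<in> carrier R \<and> h c \<in> J" for c
  using S.ideal_add[OF J, of "h a" "h c"] a that by simp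
 show "c \<otimes>\<^bsub>R\<^esub> a \<in> carrier R \<and> h (c \<otimes>\<^bsub>R\<^esub> a) \<in> J" if "c \<in> carrier R" for c
  using S.ideal_mult[OF J, of "h c" "h a"] a that by simp
qed simp

lemma ideal_image:
 assumes surj: "h ` carrier R = carrier S" and I: "ideal I R"
 shows "ideal (h ` I) S"
proof -
 have Ic: "I \<subseteq> carrier R" by (rule R.ideal_sub[OF I])
 have "h ` I = {b. \<exists>a\<in>I. b = h a}" by blast
 moreover have "ideal {b. \<exists>a\<in>I. b = h a} S"
 proof (rule S.ideal_Collect)
  show "b \<in> carrier S" if "\<exists>a\<in>I. b = h a" for b using that Ic by auto
  show "\<exists>a\<in>I. \<zero>\<^bsub>S\<^esub> = h a" using R.ideal_zero[OF I] hom_zero by metis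
  fix b assume "\<exists>a\<in>I. b = h a"
  then obtain a where a: "a \<in> I" "b = h a" by blast
  have ac: "a \<in> carrier R" using a(1) Ic by blast
  show "\<exists>a\<in>I. b \<oplus>\<^bsub>S\<^esub> c = h a" if ex: "\<exists>a\<in>I. c = h a" for c
  proof -
   obtain a' where a': "a' \<in> I" "c = h a'" using ex by blast
   have "a' \<in> carrier R" using a'(1) Ic by blast
   hence "b \<oplus>\<^bsub>S\<^esub> c = h (a \<oplus>\<^bsub>R\<^esub> a')" unfolding a(2) a'(2) using ac by simp
   thus ?thesis using R.ideal_add[OF I a(1) a'(1)] by blast
  qed
  show "\<exists>a\<in>I. c \<otimes>\<^bsub>S\<^esub> b = h a" if c: "c \<in> carrier S" for c
  proof -
   obtain a' where a': "a' \<in> carrier R" "c = h a'" using c surj by blast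
   have "c \<otimes>\<^bsub>S\<^esub> b = h (a' \<otimes>\<^bsub>R\<^esub> a)" unfolding a(2) a'(2) using ac a'(1) by simp
   thus ?thesis using R.ideal_mult[OF I a'(1) a(1)] by blast
  qed
 qed
 ultimately show ?thesis by simp
qed

lemma genideal_image_surj:
 assumes surj: "h ` carrier R = carrier S" and G: "G \<subseteq> carrier R"
 shows "h ` (Idl\<^bsub>R\<^esub> G) = Idl\<^bsub>S\<^esub> (h ` G)"
proof
 show "h ` (Idl\<^bsub>R\<^esub> G) \<subseteq> Idl\<^bsub>S\<^esub> (h ` G)" using hom_genideal[OF G] by blast
 show "Idl\<^bsub>S\<^esub> (h ` G) \<subseteq> h ` (Idl\<^bsub>R\<^esub> G)"
  by (rule S.genideal_minimal[OF ideal_image[OF surj R.genideal_ideal[OF G]]]) (use R.genideal_self[OF G] in blast)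
qed

lemma ideal_power_image:
 assumes surj: "h ` carrier R = carrier S" and I: "ideal I R"
 shows "ideal_power S (h ` I) k = h ` ideal_power R I k"
proof (induction k)
 case 0
 show ?case using surj by (simp only: R.ideal_power_0 S.ideal_power_0)
next
 case (Suc k)
 note Ik = R.ideal_power_ideal[OF I, of k] and Is = R.ideal_power_ideal[OF I, of "Suc k"]
 note hI = ideal_image[OF surj I] and hIk = ideal_image[OF surj Ik] and hIs = ideal_image[OF surj Is]
 have "ideal_prod S (h ` ideal_power R I k) (h ` I) \<subseteq> h ` ideal_power R I (Suc k)"
 proof (rule S.ideal_prod_minimal[OF hIs])
  fix a b assume "a \<in> h ` ideal_power R I k" "b \<in> h ` I"
  then obtain a' b' where ab: "a' \<in> ideal_power R I k" "a = h a'" "b' \<in> I" "b = h b'" by blast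
  have "a' \<in> carrier R" "b' \<in> carrier R" using ab R.ideal_sub[OF Ik] R.ideal_sub[OF I] by auto
  hence "a \<otimes>\<^bsub>S\<^esub> b = h (a' \<otimes>\<^bsub>R\<^esub> b')" using ab by simp
  moreover have "a' \<otimes>\<^bsub>R\<^esub> b' \<in> ideal_power R I (Suc k)"
   unfolding R.ideal_power_Suc by (rule ideal_prod.prod[OF ab(1,3)])
  ultimately show "a \<otimes>\<^bsub>S\<^esub> b \<in> h ` ideal_power R I (Suc k)" by blast
 qed
 moreover have "h ` ideal_power R I (Suc k) \<subseteq> ideal_prod S (h ` ideal_power R I k) (h ` I)"
 proof -
  note P = S.ideal_prod_is_ideal[OF hIk hI]
  have "ideal_power R I (Suc k) \<subseteq> {a. a \<in> carrier R \<and> h a \<in> ideal_prod S (h ` ideal_power R I k) (h ` I)}"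
   unfolding R.ideal_power_Suc
  proof (rule R.ideal_prod_minimal[OF ideal_preimage[OF P]])
   fix a b assume ab: "a \<in> ideal_power R I k" "b \<in> I"
   hence c: "a \<in> carrier R" "b \<in> carrier R" using R.ideal_sub[OF Ik] R.ideal_sub[OF I] by auto
   have "h a \<otimes>\<^bsub>S\<^esub> h b \<in> ideal_prod S (h ` ideal_power R I k) (h ` I)"
    by (rule ideal_prod.prod) (use ab in auto)
   thus "a \<otimes>\<^bsub>R\<^esub> b \<in> {a. a \<in> carrier R \<and> h a \<in> ideal_prod S (h ` ideal_power R I k) (h ` I)}" using c by simp
  qed
  thus ?thesis by blast
 qed
 ultimately show ?case unfolding S.ideal_power_Suc Suc by (rule equalityI)
qed

end

lemma (in cring) quotient_hom:
 assumes I: "ideal I R"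
 shows "ring_hom_cring R (R Quot I) ((+>) I)" "(+>) I ` carrier R = carrier (R Quot I)"
  "\<And>a b. a \<in> carrier R ==> b \<in> carrier R ==> I +> a = I +> b \<longleftrightarrow> a \<ominus> b \<in> I"
  "\<And>a. a \<in> I ==> I +> a = \<zero>\<^bsub>R Quot I\<^esub>"
proof -
 show 1: "ring_hom_cring R (R Quot I) ((+>) I)" by (rule ideal.rcos_ring_hom_cring[OF I cring_axioms])
 show "(+>) I ` carrier R = carrier (R Quot I)" by (auto simp: FactRing_def A_RCOSETS_def')
 show eq: "I +> a = I +> b \<longleftrightarrow> a \<ominus> b \<in> I" if "a \<in> carrier R" "b \<in> carrier R" for a b
  using quotient_eq_iff_same_a_r_cos[OF I that] by blast
 show "I +> a = \<zero>\<^bsub>R Quot I\<^esub>" if a: "a \<in> I" for a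
 proof -
  have ac: "a \<in> carrier R" using a ideal_sub[OF I] by blast
  have "I +> a = I +> \<zero>" using eq[OF ac zero_closed] a ac by (simp add: a_minus_def)
  also have "\<dots> = \<zero>\<^bsub>R Quot I\<^esub>" using ring_hom_cring.hom_zero[OF 1] by simp
  finally show ?thesis .
 qed
qed

lemma (in cring) quotient_image_iff:
 assumes I: "ideal I R" and P: "P \<subseteq> carrier R" and a: "a \<in> carrier R"
 shows "I +> a \<in> (+>) I ` P \<longleftrightarrow> (\<exists>c\<in>P. a \<ominus> c \<in> I)"
 using quotient_hom(3)[OF I a] P by blast

lemma (in ring_hom_cring) quotient_map:
 assumes I: "ideal I R" and J: "ideal J S" and IJ: "h ` I \<subseteq> J"
 shows "\<exists>f. ring_hom_cring (R Quot I) (S Quot J) f \<and> (\<forall>a\<in>carrier R. f (I +>\<^bsub>R\<^esub> a) = J +>\<^bsub>S\<^esub> h a)"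
proof -
 interpret p: ring_hom_cring R "R Quot I" "(+>\<^bsub>R\<^esub>) I" by (rule R.quotient_hom(1)[OF I])
 interpret q: ring_hom_cring S "S Quot J" "(+>\<^bsub>S\<^esub>) J" by (rule S.quotient_hom(1)[OF J])
 define f where "f c = J +>\<^bsub>S\<^esub> h (SOME a. a \<in> carrier R \<and> c = I +>\<^bsub>R\<^esub> a)" for c
 have f: "f (I +>\<^bsub>R\<^esub> a) = J +>\<^bsub>S\<^esub> h a" if a: "a \<in> carrier R" for a
 proof -
  define a' where "a' = (SOME a'. a' \<in> carrier R \<and> I +>\<^bsub>R\<^esub> a = I +>\<^bsub>R\<^esub> a')"
  have a': "a' \<in> carrier R" "I +>\<^bsub>R\<^esub> a = I +>\<^bsub>R\<^esub> a'"
   unfolding a'_def using someI[of "\<lambda>a'. a' \<in> carrier R \<and> I +>\<^bsub>R\<^esub> a = I +>\<^bsub>R\<^esub> a'" a] a by auto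
  have "a \<ominus>\<^bsub>R\<^esub> a' \<in> I" using R.quotient_hom(3)[OF I a a'(1)] a'(2) by blast
  hence "h (a \<ominus>\<^bsub>R\<^esub> a') \<in> J" using IJ by blast
  moreover have "h (a \<ominus>\<^bsub>R\<^esub> a') = h a \<ominus>\<^bsub>S\<^esub> h a'" using a a'(1) by (simp add: a_minus_def)
  ultimately have "J +>\<^bsub>S\<^esub> h a = J +>\<^bsub>S\<^esub> h a'" using S.quotient_hom(3)[OF J hom_closed[OF a] hom_closed[OF a'(1)]] by simp
  thus ?thesis unfolding f_def a'_def ..
 qed
 have "f \<in> ring_hom (R Quot I) (S Quot J)"
 proof (rule ring_hom_memI)
  fix c assume "c \<in> carrier (R Quot I)"
  then obtain a where a: "a \<in> carrier R" "c = I +>\<^bsub>R\<^esub> a" using R.quotient_hom(2)[OF I] by blast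
  show "f c \<in> carrier (S Quot J)" unfolding a(2) f[OF a(1)] using a(1) by simp
  fix d assume "d \<in> carrier (R Quot I)"
  then obtain a' where a': "a' \<in> carrier R" "d = I +>\<^bsub>R\<^esub> a'" using R.quotient_hom(2)[OF I] by blast
  have "c \<otimes>\<^bsub>R Quot I\<^esub> d = I +>\<^bsub>R\<^esub> (a \<otimes>\<^bsub>R\<^esub> a')" unfolding a(2) a'(2) by (rule p.hom_mult[OF a(1) a'(1), symmetric])
  thus "f (c \<otimes>\<^bsub>R Quot I\<^esub> d) = f c \<otimes>\<^bsub>S Quot J\<^esub> f d"
   unfolding a(2) a'(2) f[OF a(1)] f[OF a'(1)] using f[OF R.m_closed[OF a(1) a'(1)]] a(1) a'(1) by simp
  have "c \<oplus>\<^bsub>R Quot I\<^esub> d = I +>\<^bsub>R\<^esub> (a \<oplus>\<^bsub>R\<^esub> a')" unfolding a(2) a'(2) by (rule p.hom_add[OF a(1) a'(1), symmetric])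
  thus "f (c \<oplus>\<^bsub>R Quot I\<^esub> d) = f c \<oplus>\<^bsub>S Quot J\<^esub> f d"
   unfolding a(2) a'(2) f[OF a(1)] f[OF a'(1)] using f[OF R.a_closed[OF a(1) a'(1)]] a(1) a'(1) by simp
 next
  show "f \<one>\<^bsub>R Quot I\<^esub> = \<one>\<^bsub>S Quot J\<^esub>" using f[OF R.one_closed] p.hom_one q.hom_one hom_one by simp
 qed
 hence "ring_hom_cring (R Quot I) (S Quot J) f"
  using p.S.cring_axioms q.S.cring_axioms by (simp add: ring_hom_cring_def ring_hom_cring_axioms_def)
 thus ?thesis using f by blast
qed

lemma (in cring) quotient_local:
 assumes M: "ideal M R" "M \<noteq> carrier R" "\<And>a. a \<in> carrier R ==> a \<notin> M ==> a \<in> Units R" and I: "ideal I R" "I \<subseteq> M"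
 shows "(+>) I ` M \<noteq> carrier (R Quot I)"
  "\<And>c. c \<in> carrier (R Quot I) ==> c \<notin> (+>) I ` M ==> c \<in> Units (R Quot I)"
proof -
 interpret p: ring_hom_cring R "R Quot I" "(+>) I" by (rule quotient_hom(1)[OF I(1)])
 show "(+>) I ` M \<noteq> carrier (R Quot I)"
 proof
  assume "(+>) I ` M = carrier (R Quot I)"
  hence "I +> \<one> \<in> (+>) I ` M" using p.hom_closed[OF one_closed] by simp
  then obtain m where m: "m \<in> M" "\<one> \<ominus> m \<in> I" using quotient_image_iff[OF I(1) ideal_sub[OF M(1)] one_closed] by blast
  hence "\<one> \<in> M" using ideal_minusE1[OF M(1) _ m(1)] I(2) by blast
  thus False using M(2) ideal.one_imp_carrier[OF M(1)] by blast
 qed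
 fix c assume c: "c \<in> carrier (R Quot I)" "c \<notin> (+>) I ` M"
 then obtain a where a: "a \<in> carrier R" "c = I +> a" using quotient_hom(2)[OF I(1)] by blast
 hence "a \<in> Units R" using M(3) c(2) by blast
 hence "inv a \<in> carrier R" "inv a \<otimes> a = \<one>" by auto
 hence "(I +> inv a) \<otimes>\<^bsub>R Quot I\<^esub> c = \<one>\<^bsub>R Quot I\<^esub>" unfolding a(2)
  using p.hom_mult[of "inv a" a] a(1) p.hom_one by simp
 thus "c \<in> Units (R Quot I)"
  using p.hom_closed[OF \<open>inv a \<in> carrier R\<close>] c(1) p.S.m_comm[of c "I +> inv a"] unfolding Units_def by auto
qed

section \<open>Completion of a pair\<close>

lemma (in cring) max_ideal_eq:
 assumes M: "ideal M R" "M \<noteq> carrier R" "\<And>a. a \<in> carrier R ==> a \<notin> M ==> a \<in> Units R"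
 shows "max_ideal R = M"
proof -
 have le: "I \<subseteq> M" if "ideal I R" "I \<noteq> carrier R" for I
  using proper_ideal_no_unit[OF that] M(3) ideal_sub[OF that(1)] by blast
 have max: "maximalideal M R"
 proof (rule maximalidealI[OF M(1)])
  show "carrier R \<noteq> M" using M(2) by blast
  fix I assume "ideal I R" "M \<subseteq> I" "I \<subseteq> carrier R"
  thus "I = M \<or> I = carrier R" using le by blast
 qed
 show ?thesis
  unfolding max_ideal_def
 proof (rule the_equality[of "\<lambda>M. maximalideal M R", OF max])
  fix N assume N: "maximalideal N R"
  have "N \<subseteq> M" using le maximalideal.axioms(1)[OF N] maximalideal.I_notcarr[OF N] by blast
  thus "N = M" using maximalideal.I_maximal[OF N M(1)] ideal_sub[OF M(1)] M(2) by blast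
 qed
qed

text \<open>\<open>local_ring\<close> supplies one maximal ideal and its uniqueness. That a nonunit
  lies in some maximal ideal is taken from the Noetherian condition.\<close>

lemma (in cring) noetherian_local:
 assumes noeth: "noetherian_ring R" and loc: "local_ring R"
 shows "maximalideal (max_ideal R) R" "\<And>a. a \<in> carrier R ==> a \<notin> max_ideal R ==> a \<in> Units R"
proof -
 have ex: "\<exists>!M. maximalideal M R" using loc by (simp add: local_ring_def)
 show max: "maximalideal (max_ideal R) R" unfolding max_ideal_def by (rule theI'[of "\<lambda>M. maximalideal M R", OF ex])
 fix a assume a: "a \<in> carrier R" "a \<notin> max_ideal R"
 show "a \<in> Units R"
 proof (rule ccontr)
  assume nu: "a \<notin> Units R"
  have ac: "{a} \<subseteq> carrier R" using a by simp
  note I = genideal_ideal[OF ac]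
  have "\<one> \<notin> Idl {a}"
  proof
   assume "\<one> \<in> Idl {a}"
   then obtain c where "c \<in> carrier R" "\<one> = c \<otimes> a" using genideal_singleton[OF a(1)] by blast
   hence "a \<in> Units R" using a(1) m_comm[of c a] unfolding Units_def by auto
   thus False using nu by blast
  qed
  hence pr: "Idl {a} \<noteq> carrier R" by auto
  let ?C = "{N. ideal N R \<and> Idl {a} \<subseteq> N \<and> N \<noteq> carrier R}"
  have "?C \<noteq> {}" using I pr by blast
  hence "\<exists>N\<in>?C. \<forall>N'\<in>?C. \<not> N \<subset> N'" by (rule noetherian_maximal[OF noeth]) simp
  then obtain N where N: "N \<in> ?C" "\<forall>N'\<in>?C. \<not> N \<subset> N'" by blast
  have "maximalideal N R"
  proof (rule maximalidealI)
   show "ideal N R" "carrier R \<noteq> N" using N(1) by blast+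
   fix N' assume "ideal N' R" "N \<subseteq> N'" "N' \<subseteq> carrier R"
   thus "N' = N \<or> N' = carrier R" using N by blast
  qed
  hence "N = max_ideal R" using ex max by blast
  thus False using N(1) genideal_self[OF ac] a(2) by blast
 qed
qed

text \<open>A finite supremum of chain lengths is attained. The prime \<open>P\<close> makes the set
  of lengths nonempty, which matters for n = 0, because the empty supremum is 0 too.\<close>

lemma krull_dim_chain:
 fixes R :: "('a, 'm) ring_scheme"
 assumes d: "krull_dim R = enat n" and p: "primeideal P R"
 shows "\<exists>p :: nat => 'a set. (\<forall>i\<le>n. primeideal (p i) R) \<and> (\<forall>i<n. p i \<subset> p (Suc i))"
proof -
 let ?S = "{k. \<exists>p :: nat => 'a set. (\<forall>i\<le>k. primeideal (p i) R) \<and> (\<forall>i<k. p i \<subset> p (Suc i))}"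
 have S: "Sup (enat ` ?S) = enat n" using d unfolding krull_dim_def by (simp add: setcompr_eq_image)
 have "k \<le> n" if "k \<in> ?S" for k
 proof -
  have "enat k \<le> Sup (enat ` ?S)" using that by (intro Sup_upper) blast
  thus ?thesis unfolding S by simp
 qed
 hence "?S \<subseteq> {..n}" by blast
 hence fin: "finite ?S" by (rule finite_subset) simp
 have "0 \<in> ?S" using p by (auto intro: exI[of _ "\<lambda>_. P"])
 hence ne: "enat ` ?S \<noteq> {}" by blast
 have "Sup (enat ` ?S) = Max (enat ` ?S)" by (rule cSup_eq_Max[OF finite_imageI[OF fin] ne])
 hence "enat n \<in> enat ` ?S" using Max_in[OF finite_imageI[OF fin] ne] unfolding S by simp
 thus ?thesis by auto
qed

text \<open>Identifies the ideal of the point x' with the image of the maximal ideal.\<close>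

lemma (in cring) quotient_generators:
 assumes c: "set us \<union> set ys \<subseteq> carrier R" and M: "M = Idl (set us \<union> set ys)"
 shows "Idl\<^bsub>R Quot Idl (set us)\<^esub> ((+>) (Idl (set us)) ` set ys) = (+>) (Idl (set us)) ` M"
proof -
 have uc: "set us \<subseteq> carrier R" and yc: "set ys \<subseteq> carrier R" using c by auto
 define I where "I = Idl (set us)"
 have I: "ideal I R" unfolding I_def by (rule genideal_ideal[OF uc])
 interpret p: ring_hom_cring R "R Quot I" "(+>) I" by (rule quotient_hom(1)[OF I])
 have yc': "(+>) I ` set ys \<subseteq> carrier (R Quot I)" using yc p.hom_closed by blast
 note Y = p.S.genideal_ideal[OF yc']
 have "(+>) I ` M = Idl\<^bsub>R Quot I\<^esub> ((+>) I ` (set us \<union> set ys))"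
  unfolding M by (rule p.genideal_image_surj[OF quotient_hom(2)[OF I] c])
 also have "\<dots> = Idl\<^bsub>R Quot I\<^esub> ((+>) I ` set ys)"
 proof
  have "(+>) I ` set us \<subseteq> Idl\<^bsub>R Quot I\<^esub> ((+>) I ` set ys)"
   using quotient_hom(4)[OF I] genideal_self[OF uc] p.S.ideal_zero[OF Y] unfolding I_def by auto
  thus "Idl\<^bsub>R Quot I\<^esub> ((+>) I ` (set us \<union> set ys)) \<subseteq> Idl\<^bsub>R Quot I\<^esub> ((+>) I ` set ys)"
   using p.S.genideal_self[OF yc'] by (intro p.S.genideal_minimal[OF Y]) blast
  show "Idl\<^bsub>R Quot I\<^esub> ((+>) I ` set ys) \<subseteq> Idl\<^bsub>R Quot I\<^esub> ((+>) I ` (set us \<union> set ys))"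
   by (rule p.S.genideal_mono) blast
 qed
 finally show ?thesis unfolding I_def by simp
qed

lemma (in ring_hom_cring) hom_minus:
 "a \<in> carrier R ==> c \<in> carrier R ==> h (a \<ominus>\<^bsub>R\<^esub> c) = h a \<ominus>\<^bsub>S\<^esub> h c"
 by (simp add: a_minus_def)

lemma (in ring_hom_cring) hom_monomial:
 assumes "set ts \<subseteq> carrier R"
 shows "h (monomial R ts B) = monomial S (map h ts) B"
proof -
 have c: "ts ! i \<in> carrier R" if "i < length ts" for i using assms nth_mem[OF that] by blast
 have "h (monomial R ts B) = (\<Otimes>\<^bsub>S\<^esub>i\<in>{..<length ts}. (h \<circ> (\<lambda>i. (ts ! i) [^]\<^bsub>R\<^esub> (B ! i))) i)"
  unfolding monomial_def using c by (subst hom_finprod) (auto simp: o_def)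
 also have "\<dots> = monomial S (map h ts) B"
  unfolding monomial_def using c by (intro S.finprod_cong') (auto simp: hom_pow)
 finally show ?thesis .
qed

section \<open>The pair over the completion\<close>

locale completed_pair = adic_parameters R "(!) (u @ y)" "length (u @ y)" M for R (structure) and u y M +
 fixes J :: "'a set" and b :: nat
 assumes growth_R: "growth R M (length (u @ y))" and noeth_R: "noetherian_ring R"
  and J_ideal: "ideal J R" and J_power: "J \<subseteq> ideal_power R M b"
  and directrix: "yields_directrix_mod R J b u y"
begin

abbreviation n :: nat where "n \<equiv> length (u @ y)"
abbreviation N :: "(nat => 'a set) set" where "N \<equiv> FA 1"
abbreviation uh :: "(nat => 'a set) list" where "uh \<equiv> map \<iota> u"
abbreviation yh :: "(nat => 'a set) list" where "yh \<equiv> map \<iota> y"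
abbreviation Jh :: "(nat => 'a set) set" where "Jh \<equiv> Idl\<^bsub>A\<^esub> (\<iota> ` J)"

lemma max_ideal_R: "max_ideal R = M"
 by (rule max_ideal_eq[OF M_ideal M_proper M_local])

lemma completion_R: "completion R = A"
 unfolding max_ideal_R ..

lemma to_completion_R: "to_completion R = \<iota>"
 unfolding to_completion_def max_ideal_R \<iota>_def cls_def ..

lemma FA_powers: "ideal_power A N = FA"
 by (rule ext) (rule FA_power)

lemma complete_A': "complete_filtered A (ideal_power A N)"
 unfolding FA_powers by (rule complete_A)

lemma regular_A: "complete_regular A (\<iota> \<circ> (!) (u @ y)) n N"
 by (intro complete_regular.intro regular_parameters.intro regular_parameters_axioms.intro
   parameters_A growth_A growth_R complete_A')

lemma noeth_A: "noetherian_ring A"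
 by (rule complete_regular.noetherian[OF regular_A])

lemma krull_dim_A: "krull_dim A = enat n"
 by (rule regular_parameters.krull_dim_eq[OF complete_regular.axioms(1)[OF regular_A] noeth_A])

lemma N_ideal: "ideal N A"
 using complete_filtered.F_ideal[OF complete_A] .

lemma max_ideal_A: "max_ideal A = N"
 by (rule cring.max_ideal_eq[OF cring_A N_ideal FA_proper FA_local])

lemma image_uy: "(!) (u @ y) ` {..<n} = set u \<union> set y"
 by (metis atLeast0LessThan list.set_map map_nth set_append set_upt)

lemma carrier_uy: "set u \<subseteq> carrier R" "set y \<subseteq> carrier R" "set u \<union> set y \<subseteq> carrier R"
 using funcset_image[OF x_closed] unfolding image_uy by auto

lemma M_uy: "M = Idl (set u \<union> set y)"
 using M_gen unfolding image_uy .

lemma N_uy: "Idl\<^bsub>A\<^esub> (set uh \<union> set yh) = N"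
 unfolding FA_1 image_comp[symmetric] image_uy by (simp add: image_Un)

lemma carrier_uyh: "set uh \<union> set yh \<subseteq> carrier A"
 using carrier_uy iota_closed by auto

lemma regular_local_A: "regular_local A N n"
 by (intro regular_local.intro regular_local_axioms.intro cring_A N_ideal FA_proper FA_local growth_A growth_R noeth_A)

lemma pair_A: "\<exists>F. pair_setup A N n Jh F"
proof -
 interpret h: ring_hom_cring R A \<iota> by (rule iota_hom_cring)
 obtain F where F: "F \<subseteq> carrier R" "finite F" "J = Idl F" using noetherian_ring.finetely_gen[OF noeth_R J_ideal] by blast
 have "Jh = Idl\<^bsub>A\<^esub> (\<iota> ` F)" unfolding F(3) by (rule h.genideal_image[OF F(1)])
 hence "pair_setup A N n Jh (\<iota> ` F)"
  using F iota_closed regular_local_A by (intro pair_setup.intro pair_setup_axioms.intro) auto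
 thus ?thesis by blast
qed

text \<open>Coefficients in the completion are replaced by elements of R that approximate
  them.\<close>

lemma genideal_approx:
 assumes G: "G \<subseteq> carrier R" and t: "t \<in> Idl\<^bsub>A\<^esub> (\<iota> ` G)"
 shows "\<exists>c\<in>Idl G. t \<ominus>\<^bsub>A\<^esub> \<iota> c \<in> FA k"
proof -
 interpret h: ring_hom_cring R A \<iota> by (rule iota_hom_cring)
 note I = genideal_ideal[OF G] and Fk = complete_filtered.F_ideal[OF complete_A, of k]
 have cc: "c \<in> carrier R" if "c \<in> Idl G" for c using ideal_sub[OF I] that by blast
 have Fc: "s \<in> carrier A" if "s \<in> FA k" for s using h.S.ideal_sub[OF Fk] that by blast
 have "Idl\<^bsub>A\<^esub> (\<iota> ` G) \<subseteq> {t. t \<in> carrier A \<and> (\<exists>c\<in>Idl G. t \<ominus>\<^bsub>A\<^esub> \<iota> c \<in> FA k)}"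
 proof (rule h.S.genideal_minimal, rule h.S.ideal_Collect)
  show "\<zero>\<^bsub>A\<^esub> \<in> carrier A \<and> (\<exists>c\<in>Idl G. \<zero>\<^bsub>A\<^esub> \<ominus>\<^bsub>A\<^esub> \<iota> c \<in> FA k)"
   using ideal_zero[OF I] h.S.ideal_zero[OF Fk] by (intro conjI bexI[of _ \<zero>]) (auto simp: a_minus_def)
  fix t assume t: "t \<in> carrier A \<and> (\<exists>c\<in>Idl G. t \<ominus>\<^bsub>A\<^esub> \<iota> c \<in> FA k)"
  then obtain c where c: "c \<in> Idl G" "t \<ominus>\<^bsub>A\<^esub> \<iota> c \<in> FA k" and tc: "t \<in> carrier A" by blast
  have ic: "\<iota> c \<in> carrier A" by (rule iota_closed[OF cc[OF c(1)]])
  show "t \<oplus>\<^bsub>A\<^esub> s \<in> carrier A \<and> (\<exists>c\<in>Idl G. t \<oplus>\<^bsub>A\<^esub> s \<ominus>\<^bsub>A\<^esub> \<iota> c \<in> FA k)"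
   if s: "s \<in> carrier A \<and> (\<exists>c\<in>Idl G. s \<ominus>\<^bsub>A\<^esub> \<iota> c \<in> FA k)" for s
  proof -
   obtain d where d: "d \<in> Idl G" "s \<ominus>\<^bsub>A\<^esub> \<iota> d \<in> FA k" and sc: "s \<in> carrier A" using s by blast
   have id: "\<iota> d \<in> carrier A" by (rule iota_closed[OF cc[OF d(1)]])
   have "t \<oplus>\<^bsub>A\<^esub> s \<ominus>\<^bsub>A\<^esub> \<iota> (c \<oplus> d) = (t \<ominus>\<^bsub>A\<^esub> \<iota> c) \<oplus>\<^bsub>A\<^esub> (s \<ominus>\<^bsub>A\<^esub> \<iota> d)"
    unfolding h.hom_add[OF cc[OF c(1)] cc[OF d(1)]] using tc sc ic id by algebra
   thus ?thesis using h.S.ideal_add[OF Fk c(2) d(2)] ideal_add[OF I c(1) d(1)] tc sc h.S.a_closed by metis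
  qed
  show "s \<otimes>\<^bsub>A\<^esub> t \<in> carrier A \<and> (\<exists>c\<in>Idl G. s \<otimes>\<^bsub>A\<^esub> t \<ominus>\<^bsub>A\<^esub> \<iota> c \<in> FA k)" if s: "s \<in> carrier A" for s
  proof -
   obtain a where a: "a \<in> carrier R" "s \<ominus>\<^bsub>A\<^esub> \<iota> a \<in> FA k" by (rule iota_approx[OF s])
   have ia: "\<iota> a \<in> carrier A" by (rule iota_closed[OF a(1)])
   have "s \<otimes>\<^bsub>A\<^esub> t \<ominus>\<^bsub>A\<^esub> \<iota> (a \<otimes> c) = s \<otimes>\<^bsub>A\<^esub> (t \<ominus>\<^bsub>A\<^esub> \<iota> c) \<oplus>\<^bsub>A\<^esub> \<iota> c \<otimes>\<^bsub>A\<^esub> (s \<ominus>\<^bsub>A\<^esub> \<iota> a)"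
    unfolding h.hom_mult[OF a(1) cc[OF c(1)]] using tc s ic ia by algebra
   thus ?thesis
    using h.S.ideal_add[OF Fk h.S.ideal_mult[OF Fk s c(2)] h.S.ideal_mult[OF Fk ic a(2)]] ideal_mult[OF I a(1) c(1)] s tc h.S.m_closed by metis
  qed
 next
  show "\<iota> ` G \<subseteq> {t. t \<in> carrier A \<and> (\<exists>c\<in>Idl G. t \<ominus>\<^bsub>A\<^esub> \<iota> c \<in> FA k)}"
  proof (rule image_subsetI)
   fix g assume g: "g \<in> G"
   have ig: "\<iota> g \<in> carrier A" using g G iota_closed by blast
   hence "\<iota> g \<ominus>\<^bsub>A\<^esub> \<iota> g \<in> FA k" using h.S.ideal_zero[OF Fk] by (simp add: a_minus_def h.S.r_neg)
   thus "\<iota> g \<in> {t. t \<in> carrier A \<and> (\<exists>c\<in>Idl G. t \<ominus>\<^bsub>A\<^esub> \<iota> c \<in> FA k)}" using ig genideal_self[OF G] g by blast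
  qed
 qed blast
 thus ?thesis using t by blast
qed

abbreviation Iu :: "'a set" where "Iu \<equiv> Idl (set u)"
abbreviation Ih :: "(nat => 'a set) set" where "Ih \<equiv> Idl\<^bsub>A\<^esub> (set uh)"

lemma Iu: "ideal Iu R" "Iu \<subseteq> M"
 using genideal_ideal[OF carrier_uy(1)] genideal_mono[of "set u" "set u \<union> set y"] M_uy by auto

lemma Ih: "ideal Ih A" "Ih \<subseteq> N"
proof -
 interpret A: cring A by (rule cring_A)
 show "ideal Ih A" by (rule A.genideal_ideal) (use carrier_uyh in blast)
 show "Ih \<subseteq> N" unfolding N_uy[symmetric] by (rule A.genideal_mono) blast
qed

text \<open>Dividing by u commutes with completion on associated graded rings. The point is that an
  a in R that lies in \<open>FA k\<close> modulo the extended ideal lies in M^k modulo the ideal of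
  u: the correcting element of the extended ideal is approximated modulo \<open>FA k\<close> by one
  from R.\<close>

lemma quotient_graded_map:
 "\<exists>h. graded_map (R Quot Iu) ((+>) Iu ` M) (A Quot Ih) ((+>\<^bsub>A\<^esub>) Ih ` N) h \<and>
  (\<forall>a\<in>carrier R. h (Iu +> a) = Ih +>\<^bsub>A\<^esub> \<iota> a)"
proof -
 interpret \<iota>: ring_hom_cring R A \<iota> by (rule iota_hom_cring)
 interpret p: ring_hom_cring R "R Quot Iu" "(+>) Iu" by (rule quotient_hom(1)[OF Iu(1)])
 interpret q: ring_hom_cring A "A Quot Ih" "(+>\<^bsub>A\<^esub>) Ih" by (rule \<iota>.S.quotient_hom(1)[OF Ih(1)])
 note ps = quotient_hom(2)[OF Iu(1)] and qs = \<iota>.S.quotient_hom(2)[OF Ih(1)]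
 have uim: "\<iota> ` set u = set uh" by simp
 have IuIh: "\<iota> c \<in> Ih" if "c \<in> Iu" for c using \<iota>.hom_genideal[OF carrier_uy(1) that] unfolding uim .
 hence "\<iota> ` Iu \<subseteq> Ih" by blast
 from \<iota>.quotient_map[OF Iu(1) Ih(1) this] obtain h where h: "ring_hom_cring (R Quot Iu) (A Quot Ih) h"
  "\<forall>a\<in>carrier R. h (Iu +> a) = Ih +>\<^bsub>A\<^esub> \<iota> a" by blast
 have hp: "h (Iu +> a) = Ih +>\<^bsub>A\<^esub> \<iota> a" if "a \<in> carrier R" for a using h(2) that by blast
 have pP: "ideal_power (R Quot Iu) ((+>) Iu ` M) k = (+>) Iu ` Pw k" for k by (rule p.ideal_power_image[OF ps M_ideal])
 have qP: "ideal_power (A Quot Ih) ((+>\<^bsub>A\<^esub>) Ih ` N) k = (+>\<^bsub>A\<^esub>) Ih ` FA k" for k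
  using q.ideal_power_image[OF qs N_ideal] unfolding FA_power .
 have FAc: "FA k \<subseteq> carrier A" for k using \<iota>.S.ideal_sub[OF complete_filtered.F_ideal[OF complete_A]] .
 have Pc: "Pw k \<subseteq> carrier R" for k using Pw_carr by blast
 have key: "Ih +>\<^bsub>A\<^esub> \<iota> a \<in> (+>\<^bsub>A\<^esub>) Ih ` FA k \<longleftrightarrow> Iu +> a \<in> (+>) Iu ` Pw k" if a: "a \<in> carrier R" for a k
  unfolding \<iota>.S.quotient_image_iff[OF Ih(1) FAc iota_closed[OF a]] quotient_image_iff[OF Iu(1) Pc a]
 proof
  assume "\<exists>c\<in>Pw k. a \<ominus> c \<in> Iu"
  then obtain c where c: "c \<in> Pw k" "a \<ominus> c \<in> Iu" by blast
  have cc: "c \<in> carrier R" by (rule Pw_carr[OF c(1)])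
  have "\<iota> (a \<ominus> c) = \<iota> a \<ominus>\<^bsub>A\<^esub> \<iota> c" by (rule \<iota>.hom_minus[OF a cc])
  thus "\<exists>c\<in>FA k. \<iota> a \<ominus>\<^bsub>A\<^esub> c \<in> Ih" using IuIh[OF c(2)] iota_FA[OF cc] c(1) by (intro bexI[of _ "\<iota> c"]) auto
 next
  assume "\<exists>c\<in>FA k. \<iota> a \<ominus>\<^bsub>A\<^esub> c \<in> Ih"
  then obtain s where s: "s \<in> FA k" "\<iota> a \<ominus>\<^bsub>A\<^esub> s \<in> Ih" by blast
  obtain c where c: "c \<in> Iu" "(\<iota> a \<ominus>\<^bsub>A\<^esub> s) \<ominus>\<^bsub>A\<^esub> \<iota> c \<in> FA k"
   using genideal_approx[OF carrier_uy(1), of "\<iota> a \<ominus>\<^bsub>A\<^esub> s" k] s(2) unfolding uim by blast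
  have cc: "c \<in> carrier R" using c(1) ideal_sub[OF Iu(1)] by blast
  have sc: "s \<in> carrier A" using s(1) FAc by blast
  have "\<iota> (a \<ominus> c) = \<iota> a \<ominus>\<^bsub>A\<^esub> \<iota> c" by (rule \<iota>.hom_minus[OF a cc])
  also have "\<dots> = ((\<iota> a \<ominus>\<^bsub>A\<^esub> s) \<ominus>\<^bsub>A\<^esub> \<iota> c) \<oplus>\<^bsub>A\<^esub> s" using iota_closed[OF a] iota_closed[OF cc] sc by algebra
  finally have "\<iota> (a \<ominus> c) \<in> FA k" using \<iota>.S.ideal_add[OF complete_filtered.F_ideal[OF complete_A] c(2) s(1)] by simp
  hence "a \<ominus> c \<in> Pw k" using iota_FA[OF minus_closed[OF a cc]] by blast
  moreover have "a \<ominus> (a \<ominus> c) = c" using a cc by algebra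
  ultimately show "\<exists>c\<in>Pw k. a \<ominus> c \<in> Iu" using c(1) by (intro bexI[of _ "a \<ominus> c"]) auto
 qed
 have "graded_map (R Quot Iu) ((+>) Iu ` M) (A Quot Ih) ((+>\<^bsub>A\<^esub>) Ih ` N) h"
 proof (intro graded_map.intro graded_map_axioms.intro graded_setup.intro graded_setup_axioms.intro h(1)
   p.S.cring_axioms q.S.cring_axioms p.ideal_image[OF ps M_ideal] q.ideal_image[OF qs N_ideal])
  fix c k assume "c \<in> carrier (R Quot Iu)"
  then obtain a where a: "a \<in> carrier R" "c = Iu +> a" using ps by blast
  show "h c \<in> ideal_power (A Quot Ih) ((+>\<^bsub>A\<^esub>) Ih ` N) k \<longleftrightarrow> c \<in> ideal_power (R Quot Iu) ((+>) Iu ` M) k"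
   unfolding pP qP a(2) hp[OF a(1)] by (rule key[OF a(1)])
 next
  fix z k assume "z \<in> ideal_power (A Quot Ih) ((+>\<^bsub>A\<^esub>) Ih ` N) k"
  then obtain s where s: "s \<in> FA k" "z = Ih +>\<^bsub>A\<^esub> s" unfolding qP by blast
  have sc: "s \<in> carrier A" using s(1) FAc by blast
  obtain a where a: "a \<in> carrier R" "s \<ominus>\<^bsub>A\<^esub> \<iota> a \<in> FA (Suc k)" by (rule iota_approx[OF sc])
  have ia: "\<iota> a \<in> carrier A" by (rule iota_closed[OF a(1)])
  have Fk: "ideal (FA k) A" by (rule complete_filtered.F_ideal[OF complete_A])
  have "s \<ominus>\<^bsub>A\<^esub> \<iota> a \<in> FA k" using a(2) complete_filtered.F_Suc[OF complete_A] by blast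
  hence "s \<ominus>\<^bsub>A\<^esub> (s \<ominus>\<^bsub>A\<^esub> \<iota> a) \<in> FA k" by (rule \<iota>.S.ideal_minus[OF Fk s(1)])
  moreover have "s \<ominus>\<^bsub>A\<^esub> (s \<ominus>\<^bsub>A\<^esub> \<iota> a) = \<iota> a" using sc ia by algebra
  ultimately have aP: "a \<in> Pw k" using iota_FA[OF a(1)] by simp
  have "z \<ominus>\<^bsub>A Quot Ih\<^esub> h (Iu +> a) = Ih +>\<^bsub>A\<^esub> (s \<ominus>\<^bsub>A\<^esub> \<iota> a)"
   unfolding s(2) hp[OF a(1)] q.hom_minus[OF sc ia] ..
  thus "\<exists>c\<in>ideal_power (R Quot Iu) ((+>) Iu ` M) k.
    z \<ominus>\<^bsub>A Quot Ih\<^esub> h c \<in> ideal_power (A Quot Ih) ((+>\<^bsub>A\<^esub>) Ih ` N) (Suc k)"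
   unfolding pP qP using aP a(2) by auto
 qed
 thus ?thesis using h(2) by blast
qed

text \<open>The assumption on the directrix, given over R, in the form in which it is used over the
  completion.\<close>

lemma directrix_A:
 "defines_directrix (A Quot Ih) ((+>\<^bsub>A\<^esub>) Ih ` N) (Idl\<^bsub>A Quot Ih\<^esub> ((+>\<^bsub>A\<^esub>) Ih ` Jh)) b (map ((+>\<^bsub>A\<^esub>) Ih) yh)"
proof -
 obtain h where h: "graded_map (R Quot Iu) ((+>) Iu ` M) (A Quot Ih) ((+>\<^bsub>A\<^esub>) Ih ` N) h"
  "\<forall>a\<in>carrier R. h (Iu +> a) = Ih +>\<^bsub>A\<^esub> \<iota> a" using quotient_graded_map by blast
 interpret \<iota>: ring_hom_cring R A \<iota> by (rule iota_hom_cring)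
 interpret p: ring_hom_cring R "R Quot Iu" "(+>) Iu" by (rule quotient_hom(1)[OF Iu(1)])
 interpret q: ring_hom_cring A "A Quot Ih" "(+>\<^bsub>A\<^esub>) Ih" by (rule \<iota>.S.quotient_hom(1)[OF Ih(1)])
 interpret g: graded_map "R Quot Iu" "(+>) Iu ` M" "A Quot Ih" "(+>\<^bsub>A\<^esub>) Ih ` N" h by (rule h(1))
 note ps = quotient_hom(2)[OF Iu(1)]
 have hp: "h (Iu +> a) = Ih +>\<^bsub>A\<^esub> \<iota> a" if "a \<in> carrier R" for a using h(2) that by blast
 have Jc: "J \<subseteq> carrier R" by (rule ideal_sub[OF J_ideal])
 have iJc: "\<iota> ` J \<subseteq> carrier A" using Jc iota_closed by blast
 have JQ: "ideal ((+>) Iu ` J) (R Quot Iu)" by (rule p.ideal_image[OF ps J_ideal])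
 have d: "defines_directrix (R Quot Iu) ((+>) Iu ` M) ((+>) Iu ` J) b (map ((+>) Iu) y)"
  using directrix unfolding yields_directrix_mod_def Let_def quotient_generators[OF carrier_uy(3) M_uy]
   p.S.genideal_of_ideal[OF JQ] .
 have "defines_directrix (A Quot Ih) ((+>\<^bsub>A\<^esub>) Ih ` N) (Idl\<^bsub>A Quot Ih\<^esub> ((+>\<^bsub>A\<^esub>) Ih ` Jh)) b (map h (map ((+>) Iu) y))"
 proof (rule g.defines_directrix_image[OF _ _ JQ _ _ _ d])
  show "(+>) Iu ` M \<noteq> carrier (R Quot Iu)" by (rule quotient_local(1)[OF M_ideal M_proper M_local Iu])
  show "c \<in> Units (R Quot Iu)" if "c \<in> carrier (R Quot Iu)" "c \<notin> (+>) Iu ` M" for c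
   by (rule quotient_local(2)[OF M_ideal M_proper M_local Iu that])
  show "(+>) Iu ` J \<subseteq> ideal_power (R Quot Iu) ((+>) Iu ` M) b"
   unfolding p.ideal_power_image[OF ps M_ideal] using J_power by blast
  have "h ` (+>) Iu ` J = (+>\<^bsub>A\<^esub>) Ih ` \<iota> ` J" unfolding image_image using hp Jc by (intro image_cong) auto
  thus "Idl\<^bsub>A Quot Ih\<^esub> ((+>\<^bsub>A\<^esub>) Ih ` Jh) = Idl\<^bsub>A Quot Ih\<^esub> (h ` (+>) Iu ` J)"
   using q.genideal_image[OF iJc] by metis
  show "h ` (+>) Iu ` M \<subseteq> (+>\<^bsub>A\<^esub>) Ih ` N"
  proof -
   have "h (Iu +> a) \<in> (+>\<^bsub>A\<^esub>) Ih ` N" if a: "a \<in> M" for a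
    using hp[OF M_carr[OF a]] iota_FA[OF M_carr[OF a], of 1] a Pw_1 by simp
   thus ?thesis by blast
  qed
 qed
 moreover have "map h (map ((+>) Iu) y) = map ((+>\<^bsub>A\<^esub>) Ih) yh" using hp carrier_uy(2) by auto
 ultimately show ?thesis by metis
qed

lemma yields_directrix_A:
 assumes ys: "set uh \<union> set ys \<subseteq> carrier A" "Idl\<^bsub>A\<^esub> (set uh \<union> set ys) = N" "length ys = length y"
  and d: "\<And>j. j < length y ==> ys ! j \<ominus>\<^bsub>A\<^esub> yh ! j \<in> Ih"
 shows "yields_directrix_mod A Jh b uh ys"
proof -
 interpret A: cring A by (rule cring_A)
 have "map ((+>\<^bsub>A\<^esub>) Ih) ys = map ((+>\<^bsub>A\<^esub>) Ih) yh"
 proof (rule nth_equalityI)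
  fix j assume "j < length (map ((+>\<^bsub>A\<^esub>) Ih) ys)"
  hence j: "j < length ys" "j < length y" using ys(3) by auto
  have "ys ! j \<in> carrier A" "yh ! j \<in> carrier A" using ys(1) carrier_uyh nth_mem[OF j(1)] nth_mem[of j yh] j by auto
  hence "Ih +>\<^bsub>A\<^esub> ys ! j = Ih +>\<^bsub>A\<^esub> yh ! j" using A.quotient_hom(3)[OF Ih(1)] d[OF j(2)] by blast
  thus "map ((+>\<^bsub>A\<^esub>) Ih) ys ! j = map ((+>\<^bsub>A\<^esub>) Ih) yh ! j" using j by simp
 qed (simp add: ys(3))
 thus ?thesis
  using directrix_A unfolding yields_directrix_mod_def Let_def A.quotient_generators[OF ys(1) ys(2)[symmetric]] by simp
qed

text \<open>Degeneracy survives division by u, where \<open>directrix_length_less\<close> would make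
  \<open>length y\<close> smaller than itself.\<close>

lemma not_degenerate:
 assumes ps: "pair_setup A N n Jh F"
 shows "\<not> pair_setup.degenerate A N uh Jh b (length y)"
proof
 interpret ps: pair_setup A N n uh Jh F b by (rule ps)
 assume "ps.degenerate (length y)"
 then obtain ts p where ts: "length ts = length y" "p < length y" "set ts \<subseteq> N" and
  J: "Jh \<subseteq> Idl\<^bsub>A\<^esub> (set uh \<union> monomial A ts ` {B. length B = length y \<and> sum_list B = b \<and> B ! p = 0} \<union> ideal_power A N (Suc b))"
  unfolding ps.degenerate_def by blast
 interpret q: ring_hom_cring A "A Quot Ih" "(+>\<^bsub>A\<^esub>) Ih" by (rule ps.quotient_hom(1)[OF Ih(1)])
 note qs = ps.quotient_hom(2)[OF Ih(1)]
 interpret g: graded_setup "A Quot Ih" "(+>\<^bsub>A\<^esub>) Ih ` N"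
  by (intro graded_setup.intro graded_setup_axioms.intro q.S.cring_axioms q.ideal_image[OF qs N_ideal])
 define ts' where "ts' = map ((+>\<^bsub>A\<^esub>) Ih) ts"
 let ?B = "{B. length B = length y \<and> sum_list B = b \<and> B ! p = 0}"
 define G where "G = set uh \<union> monomial A ts ` ?B \<union> ideal_power A N (Suc b)"
 have tc: "set ts \<subseteq> carrier A" using ts(3) ps.ideal_sub[OF N_ideal] by blast
 have uc: "set uh \<subseteq> carrier A" using carrier_uyh by blast
 have Gc: "G \<subseteq> carrier A"
  unfolding G_def using uc ps.monomial_closed[OF tc] ps.ideal_sub[OF ps.ideal_power_ideal[OF N_ideal]] by blast
 define G' where "G' = monomial (A Quot Ih) ts' ` ?B \<union> ideal_power (A Quot Ih) ((+>\<^bsub>A\<^esub>) Ih ` N) (Suc b)"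
 have mono: "(+>\<^bsub>A\<^esub>) Ih ` monomial A ts ` ?B = monomial (A Quot Ih) ts' ` ?B"
  unfolding image_image ts'_def using q.hom_monomial[OF tc] by (intro image_cong) auto
 have G'c: "G' \<subseteq> carrier (A Quot Ih)"
  unfolding G'_def mono[symmetric] using ps.monomial_closed[OF tc] q.hom_closed q.S.ideal_sub[OF g.pw_ideal] by blast
 note I' = q.S.genideal_ideal[OF G'c]
 have s1: "(+>\<^bsub>A\<^esub>) Ih ` Jh \<subseteq> (+>\<^bsub>A\<^esub>) Ih ` (Idl\<^bsub>A\<^esub> G)" unfolding G_def by (rule image_mono[OF J])
 have s2: "(+>\<^bsub>A\<^esub>) Ih ` (Idl\<^bsub>A\<^esub> G) \<subseteq> Idl\<^bsub>A Quot Ih\<^esub> ((+>\<^bsub>A\<^esub>) Ih ` G)" by (rule image_subsetI) (rule q.hom_genideal[OF Gc])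
 have s3: "Idl\<^bsub>A Quot Ih\<^esub> ((+>\<^bsub>A\<^esub>) Ih ` G) \<subseteq> Idl\<^bsub>A Quot Ih\<^esub> G'"
 proof (rule q.S.genideal_minimal[OF I'])
  have "(+>\<^bsub>A\<^esub>) Ih ` set uh \<subseteq> Idl\<^bsub>A Quot Ih\<^esub> G'"
  proof (rule image_subsetI)
   fix a assume "a \<in> set uh"
   hence "a \<in> Ih" using ps.genideal_self[OF uc] by (rule subsetD[rotated])
   from ps.quotient_hom(4)[OF Ih(1) this] show "Ih +>\<^bsub>A\<^esub> a \<in> Idl\<^bsub>A Quot Ih\<^esub> G'"
    using q.S.ideal_zero[OF I'] by (rule ssubst)
  qed
  moreover have "(+>\<^bsub>A\<^esub>) Ih ` ideal_power A N (Suc b) = ideal_power (A Quot Ih) ((+>\<^bsub>A\<^esub>) Ih ` N) (Suc b)"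
   by (rule q.ideal_power_image[OF qs N_ideal, symmetric])
  ultimately show "(+>\<^bsub>A\<^esub>) Ih ` G \<subseteq> Idl\<^bsub>A Quot Ih\<^esub> G'"
   unfolding G_def image_Un mono using q.S.genideal_self[OF G'c] unfolding G'_def by blast
 qed
 have sub: "(+>\<^bsub>A\<^esub>) Ih ` Jh \<subseteq> Idl\<^bsub>A Quot Ih\<^esub> G'"
  by (rule order.trans[OF s1 order.trans[OF s2 s3]])
 hence sub': "Idl\<^bsub>A Quot Ih\<^esub> ((+>\<^bsub>A\<^esub>) Ih ` Jh) \<subseteq> Idl\<^bsub>A Quot Ih\<^esub> G'" by (rule q.S.genideal_minimal[OF I'])
 have Jq: "(+>\<^bsub>A\<^esub>) Ih ` Jh \<subseteq> carrier (A Quot Ih)" using sub q.S.ideal_sub[OF I'] by blast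
 have "length (map ((+>\<^bsub>A\<^esub>) Ih) yh) < length ts'"
 proof (rule g.directrix_length_less[OF _ _ directrix_A])
  show "(+>\<^bsub>A\<^esub>) Ih ` N \<noteq> carrier (A Quot Ih)" by (rule ps.quotient_local(1)[OF N_ideal FA_proper FA_local Ih])
  show "c \<in> Units (A Quot Ih)" if "c \<in> carrier (A Quot Ih)" "c \<notin> (+>\<^bsub>A\<^esub>) Ih ` N" for c
   by (rule ps.quotient_local(2)[OF N_ideal FA_proper FA_local Ih that])
  show "Idl\<^bsub>A Quot Ih\<^esub> ((+>\<^bsub>A\<^esub>) Ih ` Jh) \<subseteq> carrier (A Quot Ih)"
   by (rule q.S.ideal_sub[OF q.S.genideal_ideal[OF Jq]])
  show "set ts' \<subseteq> (+>\<^bsub>A\<^esub>) Ih ` N" using ts(3) by (auto simp: ts'_def)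
  show "p < length ts'" using ts by (simp add: ts'_def)
  show "Idl\<^bsub>A Quot Ih\<^esub> ((+>\<^bsub>A\<^esub>) Ih ` Jh) \<subseteq> Idl\<^bsub>A Quot Ih\<^esub> (monomial (A Quot Ih) ts' `
   {B. length B = length ts' \<and> sum_list B = b \<and> B ! p = 0} \<union> g.pw (Suc b))"
   using sub' ts(1) unfolding G'_def by (simp add: ts'_def)
 qed
 thus False using ts(1) by (simp add: ts'_def)
qed

text \<open>The characteristic polyhedron is an intersection over all systems. The prepared system
  is one of them and its polyhedron is contained in all the others, so it equals the
  intersection.\<close>

theorem exists_prepared:
 "\<exists>ystar. length ystar = length y \<and> regular_system_of_parameters (completion R) (map (to_completion R) u @ ystar) \<and>
   yields_directrix_mod (completion R) (Idl\<^bsub>completion R\<^esub> (to_completion R ` J)) b (map (to_completion R) u) ystar \<and>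
   polyhedron_completion R J b u ystar = characteristic_polyhedron R J b u"
proof -
 obtain F where ps: "pair_setup A N n Jh F" using pair_A by blast
 interpret ps: pair_setup A N n uh Jh F b by (rule ps)
 have rsp: "regular_system_of_parameters (completion R) (map (to_completion R) u @ ys) \<longleftrightarrow> ps.rsp ys" for ys
  unfolding regular_system_of_parameters_def completion_R to_completion_R max_ideal_A krull_dim_A ps.rsp_def by auto
 have poly: "polyhedron_completion R J b u ys = ps.newt ys" if ys: "ps.rsp ys" for ys
  unfolding polyhedron_completion_def completion_R to_completion_R
  using split_parameters.polyhedron_eq[OF ps.rsp_split[OF ys] ps.F] ps.newton_newt[OF ys] by simp
 have rh: "ps.rsp yh" unfolding ps.rsp_def using carrier_uyh N_uy by simp
 have nd: "\<not> ps.degenerate (length yh)" using not_degenerate[OF ps] by simp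
 obtain yt where yt: "ps.rsp yt" "\<forall>j<length yh. yt ! j \<ominus>\<^bsub>A\<^esub> yh ! j \<in> Ih" "\<forall>ys. ps.rsp ys \<longrightarrow> ps.newt yt \<subseteq> ps.newt ys"
  using ps.prepared_coordinates[OF complete_A' rh nd] by blast
 have len: "length yt = length y" using ps.rsp_length[OF yt(1) rh] by simp
 have "yields_directrix_mod A Jh b uh yt"
 proof (rule yields_directrix_A[OF _ _ len])
  show "set uh \<union> set yt \<subseteq> carrier A" "Idl\<^bsub>A\<^esub> (set uh \<union> set yt) = N" using yt(1) unfolding ps.rsp_def by blast+
  show "yt ! j \<ominus>\<^bsub>A\<^esub> yh ! j \<in> Ih" if "j < length y" for j using yt(2) that by simp
 qed
 moreover have "characteristic_polyhedron R J b u = ps.newt yt"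
  unfolding characteristic_polyhedron_def rsp using poly yt(1,3) by blast
 ultimately show ?thesis using rsp poly yt(1) len unfolding completion_R to_completion_R by blast
qed

end

theorem theorem2:
  fixes R :: "('a, 'm) ring_scheme" and J :: "'a set" and b :: nat and u y :: "'a list"
  assumes "regular_local_ring R"
    and "is_pair R J b"
    and "closed_point_in_Sing R J b"
    and "regular_system_of_parameters R (u @ y)"
    and "yields_directrix_mod R J b u y"
  shows "\<exists>ystar :: (nat \<Rightarrow> 'a set) list.
      length ystar = length y \<and>
      regular_system_of_parameters (completion R) (map (to_completion R) u @ ystar) \<and>
      yields_directrix_mod (completion R) (Idl\<^bsub>completion R\<^esub> (to_completion R ` J)) b
        (map (to_completion R) u) ystar \<and>
      polyhedron_completion R J b u ystar = characteristic_polyhedron R J b u"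
proof -
 have noeth: "noetherian_ring R" and loc: "local_ring R" using assms(1) by (auto simp: regular_local_ring_def)
 interpret cring R using loc by (simp add: local_ring_def)
 have sys: "set (u @ y) \<subseteq> carrier R" "Idl\<^bsub>R\<^esub> (set (u @ y)) = max_ideal R" "krull_dim R = enat (length (u @ y))"
  using assms(4) unfolding regular_system_of_parameters_def by blast+
 note max = noetherian_local[OF noeth loc]
 have im: "(!) (u @ y) ` {..<length (u @ y)} = set (u @ y)"
  by (metis atLeast0LessThan list.set_map map_nth set_upt)
 have par: "parameters R ((!) (u @ y)) (length (u @ y)) (max_ideal R)"
 proof (intro parameters.intro parameters_axioms.intro cring_axioms)
  show "(!) (u @ y) \<in> {..<length (u @ y)} \<rightarrow> carrier R" using sys(1) im by blast
  show "max_ideal R = Idl\<^bsub>R\<^esub> ((!) (u @ y) ` {..<length (u @ y)})" unfolding im sys(2) ..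
  show "max_ideal R \<noteq> carrier R" using maximalideal.I_notcarr[OF max(1)] by blast
 qed (rule max(2))
 \<comment> \<open>Regularity enters as growth: the dimension is the number of parameters, and a
   prime chain of that length exists.\<close>
 obtain p :: "nat => 'a set" where p: "\<forall>i\<le>length (u @ y). primeideal (p i) R" "\<forall>i<length (u @ y). p i \<subset> p (Suc i)"
  using krull_dim_chain[OF sys(3) maximalideal_prime[OF max(1)]] by blast
 have "growth R (max_ideal R) (length (u @ y))"
  by (rule parameters.prime_chain_growth[OF par noeth]) (use p in blast)+
 hence "completed_pair R u y (max_ideal R) J b"
  using par noeth assms(2,3,5)
  by (intro completed_pair.intro completed_pair_axioms.intro adic_parameters.intro)
    (auto simp: is_pair_def closed_point_in_Sing_def)
 thus ?thesis by (rule completed_pair.exists_prepared)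
qed

end
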